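(* Let $n\in\mathbb N$ and let $\varepsilon,\varepsilon'\in M_n(\{0,1\})$ be symmetric matrices with zero diagonal. (1) If $\varepsilon\neq\varepsilon_{\mathrm{comm}}$, then the quantum group $O_n^\varepsilon$ is not a group, i.e. $C(O_n^\varepsilon)$ is noncommutative. (2) If $\varepsilon\neq\varepsilon'$, then $O_n^\varepsilon\neq O_n^{\varepsilon'}$, i.e. there is no $*$-isomorphism $C(O_n^\varepsilon)\to C(O_n^{\varepsilon'})$ sending $u_{ij}\mapsto u_{ij}$ for all $i,j$. (3) $O_n^\varepsilon$ acts maximally on the $\varepsilon$-sphere $S_{\mathbb R,\varepsilon}^{n-1}$: there are $*$-homomorphisms $$\alpha,\beta: C(S_{\mathbb R,\varepsilon}^{n-1})\to C(O_n^\varepsilon)\otimes C(S_{\mathbb R,\varepsilon}^{n-1}),\qquad \alpha(x_i)=\sum_k u_{ik}\otimes x_k,\quad \beta(x_i)=\sum_k u_{ki}\otimes x_k,$$ and whenever $G$ is a compact matrix quantum group with fundamental matrix $v=(v_{ij})_{1\le i,j\le n}$ acting on $S_{\mathbb R,\varepsilon}^{n-1}$ in this way, i.e. such that there are $*$-homomorphisms $\alpha',\beta': C(S_{\mathbb R,\varepsilon}^{n-1})\to C(G)\otimes C(S_{\mathbb R,\varepsilon}^{n-1})$ with $\alpha'(x_i)=\sum_k v_{ik}\otimes x_k$ and $\beta'(x_i)=\sum_k v_{ki}\otimes x_k$, then $G\subset O_n^\varepsilon$.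
   Context: Throughout, $\varepsilon\in M_n(\{0,1\})$ is symmetric with $\varepsilon_{ii}=0$. The matrix $\varepsilon_{\mathrm{comm}}$ has $\varepsilon_{ij}=1$ for all $i\ne j$ and zero diagonal. The $\varepsilon$-sphere is given by the universal unital $C^*$-algebra $C(S_{\mathbb R,\varepsilon}^{n-1})=C^*(x_1,\dots,x_n\mid x_i=x_i^*,\ \sum_i x_i^2=1,\ x_ix_j=x_jx_i\text{ if }\varepsilon_{ij}=1)$. The $\varepsilon$-orthogonal quantum group $O_n^\varepsilon$ is given by the universal unital $C^*$-algebra $C(O_n^\varepsilon)$ generated by $u_{ij}$, $1\le i,j\le n$, with relations $u_{ij}=u_{ij}^*$, orthogonality $\sum_k u_{ik}u_{jk}=\sum_k u_{ki}u_{kj}=\delta_{ij}$, and the relations $R^\varepsilon$: $$u_{ik}u_{jl}=\begin{cases}u_{jl}u_{ik}&\text{if }\varepsilon_{ij}=1,\ \varepsilon_{kl}=1\\ u_{jk}u_{il}&\text{if }\varepsilon_{ij}=1,\ \varepsilon_{kl}=0\\ u_{il}u_{jk}&\text{if }\varepsilon_{ij}=0,\ \varepsilon_{kl}=1.\end{cases}$$ It is a compact matrix quantum group in Woronowicz's sense, with comultiplication $u_{ij}\mapsto\sum_k u_{ik}\otimes u_{kj}$. For compact matrix quantum groups with fundamental matrices of size $n$, $G\subset H$ means there is a surjective $*$-homomorphism $C(H)\to C(G)$ sending the generators (entries of the fundamental matrix of $H$) to the corresponding generators of $C(G)$. All tensor products of $C^*$-algebras are minimal. *)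

theory Defs
  imports
    "HOL-Library.Poly_Mapping"
    "HOL-Analysis.Infinite_Sum"
    "HOL-Analysis.Finite_Cartesian_Product"
    "HOL-Algebra.Subrings"
begin

section \<open>C*-algebras\<close>

text \<open>The ring axioms of \<^locale>\<open>ring\<close> do not exclude the zero algebra.\<close>

definition complex_ring :: "complex ring" where
  "complex_ring = \<lparr>carrier = UNIV, mult = (*), one = 1, zero = 0, add = (+)\<rparr>"

record 'a star_algebra = "(complex, 'a) module" +
  involution :: "'a \<Rightarrow> 'a"  (\<open>adj\<index> _\<close> [81] 80)

record 'a cstar_algebra = "'a star_algebra" +
  cnorm :: "'a \<Rightarrow> real"  (\<open>\<parallel>_\<parallel>\<index>\<close>)

locale star_algebra = ring A + module complex_ring A
  for A :: "('a, 'm) star_algebra_scheme" (structure) +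
  assumes smult_mult_left:
      "\<lbrakk>a \<in> carrier A; b \<in> carrier A\<rbrakk> \<Longrightarrow> (c \<odot> a) \<otimes> b = c \<odot> (a \<otimes> b)"
    and smult_mult_right:
      "\<lbrakk>a \<in> carrier A; b \<in> carrier A\<rbrakk> \<Longrightarrow> a \<otimes> (c \<odot> b) = c \<odot> (a \<otimes> b)"
    and adj_closed: "a \<in> carrier A \<Longrightarrow> adj a \<in> carrier A"
    and adj_adj: "a \<in> carrier A \<Longrightarrow> adj (adj a) = a"
    and adj_add: "\<lbrakk>a \<in> carrier A; b \<in> carrier A\<rbrakk> \<Longrightarrow> adj (a \<oplus> b) = adj a \<oplus> adj b"
    and adj_smult: "a \<in> carrier A \<Longrightarrow> adj (c \<odot> a) = cnj c \<odot> adj a"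
    and adj_mult: "\<lbrakk>a \<in> carrier A; b \<in> carrier A\<rbrakk> \<Longrightarrow> adj (a \<otimes> b) = adj b \<otimes> adj a"

definition cstar_seminorm :: "('a, 'm) star_algebra_scheme \<Rightarrow> ('a \<Rightarrow> real) \<Rightarrow> bool" where
  "cstar_seminorm A p \<longleftrightarrow>
     (\<forall>a\<in>carrier A. 0 \<le> p a) \<and>
     (\<forall>a\<in>carrier A. \<forall>b\<in>carrier A. p (a \<oplus>\<^bsub>A\<^esub> b) \<le> p a + p b) \<and>
     (\<forall>c. \<forall>a\<in>carrier A. p (c \<odot>\<^bsub>A\<^esub> a) = cmod c * p a) \<and>
     (\<forall>a\<in>carrier A. \<forall>b\<in>carrier A. p (a \<otimes>\<^bsub>A\<^esub> b) \<le> p a * p b) \<and>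
     (\<forall>a\<in>carrier A. p (adj\<^bsub>A\<^esub> a \<otimes>\<^bsub>A\<^esub> a) = (p a)\<^sup>2)"

definition cauchy_seqs :: "('a, 'm) star_algebra_scheme \<Rightarrow> ('a \<Rightarrow> real) \<Rightarrow> (nat \<Rightarrow> 'a) set" where
  "cauchy_seqs A p = {s. (\<forall>k. s k \<in> carrier A) \<and>
     (\<forall>e>0. \<exists>N. \<forall>k\<ge>N. \<forall>l\<ge>N. p (s k \<ominus>\<^bsub>A\<^esub> s l) < e)}"

locale cstar_algebra = star_algebra A
  for A :: "('a, 'm) cstar_algebra_scheme" (structure) +
  assumes seminorm: "cstar_seminorm A (cnorm A)"
    and norm_definite: "\<lbrakk>a \<in> carrier A; \<parallel>a\<parallel> = 0\<rbrakk> \<Longrightarrow> a = \<zero>"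
    and complete: "s \<in> cauchy_seqs A (cnorm A) \<Longrightarrow>
      \<exists>a\<in>carrier A. (\<lambda>k. \<parallel>s k \<ominus> a\<parallel>) \<longlonglongrightarrow> 0"

text \<open>Homomorphisms are unital (this is part of \<^const>\<open>ring_hom\<close>).\<close>

definition star_hom ::
    "('a, 'm) star_algebra_scheme \<Rightarrow> ('b, 'k) star_algebra_scheme \<Rightarrow> ('a \<Rightarrow> 'b) set" where
  "star_hom A B = {h \<in> ring_hom A B.
     (\<forall>c. \<forall>a\<in>carrier A. h (c \<odot>\<^bsub>A\<^esub> a) = c \<odot>\<^bsub>B\<^esub> h a) \<and>
     (\<forall>a\<in>carrier A. h (adj\<^bsub>A\<^esub> a) = adj\<^bsub>B\<^esub> (h a))}"

definition star_iso ::
    "('a, 'm) star_algebra_scheme \<Rightarrow> ('b, 'k) star_algebra_scheme \<Rightarrow> ('a \<Rightarrow> 'b) set" where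
  "star_iso A B = {h \<in> star_hom A B. bij_betw h (carrier A) (carrier B)}"

definition cstar_subalgebra :: "'a set \<Rightarrow> ('a, 'm) cstar_algebra_scheme \<Rightarrow> bool" where
  "cstar_subalgebra B A \<longleftrightarrow> subring B A \<and>
     (\<forall>c. \<forall>b\<in>B. c \<odot>\<^bsub>A\<^esub> b \<in> B) \<and> (\<forall>b\<in>B. adj\<^bsub>A\<^esub> b \<in> B) \<and>
     (\<forall>s a. (\<forall>k::nat. s k \<in> B) \<and> a \<in> carrier A \<and>
        (\<lambda>k. \<parallel>s k \<ominus>\<^bsub>A\<^esub> a\<parallel>\<^bsub>A\<^esub>) \<longlonglongrightarrow> 0 \<longrightarrow> a \<in> B)"

definition cstar_generated :: "('a, 'm) cstar_algebra_scheme \<Rightarrow> 'a set \<Rightarrow> 'a set" where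
  "cstar_generated A S = \<Inter>{B. cstar_subalgebra B A \<and> S \<subseteq> B}"


section \<open>Hausdorff completion with respect to a C*-seminorm\<close>

definition null_rel :: "('a, 'm) star_algebra_scheme \<Rightarrow> ('a \<Rightarrow> real) \<Rightarrow> (nat \<Rightarrow> 'a) rel" where
  "null_rel A p = {(s, t). s \<in> cauchy_seqs A p \<and> t \<in> cauchy_seqs A p \<and>
     (\<lambda>k. p (s k \<ominus>\<^bsub>A\<^esub> t k)) \<longlonglongrightarrow> 0}"

definition completion ::
    "('a, 'm) star_algebra_scheme \<Rightarrow> ('a \<Rightarrow> real) \<Rightarrow> (nat \<Rightarrow> 'a) set cstar_algebra" where
  "completion A p =
    \<lparr>carrier = cauchy_seqs A p // null_rel A p,
     mult = (\<lambda>X Y. \<Union>s\<in>X. \<Union>t\<in>Y. null_rel A p `` {\<lambda>k. s k \<otimes>\<^bsub>A\<^esub> t k}),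
     one = null_rel A p `` {\<lambda>k. \<one>\<^bsub>A\<^esub>},
     zero = null_rel A p `` {\<lambda>k. \<zero>\<^bsub>A\<^esub>},
     add = (\<lambda>X Y. \<Union>s\<in>X. \<Union>t\<in>Y. null_rel A p `` {\<lambda>k. s k \<oplus>\<^bsub>A\<^esub> t k}),
     smult = (\<lambda>c X. \<Union>s\<in>X. null_rel A p `` {\<lambda>k. c \<odot>\<^bsub>A\<^esub> s k}),
     involution = (\<lambda>X. \<Union>s\<in>X. null_rel A p `` {\<lambda>k. adj\<^bsub>A\<^esub> (s k)}),
     cnorm = (\<lambda>X. THE r. \<forall>s\<in>X. (\<lambda>k. p (s k)) \<longlonglongrightarrow> r)\<rparr>"

definition completion_embed ::
    "('a, 'm) star_algebra_scheme \<Rightarrow> ('a \<Rightarrow> real) \<Rightarrow> 'a \<Rightarrow> (nat \<Rightarrow> 'a) set" where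
  "completion_embed A p a = null_rel A p `` {\<lambda>k. a}"


section \<open>The *-algebra of a monoid with involution\<close>

text \<open>The complex vector space with basis the carrier of \<open>M\<close>, with the bilinear extension of the
  multiplication of \<open>M\<close> and the antilinear extension of \<open>star\<close>.\<close>

definition monoid_star_algebra ::
    "('w, 'm) monoid_scheme \<Rightarrow> ('w \<Rightarrow> 'w) \<Rightarrow> ('w \<Rightarrow>\<^sub>0 complex) star_algebra" where
  "monoid_star_algebra M star =
    \<lparr>carrier = {p. Poly_Mapping.keys p \<subseteq> carrier M},
     mult = (\<lambda>p q. \<Sum>x\<in>Poly_Mapping.keys p. \<Sum>y\<in>Poly_Mapping.keys q.
        Poly_Mapping.single (x \<otimes>\<^bsub>M\<^esub> y) (Poly_Mapping.lookup p x * Poly_Mapping.lookup q y)),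
     one = Poly_Mapping.single \<one>\<^bsub>M\<^esub> 1,
     zero = 0,
     add = (+),
     smult = (\<lambda>c. Poly_Mapping.map ((*) c)),
     involution = (\<lambda>p. \<Sum>x\<in>Poly_Mapping.keys p.
        Poly_Mapping.single (star x) (cnj (Poly_Mapping.lookup p x)))\<rparr>"


section \<open>Universal unital C*-algebras\<close>

datatype 'e letter = Gen 'e | GenAdj 'e

fun letter_adj :: "'e letter \<Rightarrow> 'e letter" where
  "letter_adj (Gen e) = GenAdj e"
| "letter_adj (GenAdj e) = Gen e"

type_synonym 'e star_poly = "'e letter list \<Rightarrow>\<^sub>0 complex"

definition free_star_algebra :: "'e star_poly star_algebra" where
  "free_star_algebra = monoid_star_algebra
     \<lparr>carrier = UNIV, mult = (@), one = []\<rparr> (\<lambda>w. rev (map letter_adj w))"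

text \<open>The universal C*-algebra on generators \<open>'e\<close> with relations \<open>r = 0\<close> for \<open>r \<in> R\<close>: the
  completion of the free unital *-algebra with respect to the largest C*-seminorm vanishing on
  \<open>R\<close> (a C*-seminorm vanishing on \<open>R\<close> vanishes on the *-ideal generated by \<open>R\<close>).  As usual this
  is meaningful only if the relations bound all C*-seminorms, so that the supremum is finite; the
  zero seminorm is always admitted.\<close>

definition universal_seminorm :: "'e star_poly set \<Rightarrow> 'e star_poly \<Rightarrow> real" where
  "universal_seminorm R a =
     Sup {p a | p. cstar_seminorm free_star_algebra p \<and> (\<forall>r\<in>R. p r = 0)}"

type_synonym 'e universal_elem = "(nat \<Rightarrow> 'e star_poly) set"

definition universal_cstar :: "'e star_poly set \<Rightarrow> 'e universal_elem cstar_algebra" where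
  "universal_cstar R = completion free_star_algebra (universal_seminorm R)"

definition monomial :: "'e letter list \<Rightarrow> 'e star_poly" where
  "monomial w = Poly_Mapping.single w 1"

definition universal_gen :: "'e star_poly set \<Rightarrow> 'e \<Rightarrow> 'e universal_elem" where
  "universal_gen R e =
     completion_embed free_star_algebra (universal_seminorm R) (monomial [Gen e])"


section \<open>Minimal tensor products\<close>

definition ell2 :: "('i \<Rightarrow> complex) set" where
  "ell2 = {f. (\<lambda>i. (cmod (f i))\<^sup>2) summable_on UNIV}"

definition ell2_norm :: "('i \<Rightarrow> complex) \<Rightarrow> real" where
  "ell2_norm f = sqrt (\<Sum>\<^sub>\<infinity>i. (cmod (f i))\<^sup>2)"

definition ell2_inner :: "('i \<Rightarrow> complex) \<Rightarrow> ('i \<Rightarrow> complex) \<Rightarrow> complex" where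
  "ell2_inner f g = (\<Sum>\<^sub>\<infinity>i. cnj (f i) * g i)"

text \<open>Only the values of an operator on \<^const>\<open>ell2\<close> matter.\<close>

type_synonym 'i operator = "('i \<Rightarrow> complex) \<Rightarrow> ('i \<Rightarrow> complex)"

definition bounded_operator :: "'i operator \<Rightarrow> bool" where
  "bounded_operator T \<longleftrightarrow>
     (\<forall>f\<in>ell2. T f \<in> ell2) \<and>
     (\<forall>f\<in>ell2. \<forall>g\<in>ell2. T (\<lambda>i. f i + g i) = (\<lambda>i. T f i + T g i)) \<and>
     (\<forall>c. \<forall>f\<in>ell2. T (\<lambda>i. c * f i) = (\<lambda>i. c * T f i)) \<and>
     (\<exists>C. \<forall>f\<in>ell2. ell2_norm (T f) \<le> C * ell2_norm f)"

definition operator_norm :: "'i operator \<Rightarrow> real" where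
  "operator_norm T = Sup {ell2_norm (T f) | f. f \<in> ell2 \<and> ell2_norm f \<le> 1}"

text \<open>*-representations, not necessarily nondegenerate.\<close>

definition representation :: "('a, 'm) star_algebra_scheme \<Rightarrow> ('a \<Rightarrow> 'i operator) \<Rightarrow> bool" where
  "representation A \<pi> \<longleftrightarrow>
     (\<forall>a\<in>carrier A. bounded_operator (\<pi> a)) \<and>
     (\<forall>a\<in>carrier A. \<forall>b\<in>carrier A. \<forall>f\<in>ell2. \<pi> (a \<oplus>\<^bsub>A\<^esub> b) f = (\<lambda>i. \<pi> a f i + \<pi> b f i)) \<and>
     (\<forall>c. \<forall>a\<in>carrier A. \<forall>f\<in>ell2. \<pi> (c \<odot>\<^bsub>A\<^esub> a) f = (\<lambda>i. c * \<pi> a f i)) \<and>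
     (\<forall>a\<in>carrier A. \<forall>b\<in>carrier A. \<forall>f\<in>ell2. \<pi> (a \<otimes>\<^bsub>A\<^esub> b) f = \<pi> a (\<pi> b f)) \<and>
     (\<forall>a\<in>carrier A. \<forall>f\<in>ell2. \<forall>g\<in>ell2.
        ell2_inner (\<pi> (adj\<^bsub>A\<^esub> a) f) g = ell2_inner f (\<pi> a g))"

text \<open>The operator \<open>T \<otimes> S\<close> on the Hilbert space tensor product, identified with the
  square-summable functions of two variables: \<open>S\<close> is applied in the second variable and then
  \<open>T\<close> in the first one.\<close>

definition tensor_operator :: "'i operator \<Rightarrow> 'j operator \<Rightarrow> ('i \<times> 'j) operator" where
  "tensor_operator T S h = (\<lambda>(i, j). T (\<lambda>i'. S (\<lambda>j'. h (i', j')) j) i)"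

text \<open>The spatial norm of \<open>z\<close>, i.e. the supremum of the norms of \<open>(\<pi> \<otimes> \<rho>)(z)\<close> over all
  representations \<open>\<pi>\<close> of \<open>A\<close> and \<open>\<rho>\<close> of \<open>B\<close>.  It suffices to consider representations on the
  Hilbert spaces with orthonormal bases indexed by the types of the elements of \<open>A\<close> and \<open>B\<close>: the
  dimension of a cyclic representation of \<open>A\<close> is at most the cardinality of \<open>A\<close>, so that, after
  adding a zero representation, it is equivalent to one of this form.\<close>

definition min_seminorm ::
    "('a, 'm) star_algebra_scheme \<Rightarrow> ('b, 'k) star_algebra_scheme \<Rightarrow>
     ('a \<times> 'b \<Rightarrow>\<^sub>0 complex) \<Rightarrow> real" where
  "min_seminorm A B z = Sup {operator_norm (\<lambda>h ij. \<Sum>(a, b)\<in>Poly_Mapping.keys z.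
        Poly_Mapping.lookup z (a, b) * tensor_operator (\<pi> a) (\<rho> b) h ij) | \<pi> \<rho>.
     representation A (\<pi> :: 'a \<Rightarrow> 'a operator) \<and> representation B (\<rho> :: 'b \<Rightarrow> 'b operator)}"

text \<open>The *-algebra of formal linear combinations of pairs \<open>(a, b)\<close> surjects onto the algebraic
  tensor product \<open>A \<odot> B\<close>.  The spatial norm is a norm on the latter, hence the elements of
  seminorm zero are precisely those in the kernel of this surjection, and the Hausdorff completion
  below is the completion of \<open>A \<odot> B\<close>.\<close>

definition pre_tensor ::
    "('a, 'm) star_algebra_scheme \<Rightarrow> ('b, 'k) star_algebra_scheme \<Rightarrow>
     ('a \<times> 'b \<Rightarrow>\<^sub>0 complex) star_algebra" where
  "pre_tensor A B = monoid_star_algebra (A \<times>\<times> B) (\<lambda>(a, b). (adj\<^bsub>A\<^esub> a, adj\<^bsub>B\<^esub> b))"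

type_synonym ('a, 'b) tensor_elem = "(nat \<Rightarrow> ('a \<times> 'b \<Rightarrow>\<^sub>0 complex)) set"

definition min_tensor ::
    "('a, 'm) star_algebra_scheme \<Rightarrow> ('b, 'k) star_algebra_scheme \<Rightarrow>
     ('a, 'b) tensor_elem cstar_algebra" where
  "min_tensor A B = completion (pre_tensor A B) (min_seminorm A B)"

definition tensor ::
    "('a, 'm) star_algebra_scheme \<Rightarrow> ('b, 'k) star_algebra_scheme \<Rightarrow>
     'a \<Rightarrow> 'b \<Rightarrow> ('a, 'b) tensor_elem" where
  "tensor A B a b =
     completion_embed (pre_tensor A B) (min_seminorm A B) (Poly_Mapping.single (a, b) 1)"


section \<open>Compact matrix quantum groups\<close>

text \<open>The size of a square matrix is the cardinality of the finite index type \<open>'n\<close>.\<close>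

definition invertible_matrix ::
    "('a, 'm) ring_scheme \<Rightarrow> ('n::finite \<Rightarrow> 'n \<Rightarrow> 'a) \<Rightarrow> bool" where
  "invertible_matrix A v \<longleftrightarrow> (\<exists>w. \<forall>i j. w i j \<in> carrier A \<and>
     (\<Oplus>\<^bsub>A\<^esub>k\<in>UNIV. v i k \<otimes>\<^bsub>A\<^esub> w k j) = (if i = j then \<one>\<^bsub>A\<^esub> else \<zero>\<^bsub>A\<^esub>) \<and>
     (\<Oplus>\<^bsub>A\<^esub>k\<in>UNIV. w i k \<otimes>\<^bsub>A\<^esub> v k j) = (if i = j then \<one>\<^bsub>A\<^esub> else \<zero>\<^bsub>A\<^esub>))"

text \<open>\<open>A\<close> plays the role of \<open>C(G)\<close>, and \<open>v\<close> is the fundamental matrix.\<close>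

definition compact_matrix_quantum_group ::
    "'a cstar_algebra \<Rightarrow> ('n::finite \<Rightarrow> 'n \<Rightarrow> 'a) \<Rightarrow> bool" where
  "compact_matrix_quantum_group A v \<longleftrightarrow>
     cstar_algebra A \<and>
     (\<forall>i j. v i j \<in> carrier A) \<and>
     cstar_generated A {v i j | i j. True} = carrier A \<and>
     invertible_matrix A v \<and> invertible_matrix A (\<lambda>i j. v j i) \<and>
     (\<exists>\<Delta>\<in>star_hom A (min_tensor A A). \<forall>i j.
        \<Delta> (v i j) = (\<Oplus>\<^bsub>min_tensor A A\<^esub>k\<in>UNIV. tensor A A (v i k) (v k j)))"

text \<open>\<open>G \<subset> H\<close>, where \<open>C(G) = A\<close> and \<open>C(H) = B\<close> have fundamental matrices \<open>v\<close> and \<open>u\<close>.\<close>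

definition quantum_subgroup ::
    "'a cstar_algebra \<Rightarrow> ('n \<Rightarrow> 'n \<Rightarrow> 'a) \<Rightarrow> 'b cstar_algebra \<Rightarrow> ('n \<Rightarrow> 'n \<Rightarrow> 'b) \<Rightarrow> bool" where
  "quantum_subgroup A v B u \<longleftrightarrow>
     (\<exists>\<phi>\<in>star_hom B A. \<phi> ` carrier B = carrier A \<and> (\<forall>i j. \<phi> (u i j) = v i j))"


section \<open>The \<open>\<epsilon>\<close>-sphere and the \<open>\<epsilon>\<close>-orthogonal quantum group\<close>

definition commutation_matrix :: "nat ^ 'n ^ 'n \<Rightarrow> bool" where
  "commutation_matrix \<epsilon> \<longleftrightarrow>
     (\<forall>i j. \<epsilon> $ i $ j \<in> {0, 1}) \<and> transpose \<epsilon> = \<epsilon> \<and> (\<forall>i. \<epsilon> $ i $ i = 0)"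

definition eps_comm :: "nat ^ 'n ^ 'n" where
  "eps_comm = (\<chi> i j. if i = j then 0 else 1)"

definition sphere_relations :: "nat ^ 'n ^ 'n \<Rightarrow> 'n::finite star_poly set" where
  "sphere_relations \<epsilon> =
     {monomial [Gen i] - monomial [GenAdj i] | i. True} \<union>
     {(\<Sum>i\<in>UNIV. monomial [Gen i, Gen i]) - monomial []} \<union>
     {monomial [Gen i, Gen j] - monomial [Gen j, Gen i] | i j. \<epsilon> $ i $ j = 1}"

definition C_sphere :: "nat ^ 'n ^ 'n \<Rightarrow> 'n::finite universal_elem cstar_algebra" where
  "C_sphere \<epsilon> = universal_cstar (sphere_relations \<epsilon>)"

definition sphere_coord :: "nat ^ 'n ^ 'n \<Rightarrow> 'n::finite \<Rightarrow> 'n universal_elem" where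
  "sphere_coord \<epsilon> i = universal_gen (sphere_relations \<epsilon>) i"

definition orthogonality_relations :: "('n::finite \<times> 'n) star_poly set" where
  "orthogonality_relations =
     {monomial [Gen (i, j)] - monomial [GenAdj (i, j)] | i j. True} \<union>
     {(\<Sum>k\<in>UNIV. monomial [Gen (i, k), Gen (j, k)]) - (if i = j then monomial [] else 0)
       | i j. True} \<union>
     {(\<Sum>k\<in>UNIV. monomial [Gen (k, i), Gen (k, j)]) - (if i = j then monomial [] else 0)
       | i j. True}"

definition R_eps :: "nat ^ 'n ^ 'n \<Rightarrow> ('n::finite \<times> 'n) star_poly set" where
  "R_eps \<epsilon> =
     {monomial [Gen (i, k), Gen (j, l)] - monomial [Gen (j, l), Gen (i, k)]
       | i j k l. \<epsilon> $ i $ j = 1 \<and> \<epsilon> $ k $ l = 1} \<union>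
     {monomial [Gen (i, k), Gen (j, l)] - monomial [Gen (j, k), Gen (i, l)]
       | i j k l. \<epsilon> $ i $ j = 1 \<and> \<epsilon> $ k $ l = 0} \<union>
     {monomial [Gen (i, k), Gen (j, l)] - monomial [Gen (i, l), Gen (j, k)]
       | i j k l. \<epsilon> $ i $ j = 0 \<and> \<epsilon> $ k $ l = 1}"

definition C_O :: "nat ^ 'n ^ 'n \<Rightarrow> ('n::finite \<times> 'n) universal_elem cstar_algebra" where
  "C_O \<epsilon> = universal_cstar (orthogonality_relations \<union> R_eps \<epsilon>)"

definition O_gen :: "nat ^ 'n ^ 'n \<Rightarrow> 'n::finite \<Rightarrow> 'n \<Rightarrow> ('n \<times> 'n) universal_elem" where
  "O_gen \<epsilon> i j = universal_gen (orthogonality_relations \<union> R_eps \<epsilon>) (i, j)"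

definition acts_on_sphere ::
    "'a cstar_algebra \<Rightarrow> ('n::finite \<Rightarrow> 'n \<Rightarrow> 'a) \<Rightarrow> nat ^ 'n ^ 'n \<Rightarrow> bool" where
  "acts_on_sphere A v \<epsilon> \<longleftrightarrow>
     (\<exists>\<alpha>\<in>star_hom (C_sphere \<epsilon>) (min_tensor A (C_sphere \<epsilon>)).
      \<exists>\<beta>\<in>star_hom (C_sphere \<epsilon>) (min_tensor A (C_sphere \<epsilon>)).
      \<forall>i. \<alpha> (sphere_coord \<epsilon> i) = (\<Oplus>\<^bsub>min_tensor A (C_sphere \<epsilon>)\<^esub>k\<in>UNIV.
              tensor A (C_sphere \<epsilon>) (v i k) (sphere_coord \<epsilon> k)) \<and>
          \<beta> (sphere_coord \<epsilon> i) = (\<Oplus>\<^bsub>min_tensor A (C_sphere \<epsilon>)\<^esub>k\<in>UNIV.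
              tensor A (C_sphere \<epsilon>) (v k i) (sphere_coord \<epsilon> k)))"

end

theory Submission
  imports Defs
begin

text \<open>
Write \<open>u\<close> for the fundamental matrix of \<open>C(O\<^sub>n\<^sup>\<epsilon>)\<close> and \<open>x\<close> for the coordinates of the \<open>\<epsilon>\<close>-sphere.

The first two statements rest on one equivalence: for \<open>i \<noteq> j\<close>, the elements \<open>u\<^sub>i\<^sub>i\<close> and \<open>u\<^sub>j\<^sub>j\<close>
commute if and only if \<open>\<epsilon>\<^sub>i\<^sub>j = 1\<close>.  One direction is a defining relation.  For the other one, a
diagonal matrix of selfadjoint unitaries which commute whenever \<open>\<epsilon>\<close> asks for it solves all the
relations; putting two anticommuting Pauli matrices at the places \<open>i\<close> and \<open>j\<close> and the identity
elsewhere gives a homomorphism to the two-by-two matrices which separates the two products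
(\<open>O_gen_commute_iff\<close>).  A matrix \<open>\<epsilon>\<close> other than \<open>\<epsilon>\<^sub>c\<^sub>o\<^sub>m\<^sub>m\<close> has an off-diagonal zero, and an
isomorphism fixing the generators preserves and reflects commutation, so that it determines \<open>\<epsilon>\<close>.

That \<open>O\<^sub>n\<^sup>\<epsilon>\<close> acts is a verification of the sphere relations for \<open>\<Sum>\<^sub>k u\<^sub>i\<^sub>k \<otimes> x\<^sub>k\<close> and its transpose
(\<open>action_sphere_tuple\<close>).  The substance is maximality.  An action \<open>\<alpha>\<close> of a matrix \<open>v\<close> turns the
relations of the sphere into equations \<open>\<Sum>\<^sub>k\<^sub>l c\<^sub>k\<^sub>l \<otimes> x\<^sub>k x\<^sub>l = 0\<close> with \<open>c\<^sub>k\<^sub>l \<in> C(G)\<close>.  For real vectors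
\<open>s\<close>, \<open>t\<close> with \<open>\<Sum>\<^sub>k (s\<^sub>k\<^sup>2 + t\<^sub>k\<^sup>2) = 1\<close>, and \<open>s\<^sub>k t\<^sub>l = t\<^sub>k s\<^sub>l\<close> wherever \<open>\<epsilon>\<^sub>k\<^sub>l = 1\<close>, the matrices
\<open>s\<^sub>k \<sigma>\<^sub>x + t\<^sub>k \<sigma>\<^sub>z\<close> are a model of the sphere.  Applying the matrix entries of these models to the
second tensor factor gives enough equations to conclude \<open>c\<^sub>k\<^sub>k = 0\<close> and \<open>c\<^sub>k\<^sub>l + c\<^sub>l\<^sub>k = 0\<close>, and moreover
\<open>c\<^sub>k\<^sub>l = 0\<close> for \<open>k \<noteq> l\<close> with \<open>\<epsilon>\<^sub>k\<^sub>l = 0\<close>.  These relations for \<open>v\<close> and for its transpose together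
yield orthogonality and \<open>R\<^sup>\<epsilon>\<close> (\<open>action_relations\<close>, \<open>O_tuple_of_action\<close>).  The universal
property then gives a homomorphism \<open>C(O\<^sub>n\<^sup>\<epsilon>) \<rightarrow> C(G)\<close>, which is onto because its range is a
C*-subalgebra containing the generators.

Three facts of C*-theory support this.  The universal algebra has its universal property because
in a C*-algebra the summands of a sum of squares equal to one are contractions.  The range of a
homomorphism is closed (\<open>closed_range_morphism\<close>).  Elements of the spatial tensor product are
detected by pairs of representations, so that the slices above see a nonzero element of \<open>C(G)\<close>
only if it is nonzero in some representation on the square-summable functions on the type of
\<open>C(G)\<close>; such a representation comes from a positive functional by the Gelfand-Naimark-Segal
construction, with an orthonormal basis found by orthonormalizing the countably many words in the
generators (\<open>separating_representation\<close>).  Positivity is developed without spectral theory, from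
a single iteration for square roots (\<open>power_iteration_sqrt\<close>).
\<close>


section \<open>Unital C*-algebras as a type class\<close>

text \<open>Algebras are given by carriers in records, where neither the arithmetic of the type classes nor
their limits are available.  The general theory is therefore developed for this type class and
transferred later.  The zero algebra is an instance, so the norm of \<open>1\<close> is one or zero.\<close>

class cstar = real_normed_algebra + monoid_mult + banach +
  fixes cscale :: "complex \<Rightarrow> 'a \<Rightarrow> 'a"  (infixr \<open>*\<^sub>C\<close> 75)
    and star :: "'a \<Rightarrow> 'a"
  assumes cscale_add_right: "c *\<^sub>C (x + y) = c *\<^sub>C x + c *\<^sub>C y"
    and cscale_add_left: "(c + d) *\<^sub>C x = c *\<^sub>C x + d *\<^sub>C x"
    and cscale_cscale [simp]: "c *\<^sub>C d *\<^sub>C x = (c * d) *\<^sub>C x"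
    and cscale_of_real [simp]: "complex_of_real r *\<^sub>C x = r *\<^sub>R x"
    and cscale_mult_left [simp]: "(c *\<^sub>C x) * y = c *\<^sub>C (x * y)"
    and cscale_mult_right [simp]: "x * (c *\<^sub>C y) = c *\<^sub>C (x * y)"
    and star_star [simp]: "star (star x) = x"
    and star_add: "star (x + y) = star x + star y"
    and star_mult: "star (x * y) = star y * star x"
    and star_cscale: "star (c *\<^sub>C x) = cnj c *\<^sub>C star x"
    and norm_star_mult: "norm (star x * x) = (norm x)\<^sup>2"

lemma cscale_0 [simp]: "0 *\<^sub>C x = (0::'a::cstar)"
  using cscale_of_real[of 0 x] by simp

lemma cscale_1 [simp]: "1 *\<^sub>C x = (x::'a::cstar)"
  using cscale_of_real[of 1 x] by simp

lemma cscale_0_right [simp]: "c *\<^sub>C 0 = (0::'a::cstar)"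
  using cscale_add_right[of c 0 0] by simp

lemma cscale_minus_left: "(- c) *\<^sub>C x = - (c *\<^sub>C (x::'a::cstar))"
  using cscale_add_left[of "- c" c x] by (simp add: eq_neg_iff_add_eq_0)

lemma cscale_minus_right: "c *\<^sub>C (- x) = - (c *\<^sub>C (x::'a::cstar))"
  using cscale_add_right[of c "- x" x] by (simp add: eq_neg_iff_add_eq_0)

lemma cscale_diff_right: "c *\<^sub>C (x - y) = c *\<^sub>C x - c *\<^sub>C (y::'a::cstar)"
  using cscale_add_right[of c x "- y"] by (simp add: cscale_minus_right)

lemma star_0 [simp]: "star 0 = (0::'a::cstar)"
  using star_add[of 0 0] by simp

lemma star_minus: "star (- x) = - star (x::'a::cstar)"
  using star_add[of "- x" x] by (simp add: eq_neg_iff_add_eq_0)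

lemma star_diff: "star (x - y) = star x - star (y::'a::cstar)"
  using star_add[of x "- y"] by (simp add: star_minus)

lemma star_scaleR: "star (r *\<^sub>R x) = r *\<^sub>R star (x::'a::cstar)"
  using star_cscale[of "complex_of_real r" x] by simp

lemma star_1 [simp]: "star 1 = (1::'a::cstar)"
proof -
  have "star (star 1 * 1) = star 1 * star (star 1)" by (rule star_mult)
  then show ?thesis by simp
qed

lemma norm_le_norm_star: "norm x \<le> norm (star (x::'a::cstar))"
proof (cases "norm x = 0")
  case False
  have "norm x * norm x \<le> norm (star x) * norm x"
    using norm_mult_ineq[of "star x" x] by (simp add: norm_star_mult power2_eq_square)
  then show ?thesis using False by (simp add: mult_right_le_imp_le)
qed simp

lemma norm_star [simp]: "norm (star x) = norm (x::'a::cstar)"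
  using norm_le_norm_star[of x] norm_le_norm_star[of "star x"] by simp

lemma norm_one_le: "norm (1::'a::cstar) \<le> 1"
proof -
  have "norm (1::'a) = (norm (1::'a))\<^sup>2" using norm_star_mult[of 1] by simp
  then have "norm (1::'a) * (norm (1::'a) - 1) = 0" by (simp add: power2_eq_square algebra_simps)
  then show ?thesis by (metis eq_iff_diff_eq_0 linear mult_eq_0_iff order.trans zero_le_one)
qed

lemma norm_cscale [simp]: "norm (c *\<^sub>C x) = cmod c * norm (x::'a::cstar)"
proof -
  have "star (c *\<^sub>C x) * (c *\<^sub>C x) = (cmod c)\<^sup>2 *\<^sub>R (star x * x)"
    unfolding cscale_of_real[symmetric] complex_norm_square by (simp add: star_cscale mult.commute)
  then have "(norm (c *\<^sub>C x))\<^sup>2 = (cmod c * norm x)\<^sup>2"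
    by (simp flip: norm_star_mult add: power_mult_distrib)
  then show ?thesis by (simp add: power2_eq_iff_nonneg)
qed

lemma selfadj_square_norm: "star x = x \<Longrightarrow> norm (x * x :: 'a::cstar) = (norm x)\<^sup>2"
  using norm_star_mult[of x] by simp

lemma selfadj_square_eq_0: "star x = x \<Longrightarrow> x * x = 0 \<Longrightarrow> x = (0::'a::cstar)"
  using selfadj_square_norm[of x] by simp

lemma star_sum: "star (sum f S :: 'a::cstar) = (\<Sum>i\<in>S. star (f i))"
  by (induction S rule: infinite_finite_induct) (auto simp: star_add)

lemma cscale_sum_right: "c *\<^sub>C (sum f S :: 'a::cstar) = (\<Sum>i\<in>S. c *\<^sub>C f i)"
  by (induction S rule: infinite_finite_induct) (auto simp: cscale_add_right)

lemma cscale_scaleR: "c *\<^sub>C (r *\<^sub>R x) = (c * complex_of_real r) *\<^sub>C (x::'a::cstar)"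
  by (simp flip: cscale_of_real)

lemma scaleR_cscale: "r *\<^sub>R (c *\<^sub>C x) = (complex_of_real r * c) *\<^sub>C (x::'a::cstar)"
  by (simp flip: cscale_of_real)

lemma bounded_linear_star: "bounded_linear (star :: 'a::cstar \<Rightarrow> 'a)"
  by (rule bounded_linear_intro[where K=1]) (auto simp: star_add star_scaleR)

lemmas tendsto_star = bounded_linear.tendsto[OF bounded_linear_star]

text \<open>The iteration \<open>y \<mapsto> (x + y\<^sup>2) / 2\<close> started at zero converges to a fixed point \<open>L\<close>, and a fixed point
satisfies \<open>(1 - L)\<^sup>2 = 1 - x\<close>.  All iterates are polynomials in \<open>x\<close>, so the root commutes with
everything that commutes with \<open>x\<close>.  Convergence follows by comparison with the scalar iteration
for \<open>x = 1\<close>, which dominates both the iterates and their differences.\<close>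

lemma power_iteration_sqrt:
  fixes x :: "'a::cstar"
  assumes sx: "star x = x" and nx: "norm x \<le> 1"
  shows "\<exists>s. star s = s \<and> s * s = 1 - x \<and> norm (1 - s) \<le> 1 \<and> (\<forall>z. z * x = x * z \<longrightarrow> z * s = s * z)"
proof -
  define y :: "nat \<Rightarrow> 'a" where "y = rec_nat 0 (\<lambda>_ v. (1/2) *\<^sub>R (x + v * v))"
  \<comment> \<open>The scalar majorant: the same iteration at \<open>x = 1\<close>.\<close>
  define a :: "nat \<Rightarrow> real" where "a = rec_nat 0 (\<lambda>_ v. (1/2) * (1 + v * v))"
  have y0 [simp]: "y 0 = 0" and yS: "\<And>n. y (Suc n) = (1/2) *\<^sub>R (x + y n * y n)"
    by (simp_all add: y_def)
  have a0 [simp]: "a 0 = 0" and aS: "\<And>n. a (Suc n) = (1/2) * (1 + a n * a n)"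
    by (simp_all add: a_def)
  have a_bd: "0 \<le> a n \<and> a n \<le> 1" for n
  proof (induction n)
    case (Suc n)
    then have "a n * a n \<le> 1 * 1" by (intro mult_mono) auto
    then show ?case by (simp add: aS)
  qed simp
  have y_norm: "norm (y n) \<le> a n" for n
  proof (induction n)
    case (Suc n)
    have "norm (x + y n * y n) \<le> 1 + a n * a n"
      by (intro norm_triangle_le add_mono nx order_trans[OF norm_mult_ineq] mult_mono)
         (use Suc a_bd in auto)
    then show ?case by (simp add: yS aS)
  qed simp
  have y_star: "star (y n) = y n" for n
    by (induction n) (auto simp: yS star_scaleR star_add star_mult sx)
  have y_comm: "z * y n = y n * z" if "z * x = x * z" for z n
  proof (induction n)
    case (Suc n)
    then have "z * (y n * y n) = (y n * y n) * z" by (metis mult.assoc)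
    then show ?case using that by (simp add: yS algebra_simps)
  qed simp
  have y_comm2: "y m * y n = y n * y m" for m n
    by (rule y_comm) (rule y_comm[symmetric], simp)
  have step: "norm (y (Suc n) - y n) \<le> a (Suc n) - a n" for n
  proof (induction n)
    case (Suc n)
    have "y (Suc (Suc n)) - y (Suc n) = (1/2) *\<^sub>R (y (Suc n) * y (Suc n) - y n * y n)"
      by (simp add: yS[of "Suc n"] yS[of n] algebra_simps)
    also have "y (Suc n) * y (Suc n) - y n * y n = (y (Suc n) - y n) * (y (Suc n) + y n)"
      using y_comm2[of n "Suc n"] by (simp add: algebra_simps)
    finally have "norm (y (Suc (Suc n)) - y (Suc n))
        \<le> (1/2) * (norm (y (Suc n) - y n) * norm (y (Suc n) + y n))"
      by (simp add: norm_mult_ineq)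
    also have "\<dots> \<le> (1/2) * ((a (Suc n) - a n) * (a (Suc n) + a n))"
      using Suc y_norm[of n] y_norm[of "Suc n"] norm_triangle_ineq[of "y (Suc n)" "y n"]
        order_trans[OF norm_ge_zero Suc]
      by (intro mult_left_mono mult_mono) auto
    also have "\<dots> = a (Suc (Suc n)) - a (Suc n)"
      by (simp add: aS[of "Suc n"] aS[of n] field_simps)
    finally show ?case .
  qed (use nx in \<open>simp add: yS aS\<close>)
  have steps: "norm (y (m + n) - y n) \<le> a (m + n) - a n" for m n
  proof (induction m)
    case (Suc m)
    then show ?case using step[of "m + n"] norm_triangle_ineq[of "y (Suc (m + n)) - y (m + n)" "y (m + n) - y n"]
      by simp
  qed simp
  have "a n \<le> a (Suc n)" for n using order_trans[OF norm_ge_zero step[of n]] by simp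
  then have "incseq a" by (rule incseq_SucI)
  moreover have "Bseq a" by (rule BseqI'[where K=1]) (use a_bd in auto)
  ultimately have "convergent a" by (simp add: Bseq_mono_convergent incseq_def)
  then have Ca: "Cauchy a" by (rule convergent_Cauchy)
  have "Cauchy y"
  proof (rule CauchyI')
    fix e :: real assume "0 < e"
    then obtain N where N: "\<And>m n. m \<ge> N \<Longrightarrow> n \<ge> N \<Longrightarrow> norm (a m - a n) < e"
      using CauchyD[OF Ca] by blast
    show "\<exists>M. \<forall>m\<ge>M. \<forall>n>m. dist (y m) (y n) < e"
    proof (intro exI allI impI)
      fix m n assume "m \<ge> N" "n > m"
      then have "norm (y n - y m) \<le> a n - a m" using steps[of "n - m" m] by simp
      also have "\<dots> < e" using N[of n m] \<open>m \<ge> N\<close> \<open>n > m\<close> by auto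
      finally show "dist (y m) (y n) < e" by (simp add: dist_norm norm_minus_commute)
    qed
  qed
  then obtain L where L: "y \<longlonglongrightarrow> L" by (auto simp: Cauchy_convergent_iff convergent_def)
  have "(\<lambda>n. (1/2) *\<^sub>R (x + y n * y n)) \<longlonglongrightarrow> (1/2) *\<^sub>R (x + L * L)"
    by (intro tendsto_intros L)
  then have "(\<lambda>n. y (Suc n)) \<longlonglongrightarrow> (1/2) *\<^sub>R (x + L * L)" by (simp add: yS)
  then have "L = (1/2) *\<^sub>R (x + L * L)" using L LIMSEQ_Suc LIMSEQ_unique by blast
  then have L2: "2 *\<^sub>R L = x + L * L" by (metis scaleR_half_double scaleR_2 scaleR_right_distrib)
  have nL: "norm L \<le> 1"
    by (rule Lim_bounded[OF tendsto_norm[OF L], of 0]) (use y_norm a_bd order_trans in blast)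
  have sL: "star L = L"
    using tendsto_star[OF L] by (simp add: y_star LIMSEQ_unique L)
  have cL: "z * L = L * z" if "z * x = x * z" for z
  proof (rule LIMSEQ_unique)
    show "(\<lambda>n. z * y n) \<longlonglongrightarrow> z * L" by (intro tendsto_intros L)
    show "(\<lambda>n. z * y n) \<longlonglongrightarrow> L * z" unfolding y_comm[OF that] by (intro tendsto_intros L)
  qed
  have LL: "(1 - L) * (1 - L) = 1 - x"
  proof -
    have "(1 - L) * (1 - L) = 1 + L * L - 2 *\<^sub>R L"
      by (simp add: left_diff_distrib right_diff_distrib scaleR_2)
    then show ?thesis unfolding L2 by simp
  qed
  show ?thesis
  proof (intro exI[of _ "1 - L"] conjI allI impI)
    show "star (1 - L) = 1 - L" by (simp add: star_diff sL)
    show "(1 - L) * (1 - L) = 1 - x" by (rule LL)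
    show "norm (1 - (1 - L)) \<le> 1" using nL by simp
    show "z * (1 - L) = (1 - L) * z" if "z * x = x * z" for z
      using cL[OF that] by (simp add: left_diff_distrib right_diff_distrib)
  qed
qed

lemma commute_mult:
  fixes h :: "'a::semigroup_mult"
  assumes "h * x = x * h" "h * y = y * h" shows "h * (x * y) = (x * y) * h"
proof -
  have "h * (x * y) = x * (h * y)" by (simp add: assms(1) flip: mult.assoc)
  then show ?thesis by (simp add: assms(2) mult.assoc)
qed

lemma commute_square:
  fixes x :: "'a::semigroup_mult"
  assumes "x * y = y * x" shows "(x * y) * (x * y) = (x * x) * (y * y)"
proof -
  have "(x * y) * (x * y) = x * (y * x) * y" by (simp only: mult.assoc)
  also have "\<dots> = (x * x) * (y * y)" by (simp only: assms[symmetric] mult.assoc)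
  finally show ?thesis .
qed

subsection \<open>Positive elements\<close>

text \<open>The usual condition that the spectrum lies in \<open>[0, \<infinity>)\<close> is expressed by norms: a selfadjoint
element with spectrum in \<open>[0, 2t]\<close> has distance at most \<open>t\<close> from \<open>t\<close>.  In this form positive elements
visibly are a cone, and after rescaling the square root iteration applies to them.\<close>

definition cpos :: "'a::cstar \<Rightarrow> bool" where
  "cpos h \<longleftrightarrow> star h = h \<and> (\<exists>t\<ge>0. norm (t *\<^sub>R 1 - h) \<le> t)"

lemma cpos_selfadj: "cpos h \<Longrightarrow> star h = h"
  by (simp add: cpos_def)

lemma cpos_0 [simp]: "cpos 0"
  by (auto simp: cpos_def)

lemma cpos_add: assumes "cpos a" "cpos b" shows "cpos (a + b)"
proof -
  obtain s t where st: "s \<ge> 0" "t \<ge> 0" "norm (s *\<^sub>R 1 - a) \<le> s" "norm (t *\<^sub>R 1 - b) \<le> t"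
    using assms by (auto simp: cpos_def)
  have "norm ((s + t) *\<^sub>R 1 - (a + b)) = norm ((s *\<^sub>R 1 - a) + (t *\<^sub>R 1 - b))"
    by (simp add: algebra_simps)
  also have "\<dots> \<le> s + t" using st by (intro norm_triangle_le) auto
  finally show ?thesis using assms st by (auto simp: cpos_def star_add intro!: exI[of _ "s + t"])
qed

lemma cpos_scaleR: assumes "cpos a" "r \<ge> 0" shows "cpos (r *\<^sub>R a)"
proof -
  obtain s where s: "s \<ge> 0" "norm (s *\<^sub>R 1 - a) \<le> s" using assms by (auto simp: cpos_def)
  have "norm ((r * s) *\<^sub>R 1 - r *\<^sub>R a) = r * norm (s *\<^sub>R 1 - a)"
    using assms(2) norm_scaleR[of r "s *\<^sub>R 1 - a"] by (simp add: algebra_simps)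
  then show ?thesis using assms s
    by (auto simp: cpos_def star_scaleR mult_left_mono intro!: exI[of _ "r * s"])
qed

lemma cpos_sum: "(\<And>i. i \<in> S \<Longrightarrow> cpos (f i)) \<Longrightarrow> cpos (sum f S)"
  by (induction S rule: infinite_finite_induct) (auto intro: cpos_add)

lemma cpos_sqrt:
  assumes "cpos h"
  shows "\<exists>s. cpos s \<and> s * s = h \<and> (\<forall>z. z * h = h * z \<longrightarrow> z * s = s * z)"
proof -
  obtain t where h: "star h = h" and t: "t \<ge> 0" "norm (t *\<^sub>R 1 - h) \<le> t"
    using assms by (auto simp: cpos_def)
  show ?thesis
  proof (cases "t = 0")
    case True
    then show ?thesis using t by (intro exI[of _ 0]) auto
  next
    case False
    define x where "x = 1 - (1/t) *\<^sub>R h"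
    have tx: "t *\<^sub>R 1 - h = t *\<^sub>R x" using False by (simp add: x_def algebra_simps)
    have "star x = x" by (simp add: x_def star_diff star_scaleR h)
    moreover have "norm x \<le> 1" using t False by (simp add: tx)
    ultimately obtain s where s: "star s = s" "s * s = 1 - x" "norm (1 - s) \<le> 1"
        "\<And>z. z * x = x * z \<Longrightarrow> z * s = s * z"
      using power_iteration_sqrt[of x] by blast
    show ?thesis
    proof (intro exI[of _ "sqrt t *\<^sub>R s"] conjI allI impI)
      have "norm (sqrt t *\<^sub>R 1 - sqrt t *\<^sub>R s) = sqrt t * norm (1 - s)"
        using t norm_scaleR[of "sqrt t" "1 - s"] by (simp add: algebra_simps)
      also have "\<dots> \<le> sqrt t * 1" by (intro mult_left_mono s(3)) (use t in simp)
      finally show "cpos (sqrt t *\<^sub>R s)" using t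
        by (auto simp: cpos_def star_scaleR s intro!: exI[of _ "sqrt t"])
      show "sqrt t *\<^sub>R s * sqrt t *\<^sub>R s = h" using t False by (simp add: s x_def)
      fix z assume "z * h = h * z"
      then have "z * x = x * z" by (simp add: x_def algebra_simps)
      then have "z * s = s * z" by (rule s(4))
      then show "z * sqrt t *\<^sub>R s = sqrt t *\<^sub>R s * z" by simp
    qed
  qed
qed

lemma norm_le_of_star_mult:
  assumes "star u * u = r *\<^sub>R (1::'a::cstar)" "r \<ge> 0"
  shows "norm u \<le> sqrt r"
proof -
  have "(norm u)\<^sup>2 = r * norm (1::'a)" using assms by (simp flip: norm_star_mult)
  also have "\<dots> \<le> r" using assms norm_one_le[where 'a='a] mult_left_le by blast
  finally show ?thesis by (simp add: real_le_rsqrt)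
qed

text \<open>The element \<open>u = a + i b\<close> satisfies \<open>u* u = r\<close>, and \<open>a\<close> is its real part.\<close>

lemma norm_le_of_sum_squares:
  fixes a b :: "'a::cstar"
  assumes a: "star a = a" and b: "star b = b" and ab: "a * b = b * a"
    and eq: "a * a + b * b = r *\<^sub>R 1" and r: "r \<ge> 0"
  shows "norm a \<le> sqrt r"
proof -
  define u where "u = a + \<i> *\<^sub>C b"
  have su: "star u = a + (- \<i>) *\<^sub>C b" by (simp add: u_def star_add star_cscale a b)
  have "star u * u = r *\<^sub>R 1"
    unfolding su by (simp add: u_def distrib_left distrib_right left_diff_distrib cscale_diff_right cscale_add_right ab cscale_minus_left flip: eq)
  then have u: "norm u \<le> sqrt r" using r by (rule norm_le_of_star_mult)
  have "u + star u = 2 *\<^sub>R a" unfolding su by (simp add: u_def cscale_minus_left scaleR_2)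
  then have "2 * norm a \<le> norm u + norm (star u)"
    using norm_triangle_ineq[of u "star u"] by simp
  then show ?thesis using u by simp
qed

text \<open>After rescaling to norm one, \<open>1 - s\<^sup>2\<close> has a square root \<open>y\<close>, so that \<open>y\<^sup>2 + s\<^sup>2 = 1\<close> bounds the norm of
\<open>y\<close> by one, and with it the norm of \<open>1 - s\<^sup>2\<close>.\<close>

lemma cpos_square:
  fixes s :: "'a::cstar"
  assumes s: "star s = s" shows "cpos (s * s)"
proof (cases "s = 0")
  case False
  define n where "n = norm s"
  have n: "n > 0" using False by (simp add: n_def)
  define q where "q = (1/n) *\<^sub>R s"
  have q: "star q = q" by (simp add: q_def star_scaleR s)
  have nq: "norm q = 1" using n by (simp add: q_def n_def)
  have "star (q * q) = q * q" by (simp add: star_mult q)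
  moreover have "norm (q * q) \<le> 1" by (simp add: selfadj_square_norm q nq)
  ultimately obtain y where y: "star y = y" "y * y = 1 - q * q"
      "\<And>z. z * (q * q) = (q * q) * z \<Longrightarrow> z * y = y * z"
    using power_iteration_sqrt[of "q * q"] by blast
  have "norm y \<le> sqrt 1"
    by (rule norm_le_of_sum_squares[of y q]) (use y q in \<open>auto simp: mult.assoc\<close>)
  then have "norm (1 - q * q) \<le> 1"
    using selfadj_square_norm[OF y(1)] y(2) power_le_one[of "norm y" 2] by simp
  moreover have "star (q * q) = q * q" by (simp add: star_mult q)
  ultimately have "cpos (q * q)" by (auto simp: cpos_def intro!: exI[of _ 1])
  then have "cpos ((n * n) *\<^sub>R (q * q))" by (rule cpos_scaleR) (use n in auto)
  moreover have "(n * n) *\<^sub>R (q * q) = s * s" using n by (simp add: q_def)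
  ultimately show ?thesis by simp
qed simp

lemma cpos_scaleR_one: "r \<ge> 0 \<Longrightarrow> cpos (r *\<^sub>R 1)"
  using cpos_scaleR[OF cpos_square[of 1]] by simp

lemma cpos_norm_diff: "star h = h \<Longrightarrow> norm h \<le> t \<Longrightarrow> cpos (t *\<^sub>R 1 - h)"
  by (auto simp: cpos_def star_diff star_scaleR intro!: exI[of _ t] order_trans[OF norm_ge_zero])

lemma cpos_mult:
  assumes "cpos a" "cpos b" "a * b = b * a" shows "cpos (a * b)"
proof -
  obtain x where x: "cpos x" "x * x = a" "\<And>z. z * a = a * z \<Longrightarrow> z * x = x * z"
    using cpos_sqrt[OF assms(1)] by blast
  obtain y where y: "cpos y" "y * y = b" "\<And>z. z * b = b * z \<Longrightarrow> z * y = y * z"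
    using cpos_sqrt[OF assms(2)] by blast
  have "b * x = x * b" by (rule x(3)) (simp add: assms)
  then have xy: "x * y = y * x" using y(3)[of x] by simp
  have "star (x * y) = x * y" by (simp add: star_mult cpos_selfadj[OF x(1)] cpos_selfadj[OF y(1)] xy)
  moreover have "(x * y) * (x * y) = a * b"
    using commute_square[OF xy] by (simp add: x(2) y(2))
  ultimately show ?thesis using cpos_square[of "x * y"] by simp
qed

text \<open>The square roots \<open>x\<close> and \<open>y\<close> of \<open>t - h\<close> and \<open>t + h\<close> commute with \<open>h\<close> and \<open>h\<^sup>2 + (x y)\<^sup>2 = t\<^sup>2\<close>.\<close>

lemma norm_le_of_cpos:
  fixes h :: "'a::cstar"
  assumes t: "t \<ge> 0" and m: "cpos (t *\<^sub>R 1 - h)" and p: "cpos (t *\<^sub>R 1 + h)"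
  shows "norm h \<le> t"
proof -
  have h: "star h = h" using cpos_selfadj[OF p] by (simp add: star_add star_scaleR)
  obtain x where x: "cpos x" "x * x = t *\<^sub>R 1 - h" "\<And>z. z * (t *\<^sub>R 1 - h) = (t *\<^sub>R 1 - h) * z \<Longrightarrow> z * x = x * z"
    using cpos_sqrt[OF m] by blast
  obtain y where y: "cpos y" "y * y = t *\<^sub>R 1 + h" "\<And>z. z * (t *\<^sub>R 1 + h) = (t *\<^sub>R 1 + h) * z \<Longrightarrow> z * y = y * z"
    using cpos_sqrt[OF p] by blast
  have hx: "h * x = x * h" by (rule x(3)) (simp add: algebra_simps)
  then have xy: "x * y = y * x" using y(3)[of x] by (simp add: algebra_simps)
  have hy: "h * y = y * h" by (rule y(3)) (simp add: algebra_simps)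
  have "norm h \<le> sqrt (t * t)"
  proof (rule norm_le_of_sum_squares[of h "x * y"])
    show "star (x * y) = x * y" by (simp add: star_mult cpos_selfadj[OF x(1)] cpos_selfadj[OF y(1)] xy)
    show "h * (x * y) = x * y * h" using hx hy by (rule commute_mult)
    show "h * h + x * y * (x * y) = (t * t) *\<^sub>R 1"
      unfolding commute_square[OF xy] by (simp add: x(2) y(2) algebra_simps)
  qed (use h t in auto)
  then show ?thesis using t by simp
qed

lemma cpos_antisym: "cpos h \<Longrightarrow> cpos (- h) \<Longrightarrow> h = 0"
  using norm_le_of_cpos[of 0 h] by simp

lemma cpos_add_eq_0:
  assumes "cpos a" "cpos b" "a + b = 0" shows "a = 0"
  using assms by (metis cpos_antisym add_eq_0_iff)

text \<open>Writing \<open>d\<close> as \<open>(p + i q) / 2\<close> with selfadjoint \<open>p\<close>, \<open>q\<close>, the sum is half of \<open>p\<^sup>2 + q\<^sup>2\<close>.\<close>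

lemma cpos_half_diff: "star d = e \<Longrightarrow> cpos (d * e + e * (d::'a::cstar))"
proof -
  assume de: "star d = e"
  then have ed: "star e = d" by auto
  define p where "p = d + e"
  define q where "q = \<i> *\<^sub>C (e - d)"
  have "star p = p" by (simp add: p_def star_add de ed add.commute)
  moreover have "star q = q"
    by (simp add: q_def star_cscale star_diff de ed cscale_minus_left cscale_diff_right)
  ultimately have "cpos ((1/2) *\<^sub>R (p * p + q * q))"
    by (intro cpos_scaleR cpos_add cpos_square) auto
  also have "p * p + q * q = 2 *\<^sub>R (d * e + e * d)"
    by (simp add: p_def q_def distrib_left distrib_right left_diff_distrib right_diff_distrib
        cscale_minus_left cscale_diff_right scaleR_2)
  finally show ?thesis by simp
qed

text \<open>The key step of the Kelley-Vaught argument that \<open>b* b\<close> is positive.  Without spectra one cannot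
compare \<open>c* c\<close> with \<open>c c*\<close> directly.  For \<open>d = c w\<close>, however, both \<open>d* d = - w\<^sup>4\<close> and
\<open>d d* = - (c c*)\<^sup>2\<close> are negatives of squares, while their sum is positive; hence \<open>c c* = 0\<close>.\<close>

lemma star_mult_negative_imp_0:
  fixes c :: "'a::cstar"
  assumes w: "star w = w" and cw: "star c * c = - (w * w)"
  shows "c = 0"
proof -
  define d where "d = c * w"
  define k where "k = c * star c"
  have sd: "star d = w * star c" by (simp add: d_def star_mult w)
  have sk: "star k = k" by (simp add: k_def star_mult)
  have sww: "star (w * w) = w * w" by (simp add: star_mult w)
  have "star d * d = w * (star c * c) * w" by (simp add: sd, simp add: d_def mult.assoc)
  also have "\<dots> = - ((w * w) * (w * w))" by (simp add: cw mult.assoc)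
  finally have 1: "star d * d = - ((w * w) * (w * w))" .
  have "d * star d = c * (w * w) * star c" by (simp add: sd, simp add: d_def mult.assoc)
  also have "w * w = - (star c * c)" by (simp add: cw)
  finally have 2: "d * star d = - (k * k)" by (simp add: k_def mult.assoc)
  have "cpos ((w * w) * (w * w) + (d * star d + star d * d))"
    by (intro cpos_add cpos_square cpos_half_diff sww refl)
  moreover have "cpos (k * k)" by (rule cpos_square[OF sk])
  ultimately have "k * k = 0" by (intro cpos_add_eq_0[of "k * k"]) (auto simp: 1 2)
  then have "k = 0" by (rule selfadj_square_eq_0[OF sk])
  then have "(norm (star c))\<^sup>2 = 0" using norm_star_mult[of "star c"] by (simp add: k_def)
  then show ?thesis by simp
qed

lemma commute_diff: "h * x = x * h \<Longrightarrow> h * y = y * h \<Longrightarrow> h * (x - y) = (x - y) * (h::'a::ring)"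
  by (simp add: left_diff_distrib right_diff_distrib)

lemma commute_scaleR: "h * x = x * h \<Longrightarrow> h * (r *\<^sub>R x) = (r *\<^sub>R x) * (h::'a::real_algebra)"
  by simp

text \<open>If \<open>s\<close> is the absolute value of \<open>h\<close> then \<open>n\<close> is its negative part.\<close>

lemma negative_part:
  fixes s h :: "'a::cstar"
  assumes sh: "s * h = h * s" and ss: "s * s = h * h" and n: "n = (1/2) *\<^sub>R (s - h)"
  shows "s * n = n * s" "h * n = n * h" "n * s = n * n" "n * h = - (n * n)"
proof -
  show 1: "s * n = n * s" unfolding n by (intro commute_scaleR commute_diff refl sh)
  show "h * n = n * h" unfolding n by (intro commute_scaleR commute_diff refl sh[symmetric])
  have "2 *\<^sub>R n = s - h" by (simp add: n)
  then have h: "h = s - 2 *\<^sub>R n" by simp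
  have "(s - h) * (s + h) = 0" using sh ss by (simp add: distrib_left left_diff_distrib)
  then have "n * (s + h) = 0" by (simp add: n)
  then have "n * (2 *\<^sub>R (s - n)) = 0" by (simp add: h scaleR_2 algebra_simps)
  then show 2: "n * s = n * n" by (simp add: right_diff_distrib)
  show "n * h = - (n * n)" unfolding h by (simp add: right_diff_distrib distrib_left 2 scaleR_2)
qed

lemma selfadj_cube_eq_0: assumes "star n = n" "n * n * n = 0" shows "n = (0::'a::cstar)"
proof (rule selfadj_square_eq_0[OF assms(1)], rule selfadj_square_eq_0)
  have "n * n * (n * n) = n * n * n * n" by (simp only: mult.assoc)
  then show "n * n * (n * n) = 0" by (simp add: assms)
qed (simp add: star_mult assms)

text \<open>With \<open>n\<close> the negative part of \<open>h = b* b\<close>, the element \<open>(b n)* (b n) = n h n = - n\<^sup>3\<close> is the negative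
of the square of \<open>w = n |h|\<^sup>1\<^sup>/\<^sup>2\<close>; so \<open>b n\<close> vanishes, and then \<open>n\<close> does.\<close>

lemma cpos_star_mult: "cpos (star b * (b::'a::cstar))"
proof -
  define h where "h = star b * b"
  have h: "star h = h" by (simp add: h_def star_mult)
  obtain s where s: "cpos s" "s * s = h * h" "\<And>z. z * (h * h) = (h * h) * z \<Longrightarrow> z * s = s * z"
    using cpos_sqrt[OF cpos_square[OF h]] by blast
  have sh: "s * h = h * s" by (rule s(3)[symmetric]) (simp only: mult.assoc)
  obtain r where r: "cpos r" "r * r = s" "\<And>z. z * s = s * z \<Longrightarrow> z * r = r * z"
    using cpos_sqrt[OF s(1)] by blast
  define n where "n = (1/2) *\<^sub>R (s - h)"
  note N = negative_part[OF sh s(2) n_def]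
  have sn: "star n = n" by (simp add: n_def star_scaleR star_diff h cpos_selfadj[OF s(1)])
  have nr: "n * r = r * n" by (rule r(3)) (simp only: N(1))
  define w where "w = n * r"
  have sw: "star w = w" by (simp add: w_def star_mult sn cpos_selfadj[OF r(1)] nr)
  have ww: "w * w = n * n * n"
    unfolding w_def commute_square[OF nr] by (simp add: r(2) mult.assoc N(3))
  have "star (b * n) * (b * n) = n * h * n" by (simp add: star_mult sn h_def mult.assoc)
  also have "\<dots> = - (w * w)" by (simp add: N(4) ww)
  finally have "b * n = 0" by (rule star_mult_negative_imp_0[OF sw])
  then have "h * n = 0" by (simp add: h_def mult.assoc)
  then have "n * n = 0" using N(2,4) by simp
  then have "n = 0" by (rule selfadj_square_eq_0[OF sn])
  then have "h = s" by (simp add: n_def)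
  then show ?thesis using s(1) h_def by simp
qed

lemma norm_le_of_star_mult_add:
  fixes a :: "'a::cstar"
  assumes "star a * a + c = t *\<^sub>R 1" "cpos c" "t \<ge> 0"
  shows "norm a \<le> sqrt t"
proof -
  have "t *\<^sub>R 1 - star a * a = c" using assms(1) by (simp add: algebra_simps)
  then have "norm (star a * a) \<le> t"
    using assms by (intro norm_le_of_cpos cpos_add cpos_star_mult cpos_scaleR_one) auto
  then show ?thesis by (simp add: norm_star_mult real_le_rsqrt)
qed

text \<open>For \<open>d = m - p\<close> the positive elements \<open>d m d\<close> and \<open>d p d\<close> add up to \<open>d (m\<^sup>2 - p\<^sup>2) = 0\<close>, so both vanish,
and so does their difference \<open>d\<^sup>3\<close>.\<close>

lemma cpos_commuting_square_unique:
  fixes m p :: "'a::cstar"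
  assumes m: "cpos m" and p: "cpos p" and mp: "m * p = p * m" and eq: "m * m = p * p"
  shows "m = p"
proof -
  define d where "d = m - p"
  have sd: "star d = d" by (simp add: d_def star_diff cpos_selfadj m p)
  have dm: "d * m = m * d" and dp: "d * p = p * d"
    using mp by (simp_all add: d_def left_diff_distrib right_diff_distrib)
  have *: "cpos (d * a * d)" if "cpos a" "d * a = a * d" for a
  proof -
    have "cpos (a * (d * d))"
      by (rule cpos_mult[OF that(1) cpos_square[OF sd] commute_mult]) (use that in auto)
    then show ?thesis using that(2) by (simp add: mult.assoc)
  qed
  have "d * (m + p) = 0" using mp eq by (simp add: d_def left_diff_distrib distrib_left)
  then have "d * (m + p) * d = 0" by simp
  then have sum: "d * m * d + d * p * d = 0" by (simp add: distrib_left distrib_right)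
  then have 1: "d * m * d = 0" by (rule cpos_add_eq_0[OF *[OF m dm] *[OF p dp]])
  then have "d * d * d = 0" using sum
    by (metis add_0 d_def diff_self left_diff_distrib right_diff_distrib)
  then have "d = 0" by (rule selfadj_cube_eq_0[OF sd])
  then show ?thesis by (simp add: d_def)
qed

text \<open>This is the inequality \<open>x \<le> |x|\<close>.  It amounts to positivity of the negative part \<open>n\<close>, which is shown
by proving that \<open>n\<close> equals its own absolute value \<open>a\<close>: first \<open>a s = n\<^sup>2\<close>, by uniqueness of positive
square roots, and from this \<open>y = a - n\<close> is successively seen to annihilate \<open>s\<close>, \<open>x\<close>, \<open>n\<close>, \<open>a\<close> and itself.\<close>

lemma cpos_abs_minus:
  fixes s x :: "'a::cstar"
  assumes s: "cpos s" and x: "star x = x" and sx: "s * x = x * s" and eq: "s * s = x * x"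
  shows "cpos (s - x)"
proof -
  define n where "n = (1/2) *\<^sub>R (s - x)"
  note N = negative_part[OF sx eq n_def]
  have ss: "star s = s" by (rule cpos_selfadj[OF s])
  have sn: "star n = n" by (simp add: n_def star_scaleR star_diff x ss)
  obtain a where a: "cpos a" "a * a = n * n" "\<And>z. z * (n * n) = (n * n) * z \<Longrightarrow> z * a = a * z"
    using cpos_sqrt[OF cpos_square[OF sn]] by blast
  have sa: "s * a = a * s" and xa: "x * a = a * x" and na: "n * a = a * n"
    by (rule a(3), rule commute_mult, (rule N refl)+)+
  have snn: "s * (n * n) = (n * n) * s" by (rule commute_mult; rule N)
  have nna: "n * n * a = a * (n * n)" unfolding a(2)[symmetric] by (simp only: mult.assoc)
  have "a * s = n * n"
  proof (rule cpos_commuting_square_unique)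
    show "cpos (a * s)" by (rule cpos_mult[OF a(1) s sa[symmetric]])
    show "cpos (n * n)" by (rule cpos_square[OF sn])
    show "a * s * (n * n) = n * n * (a * s)"
      by (rule commute_mult[OF nna snn[symmetric], symmetric])
    show "a * s * (a * s) = n * n * (n * n)"
      unfolding commute_square[OF sa[symmetric]] a(2) commute_square[OF N(1)[symmetric], symmetric]
      by (simp only: N(3))
  qed
  define y where "y = a - n"
  have sy: "star y = y" by (simp add: y_def star_diff sn cpos_selfadj[OF a(1)])
  have ys: "y * s = 0" using \<open>a * s = n * n\<close> N(3) by (simp add: y_def left_diff_distrib)
  have xy: "x * y = y * x" unfolding y_def by (rule commute_diff[OF xa N(2)])
  have "y * x = 0"
  proof (rule selfadj_square_eq_0)
    show "star (y * x) = y * x" by (simp add: star_mult sy x xy)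
    show "y * x * (y * x) = 0" unfolding commute_square[OF xy[symmetric]] eq[symmetric]
      using ys by (simp add: mult.assoc flip: mult.assoc[of y s s])
  qed
  then have yn: "y * n = 0" using ys by (simp add: n_def right_diff_distrib)
  have ya_comm: "y * a = a * y" by (simp add: y_def left_diff_distrib right_diff_distrib na)
  have "y * a = 0"
  proof (rule selfadj_square_eq_0)
    show "star (y * a) = y * a" by (simp add: star_mult sy cpos_selfadj[OF a(1)] ya_comm)
    have "y * (a * a) = 0" unfolding a(2) using yn by (simp flip: mult.assoc)
    then show "y * a * (y * a) = 0" unfolding commute_square[OF ya_comm] by (simp add: mult.assoc)
  qed
  then have "y * y = 0" using yn by (metis y_def diff_self right_diff_distrib)
  then have "y = 0" by (rule selfadj_square_eq_0[OF sy])
  then have "n = a" by (simp add: y_def)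
  then have "cpos (2 *\<^sub>R n)" using a(1) by (intro cpos_scaleR) auto
  then show ?thesis by (simp add: n_def)
qed

text \<open>With \<open>m = |b - r|\<close> and \<open>q = |b + r|\<close>, the element \<open>v = (q - m) / 2\<close> is \<open>b\<close> truncated to the interval
from \<open>-r\<close> to \<open>r\<close>.  The bound on its norm holds since \<open>r\<^sup>2 - v\<^sup>2\<close> is half of \<open>|x| - x\<close> for \<open>x = b\<^sup>2 - r\<^sup>2\<close>.\<close>

lemma truncation:
  fixes b :: "'a::cstar"
  assumes b: "star b = b" and r: "r \<ge> 0"
  shows "\<exists>m q. cpos m \<and> cpos q \<and> m * m = (b - r *\<^sub>R 1) * (b - r *\<^sub>R 1) \<and>
    q * q = (b + r *\<^sub>R 1) * (b + r *\<^sub>R 1) \<and> m * b = b * m \<and> q * b = b * q \<and>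
    norm ((1/2) *\<^sub>R (q - m)) \<le> r"
proof -
  have s1: "star (b - r *\<^sub>R 1) = b - r *\<^sub>R 1" and s2: "star (b + r *\<^sub>R 1) = b + r *\<^sub>R 1"
    by (simp_all add: star_diff star_add star_scaleR b)
  obtain m where m: "cpos m" "m * m = (b - r *\<^sub>R 1) * (b - r *\<^sub>R 1)"
     and mc: "\<And>z. z * ((b - r *\<^sub>R 1) * (b - r *\<^sub>R 1)) = ((b - r *\<^sub>R 1) * (b - r *\<^sub>R 1)) * z \<Longrightarrow> z * m = m * z"
    using cpos_sqrt[OF cpos_square[OF s1]] by blast
  obtain q where q: "cpos q" "q * q = (b + r *\<^sub>R 1) * (b + r *\<^sub>R 1)"
     and qc: "\<And>z. z * ((b + r *\<^sub>R 1) * (b + r *\<^sub>R 1)) = ((b + r *\<^sub>R 1) * (b + r *\<^sub>R 1)) * z \<Longrightarrow> z * q = q * z"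
    using cpos_sqrt[OF cpos_square[OF s2]] by blast
  have bm: "b * m = m * b" by (rule mc, rule commute_mult) (simp_all add: algebra_simps)
  have bq: "b * q = q * b" by (rule qc, rule commute_mult) (simp_all add: algebra_simps)
  have mq: "m * q = q * m" by (rule qc, rule commute_mult) (simp_all add: distrib_left distrib_right bm)
  define x where "x = b * b - (r * r) *\<^sub>R 1"
  have x: "x = (b - r *\<^sub>R 1) * (b + r *\<^sub>R 1)" by (simp add: x_def algebra_simps)
  have "(b - r *\<^sub>R 1) * (b + r *\<^sub>R 1) = (b + r *\<^sub>R 1) * (b - r *\<^sub>R 1)" by (simp add: algebra_simps)
  note X = commute_square[OF this]
  have xx: "(q * m) * (q * m) = x * x"
    unfolding mq[symmetric] commute_square[OF mq] m(2) q(2) x X ..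
  have xbb: "z * x = x * z" if "b * z = z * b" for z
    unfolding x_def by (rule commute_diff, rule commute_mult) (simp_all add: that)
  have "cpos (q * m - x)"
  proof (rule cpos_abs_minus)
    show "cpos (q * m)" by (rule cpos_mult[OF q(1) m(1) mq[symmetric]])
    show "star x = x" by (simp add: x_def star_diff star_mult star_scaleR b)
    show "q * m * x = x * (q * m)" by (rule xbb, rule commute_mult[OF bq bm])
  qed (rule xx)
  then have p: "cpos ((1/2) *\<^sub>R (q * m - x))" by (rule cpos_scaleR) simp
  define v where "v = (1/2) *\<^sub>R (q - m)"
  have sv: "star v = v" by (simp add: v_def star_scaleR star_diff cpos_selfadj m(1) q(1))
  have "4 *\<^sub>R (v * v) = (q - m) * (q - m)"
    unfolding v_def by (simp only: mult_scaleR_left mult_scaleR_right scaleR_scaleR) simp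
  also have "\<dots> = q * q + m * m - 2 *\<^sub>R (q * m)"
    by (simp add: left_diff_distrib right_diff_distrib mq scaleR_2)
  also have "\<dots> = 2 *\<^sub>R (b * b) + (2 * r * r) *\<^sub>R 1 - 2 *\<^sub>R (q * m)"
    unfolding m(2) q(2) by (simp add: algebra_simps scaleR_2 flip: scaleR_add_left)
  finally have "4 *\<^sub>R (v * v) = 2 *\<^sub>R (b * b) + 2 *\<^sub>R ((r * r) *\<^sub>R 1) - 2 *\<^sub>R (q * m)" by simp
  then have "(1/4) *\<^sub>R (4 *\<^sub>R (v * v)) = (1/4) *\<^sub>R (2 *\<^sub>R (b * b) + 2 *\<^sub>R ((r * r) *\<^sub>R 1) - 2 *\<^sub>R (q * m))"
    by simp
  then have vv: "v * v = (1/2) *\<^sub>R (b * b) + (1/2) *\<^sub>R ((r * r) *\<^sub>R 1) - (1/2) *\<^sub>R (q * m)"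
    by (simp add: scaleR_right_diff_distrib scaleR_right_distrib)
  have "star v * v + (1/2) *\<^sub>R (q * m - x) = (1/2) *\<^sub>R ((r * r) *\<^sub>R 1) + (1/2) *\<^sub>R ((r * r) *\<^sub>R 1)"
    unfolding sv vv x_def by (simp add: scaleR_right_diff_distrib)
  also have "\<dots> = (r * r) *\<^sub>R 1" by (simp flip: scaleR_add_left)
  finally have "star v * v + (1/2) *\<^sub>R (q * m - x) = (r * r) *\<^sub>R 1" .
  then have "norm v \<le> sqrt (r * r)" using p by (intro norm_le_of_star_mult_add) auto
  then have "norm v \<le> r" using r by simp
  then show ?thesis using m q bm[symmetric] bq[symmetric] unfolding v_def
    by (intro exI[of _ m] exI[of _ q] conjI)
qed

text \<open>Truncation at a level above the norm does nothing: \<open>|y - r|\<close> is then \<open>r - y\<close>.\<close>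

lemma truncation_unique:
  fixes y :: "'a::cstar"
  assumes y: "star y = y" "norm y \<le> r" and m: "cpos m" "m * y = y * m"
    and eq: "m * m = (y - r *\<^sub>R 1) * (y - r *\<^sub>R 1)"
  shows "m = r *\<^sub>R 1 - y"
proof (rule cpos_commuting_square_unique[OF m(1) cpos_norm_diff[OF y]])
  show "m * (r *\<^sub>R 1 - y) = (r *\<^sub>R 1 - y) * m" using m by (simp add: algebra_simps)
  show "m * m = (r *\<^sub>R 1 - y) * (r *\<^sub>R 1 - y)" by (simp add: eq algebra_simps)
qed

section \<open>Positive functionals\<close>

text \<open>The Hahn-Banach theorem is obtained from minimal sublinear functionals, which turn out to be
linear.  A norming functional for \<open>y\<close> appears when one starts below \<open>sublinear_shift norm y\<close>
rather than below the norm itself.\<close>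

definition sublinear :: "('a::real_vector \<Rightarrow> real) \<Rightarrow> bool" where
  "sublinear q \<longleftrightarrow> (\<forall>x y. q (x + y) \<le> q x + q y) \<and> (\<forall>c>0. \<forall>x. q (c *\<^sub>R x) \<le> c * q x)"

lemma sublinear_0: assumes "sublinear q" shows "q 0 = 0"
proof -
  have "q 0 \<le> q 0 + q 0" using assms unfolding sublinear_def by (metis add_0)
  moreover have "q ((1/2) *\<^sub>R 0) \<le> (1/2) * q 0"
    using assms unfolding sublinear_def by (meson half_gt_zero zero_less_one)
  ultimately show ?thesis by simp
qed

lemma sublinear_scale: assumes "sublinear q" "c > 0" shows "q (c *\<^sub>R x) = c * q x"
proof (rule antisym)
  have "q ((1/c) *\<^sub>R (c *\<^sub>R x)) \<le> (1/c) * q (c *\<^sub>R x)"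
    using assms unfolding sublinear_def by (meson zero_less_divide_1_iff)
  then have "q x \<le> q (c *\<^sub>R x) / c" using assms(2) by simp
  then show "c * q x \<le> q (c *\<^sub>R x)" using assms(2) by (simp add: field_simps)
qed (use assms in \<open>auto simp: sublinear_def\<close>)

lemma sublinear_ge: assumes "sublinear q" shows "- q (- x) \<le> q x"
proof -
  have "q (x + - x) \<le> q x + q (- x)" using assms unfolding sublinear_def by blast
  then show ?thesis using sublinear_0[OF assms] by simp
qed

text \<open>The largest sublinear function below \<open>q\<close> whose value at \<open>- y\<close> is at most \<open>- q y\<close>.\<close>

definition sublinear_shift :: "('a::real_vector \<Rightarrow> real) \<Rightarrow> 'a \<Rightarrow> 'a \<Rightarrow> real" where
  "sublinear_shift q y x = (INF t\<in>{0..}. q (x + t *\<^sub>R y) - t * q y)"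

lemma sublinear_shift:
  assumes q: "sublinear q"
  shows "sublinear (sublinear_shift q y)"
    and "t \<ge> 0 \<Longrightarrow> sublinear_shift q y x \<le> q (x + t *\<^sub>R y) - t * q y"
proof -
  have sub: "q (u + v) \<le> q u + q v" for u v using q by (auto simp: sublinear_def)
  have lb: "- q (- x) \<le> q (x + t *\<^sub>R y) - t * q y" if "t \<ge> 0" for x t
  proof -
    have "q (t *\<^sub>R y) = t * q y" using that sublinear_scale[OF q] sublinear_0[OF q]
      by (cases "t = 0") auto
    moreover have "q ((x + t *\<^sub>R y) + - x) \<le> q (x + t *\<^sub>R y) + q (- x)" by (rule sub)
    ultimately show ?thesis by simp
  qed
  have bdd: "bdd_below ((\<lambda>t. q (x + t *\<^sub>R y) - t * q y) ` {0..})" for x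
    by (rule bdd_belowI2[of _ "- q (- x)"]) (use lb in auto)
  show upper: "sublinear_shift q y x \<le> q (x + t *\<^sub>R y) - t * q y" if "t \<ge> 0" for t x
    unfolding sublinear_shift_def by (rule cINF_lower[OF bdd]) (use that in auto)
  show "sublinear (sublinear_shift q y)"
    unfolding sublinear_def
  proof (intro conjI allI impI)
    fix u v
    have *: "sublinear_shift q y (u + v) \<le> (q (u + s *\<^sub>R y) - s * q y) + (q (v + t *\<^sub>R y) - t * q y)"
      if "s \<ge> 0" "t \<ge> 0" for s t
      using upper[of "s + t" "u + v"] sub[of "u + s *\<^sub>R y" "v + t *\<^sub>R y"] that
      by (simp add: algebra_simps)
    have "sublinear_shift q y (u + v) - (q (u + s *\<^sub>R y) - s * q y) \<le> sublinear_shift q y v"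
      if "s \<ge> 0" for s
      unfolding sublinear_shift_def[of q y v] by (rule cINF_greatest) (use *[OF that] in \<open>auto simp: algebra_simps\<close>)
    then have "sublinear_shift q y (u + v) - sublinear_shift q y v \<le> sublinear_shift q y u"
      unfolding sublinear_shift_def[of q y u] by (intro cINF_greatest) (auto simp: algebra_simps)
    then show "sublinear_shift q y (u + v) \<le> sublinear_shift q y u + sublinear_shift q y v" by simp
  next
    fix c :: real and x assume c: "c > 0"
    have "sublinear_shift q y (c *\<^sub>R x) / c \<le> sublinear_shift q y x"
      unfolding sublinear_shift_def[of q y x]
    proof (rule cINF_greatest)
      fix t :: real assume t: "t \<in> {0..}"
      have "sublinear_shift q y (c *\<^sub>R x) \<le> q (c *\<^sub>R x + (c * t) *\<^sub>R y) - (c * t) * q y"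
        by (rule upper) (use c t in auto)
      also have "q (c *\<^sub>R x + (c * t) *\<^sub>R y) = c * q (x + t *\<^sub>R y)"
        using sublinear_scale[OF q c, of "x + t *\<^sub>R y"] by (simp add: algebra_simps)
      finally show "sublinear_shift q y (c *\<^sub>R x) / c \<le> q (x + t *\<^sub>R y) - t * q y"
        using c by (simp add: field_simps)
    qed auto
    then show "sublinear_shift q y (c *\<^sub>R x) \<le> c * sublinear_shift q y x"
      using c by (simp add: field_simps)
  qed
qed

text \<open>Minimality forces \<open>sublinear_shift q y = q\<close>, which is superadditivity in the direction of \<open>y\<close>.\<close>

lemma minimal_sublinear_linear:
  assumes q: "sublinear q" and min: "\<And>p. sublinear p \<Longrightarrow> p \<le> q \<Longrightarrow> p = q"
  shows "linear q"
proof -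
  have add: "q (x + y) = q x + q y" for x y
  proof (rule antisym)
    have "sublinear_shift q y \<le> q"
      using sublinear_shift(2)[OF q, of 0] by (auto simp: le_fun_def)
    then have "sublinear_shift q y = q" by (rule min[OF sublinear_shift(1)[OF q]])
    then show "q x + q y \<le> q (x + y)" using sublinear_shift(2)[OF q, of 1 y x] by simp
  qed (use q in \<open>auto simp: sublinear_def\<close>)
  have neg: "q (- x) = - q x" for x using add[of x "- x"] sublinear_0[OF q] by simp
  have "q (c *\<^sub>R x) = c * q x" for c x
  proof (cases c "0::real" rule: linorder_cases)
    case less
    then show ?thesis using sublinear_scale[OF q, of "- c" x] neg[of "c *\<^sub>R x"] by simp
  qed (use sublinear_0[OF q] sublinear_scale[OF q] in auto)
  then show ?thesis using add by (intro linearI) auto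
qed

lemma exists_linear_below_sublinear:
  fixes p :: "'a::real_vector \<Rightarrow> real"
  assumes p: "sublinear p"
  shows "\<exists>g. linear g \<and> g \<le> p"
proof -
  define r where "r = {(q, q'). sublinear q \<and> sublinear q' \<and> q \<le> p \<and> q' \<le> p \<and> q' \<le> q}"
  have Fr: "Field r = {q. sublinear q \<and> q \<le> p}" by (auto simp: r_def Field_def)
  have po: "Partial_order r"
    by (auto simp: partial_order_on_def preorder_on_def refl_on_def trans_def antisym_def Fr)
       (auto simp: r_def)
  have "\<exists>u\<in>Field r. \<forall>q\<in>C. (q, u) \<in> r" if C: "C \<in> Chains r" for C
  proof (cases "C = {}")
    case True
    then show ?thesis using p by (auto simp: Fr)
  next
    case False
    have Cs: "sublinear q" "q \<le> p" if "q \<in> C" for q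
      using C that by (auto simp: Chains_def r_def)
    have Cc: "q \<le> q' \<or> q' \<le> q" if "q \<in> C" "q' \<in> C" for q q'
      using C that by (auto simp: Chains_def r_def)
    define u where "u x = (INF q\<in>C. q x)" for x
    have lb: "- p (- x) \<le> q x" if "q \<in> C" for q x
      using sublinear_ge[OF Cs(1)[OF that], of x] Cs(2)[OF that] le_funD[of q p "- x"] by force
    have bdd: "bdd_below ((\<lambda>q. q x) ` C)" for x
      by (rule bdd_belowI2[of _ "- p (- x)"]) (rule lb)
    have uq: "u x \<le> q x" if "q \<in> C" for q x
      unfolding u_def by (rule cINF_lower[OF bdd that])
    have "sublinear u" unfolding sublinear_def
    proof (intro conjI allI impI)
      fix x y
      have *: "u (x + y) \<le> q x + q' y" if qC: "q \<in> C" "q' \<in> C" for q q'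
      proof -
        obtain k where k: "k \<in> C" "k \<le> q" "k \<le> q'" using Cc[OF qC] qC by blast
        have "u (x + y) \<le> k (x + y)" by (rule uq[OF k(1)])
        also have "\<dots> \<le> k x + k y" using Cs(1)[OF k(1)] by (auto simp: sublinear_def)
        also have "\<dots> \<le> q x + q' y" using k by (auto simp: le_fun_def intro: add_mono)
        finally show ?thesis .
      qed
      have "u (x + y) - q x \<le> u y" if "q \<in> C" for q
        unfolding u_def[of y] by (rule cINF_greatest[OF False]) (use *[OF that] in \<open>auto simp: algebra_simps\<close>)
      then have "u (x + y) - u y \<le> u x"
        unfolding u_def[of x] by (intro cINF_greatest[OF False]) (auto simp: algebra_simps)
      then show "u (x + y) \<le> u x + u y" by simp
    next
      fix c :: real and x assume c: "c > 0"
      have "u (c *\<^sub>R x) / c \<le> u x" unfolding u_def[of x]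
      proof (rule cINF_greatest[OF False])
        fix q assume "q \<in> C"
        then show "u (c *\<^sub>R x) / c \<le> q x"
          using uq[of q "c *\<^sub>R x"] sublinear_scale[OF Cs(1) c, of q x] c by (simp add: field_simps)
      qed
      then show "u (c *\<^sub>R x) \<le> c * u x" using c by (simp add: field_simps)
    qed
    moreover obtain q0 where "q0 \<in> C" using False by blast
    have "u \<le> p"
    proof (rule le_funI)
      fix x
      show "u x \<le> p x" using uq[OF \<open>q0 \<in> C\<close>, of x] le_funD[OF Cs(2)[OF \<open>q0 \<in> C\<close>], of x] by simp
    qed
    ultimately have "u \<in> Field r" by (simp add: Fr)
    moreover have "\<forall>q\<in>C. (q, u) \<in> r"
      using \<open>sublinear u\<close> \<open>u \<le> p\<close> Cs uq by (simp add: r_def le_fun_def)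
    ultimately show ?thesis by blast
  qed
  from Zorns_po_lemma[OF po] this obtain q where q: "sublinear q" "q \<le> p"
    and min: "\<And>p'. p' \<in> Field r \<Longrightarrow> (q, p') \<in> r \<Longrightarrow> q = p'"
    unfolding Fr by (smt (verit) mem_Collect_eq)
  have "linear q"
  proof (rule minimal_sublinear_linear[OF q(1)])
    fix p' assume "sublinear p'" "p' \<le> q"
    moreover then have "p' \<le> p" using q(2) by (rule_tac order_trans)
    ultimately have "p' \<in> Field r" "(q, p') \<in> r" using q by (simp add: Fr, simp add: r_def)
    then show "p' = q" by (rule min[symmetric])
  qed
  then show ?thesis using q by blast
qed

lemma norming_functional:
  fixes y :: "'a::real_normed_vector"
  shows "\<exists>g. linear g \<and> (\<forall>x. g x \<le> norm x) \<and> g y = norm y"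
proof -
  have n: "sublinear (norm :: 'a \<Rightarrow> real)"
    by (auto simp: sublinear_def norm_triangle_ineq)
  obtain g where g: "linear g" "g \<le> sublinear_shift norm y"
    using exists_linear_below_sublinear[OF sublinear_shift(1)[OF n]] by blast
  have gle: "g x \<le> norm (x + t *\<^sub>R y) - t * norm y" if "t \<ge> 0" for x t
    using le_funD[OF g(2), of x] sublinear_shift(2)[OF n that, of y x] by linarith
  have "g (- y) \<le> - norm y" using gle[of 1 "- y"] by simp
  moreover have "g (- y) = - g y" using linear_neg[OF g(1)] .
  ultimately show ?thesis using g(1) gle[of 0] by (intro exI[of _ g]) (force intro: antisym)
qed

definition positive_functional :: "('a::cstar \<Rightarrow> complex) \<Rightarrow> bool" where
  "positive_functional f \<longleftrightarrow> (\<forall>x y. f (x + y) = f x + f y) \<and> (\<forall>c x. f (c *\<^sub>C x) = c * f x) \<and>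
     (\<forall>x. Im (f (star x * x)) = 0 \<and> 0 \<le> Re (f (star x * x)))"

text \<open>A norming functional of \<open>h + 1\<close> is therefore norming for both \<open>h\<close> and \<open>1\<close>, and a norm-one functional
with value one at \<open>1\<close> is positive.\<close>

lemma norm_add_one:
  fixes h :: "'a::cstar"
  assumes h: "cpos h" and one: "norm (1::'a) = 1"
  shows "norm (h + 1) = norm h + 1"
proof (rule antisym)
  define s where "s = norm (h + 1)"
  have sh: "star (h + 1) = h + 1" by (simp add: star_add cpos_selfadj[OF h])
  have p: "cpos (s *\<^sub>R 1 - (h + 1))" by (rule cpos_norm_diff[OF sh]) (simp add: s_def)
  have p1: "cpos ((s - 1) *\<^sub>R (1::'a))" using cpos_add[OF p h] by (simp add: algebra_simps)
  have "s \<ge> 1"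
  proof (rule ccontr)
    assume "\<not> s \<ge> 1"
    then have "cpos ((1 - s) *\<^sub>R (1::'a))" by (intro cpos_scaleR_one) simp
    then have "(s - 1) *\<^sub>R (1::'a) = 0" using cpos_antisym[OF p1] by (simp flip: scaleR_minus_left)
    then show False using one \<open>\<not> s \<ge> 1\<close> by auto
  qed
  then have "norm h \<le> s - 1"
    using p by (intro norm_le_of_cpos cpos_add cpos_scaleR_one h) (auto simp: algebra_simps)
  then show "norm h + 1 \<le> norm (h + 1)" by (simp add: s_def)
  show "norm (h + 1) \<le> norm h + 1" using norm_triangle_ineq[of h 1] one by simp
qed

theorem exists_positive_functional:
  fixes a :: "'a::cstar"
  assumes "a \<noteq> 0"
  shows "\<exists>f. positive_functional f \<and> f (star a * a) \<noteq> 0"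
proof -
  have "a = a * 1" by simp
  then have "norm (1::'a) \<noteq> 0" using assms by (metis norm_eq_zero mult_zero_right)
  then have one: "norm (1::'a) = 1"
    using norm_star_mult[of "1::'a"] by (simp add: power2_eq_square)
  define h where "h = star a * a"
  have h: "cpos h" unfolding h_def by (rule cpos_star_mult)
  obtain g where g: "linear g" "\<And>x. g x \<le> norm x" "g (h + 1) = norm (h + 1)"
    using norming_functional[of "h + 1"] by blast
  have "g h + g 1 = norm h + 1"
    using g(3) norm_add_one[OF h one] linear_add[OF g(1)] by simp
  then have gh: "g h = norm h" and g1: "g 1 = 1" using g(2)[of h] g(2)[of 1] one by auto
  have gpos: "0 \<le> g k" if k: "cpos k" for k
  proof -
    obtain t where t: "t \<ge> 0" "norm (t *\<^sub>R 1 - k) \<le> t" using k by (auto simp: cpos_def)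
    have "g (t *\<^sub>R 1 - k) = t - g k"
      using linear_diff[OF g(1)] linear_scale[OF g(1)] g1 by simp
    then show ?thesis using g(2)[of "t *\<^sub>R 1 - k"] t by simp
  qed
  \<comment> \<open>The functional \<open>g\<close> is only real linear; \<open>f\<close> is the complex linear extension of its restriction to the selfadjoint elements.\<close>
  define f where "f x = complex_of_real (g ((1/2) *\<^sub>R (x + star x))) +
      \<i> * complex_of_real (g ((1/2) *\<^sub>R ((- \<i>) *\<^sub>C (x - star x))))" for x
  have fsa: "f x = complex_of_real (g x)" if "star x = x" for x
  proof -
    have "(1/2) *\<^sub>R (x + x) = x" by (simp flip: scaleR_2)
    then show ?thesis using that linear_0[OF g(1)] by (simp add: f_def)
  qed
  have fadd: "f (x + y) = f x + f y" for x y
    using linear_add[OF g(1)]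
    by (simp add: f_def star_add scaleR_right_distrib scaleR_right_diff_distrib cscale_add_right
        cscale_diff_right cscale_minus_left linear_diff[OF g(1)] linear_neg[OF g(1)] algebra_simps)
  have fr: "f (r *\<^sub>R x) = complex_of_real r * f x" for r x
  proof -
    have 1: "(1/2) *\<^sub>R (r *\<^sub>R x + star (r *\<^sub>R x)) = r *\<^sub>R ((1/2) *\<^sub>R (x + star x))"
      by (simp add: star_scaleR scaleR_right_distrib)
    have 2: "(1/2) *\<^sub>R ((- \<i>) *\<^sub>C (r *\<^sub>R x - star (r *\<^sub>R x))) = r *\<^sub>R ((1/2) *\<^sub>R ((- \<i>) *\<^sub>C (x - star x)))"
      by (simp add: star_scaleR cscale_diff_right scaleR_right_diff_distrib cscale_scaleR scaleR_cscale mult.commute)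
    show ?thesis unfolding f_def 1 2 linear_scale[OF g(1)] by (simp only: of_real_mult real_scaleR_def distrib_left mult.left_commute mult.commute)
  qed
  have fi: "f (\<i> *\<^sub>C x) = \<i> * f x" for x
  proof -
    have 1: "\<i> *\<^sub>C x + star (\<i> *\<^sub>C x) = - ((- \<i>) *\<^sub>C (x - star x))"
      by (simp add: star_cscale cscale_minus_left cscale_diff_right)
    have 2: "(- \<i>) *\<^sub>C (\<i> *\<^sub>C x - star (\<i> *\<^sub>C x)) = x + star x"
      by (simp add: star_cscale cscale_minus_left cscale_diff_right cscale_add_right)
    show ?thesis unfolding f_def 1 2
      by (simp add: linear_neg[OF g(1)] scaleR_minus_right algebra_simps)
  qed
  have fscale: "f (c *\<^sub>C x) = c * f x" for c x
  proof -
    have c: "c = complex_of_real (Re c) + \<i> * complex_of_real (Im c)" by (simp add: complex_eq)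
    have "c *\<^sub>C x = Re c *\<^sub>R x + \<i> *\<^sub>C (Im c *\<^sub>R x)"
      by (subst c) (simp only: cscale_add_left cscale_of_real cscale_scaleR)
    then have "f (c *\<^sub>C x) = (complex_of_real (Re c) + \<i> * complex_of_real (Im c)) * f x"
      by (simp add: fadd fr fi algebra_simps)
    then show ?thesis using c by simp
  qed
  have "Im (f (star x * x)) = 0 \<and> 0 \<le> Re (f (star x * x))" for x
    using fsa[of "star x * x"] gpos[OF cpos_star_mult[of x]] by (simp add: star_mult)
  then have "positive_functional f" using fadd fscale by (simp add: positive_functional_def)
  moreover have "f h = complex_of_real (norm h)" using fsa[of h] gh cpos_selfadj[OF h] by simp
  then have "f h \<noteq> 0" using assms by (simp add: h_def norm_star_mult)
  ultimately show ?thesis unfolding h_def by blast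
qed

section \<open>Realizing carrier-based C*-algebras inside the type class\<close>

lemmas complex_ring_simps [simp] =
  complex_ring_def[THEN arg_cong, of carrier, simplified]
  complex_ring_def[THEN arg_cong, of mult, simplified]
  complex_ring_def[THEN arg_cong, of one, simplified]
  complex_ring_def[THEN arg_cong, of add, simplified]
  complex_ring_def[THEN arg_cong, of zero, simplified]

context star_algebra
begin

lemma is_ring: "ring A" by (rule star_algebra.axioms(1)[OF star_algebra_axioms])

lemmas rs = ring.ring_simprules[OF is_ring]

lemmas rs_closed [simp] = rs(1-6)

lemma cs_closed [simp]: "a \<in> carrier A \<Longrightarrow> c \<odot> a \<in> carrier A"
  using smult_closed[of c a] by simp

lemma cs_add_left: "a \<in> carrier A \<Longrightarrow> (c + d) \<odot> a = c \<odot> a \<oplus> d \<odot> a"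
  using smult_l_distr[of c d a] by simp

lemma cs_add_right: "a \<in> carrier A \<Longrightarrow> b \<in> carrier A \<Longrightarrow> c \<odot> (a \<oplus> b) = c \<odot> a \<oplus> c \<odot> b"
  using smult_r_distr[of c a b] by simp

lemma cs_assoc: "a \<in> carrier A \<Longrightarrow> c \<odot> (d \<odot> a) = (c * d) \<odot> a"
  using smult_assoc1[of c d a] by simp

lemma cs_one [simp]: "a \<in> carrier A \<Longrightarrow> 1 \<odot> a = a"
  using smult_one[of a] by simp

lemma cs_zero_right [simp]: "c \<odot> \<zero> = \<zero>"
  using smult_r_null[of c] by simp

lemma cs_zero_left [simp]: "a \<in> carrier A \<Longrightarrow> 0 \<odot> a = \<zero>"
  using smult_l_null[of a] by simp

lemma cs_minus_one: assumes a: "a \<in> carrier A" shows "\<ominus> a = (- 1) \<odot> a"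
proof -
  have "a \<oplus> (- 1) \<odot> a = \<zero>" using cs_add_left[OF a, of 1 "- 1"] a by simp
  then have "\<ominus> a \<oplus> (a \<oplus> (- 1) \<odot> a) = \<ominus> a \<oplus> \<zero>" by simp
  then show ?thesis using a by (simp add: rs)
qed

lemma adj_zero [simp]: "adj \<zero> = \<zero>"
  using adj_smult[of \<zero> 0] by (simp add: adj_closed)

lemma adj_one [simp]: "adj \<one> = \<one>"
proof -
  have o: "adj \<one> \<in> carrier A" by (simp add: adj_closed)
  have "adj (adj \<one> \<otimes> \<one>) = adj \<one> \<otimes> adj (adj \<one>)" by (rule adj_mult) (use o in auto)
  then show ?thesis using o by (simp add: adj_adj)
qed

lemma adj_minus: "a \<in> carrier A \<Longrightarrow> adj (\<ominus> a) = \<ominus> (adj a)"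
  by (simp add: cs_minus_one adj_smult adj_closed)

end

lemma
  assumes p: "cstar_seminorm A p" and a: "a \<in> carrier A"
  shows seminorm_ge_0: "0 \<le> p a"
    and seminorm_add: "b \<in> carrier A \<Longrightarrow> p (a \<oplus>\<^bsub>A\<^esub> b) \<le> p a + p b"
    and seminorm_smult: "p (c \<odot>\<^bsub>A\<^esub> a) = cmod c * p a"
    and seminorm_mult: "b \<in> carrier A \<Longrightarrow> p (a \<otimes>\<^bsub>A\<^esub> b) \<le> p a * p b"
    and seminorm_adj_mult: "p (adj\<^bsub>A\<^esub> a \<otimes>\<^bsub>A\<^esub> a) = (p a)\<^sup>2"
  using assms by (auto simp: cstar_seminorm_def)

lemma
  assumes "cstar_algebra A"
  shows cstar_ring: "ring A" and cstar_star: "star_algebra A" and cstar_sn: "cstar_seminorm A (cnorm A)"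
proof -
  interpret cstar_algebra A by (rule assms)
  show "ring A" "star_algebra A" "cstar_seminorm A (cnorm A)"
    by (rule is_ring) (rule star_algebra_axioms, rule seminorm)
qed

context
  fixes A :: "('a, 'm) star_algebra_scheme" and p
  assumes A: "star_algebra A" and p: "cstar_seminorm A p"
begin

interpretation star_algebra A by (rule A)

lemma seminorm_zero: "p \<zero>\<^bsub>A\<^esub> = 0"
  using seminorm_smult[OF p rs(2), of 0] by simp

lemma seminorm_minus: "a \<in> carrier A \<Longrightarrow> p (\<ominus>\<^bsub>A\<^esub> a) = p a"
  using seminorm_smult[OF p, of a "- 1"] unfolding cs_minus_one by simp

lemma seminorm_le_adj: assumes a: "a \<in> carrier A" shows "p a \<le> p (adj\<^bsub>A\<^esub> a)"
proof (cases "p a = 0")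
  case True
  then show ?thesis using seminorm_ge_0[OF p adj_closed[OF a]] by simp
next
  case False
  have "p a * p a \<le> p (adj\<^bsub>A\<^esub> a) * p a"
    using seminorm_mult[OF p adj_closed[OF a] a] seminorm_adj_mult[OF p a] unfolding power2_eq_square by linarith
  then show ?thesis
    by (rule mult_right_le_imp_le) (use False seminorm_ge_0[OF p a] in linarith)
qed

lemma seminorm_adj: "a \<in> carrier A \<Longrightarrow> p (adj\<^bsub>A\<^esub> a) = p a"
  using seminorm_le_adj[of a] seminorm_le_adj[of "adj\<^bsub>A\<^esub> a"] by (simp add: adj_closed adj_adj)

lemma seminorm_one: "p \<one>\<^bsub>A\<^esub> \<le> 1"
proof -
  have "p \<one>\<^bsub>A\<^esub> = (p \<one>\<^bsub>A\<^esub>)\<^sup>2"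
    using seminorm_adj_mult[OF p rs(6)] by simp
  then have "p \<one>\<^bsub>A\<^esub> * (p \<one>\<^bsub>A\<^esub> - 1) = 0" by (simp add: power2_eq_square algebra_simps)
  then show ?thesis by auto
qed

lemma seminorm_diff: "a \<in> carrier A \<Longrightarrow> b \<in> carrier A \<Longrightarrow> p (a \<ominus>\<^bsub>A\<^esub> b) \<le> p a + p b"
  using seminorm_add[OF p, of a "\<ominus>\<^bsub>A\<^esub> b"] seminorm_minus[of b] by (simp add: rs(14))

lemma seminorm_diff_commute: assumes "a \<in> carrier A" "b \<in> carrier A"
  shows "p (a \<ominus>\<^bsub>A\<^esub> b) = p (b \<ominus>\<^bsub>A\<^esub> a)"
proof -
  have "\<ominus>\<^bsub>A\<^esub> (a \<ominus>\<^bsub>A\<^esub> b) = b \<ominus>\<^bsub>A\<^esub> a"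
    using assms by (simp add: rs)
  then show ?thesis using seminorm_minus[of "a \<ominus>\<^bsub>A\<^esub> b"] assms rs(4) by metis
qed

lemma seminorm_diff_triangle:
  assumes "a \<in> carrier A" "b \<in> carrier A" "c \<in> carrier A"
  shows "p (a \<ominus>\<^bsub>A\<^esub> c) \<le> p (a \<ominus>\<^bsub>A\<^esub> b) + p (b \<ominus>\<^bsub>A\<^esub> c)"
proof -
  have "a \<ominus>\<^bsub>A\<^esub> c = (a \<ominus>\<^bsub>A\<^esub> b) \<oplus>\<^bsub>A\<^esub> (b \<ominus>\<^bsub>A\<^esub> c)"
    using assms by (simp add: rs)
  then show ?thesis using assms seminorm_add[OF p] rs(4) by metis
qed

lemma seminorm_triangle_diff:
  assumes "a \<in> carrier A" "b \<in> carrier A"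
  shows "\<bar>p a - p b\<bar> \<le> p (a \<ominus>\<^bsub>A\<^esub> b)"
proof -
  have *: "p x \<le> p (x \<ominus>\<^bsub>A\<^esub> y) + p y" if "x \<in> carrier A" "y \<in> carrier A" for x y
  proof -
    have "x = (x \<ominus>\<^bsub>A\<^esub> y) \<oplus>\<^bsub>A\<^esub> y"
      using that by (simp add: rs)
    then show ?thesis using that seminorm_add[OF p, of "x \<ominus>\<^bsub>A\<^esub> y" y] rs(4) by metis
  qed
  show ?thesis using *[OF assms] *[OF assms(2,1)] seminorm_diff_commute[OF assms] by linarith
qed

end

text \<open>To apply results about a type class to a C*-algebra with a carrier in the type \<open>'a\<close>, one needs a
type with the class structure that contains it.  The \<open>\<ell>\<^sup>\<infinity>\<close>-product of all C*-algebras with carriers in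
\<open>'a\<close> serves for all of them at once: each one is a direct summand, with projection \<open>ev A\<close> and
inclusion \<open>sec A\<close>.  The inclusion is isometric and respects all operations but the unit.\<close>

definition bounded_choices :: "('a cstar_algebra \<Rightarrow> 'a) set" where
  "bounded_choices = {F. (\<forall>A. if cstar_algebra A then F A \<in> carrier A else F A = undefined) \<and>
     bdd_above ((\<lambda>A. \<parallel>F A\<parallel>\<^bsub>A\<^esub>) ` Collect cstar_algebra)}"

lemma zero_choice: "(\<lambda>A. if cstar_algebra A then \<zero>\<^bsub>A\<^esub> else undefined) \<in> bounded_choices"
proof -
  have "\<zero>\<^bsub>A\<^esub> \<in> carrier A" "\<parallel>\<zero>\<^bsub>A\<^esub>\<parallel>\<^bsub>A\<^esub> = 0" if "cstar_algebra A" for A :: "'a cstar_algebra"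
    using ring.ring_simprules(2)[OF cstar_ring[OF that]]
      seminorm_zero[OF cstar_star[OF that] cstar_sn[OF that]] by auto
  then show ?thesis by (auto simp: bounded_choices_def intro!: bdd_aboveI[where M=0])
qed

typedef 'a cfam = "bounded_choices :: ('a cstar_algebra \<Rightarrow> 'a) set"
  using zero_choice by blast

abbreviation ev :: "'a cstar_algebra \<Rightarrow> 'a cfam \<Rightarrow> 'a" where
  "ev A F \<equiv> Rep_cfam F A"

text \<open>The value outside the C*-algebras is fixed so that equality of families is equality of all \<open>ev A\<close>.\<close>

definition cfam :: "('a cstar_algebra \<Rightarrow> 'a) \<Rightarrow> 'a cfam" where
  "cfam F = Abs_cfam (\<lambda>A. if cstar_algebra A then F A else undefined)"

text \<open>The zero is inserted because the least upper bound needs a nonempty set.\<close>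

definition cfam_norm :: "'a cfam \<Rightarrow> real" where
  "cfam_norm F = Sup (insert 0 ((\<lambda>A. \<parallel>ev A F\<parallel>\<^bsub>A\<^esub>) ` Collect cstar_algebra))"

lemma ev_closed [simp]: "cstar_algebra A \<Longrightarrow> ev A F \<in> carrier A"
  using Rep_cfam[of F] by (auto simp: bounded_choices_def split: if_splits)

lemma cfam_eqI: assumes "\<And>A. cstar_algebra A \<Longrightarrow> ev A F = ev A G" shows "F = G"
proof -
  have "Rep_cfam F A = Rep_cfam G A" for A
    using assms[of A] Rep_cfam[of F] Rep_cfam[of G] by (cases "cstar_algebra A") (auto simp: bounded_choices_def)
  then show ?thesis by (metis Rep_cfam_inject ext)
qed

lemma ev_cfam:
  assumes "\<And>A. cstar_algebra A \<Longrightarrow> F A \<in> carrier A" "\<And>A. cstar_algebra A \<Longrightarrow> \<parallel>F A\<parallel>\<^bsub>A\<^esub> \<le> K"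
    and "cstar_algebra A"
  shows "ev A (cfam F) = F A"
proof -
  have "(\<lambda>A. if cstar_algebra A then F A else undefined) \<in> bounded_choices"
    using assms by (auto simp: bounded_choices_def intro!: bdd_aboveI[where M=K])
  then show ?thesis using assms(3) by (simp add: cfam_def Abs_cfam_inverse)
qed

lemma cnorm_ge_0: "cstar_algebra A \<Longrightarrow> a \<in> carrier A \<Longrightarrow> 0 \<le> \<parallel>a\<parallel>\<^bsub>A\<^esub>"
  by (rule seminorm_ge_0[OF cstar_sn])

lemma cnorm_zero [simp]: "cstar_algebra A \<Longrightarrow> \<parallel>\<zero>\<^bsub>A\<^esub>\<parallel>\<^bsub>A\<^esub> = 0"
  by (rule seminorm_zero[OF cstar_star cstar_sn])

lemma cnorm_one: "cstar_algebra A \<Longrightarrow> \<parallel>\<one>\<^bsub>A\<^esub>\<parallel>\<^bsub>A\<^esub> \<le> 1"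
  by (rule seminorm_one[OF cstar_star cstar_sn])

lemma norm_ev: assumes "cstar_algebra A" shows "\<parallel>ev A F\<parallel>\<^bsub>A\<^esub> \<le> cfam_norm F"
  unfolding cfam_norm_def
  by (rule cSup_upper) (use assms Rep_cfam[of F] in \<open>auto simp: bounded_choices_def\<close>)

lemma cfam_norm_ge_0: "0 \<le> cfam_norm F"
  unfolding cfam_norm_def
  by (rule cSup_upper) (use Rep_cfam[of F] in \<open>auto simp: bounded_choices_def\<close>)

lemma cfam_norm_least:
  assumes "0 \<le> K" "\<And>A. cstar_algebra A \<Longrightarrow> \<parallel>ev A F\<parallel>\<^bsub>A\<^esub> \<le> K" shows "cfam_norm F \<le> K"
  unfolding cfam_norm_def by (rule cSup_least) (use assms in auto)

instantiation cfam :: (type) "{zero, one, plus, minus, uminus, times, scaleR, norm, sgn, dist}"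
begin

definition "0 = cfam (\<lambda>A. \<zero>\<^bsub>A\<^esub>)"
definition "1 = cfam (\<lambda>A. \<one>\<^bsub>A\<^esub>)"
definition "F + G = cfam (\<lambda>A. ev A F \<oplus>\<^bsub>A\<^esub> ev A G)"
definition "F - G = cfam (\<lambda>A. ev A F \<ominus>\<^bsub>A\<^esub> ev A G)"
definition "- F = cfam (\<lambda>A. \<ominus>\<^bsub>A\<^esub> ev A F)"
definition "F * G = cfam (\<lambda>A. ev A F \<otimes>\<^bsub>A\<^esub> ev A G)"
definition "r *\<^sub>R F = cfam (\<lambda>A. complex_of_real r \<odot>\<^bsub>A\<^esub> ev A F)"
definition "norm F = cfam_norm F"
definition "sgn (F :: 'a cfam) = inverse (norm F) *\<^sub>R F"
definition "dist F G = norm (F - G :: 'a cfam)"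

instance ..
end

definition cfam_cscale :: "complex \<Rightarrow> 'a cfam \<Rightarrow> 'a cfam" where
  "cfam_cscale c F = cfam (\<lambda>A. c \<odot>\<^bsub>A\<^esub> ev A F)"

definition cfam_star :: "'a cfam \<Rightarrow> 'a cfam" where
  "cfam_star F = cfam (\<lambda>A. adj\<^bsub>A\<^esub> ev A F)"

lemma ev_simps [simp]:
  fixes A :: "'a cstar_algebra"
  assumes A: "cstar_algebra A"
  shows ev_zero: "ev A 0 = \<zero>\<^bsub>A\<^esub>" and ev_one: "ev A 1 = \<one>\<^bsub>A\<^esub>"
    and ev_plus: "ev A (F + G) = ev A F \<oplus>\<^bsub>A\<^esub> ev A G"
    and ev_minus: "ev A (F - G) = ev A F \<ominus>\<^bsub>A\<^esub> ev A G"
    and ev_uminus: "ev A (- F) = \<ominus>\<^bsub>A\<^esub> ev A F"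
    and ev_times: "ev A (F * G) = ev A F \<otimes>\<^bsub>A\<^esub> ev A G"
    and ev_scaleR: "ev A (r *\<^sub>R F) = complex_of_real r \<odot>\<^bsub>A\<^esub> ev A F"
    and ev_cfam_cscale: "ev A (cfam_cscale c F) = c \<odot>\<^bsub>A\<^esub> ev A F"
    and ev_cfam_star: "ev A (cfam_star F) = adj\<^bsub>A\<^esub> ev A F"
proof -
  have c: "\<zero>\<^bsub>B\<^esub> \<in> carrier B" "\<one>\<^bsub>B\<^esub> \<in> carrier B" "ev B F \<oplus>\<^bsub>B\<^esub> ev B G \<in> carrier B" "ev B F \<ominus>\<^bsub>B\<^esub> ev B G \<in> carrier B"
     "\<ominus>\<^bsub>B\<^esub> ev B F \<in> carrier B" "ev B F \<otimes>\<^bsub>B\<^esub> ev B G \<in> carrier B" "d \<odot>\<^bsub>B\<^esub> ev B F \<in> carrier B" "adj\<^bsub>B\<^esub> ev B F \<in> carrier B"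
    if B: "cstar_algebra B" for B d and F G :: "'a cfam"
    using ring.ring_simprules(1-6)[OF cstar_ring[OF B]] star_algebra.cs_closed[OF cstar_star[OF B]]
      star_algebra.adj_closed[OF cstar_star[OF B]] B by auto
  have n: "\<parallel>ev B F \<oplus>\<^bsub>B\<^esub> ev B G\<parallel>\<^bsub>B\<^esub> \<le> cfam_norm F + cfam_norm G"
     "\<parallel>ev B F \<ominus>\<^bsub>B\<^esub> ev B G\<parallel>\<^bsub>B\<^esub> \<le> cfam_norm F + cfam_norm G"
     "\<parallel>ev B F \<otimes>\<^bsub>B\<^esub> ev B G\<parallel>\<^bsub>B\<^esub> \<le> cfam_norm F * cfam_norm G"
     "\<parallel>\<ominus>\<^bsub>B\<^esub> ev B F\<parallel>\<^bsub>B\<^esub> \<le> cfam_norm F" "\<parallel>adj\<^bsub>B\<^esub> ev B F\<parallel>\<^bsub>B\<^esub> \<le> cfam_norm F"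
     "\<parallel>d \<odot>\<^bsub>B\<^esub> ev B F\<parallel>\<^bsub>B\<^esub> \<le> cmod d * cfam_norm F"
    if B: "cstar_algebra B" for B d and F G :: "'a cfam"
  proof -
    note sn = cstar_sn[OF B] and st = cstar_star[OF B] and cl = ev_closed[OF B]
    show "\<parallel>ev B F \<oplus>\<^bsub>B\<^esub> ev B G\<parallel>\<^bsub>B\<^esub> \<le> cfam_norm F + cfam_norm G"
      by (rule order_trans[OF seminorm_add[OF sn cl cl] add_mono[OF norm_ev[OF B] norm_ev[OF B]]])
    show "\<parallel>ev B F \<ominus>\<^bsub>B\<^esub> ev B G\<parallel>\<^bsub>B\<^esub> \<le> cfam_norm F + cfam_norm G"
      by (rule order_trans[OF seminorm_diff[OF st sn cl cl] add_mono[OF norm_ev[OF B] norm_ev[OF B]]])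
    show "\<parallel>ev B F \<otimes>\<^bsub>B\<^esub> ev B G\<parallel>\<^bsub>B\<^esub> \<le> cfam_norm F * cfam_norm G"
      by (rule order_trans[OF seminorm_mult[OF sn cl cl] mult_mono[OF norm_ev[OF B] norm_ev[OF B] cfam_norm_ge_0 cnorm_ge_0[OF B cl]]])
    show "\<parallel>\<ominus>\<^bsub>B\<^esub> ev B F\<parallel>\<^bsub>B\<^esub> \<le> cfam_norm F" "\<parallel>adj\<^bsub>B\<^esub> ev B F\<parallel>\<^bsub>B\<^esub> \<le> cfam_norm F"
      using norm_ev[OF B, of F] seminorm_minus[OF st sn cl, of F] seminorm_adj[OF st sn cl, of F] by simp_all
    show "\<parallel>d \<odot>\<^bsub>B\<^esub> ev B F\<parallel>\<^bsub>B\<^esub> \<le> cmod d * cfam_norm F"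
      unfolding seminorm_smult[OF sn cl] by (rule mult_left_mono[OF norm_ev[OF B]]) simp
  qed
  show "ev A 0 = \<zero>\<^bsub>A\<^esub>" unfolding zero_cfam_def
    by (rule ev_cfam[where K=0]) (simp_all add: A c)
  show "ev A 1 = \<one>\<^bsub>A\<^esub>" unfolding one_cfam_def
    by (rule ev_cfam[where K=1]) (simp_all add: A c cnorm_one)
  show "ev A (F + G) = ev A F \<oplus>\<^bsub>A\<^esub> ev A G" unfolding plus_cfam_def
    by (rule ev_cfam[OF c(3) n(1) A])
  show "ev A (F - G) = ev A F \<ominus>\<^bsub>A\<^esub> ev A G" unfolding minus_cfam_def
    by (rule ev_cfam[OF c(4) n(2) A])
  show "ev A (- F) = \<ominus>\<^bsub>A\<^esub> ev A F" unfolding uminus_cfam_def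
    by (rule ev_cfam[OF c(5) n(4) A])
  show "ev A (F * G) = ev A F \<otimes>\<^bsub>A\<^esub> ev A G" unfolding times_cfam_def
    by (rule ev_cfam[OF c(6) n(3) A])
  show "ev A (r *\<^sub>R F) = complex_of_real r \<odot>\<^bsub>A\<^esub> ev A F" unfolding scaleR_cfam_def
    by (rule ev_cfam[OF c(7) n(6) A])
  show "ev A (cfam_cscale c F) = c \<odot>\<^bsub>A\<^esub> ev A F" unfolding cfam_cscale_def
    by (rule ev_cfam[OF c(7) n(6) A])
  show "ev A (cfam_star F) = adj\<^bsub>A\<^esub> ev A F" unfolding cfam_star_def
    by (rule ev_cfam[OF c(8) n(5) A])
qed

lemma cfam_ring_eqs:
  fixes F G H :: "'a cfam"
  shows "F + G + H = F + (G + H)" "F + G = G + F" "0 + F = F" "- F + F = 0" "F - G = F + - G"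
    "F * G * H = F * (G * H)" "(F + G) * H = F * H + G * H" "H * (F + G) = H * F + H * G"
    "1 * F = F" "F * 1 = F"
  by (rule cfam_eqI, simp add: ring.ring_simprules[OF cstar_ring] monoid.l_one[OF ring.is_monoid[OF cstar_ring]]
      monoid.r_one[OF ring.is_monoid[OF cstar_ring]])+

lemma cfam_cscale_eqs:
  fixes F G :: "'a cfam"
  shows "cfam_cscale c (F + G) = cfam_cscale c F + cfam_cscale c G"
    "cfam_cscale (c + d) F = cfam_cscale c F + cfam_cscale d F"
    "cfam_cscale c (cfam_cscale d F) = cfam_cscale (c * d) F"
    "cfam_cscale 1 F = F"
    "cfam_cscale (complex_of_real r) F = r *\<^sub>R F"
    "cfam_cscale c F * G = cfam_cscale c (F * G)"
    "F * cfam_cscale c G = cfam_cscale c (F * G)"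
    "cfam_star (cfam_star F) = F"
    "cfam_star (F + G) = cfam_star F + cfam_star G"
    "cfam_star (F * G) = cfam_star G * cfam_star F"
    "cfam_star (cfam_cscale c F) = cfam_cscale (cnj c) (cfam_star F)"
  by (rule cfam_eqI, simp add: star_algebra.cs_add_left[OF cstar_star] star_algebra.cs_add_right[OF cstar_star]
     star_algebra.cs_assoc[OF cstar_star] star_algebra.cs_one[OF cstar_star]
     star_algebra.smult_mult_left[OF cstar_star] star_algebra.smult_mult_right[OF cstar_star]
     star_algebra.adj_adj[OF cstar_star] star_algebra.adj_add[OF cstar_star]
     star_algebra.adj_smult[OF cstar_star] star_algebra.adj_mult[OF cstar_star])+

lemma cfam_norm_eqs:
  fixes F G :: "'a cfam"
  shows "cfam_norm F = 0 \<longleftrightarrow> F = 0" "cfam_norm (F + G) \<le> cfam_norm F + cfam_norm G"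
    "cfam_norm (F * G) \<le> cfam_norm F * cfam_norm G"
    "cfam_norm (r *\<^sub>R F) = \<bar>r\<bar> * cfam_norm F"
    "cfam_norm (cfam_star F * F) = (cfam_norm F)\<^sup>2"
proof -
  show 0: "cfam_norm F = 0 \<longleftrightarrow> F = 0"
  proof
    assume z: "cfam_norm F = 0"
    show "F = 0"
    proof (rule cfam_eqI)
      fix A :: "'a cstar_algebra" assume A: "cstar_algebra A"
      have "\<parallel>ev A F\<parallel>\<^bsub>A\<^esub> = 0" using norm_ev[OF A, of F] cnorm_ge_0[OF A ev_closed[OF A, of F]] z by simp
      then show "ev A F = ev A 0" using A by (simp add: cstar_algebra.norm_definite)
    qed
  next
    assume "F = 0"
    then have "cfam_norm F \<le> 0"
      by (intro cfam_norm_least) (auto simp: seminorm_zero[OF cstar_star cstar_sn])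
    then show "cfam_norm F = 0" using cfam_norm_ge_0[of F] by simp
  qed
  show "cfam_norm (F + G) \<le> cfam_norm F + cfam_norm G"
    by (rule cfam_norm_least)
       (auto simp: cfam_norm_ge_0 intro: order_trans[OF seminorm_add[OF cstar_sn] add_mono[OF norm_ev norm_ev]])
  show "cfam_norm (F * G) \<le> cfam_norm F * cfam_norm G"
    by (rule cfam_norm_least)
       (auto simp: cfam_norm_ge_0 intro: order_trans[OF seminorm_mult[OF cstar_sn] mult_mono[OF norm_ev norm_ev cfam_norm_ge_0 cnorm_ge_0]])
  have le: "cfam_norm (r *\<^sub>R F) \<le> \<bar>r\<bar> * cfam_norm F" for r and F :: "'a cfam"
    by (rule cfam_norm_least)
       (auto simp: cfam_norm_ge_0 seminorm_smult[OF cstar_sn] intro: mult_left_mono[OF norm_ev])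
  show "cfam_norm (r *\<^sub>R F) = \<bar>r\<bar> * cfam_norm F"
  proof (cases "r = 0")
    case True
    then show ?thesis using le[of 0 F] cfam_norm_ge_0[of "0 *\<^sub>R F"] by simp
  next
    case False
    have "(1/r) *\<^sub>R (r *\<^sub>R F) = F"
      using False by (simp add: cfam_cscale_eqs flip: cfam_cscale_eqs(5) of_real_mult)
    then have "cfam_norm F \<le> \<bar>1/r\<bar> * cfam_norm (r *\<^sub>R F)" using le[of "1/r" "r *\<^sub>R F"] by simp
    then have "\<bar>r\<bar> * cfam_norm F \<le> cfam_norm (r *\<^sub>R F)" using False by (simp add: field_simps abs_if split: if_splits)
    then show ?thesis using le[of r F] by simp
  qed
  show "cfam_norm (cfam_star F * F) = (cfam_norm F)\<^sup>2"
  proof (rule antisym)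
    show "cfam_norm (cfam_star F * F) \<le> (cfam_norm F)\<^sup>2"
      by (rule cfam_norm_least)
         (auto simp: seminorm_adj_mult[OF cstar_sn] intro!: power_mono norm_ev cnorm_ge_0)
    have "cfam_norm F \<le> sqrt (cfam_norm (cfam_star F * F))"
    proof (rule cfam_norm_least)
      fix A :: "'a cstar_algebra" assume A: "cstar_algebra A"
      have "(\<parallel>ev A F\<parallel>\<^bsub>A\<^esub>)\<^sup>2 \<le> cfam_norm (cfam_star F * F)"
        using norm_ev[OF A, of "cfam_star F * F"] A by (simp add: seminorm_adj_mult[OF cstar_sn])
      then show "\<parallel>ev A F\<parallel>\<^bsub>A\<^esub> \<le> sqrt (cfam_norm (cfam_star F * F))" by (rule real_le_rsqrt)
    qed (simp add: cfam_norm_ge_0)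
    then have "(cfam_norm F)\<^sup>2 \<le> (sqrt (cfam_norm (cfam_star F * F)))\<^sup>2"
      by (rule power_mono) (rule cfam_norm_ge_0)
    then show "(cfam_norm F)\<^sup>2 \<le> cfam_norm (cfam_star F * F)" by (simp add: cfam_norm_ge_0)
  qed
qed

instantiation cfam :: (type) real_normed_algebra
begin

definition "uniformity = (INF e\<in>{0 <..}. principal {(F, G :: 'a cfam). dist F G < e})"
definition "open U = (\<forall>F\<in>U. eventually (\<lambda>(F', G). F' = F \<longrightarrow> G \<in> U) (uniformity :: ('a cfam \<times> 'a cfam) filter))"

instance
proof
  fix F G H :: "'a cfam" and r s :: real
  show "F + G + H = F + (G + H)" "F + G = G + F" "0 + F = F" "- F + F = 0" "F - G = F + - G"
    "F * G * H = F * (G * H)" "(F + G) * H = F * H + G * H" "H * (F + G) = H * F + H * G"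
    by (rule cfam_ring_eqs)+
  show "r *\<^sub>R (F + G) = r *\<^sub>R F + r *\<^sub>R G" "(r + s) *\<^sub>R F = r *\<^sub>R F + s *\<^sub>R F"
    "r *\<^sub>R s *\<^sub>R F = (r * s) *\<^sub>R F" "1 *\<^sub>R F = F" "r *\<^sub>R F * G = r *\<^sub>R (F * G)" "F * r *\<^sub>R G = r *\<^sub>R (F * G)"
    unfolding cfam_cscale_eqs(5)[symmetric] by (simp_all only: cfam_cscale_eqs(1-4,6,7) of_real_add of_real_mult of_real_1)
  show "norm F = 0 \<longleftrightarrow> F = 0" "norm (F + G) \<le> norm F + norm G" "norm (F * G) \<le> norm F * norm G"
    "norm (r *\<^sub>R F) = \<bar>r\<bar> * norm F"
    unfolding norm_cfam_def by (rule cfam_norm_eqs)+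
qed (rule dist_cfam_def sgn_cfam_def uniformity_cfam_def open_cfam_def)+

end

instance cfam :: (type) monoid_mult
  by standard (rule cfam_ring_eqs)+

instance cfam :: (type) banach
proof
  fix X :: "nat \<Rightarrow> 'a cfam" assume X: "Cauchy X"
  have XN: "\<exists>N. \<forall>m\<ge>N. \<forall>n\<ge>N. norm (X m - X n) < e" if "e > 0" for e
    using CauchyD[OF X that] .
  have evd: "\<parallel>ev A F \<ominus>\<^bsub>A\<^esub> ev A G\<parallel>\<^bsub>A\<^esub> \<le> norm (F - G)" if "cstar_algebra A" for A F and G :: "'a cfam"
    using norm_ev[OF that, of "F - G"] that by (simp add: norm_cfam_def)
  have "\<exists>l. cstar_algebra A \<longrightarrow> l \<in> carrier A \<and> (\<lambda>k. \<parallel>ev A (X k) \<ominus>\<^bsub>A\<^esub> l\<parallel>\<^bsub>A\<^esub>) \<longlonglongrightarrow> 0" for A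
  proof (cases "cstar_algebra A")
    case A: True
    have "(\<lambda>k. ev A (X k)) \<in> cauchy_seqs A (cnorm A)"
      unfolding cauchy_seqs_def mem_Collect_eq
    proof (intro conjI allI impI)
      fix e :: real assume "e > 0"
      then show "\<exists>N. \<forall>k\<ge>N. \<forall>l\<ge>N. \<parallel>ev A (X k) \<ominus>\<^bsub>A\<^esub> ev A (X l)\<parallel>\<^bsub>A\<^esub> < e"
        using XN[of e] order_le_less_trans[OF evd[OF A]] by meson
    qed (rule ev_closed[OF A])
    then show ?thesis using cstar_algebra.complete[OF A] by blast
  qed simp
  then obtain l where l: "\<And>A. cstar_algebra A \<Longrightarrow> l A \<in> carrier A"
      "\<And>A. cstar_algebra A \<Longrightarrow> (\<lambda>k. \<parallel>ev A (X k) \<ominus>\<^bsub>A\<^esub> l A\<parallel>\<^bsub>A\<^esub>) \<longlonglongrightarrow> 0"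
    by metis
  have bound: "\<parallel>ev A (X m) \<ominus>\<^bsub>A\<^esub> l A\<parallel>\<^bsub>A\<^esub> \<le> e"
    if A: "cstar_algebra A" and m: "m \<ge> N" and N: "\<And>m n. m \<ge> N \<Longrightarrow> n \<ge> N \<Longrightarrow> norm (X m - X n) < e" for A m N e
  proof (rule LIMSEQ_le_const)
    show "(\<lambda>n. e + \<parallel>ev A (X n) \<ominus>\<^bsub>A\<^esub> l A\<parallel>\<^bsub>A\<^esub>) \<longlonglongrightarrow> e"
      using tendsto_add[OF tendsto_const l(2)[OF A], of e] by simp
    have "\<parallel>ev A (X m) \<ominus>\<^bsub>A\<^esub> l A\<parallel>\<^bsub>A\<^esub> \<le> e + \<parallel>ev A (X n) \<ominus>\<^bsub>A\<^esub> l A\<parallel>\<^bsub>A\<^esub>" if "n \<ge> N" for n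
      using seminorm_diff_triangle[OF cstar_star[OF A] cstar_sn[OF A] ev_closed[OF A] ev_closed[OF A] l(1)[OF A], of "X m" "X n"]
        evd[OF A, of "X m" "X n"] N[OF m that] by simp
    then show "\<exists>N. \<forall>n\<ge>N. \<parallel>ev A (X m) \<ominus>\<^bsub>A\<^esub> l A\<parallel>\<^bsub>A\<^esub> \<le> e + \<parallel>ev A (X n) \<ominus>\<^bsub>A\<^esub> l A\<parallel>\<^bsub>A\<^esub>" by blast
  qed
  obtain N1 where N1: "\<And>m n. m \<ge> N1 \<Longrightarrow> n \<ge> N1 \<Longrightarrow> norm (X m - X n) < 1" using XN[of 1] by auto
  have "\<parallel>l A\<parallel>\<^bsub>A\<^esub> \<le> norm (X N1) + 1" if A: "cstar_algebra A" for A
  proof -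
    have b: "\<parallel>ev A (X N1) \<ominus>\<^bsub>A\<^esub> l A\<parallel>\<^bsub>A\<^esub> \<le> 1" by (rule bound[OF A order_refl N1])
    show ?thesis using seminorm_triangle_diff[OF cstar_star[OF A] cstar_sn[OF A] ev_closed[OF A] l(1)[OF A], of "X N1"]
      b norm_ev[OF A, of "X N1"] by (simp add: norm_cfam_def)
  qed
  then have ev_l: "ev A (cfam l) = l A" if "cstar_algebra A" for A
    using ev_cfam[of l "norm (X N1) + 1"] l(1) that by blast
  have "X \<longlonglongrightarrow> cfam l"
  proof (rule LIMSEQ_I)
    fix e :: real assume "e > 0"
    then obtain N where N: "\<And>m n. m \<ge> N \<Longrightarrow> n \<ge> N \<Longrightarrow> norm (X m - X n) < e / 2" using XN[of "e/2"] by auto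
    have "norm (X m - cfam l) \<le> e / 2" if m: "m \<ge> N" for m
      unfolding norm_cfam_def
      by (rule cfam_norm_least) (use \<open>e > 0\<close> bound[OF _ m N] ev_l in auto)
    then show "\<exists>no. \<forall>n\<ge>no. norm (X n - cfam l) < e" using \<open>e > 0\<close> by (intro exI[of _ N]) fastforce
  qed
  then show "convergent X" by (auto simp: convergent_def)
qed

instantiation cfam :: (type) cstar
begin

definition "cscale = (cfam_cscale :: complex \<Rightarrow> 'a cfam \<Rightarrow> 'a cfam)"
definition "star = (cfam_star :: 'a cfam \<Rightarrow> 'a cfam)"

instance
  by standard (simp_all add: cscale_cfam_def star_cfam_def norm_cfam_def cfam_norm_eqs cfam_cscale_eqs)

end

lemma ev_cscale [simp]: "cstar_algebra A \<Longrightarrow> ev A (c *\<^sub>C F) = c \<odot>\<^bsub>A\<^esub> ev A F"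
  by (simp add: cscale_cfam_def)

lemma ev_star [simp]: "cstar_algebra A \<Longrightarrow> ev A (star F) = adj\<^bsub>A\<^esub> ev A F"
  by (simp add: star_cfam_def)

lemma norm_ev_le: "cstar_algebra A \<Longrightarrow> \<parallel>ev A F\<parallel>\<^bsub>A\<^esub> \<le> norm F"
  using norm_ev by (simp add: norm_cfam_def)

definition sec :: "'a cstar_algebra \<Rightarrow> 'a \<Rightarrow> 'a cfam" where
  "sec A a = cfam (\<lambda>B. if B = A then a else \<zero>\<^bsub>B\<^esub>)"

lemma ev_sec:
  assumes "cstar_algebra A" "a \<in> carrier A" "cstar_algebra B"
  shows "ev B (sec A a) = (if B = A then a else \<zero>\<^bsub>B\<^esub>)"
  unfolding sec_def
  by (rule ev_cfam[where K="\<parallel>a\<parallel>\<^bsub>A\<^esub>"])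
     (use assms in \<open>auto simp: ring.ring_simprules(2)[OF cstar_ring] cnorm_ge_0\<close>)

context
  fixes A :: "'a cstar_algebra"
  assumes A: "cstar_algebra A"
begin

lemma ev_sec_same [simp]: "a \<in> carrier A \<Longrightarrow> ev A (sec A a) = a"
  by (simp add: ev_sec A)

lemma norm_sec: assumes a: "a \<in> carrier A" shows "norm (sec A a) = \<parallel>a\<parallel>\<^bsub>A\<^esub>"
proof (rule antisym)
  show "norm (sec A a) \<le> \<parallel>a\<parallel>\<^bsub>A\<^esub>" unfolding norm_cfam_def
    by (rule cfam_norm_least)
       (use a A cnorm_ge_0 in \<open>auto simp: ev_sec seminorm_zero[OF cstar_star cstar_sn]\<close>)
  show "\<parallel>a\<parallel>\<^bsub>A\<^esub> \<le> norm (sec A a)" using norm_ev_le[OF A, of "sec A a"] a by simp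
qed

lemma sec_simps:
  assumes "a \<in> carrier A"
  shows "b \<in> carrier A \<Longrightarrow> sec A (a \<oplus>\<^bsub>A\<^esub> b) = sec A a + sec A b" "b \<in> carrier A \<Longrightarrow> sec A (a \<otimes>\<^bsub>A\<^esub> b) = sec A a * sec A b"
    "sec A (c \<odot>\<^bsub>A\<^esub> a) = c *\<^sub>C sec A a" "sec A (adj\<^bsub>A\<^esub> a) = star (sec A a)" and "sec A (\<zero>\<^bsub>A\<^esub>) = 0"
  by (rule cfam_eqI, simp add: ev_sec A assms ring.ring_simprules(1-6)[OF cstar_ring] ring.ring_simprules[OF cstar_ring]
     star_algebra.cs_closed[OF cstar_star] star_algebra.adj_closed[OF cstar_star]
     star_algebra.cs_zero_right[OF cstar_star] star_algebra.adj_zero[OF cstar_star])+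

lemma sec_inj: "a \<in> carrier A \<Longrightarrow> b \<in> carrier A \<Longrightarrow> sec A a = sec A b \<longleftrightarrow> a = b"
  by (metis ev_sec_same)

end

section \<open>Morphisms\<close>

text \<open>Units need not be preserved: the inclusion of a direct summand has to be a morphism.  The image of
\<open>1\<close> is then just a projection, which accounts for the terms \<open>1 - f 1\<close> below.\<close>

definition star_morphism :: "('a::cstar \<Rightarrow> 'b::cstar) \<Rightarrow> bool" where
  "star_morphism f \<longleftrightarrow> (\<forall>x y. f (x + y) = f x + f y) \<and> (\<forall>c x. f (c *\<^sub>C x) = c *\<^sub>C f x) \<and>
     (\<forall>x y. f (x * y) = f x * f y) \<and> (\<forall>x. f (star x) = star (f x))"

context
  fixes f :: "'a::cstar \<Rightarrow> 'b::cstar"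
  assumes f: "star_morphism f"
begin

lemma morphism_simps:
  shows "f (x + y) = f x + f y" "f (c *\<^sub>C x) = c *\<^sub>C f x" "f (x * y) = f x * f y" "f (star x) = star (f x)"
    "f 0 = 0" "f (- x) = - f x" "f (x - y) = f x - f y" "f (r *\<^sub>R x) = r *\<^sub>R f x"
proof -
  show 1: "f (x + y) = f x + f y" "f (c *\<^sub>C x) = c *\<^sub>C f x" "f (x * y) = f x * f y" "f (star x) = star (f x)"
    for x y c using f by (simp_all add: star_morphism_def)
  show "f 0 = 0" using 1(2)[of 0 0] by simp
  show neg: "f (- x) = - f x" for x using 1(2)[of "- 1" x] by (simp add: cscale_minus_left)
  show "f (x - y) = f x - f y" using 1(1)[of x "- y"] by (simp add: neg)
  show "f (r *\<^sub>R x) = r *\<^sub>R f x" using 1(2)[of "complex_of_real r" x] by simp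
qed

lemma cpos_one_minus_image: "cpos (1 - f 1)"
proof -
  have s: "star (f 1) = f 1" using morphism_simps(4)[of 1] by simp
  have i: "f 1 * f 1 = f 1" using morphism_simps(3)[of 1 1] by simp
  have "(1 - f 1) * (1 - f 1) = 1 - f 1" by (simp add: left_diff_distrib right_diff_distrib i)
  then show ?thesis using cpos_square[of "1 - f 1"] by (simp add: star_diff s)
qed

text \<open>If the norm of \<open>x\<close> is at most one then \<open>1 - x* x\<close> is a square \<open>s\<^sup>2\<close>, and the image of the equation
\<open>x* x + s\<^sup>2 = 1\<close> bounds \<open>f x\<close>.\<close>

lemma norm_morphism_le: "norm (f x) \<le> norm x"
proof -
  have *: "norm (f x) \<le> 1" if x: "norm x \<le> 1" for x
  proof -
    have "star (star x * x) = star x * x" by (simp add: star_mult)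
    moreover have "norm (star x * x) \<le> 1" using x by (simp add: norm_star_mult power_le_one)
    ultimately obtain s where s: "star s = s" "s * s = 1 - star x * x"
      using power_iteration_sqrt[of "star x * x"] by blast
    have "star (f x) * f x + (f s * f s + (1 - f 1)) = 1 *\<^sub>R 1"
      using arg_cong[OF s(2), of f] by (simp add: morphism_simps)
    moreover have "cpos (f s * f s + (1 - f 1))"
      using s(1) morphism_simps(4)[of s] by (intro cpos_add cpos_square cpos_one_minus_image) simp
    ultimately show ?thesis using norm_le_of_star_mult_add by fastforce
  qed
  show ?thesis
  proof (cases "x = 0")
    case False
    then have "norm (f ((1 / norm x) *\<^sub>R x)) \<le> 1" by (intro *) simp
    then show ?thesis using False by (simp add: morphism_simps field_simps)
  qed (simp add: morphism_simps)
qed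

lemma bounded_linear_morphism: "bounded_linear f"
  by (rule bounded_linear_intro[where K=1]) (auto simp: morphism_simps norm_morphism_le)

text \<open>A morphism sends \<open>|x - r|\<close> to a positive square root of the square of \<open>f x - r\<close> inside the corner with
unit \<open>f 1\<close>; the summand \<open>r (1 - f 1)\<close> completes it to one for the whole algebra, where it is known.\<close>

lemma morphism_truncation:
  assumes x: "star x = x" and r: "norm (f x) \<le> r" and m: "cpos m" "m * x = x * m"
    and mm: "m * m = (x - r *\<^sub>R 1) * (x - r *\<^sub>R 1)"
  shows "f m = r *\<^sub>R f 1 - f x"
proof -
  have r0: "r \<ge> 0" using r norm_ge_zero[of "f x"] by linarith
  obtain k where k: "cpos k" "k * k = m" using cpos_sqrt[OF m(1)] by blast
  define e where "e = f 1"
  have e: "e * f z = f z" "f z * e = f z" for z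
    using morphism_simps(3)[of 1 z] morphism_simps(3)[of z 1] by (simp_all add: e_def)
  have ee: "e * e = e" using e(1)[of 1] by (simp add: e_def)
  define m' where "m' = f m + r *\<^sub>R (1 - e)"
  have sx: "star (f x) = f x" using morphism_simps(4)[of x] x by simp
  have sk: "star (f k) = f k" using morphism_simps(4)[of k] cpos_selfadj[OF k(1)] by simp
  have "cpos (f k * f k + r *\<^sub>R (1 - e))"
    unfolding e_def by (intro cpos_add cpos_square[OF sk] cpos_scaleR[OF cpos_one_minus_image r0])
  then have pm: "cpos m'" by (simp add: m'_def flip: k(2) morphism_simps(3))
  have comm: "m' * f x = f x * m'"
    using m(2) by (simp add: m'_def distrib_left distrib_right left_diff_distrib right_diff_distrib e flip: morphism_simps(3))
  have 1: "m' * m' = f (m * m) + (r * r) *\<^sub>R (1 - e)"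
    by (simp add: m'_def distrib_left distrib_right left_diff_distrib right_diff_distrib e ee morphism_simps(3))
  have 2: "f (m * m) = f x * f x - r *\<^sub>R f x - r *\<^sub>R f x + (r * r) *\<^sub>R e"
    unfolding mm by (simp add: left_diff_distrib right_diff_distrib morphism_simps e_def scaleR_right_diff_distrib)
  have "m' * m' = (f x - r *\<^sub>R 1) * (f x - r *\<^sub>R 1)"
    unfolding 1 2 by (simp add: left_diff_distrib right_diff_distrib scaleR_right_diff_distrib)
  from truncation_unique[OF sx r pm comm this]
  have "f m = (r *\<^sub>R 1 - f x) - r *\<^sub>R (1 - e)" by (simp add: m'_def algebra_simps)
  then show ?thesis by (simp add: e_def algebra_simps)
qed

text \<open>Truncating a preimage does not change its image but makes its norm small.\<close>

lemma selfadj_lift_same_norm: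
  assumes x: "star x = x" and r: "norm (f x) \<le> r"
  shows "\<exists>x'. f x' = f x \<and> norm x' \<le> r"
proof -
  have r0: "r \<ge> 0" using r norm_ge_zero[of "f x"] by linarith
  obtain m q where m: "cpos m" "m * m = (x - r *\<^sub>R 1) * (x - r *\<^sub>R 1)" "m * x = x * m"
    and q: "cpos q" "q * q = (x + r *\<^sub>R 1) * (x + r *\<^sub>R 1)" "q * x = x * q"
    and n: "norm ((1/2) *\<^sub>R (q - m)) \<le> r"
    using truncation[OF x r0] by blast
  have 1: "f m = r *\<^sub>R f 1 - f x" by (rule morphism_truncation[OF x r m(1,3,2)])
  have 2: "f q = r *\<^sub>R f 1 - f (- x)"
    by (rule morphism_truncation) (use x r q in \<open>simp_all add: star_minus morphism_simps algebra_simps\<close>)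
  have "f ((1/2) *\<^sub>R (q - m)) = (1/2) *\<^sub>R (f x + f x)" by (simp add: morphism_simps 1, simp add: 2 morphism_simps)
  also have "\<dots> = f x" by (simp flip: scaleR_2)
  finally show ?thesis using n by blast
qed

text \<open>The differences of an approximating sequence in the range are small, so they lift to small elements
and the lifts have a convergent series.\<close>

lemma selfadj_closure_in_range:
  assumes y: "y \<in> closure (range f)" and sy: "star y = y"
  shows "y \<in> range f"
proof -
  have "\<exists>x. star x = x \<and> norm (f x - y) < (1/2)^k" for k :: nat
  proof -
    obtain X where X: "\<And>n. X n \<in> range f" "X \<longlonglongrightarrow> y" using y by (auto simp: closure_sequential)
    obtain n where "norm (X n - y) < (1/2)^k" using LIMSEQ_D[OF X(2), of "(1/2)^k"] by auto
    then obtain x where x: "norm (f x - y) < (1/2)^k" using X(1)[of n] by auto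
    define h where "h = (1/2) *\<^sub>R (x + star x)"
    have "f h - y = (1/2) *\<^sub>R (f x - y) + (1/2) *\<^sub>R star (f x - y)"
    proof -
      have yy: "(1/2) *\<^sub>R y + (1/2) *\<^sub>R y = y" by (simp flip: scaleR_add_left)
      have "(1/2) *\<^sub>R (f x - y) + (1/2) *\<^sub>R star (f x - y) = f h - ((1/2) *\<^sub>R y + (1/2) *\<^sub>R y)"
        using sy by (simp add: h_def morphism_simps star_diff scaleR_right_distrib scaleR_right_diff_distrib)
      then show ?thesis unfolding yy by simp
    qed
    then have "norm (f h - y) \<le> norm (f x - y)"
      using norm_triangle_ineq[of "(1/2) *\<^sub>R (f x - y)" "(1/2) *\<^sub>R star (f x - y)"] by simp
    moreover have "star h = h" by (simp add: h_def star_scaleR star_add add.commute)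
    ultimately show ?thesis using x by (intro exI[of _ h]) auto
  qed
  then obtain x where x: "\<And>k. star (x k) = x k" "\<And>k. norm (f (x k) - y) < (1/2)^k" by metis
  \<comment> \<open>Only the increments are lifted with control of the norm; the \<open>x k\<close> themselves need not converge.\<close>
  have "\<exists>d. f d = f (x (Suc k) - x k) \<and> norm d \<le> 2 * (1/2)^k" for k
  proof (rule selfadj_lift_same_norm)
    have "norm (f (x (Suc k) - x k)) \<le> norm (f (x (Suc k)) - y) + norm (f (x k) - y)"
      using norm_triangle_ineq4[of "f (x (Suc k)) - y" "f (x k) - y"] by (simp add: morphism_simps)
    also have "\<dots> \<le> (1/2)^Suc k + (1/2)^k" using x(2)[of k] x(2)[of "Suc k"] by linarith
    also have "\<dots> \<le> 2 * (1/2)^k" by simp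
    finally show "norm (f (x (Suc k) - x k)) \<le> 2 * (1/2)^k" .
  qed (simp add: star_diff x)
  then obtain d where d: "\<And>k. f (d k) = f (x (Suc k) - x k)" "\<And>k. norm (d k) \<le> 2 * (1/2)^k" by metis
  have "summable (\<lambda>k. 2 * (1/2)^k :: real)" by (intro summable_mult summable_geometric) simp
  then have "summable d" by (rule summable_comparison_test'[where N=0]) (rule d(2))
  then have "(\<lambda>n. x 0 + (\<Sum>k<n. d k)) \<longlonglongrightarrow> x 0 + suminf d"
    by (intro tendsto_add tendsto_const summable_LIMSEQ)
  then have 1: "(\<lambda>n. f (x 0 + (\<Sum>k<n. d k))) \<longlonglongrightarrow> f (x 0 + suminf d)"
    by (rule bounded_linear.tendsto[OF bounded_linear_morphism])
  have "f (x 0 + (\<Sum>k<n. d k)) = f (x n)" for n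
    by (induction n) (simp_all add: morphism_simps d flip: add.assoc)
  moreover have "(\<lambda>n. f (x n)) \<longlonglongrightarrow> y"
  proof (rule LIM_zero_cancel, rule tendsto_norm_zero_cancel, rule tendsto_sandwich)
    show "\<forall>\<^sub>F n in sequentially. 0 \<le> norm (f (x n) - y)" by simp
    show "\<forall>\<^sub>F n in sequentially. norm (f (x n) - y) \<le> (1/2)^n" using x(2) by (intro always_eventually allI less_imp_le)
    show "(\<lambda>n. (1/2)^n :: real) \<longlonglongrightarrow> 0" by (intro LIMSEQ_realpow_zero) auto
  qed simp
  ultimately have "f (x 0 + suminf d) = y" using 1 LIMSEQ_unique by simp
  then show ?thesis by blast
qed

text \<open>Real and imaginary parts reduce this to limits that are selfadjoint.\<close>

theorem closed_range_morphism: "closed (range f)"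
proof -
  have "y \<in> range f" if y: "y \<in> closure (range f)" for y
  proof -
    obtain X where X: "\<And>n. X n \<in> range f" "X \<longlonglongrightarrow> y" using y by (auto simp: closure_sequential)
    then have "\<forall>n. \<exists>x. X n = f x" by blast
    then obtain x where "\<And>n. X n = f (x n)" by metis
    then have "X = (\<lambda>n. f (x n))" by (rule ext)
    then have x: "(\<lambda>n. f (x n)) \<longlonglongrightarrow> y" using X(2) by simp
    have c: "z \<in> closure (range f)" if "(\<lambda>n. f (g n)) \<longlonglongrightarrow> z" for z g
      using that by (auto simp: closure_sequential intro!: exI[of _ "\<lambda>n. f (g n)"])
    define h where "h = y + star y"
    define k where "k = \<i> *\<^sub>C (star y - y)"
    have sx: "(\<lambda>n. star (f (x n))) \<longlonglongrightarrow> star y" by (rule tendsto_star[OF x])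
    have "(\<lambda>n. f (x n + star (x n))) \<longlonglongrightarrow> h" unfolding morphism_simps h_def by (intro tendsto_intros x sx)
    then have "h \<in> closure (range f)" by (rule c)
    then have hr: "h \<in> range f" by (rule selfadj_closure_in_range) (simp add: h_def star_add add.commute)
    have bl: "bounded_linear (\<lambda>z::'b. \<i> *\<^sub>C z)"
      by (rule bounded_linear_intro[where K=1]) (auto simp: cscale_add_right cscale_scaleR scaleR_cscale mult.commute)
    have "(\<lambda>n. f (\<i> *\<^sub>C (star (x n) - x n))) \<longlonglongrightarrow> k" unfolding morphism_simps k_def
      by (intro bounded_linear.tendsto[OF bl] tendsto_diff x sx)
    then have "k \<in> closure (range f)" by (rule c)
    then have kr: "k \<in> range f"
      by (rule selfadj_closure_in_range) (simp add: k_def star_cscale star_diff cscale_minus_left cscale_diff_right)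
    obtain u v where uv: "h = f u" "k = f v" using hr kr by blast
    have "f ((1/2) *\<^sub>R (u + \<i> *\<^sub>C v)) = (1/2) *\<^sub>R (h + \<i> *\<^sub>C k)" by (simp add: morphism_simps uv)
    also have "\<dots> = (1/2) *\<^sub>R (y + y)" by (simp add: h_def k_def cscale_minus_left)
    also have "\<dots> = y" by (simp flip: scaleR_2)
    finally show ?thesis by (metis rangeI)
  qed
  then have "closure (range f) \<subseteq> range f" by (rule subsetI)
  then show ?thesis by (simp add: closure_subset_eq)
qed

end

subsection \<open>Consequences for carrier-based algebras\<close>

lemma star_homD:
  assumes "h \<in> star_hom A B" "a \<in> carrier A"
  shows "h a \<in> carrier B" "b \<in> carrier A \<Longrightarrow> h (a \<otimes>\<^bsub>A\<^esub> b) = h a \<otimes>\<^bsub>B\<^esub> h b"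
    "b \<in> carrier A \<Longrightarrow> h (a \<oplus>\<^bsub>A\<^esub> b) = h a \<oplus>\<^bsub>B\<^esub> h b" "h \<one>\<^bsub>A\<^esub> = \<one>\<^bsub>B\<^esub>"
    "h (c \<odot>\<^bsub>A\<^esub> a) = c \<odot>\<^bsub>B\<^esub> h a" "h (adj\<^bsub>A\<^esub> a) = adj\<^bsub>B\<^esub> h a"
  using assms by (auto simp: star_hom_def ring_hom_memE)

lemma star_hom_minus:
  assumes "star_algebra A" "star_algebra B" "h \<in> star_hom A B" "a \<in> carrier A" "b \<in> carrier A"
  shows "h (a \<ominus>\<^bsub>A\<^esub> b) = h a \<ominus>\<^bsub>B\<^esub> h b" "h \<zero>\<^bsub>A\<^esub> = \<zero>\<^bsub>B\<^esub>"
proof -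
  interpret A: star_algebra A by (rule assms)
  interpret B: star_algebra B by (rule assms)
  note h = star_homD[OF assms(3)]
  have "h (\<ominus>\<^bsub>A\<^esub> b) = \<ominus>\<^bsub>B\<^esub> h b"
    using h[of b] assms by (simp add: A.cs_minus_one B.cs_minus_one)
  then show "h (a \<ominus>\<^bsub>A\<^esub> b) = h a \<ominus>\<^bsub>B\<^esub> h b"
    using assms h by (simp add: A.rs(14) B.rs(14))
  have "h (0 \<odot>\<^bsub>A\<^esub> a) = 0 \<odot>\<^bsub>B\<^esub> h a" by (rule h(5)[OF assms(4)])
  then show "h \<zero>\<^bsub>A\<^esub> = \<zero>\<^bsub>B\<^esub>" using assms h(1) by simp
qed

lemma star_morphism_of_star_hom:
  fixes A :: "'a cstar_algebra" and B :: "'b cstar_algebra"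
  assumes A: "cstar_algebra A" and B: "cstar_algebra B" and h: "h \<in> star_hom A B"
  shows "star_morphism (\<lambda>x. sec B (h (ev A x)))"
  unfolding star_morphism_def using A B
  by (simp add: star_homD[OF h] sec_simps[OF B])

lemma star_hom_closed_range:
  fixes A :: "'a cstar_algebra" and B :: "'b cstar_algebra"
  assumes A: "cstar_algebra A" and B: "cstar_algebra B" and h: "h \<in> star_hom A B"
    and s: "\<And>k::nat. s k \<in> h ` carrier A" and b: "b \<in> carrier B"
    and lim: "(\<lambda>k. \<parallel>s k \<ominus>\<^bsub>B\<^esub> b\<parallel>\<^bsub>B\<^esub>) \<longlonglongrightarrow> 0"
  shows "b \<in> h ` carrier A"
proof -
  let ?f = "\<lambda>x. sec B (h (ev A x))"
  have sB: "s k \<in> carrier B" for k using s[of k] star_homD(1)[OF h] by auto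
  have "sec B (s k) \<in> range ?f" for k
  proof -
    obtain a where "a \<in> carrier A" "s k = h a" using s[of k] by blast
    then have "sec B (s k) = ?f (sec A a)" by (simp add: A)
    then show ?thesis by blast
  qed
  moreover have "(\<lambda>k. sec B (s k)) \<longlonglongrightarrow> sec B b"
  proof (rule LIM_zero_cancel, rule tendsto_norm_zero_cancel)
    have "sec B (s k) - sec B b = sec B (s k \<ominus>\<^bsub>B\<^esub> b)" for k
      by (rule cfam_eqI) (simp add: ev_sec B b sB ring.ring_simprules[OF cstar_ring])
    then show "(\<lambda>k. norm (sec B (s k) - sec B b)) \<longlonglongrightarrow> 0"
      using lim sB b by (simp add: norm_sec[OF B] ring.ring_simprules(4)[OF cstar_ring[OF B]])
  qed
  ultimately have "sec B b \<in> range ?f"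
    by (rule closed_sequentially[OF closed_range_morphism[OF star_morphism_of_star_hom[OF A B h]]])
  then obtain x where "sec B b = sec B (h (ev A x))" by blast
  then have "b = h (ev A x)" using sec_inj[OF B b] star_homD(1)[OF h] A by simp
  then show ?thesis using A by auto
qed

lemma ring_abelian_monoid: "ring R \<Longrightarrow> abelian_monoid R"
  by (simp add: ring_def abelian_group_def)

lemma sec_finsum:
  fixes A :: "'a cstar_algebra"
  assumes A: "cstar_algebra A" and S: "finite S"
  shows "(\<And>i. i \<in> S \<Longrightarrow> f i \<in> carrier A) \<Longrightarrow> sec A (\<Oplus>\<^bsub>A\<^esub>i\<in>S. f i) = (\<Sum>i\<in>S. sec A (f i))"
  using S
proof (induction S rule: finite_induct)
  case empty
  then show ?case
    by (simp add: abelian_monoid.finsum_empty[OF ring_abelian_monoid[OF cstar_ring[OF A]]] sec_simps(5)[OF A ring.ring_simprules(2)[OF cstar_ring[OF A]]])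
next
  case (insert i S)
  note am = ring_abelian_monoid[OF cstar_ring[OF A]]
  have "(\<Oplus>\<^bsub>A\<^esub>j\<in>S. f j) \<in> carrier A"
    by (rule abelian_monoid.finsum_closed[OF am]) (use insert.prems in auto)
  then show ?case using insert
    by (simp add: abelian_monoid.finsum_insert[OF am] Pi_def sec_simps[OF A])
qed

lemma norm_le_one_of_sum_squares:
  fixes A :: "'a cstar_algebra"
  assumes A: "cstar_algebra A" and S: "finite S" and f: "\<And>i. i \<in> S \<Longrightarrow> f i \<in> carrier A"
    and eq: "(\<Sum>j\<in>S. star (sec A (f j)) * sec A (f j)) = sec A \<one>\<^bsub>A\<^esub>" and i: "i \<in> S"
  shows "\<parallel>f i\<parallel>\<^bsub>A\<^esub> \<le> 1"
proof -
  let ?F = "\<lambda>i. sec A (f i)"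
  let ?c = "(\<Sum>j\<in>S - {i}. star (?F j) * ?F j) + (1 - sec A \<one>\<^bsub>A\<^esub>)"
  have one: "\<one>\<^bsub>A\<^esub> \<in> carrier A" using ring.ring_simprules(6)[OF cstar_ring[OF A]] .
  have "star (?F i) * ?F i + ?c = 1 *\<^sub>R 1"
    using eq sum.remove[OF S i, of "\<lambda>j. star (?F j) * ?F j"] by (simp add: add.assoc[symmetric])
  moreover have "cpos (1 - sec A \<one>\<^bsub>A\<^esub>)"
    using cpos_one_minus_image[of "\<lambda>x. sec A (ev A x)"] A
    by (simp add: star_morphism_def sec_simps[OF A])
  then have "cpos ?c" by (intro cpos_add cpos_sum cpos_star_mult)
  ultimately have "norm (?F i) \<le> 1" using norm_le_of_star_mult_add[of "?F i" ?c 1] by simp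
  then show ?thesis using norm_sec[OF A f[OF i]] by simp
qed

text \<open>The element \<open>s\<close> is the square root of \<open>1 - a* a\<close>.  In this form the contractivity of \<open>a\<close> can be
transported by representations.\<close>

lemma defect_exists:
  fixes A :: "'a cstar_algebra"
  assumes A: "cstar_algebra A" and a: "a \<in> carrier A" and n: "\<parallel>a\<parallel>\<^bsub>A\<^esub> \<le> 1"
  shows "\<exists>s\<in>carrier A. adj\<^bsub>A\<^esub> s = s \<and> adj\<^bsub>A\<^esub> a \<otimes>\<^bsub>A\<^esub> a \<oplus>\<^bsub>A\<^esub> s \<otimes>\<^bsub>A\<^esub> s = \<one>\<^bsub>A\<^esub>"
proof -
  let ?x = "star (sec A a) * sec A a"
  have "norm ?x \<le> 1" using n by (simp add: norm_star_mult norm_sec[OF A a] power_le_one cnorm_ge_0[OF A a])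
  then obtain s where s: "star s = s" "s * s = 1 - ?x"
    using power_iteration_sqrt[of ?x] by (auto simp: star_mult)
  have "?x + s * s = 1" by (simp add: s)
  then have "ev A (?x + s * s) = \<one>\<^bsub>A\<^esub>" using A by simp
  moreover have "ev A (star s) = ev A s" by (simp add: s)
  ultimately show ?thesis using A a by (intro bexI[of _ "ev A s"]) auto
qed

section \<open>Completion and suprema of seminorms\<close>

lemma cstar_seminorm_SUP:
  assumes A: "star_algebra A" and ne: "P \<noteq> {}" and P: "\<And>p. p \<in> P \<Longrightarrow> cstar_seminorm A p"
    and bdd: "\<And>a. a \<in> carrier A \<Longrightarrow> bdd_above ((\<lambda>p. p a) ` P)"
  shows "cstar_seminorm A (\<lambda>a. SUP p\<in>P. p a)"
proof -
  interpret star_algebra A by (rule A)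
  let ?q = "\<lambda>a. SUP p\<in>P. p a"
  have up: "p a \<le> ?q a" if "p \<in> P" "a \<in> carrier A" for p a
    by (rule cSUP_upper[OF that(1) bdd[OF that(2)]])
  have least: "?q a \<le> K" if "\<And>p. p \<in> P \<Longrightarrow> p a \<le> K" for a K
    by (rule cSUP_least[OF ne that])
  have q0: "0 \<le> ?q a" if a: "a \<in> carrier A" for a
  proof -
    obtain p where p: "p \<in> P" using ne by blast
    show ?thesis using up[OF p a] seminorm_ge_0[OF P[OF p] a] by linarith
  qed
  show ?thesis unfolding cstar_seminorm_def
  proof (intro conjI ballI allI)
    fix a assume a: "a \<in> carrier A"
    show "0 \<le> ?q a" by (rule q0[OF a])
    show "?q (c \<odot>\<^bsub>A\<^esub> a) = cmod c * ?q a" for c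
    proof (rule antisym)
      show le: "?q (c \<odot>\<^bsub>A\<^esub> a) \<le> cmod c * ?q a"
        by (rule least) (simp add: seminorm_smult[OF P a] mult_left_mono up a)
      show "cmod c * ?q a \<le> ?q (c \<odot>\<^bsub>A\<^esub> a)"
      proof (cases "c = 0")
        case True
        then show ?thesis using q0[of "c \<odot>\<^bsub>A\<^esub> a"] a by simp
      next
        case False
        have "?q a \<le> ?q (c \<odot>\<^bsub>A\<^esub> a) / cmod c"
        proof (rule least)
          fix p assume p: "p \<in> P"
          show "p a \<le> ?q (c \<odot>\<^bsub>A\<^esub> a) / cmod c"
            using up[OF p, of "c \<odot>\<^bsub>A\<^esub> a"] a False by (simp add: seminorm_smult[OF P[OF p] a] field_simps)
        qed
        then show ?thesis using False by (simp add: field_simps)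
      qed
    qed
    show "?q (adj\<^bsub>A\<^esub> a \<otimes>\<^bsub>A\<^esub> a) = (?q a)\<^sup>2"
    proof (rule antisym)
      show "?q (adj\<^bsub>A\<^esub> a \<otimes>\<^bsub>A\<^esub> a) \<le> (?q a)\<^sup>2"
        by (rule least) (simp add: seminorm_adj_mult[OF P a] power_mono[OF up] a seminorm_ge_0[OF P a])
      have c: "adj\<^bsub>A\<^esub> a \<otimes>\<^bsub>A\<^esub> a \<in> carrier A" using a by (simp add: adj_closed)
      have "?q a \<le> sqrt (?q (adj\<^bsub>A\<^esub> a \<otimes>\<^bsub>A\<^esub> a))"
        by (rule least) (rule real_le_rsqrt, use up[OF _ c] in \<open>simp add: seminorm_adj_mult[OF P a]\<close>)
      then have "(?q a)\<^sup>2 \<le> (sqrt (?q (adj\<^bsub>A\<^esub> a \<otimes>\<^bsub>A\<^esub> a)))\<^sup>2" by (rule power_mono) (rule q0[OF a])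
      then show "(?q a)\<^sup>2 \<le> ?q (adj\<^bsub>A\<^esub> a \<otimes>\<^bsub>A\<^esub> a)" by (simp add: q0[OF c])
    qed
    fix b assume b: "b \<in> carrier A"
    show "?q (a \<oplus>\<^bsub>A\<^esub> b) \<le> ?q a + ?q b"
      by (rule least) (rule order_trans[OF seminorm_add[OF P a b] add_mono[OF up[OF _ a] up[OF _ b]]])
    show "?q (a \<otimes>\<^bsub>A\<^esub> b) \<le> ?q a * ?q b"
      by (rule least) (rule order_trans[OF seminorm_mult[OF P a b] mult_mono[OF up[OF _ a] up[OF _ b] q0[OF a] seminorm_ge_0[OF P b]]])
  qed
qed

text \<open>In this locale \<open>C\<close> denotes the completion, \<open>CS\<close> the Cauchy sequences and \<open>cls s\<close> the class of \<open>s\<close>.\<close>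

locale completing = star_algebra A for A :: "('a, 'm) star_algebra_scheme" (structure) +
  fixes p :: "'a \<Rightarrow> real"
  assumes sn: "cstar_seminorm A p"
begin

abbreviation "CS \<equiv> cauchy_seqs A p"
abbreviation "cls s \<equiv> null_rel A p `` {s}"
abbreviation "C \<equiv> completion A p"

lemma star_alg: "star_algebra A" by (rule star_algebra_axioms)

lemmas p_ge_0 = seminorm_ge_0[OF sn] and p_add = seminorm_add[OF sn] and p_smult = seminorm_smult[OF sn]
  and p_mult = seminorm_mult[OF sn] and p_adj_mult = seminorm_adj_mult[OF sn]
  and p_zero = seminorm_zero[OF star_alg sn] and p_diff_commute = seminorm_diff_commute[OF star_alg sn]
  and p_triangle = seminorm_diff_triangle[OF star_alg sn] and p_abs_diff = seminorm_triangle_diff[OF star_alg sn]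
  and p_adj = seminorm_adj[OF star_alg sn]

lemma CS_closed: "s \<in> CS \<Longrightarrow> s k \<in> carrier A"
  by (simp add: cauchy_seqs_def)

lemma CS_D: assumes "s \<in> CS" "e > 0" shows "\<exists>N. \<forall>k\<ge>N. \<forall>l\<ge>N. p (s k \<ominus> s l) < e"
  using assms by (simp add: cauchy_seqs_def)

lemma CS_const [simp]: "a \<in> carrier A \<Longrightarrow> (\<lambda>k. a) \<in> CS"
  by (simp add: cauchy_seqs_def rs(14) rs(16) p_zero)

text \<open>A single criterion which covers all pointwise operations.\<close>

lemma CS_I:
  assumes "\<And>k. u k \<in> carrier A" and "s \<in> CS" "t \<in> CS" "K \<ge> 0"
    and "\<And>k l. p (u k \<ominus> u l) \<le> K * (p (s k \<ominus> s l) + p (t k \<ominus> t l))"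
  shows "u \<in> CS"
  unfolding cauchy_seqs_def
proof (intro CollectI conjI allI impI)
  fix e :: real assume e: "e > 0"
  define d where "d = e / 2 / (K + 1)"
  have d: "d > 0" using e assms(4) by (simp add: d_def)
  have Kd: "(K + 1) * d = e / 2" using assms(4) unfolding d_def by (intro nonzero_mult_div_cancel_left[of "K + 1" "e / 2", unfolded times_divide_eq_right[symmetric]]) simp
  obtain N where N: "\<And>k l. k \<ge> N \<Longrightarrow> l \<ge> N \<Longrightarrow> p (s k \<ominus> s l) < d" using CS_D[OF assms(2) d] by blast
  obtain M where M: "\<And>k l. k \<ge> M \<Longrightarrow> l \<ge> M \<Longrightarrow> p (t k \<ominus> t l) < d" using CS_D[OF assms(3) d] by blast
  show "\<exists>N. \<forall>k\<ge>N. \<forall>l\<ge>N. p (u k \<ominus> u l) < e"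
  proof (intro exI[of _ "max N M"] allI impI)
    fix k l assume kl: "max N M \<le> k" "max N M \<le> l"
    have "p (u k \<ominus> u l) \<le> K * (p (s k \<ominus> s l) + p (t k \<ominus> t l))" by (rule assms(5))
    also have "\<dots> \<le> K * (d + d)" using N[of k l] M[of k l] kl assms(4) by (intro mult_left_mono add_mono) auto
    also have "\<dots> < (K + 1) * (d + d)" using d by (simp add: algebra_simps)
    also have "\<dots> = e" using Kd by (simp add: distrib_left)
    finally show "p (u k \<ominus> u l) < e" .
  qed
qed (rule assms)

lemma CS_p_convergent: assumes s: "s \<in> CS" shows "convergent (\<lambda>k. p (s k))"
proof -
  have "Cauchy (\<lambda>k. p (s k))"
  proof (rule CauchyI)
    fix e :: real assume "0 < e"
    then obtain N where N: "\<forall>k\<ge>N. \<forall>l\<ge>N. p (s k \<ominus> s l) < e" using CS_D[OF s] by blast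
    show "\<exists>M. \<forall>m\<ge>M. \<forall>n\<ge>M. norm (p (s m) - p (s n)) < e"
    proof (intro exI[of _ N] allI impI)
      fix m n assume "N \<le> m" "N \<le> n"
      then have "p (s m \<ominus> s n) < e" using N by blast
      then show "norm (p (s m) - p (s n)) < e"
        using p_abs_diff[OF CS_closed[OF s] CS_closed[OF s], of m n] by simp
    qed
  qed
  then show ?thesis by (simp add: Cauchy_convergent_iff)
qed

lemma CS_bounded: assumes s: "s \<in> CS" shows "\<exists>K>0. \<forall>k. p (s k) \<le> K"
proof -
  have "Bseq (\<lambda>k. p (s k))" using CS_p_convergent[OF s] by (rule convergent_imp_Bseq)
  then obtain K where "K > 0" "\<And>k. norm (p (s k)) \<le> K" by (auto simp: Bseq_def)
  then show ?thesis by (intro exI[of _ K]) (auto intro: abs_le_D1)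
qed

lemma diff_add: "\<lbrakk>a \<in> carrier A; b \<in> carrier A; c \<in> carrier A; d \<in> carrier A\<rbrakk> \<Longrightarrow>
    (a \<oplus> b) \<ominus> (c \<oplus> d) = (a \<ominus> c) \<oplus> (b \<ominus> d)"
  by (simp add: rs)

lemma diff_mult: "\<lbrakk>a \<in> carrier A; b \<in> carrier A; c \<in> carrier A; d \<in> carrier A\<rbrakk> \<Longrightarrow>
    (a \<otimes> b) \<ominus> (c \<otimes> d) = a \<otimes> (b \<ominus> d) \<oplus> (a \<ominus> c) \<otimes> d"
  by (simp add: rs)

lemma diff_smult: "\<lbrakk>a \<in> carrier A; b \<in> carrier A\<rbrakk> \<Longrightarrow> (c \<odot> a) \<ominus> (c \<odot> b) = c \<odot> (a \<ominus> b)"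
  by (simp add: rs(14) cs_minus_one cs_add_right cs_assoc)

lemma diff_adj: "\<lbrakk>a \<in> carrier A; b \<in> carrier A\<rbrakk> \<Longrightarrow> adj a \<ominus> adj b = adj (a \<ominus> b)"
  by (simp add: rs(14) adj_add adj_minus)

lemma p_diff_mult:
  assumes "a \<in> carrier A" "b \<in> carrier A" "c \<in> carrier A" "d \<in> carrier A"
  shows "p ((a \<otimes> b) \<ominus> (c \<otimes> d)) \<le> p a * p (b \<ominus> d) + p (a \<ominus> c) * p d"
  unfolding diff_mult[OF assms] using assms
  by (intro order_trans[OF p_add] add_mono p_mult) auto

lemma CS_ops:
  assumes s: "s \<in> CS" and t: "t \<in> CS"
  shows "(\<lambda>k. s k \<oplus> t k) \<in> CS" "(\<lambda>k. s k \<otimes> t k) \<in> CS" "(\<lambda>k. c \<odot> s k) \<in> CS" "(\<lambda>k. adj (s k)) \<in> CS"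
proof -
  note cl = CS_closed[OF s] CS_closed[OF t]
  show "(\<lambda>k. s k \<oplus> t k) \<in> CS"
    by (rule CS_I[OF _ s t, where K=1]) (use cl in \<open>auto simp: diff_add intro!: p_add\<close>)
  show "(\<lambda>k. c \<odot> s k) \<in> CS"
    by (rule CS_I[OF _ s t, where K="cmod c"]) (use cl in \<open>auto simp: diff_smult p_smult p_ge_0 mult_left_mono\<close>)
  show "(\<lambda>k. adj (s k)) \<in> CS"
    by (rule CS_I[OF _ s t, where K=1]) (use cl in \<open>auto simp: adj_closed diff_adj p_adj p_ge_0\<close>)
  obtain K L where K: "K > 0" "\<And>k. p (s k) \<le> K" and L: "L > 0" "\<And>k. p (t k) \<le> L"
    using CS_bounded[OF s] CS_bounded[OF t] by blast
  show "(\<lambda>k. s k \<otimes> t k) \<in> CS"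
  proof (rule CS_I[OF _ s t, where K="K + L"])
    fix k l
    have "p (s k \<otimes> t k \<ominus> s l \<otimes> t l) \<le> p (s k) * p (t k \<ominus> t l) + p (s k \<ominus> s l) * p (t l)"
      by (rule p_diff_mult) (rule cl)+
    also have "\<dots> \<le> K * p (t k \<ominus> t l) + p (s k \<ominus> s l) * L"
      using cl by (intro add_mono mult_right_mono mult_left_mono K L p_ge_0) auto
    also have "\<dots> \<le> (K + L) * (p (s k \<ominus> s l) + p (t k \<ominus> t l))"
      using cl K L by (simp add: algebra_simps p_ge_0)
    finally show "p (s k \<otimes> t k \<ominus> s l \<otimes> t l) \<le> (K + L) * (p (s k \<ominus> s l) + p (t k \<ominus> t l))" .
  qed (use cl K L in auto)
qed

lemma CS_ops1: "s \<in> CS \<Longrightarrow> (\<lambda>k. c \<odot> s k) \<in> CS" "s \<in> CS \<Longrightarrow> (\<lambda>k. adj (s k)) \<in> CS"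
  using CS_ops(3,4)[of s s] by simp_all

lemma null_rel_iff: "(s, t) \<in> null_rel A p \<longleftrightarrow> s \<in> CS \<and> t \<in> CS \<and> (\<lambda>k. p (s k \<ominus> t k)) \<longlonglongrightarrow> 0"
  by (simp add: null_rel_def)

lemma null_seq_le:
  assumes "\<And>k. 0 \<le> f k" "\<And>k. f k \<le> g k" "g \<longlonglongrightarrow> 0" shows "f \<longlonglongrightarrow> (0::real)"
  by (rule tendsto_sandwich[of "\<lambda>_. 0" f sequentially g]) (use assms in auto)

lemma equiv_null: "equiv CS (null_rel A p)"
proof (rule equivI)
  show "null_rel A p \<subseteq> CS \<times> CS" by (auto simp: null_rel_def)
  show "refl_on CS (null_rel A p)"
    by (rule refl_onI) (auto simp: null_rel_def CS_closed rs(14) rs(16) p_zero)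
  show "sym (null_rel A p)"
    by (rule symI) (auto simp: null_rel_def CS_closed p_diff_commute)
  show "trans (null_rel A p)"
  proof (rule transI)
    fix s t u assume st: "(s, t) \<in> null_rel A p" and tu: "(t, u) \<in> null_rel A p"
    have "(\<lambda>k. p (s k \<ominus> u k)) \<longlonglongrightarrow> 0"
    proof (rule null_seq_le)
      show "(\<lambda>k. p (s k \<ominus> t k) + p (t k \<ominus> u k)) \<longlonglongrightarrow> 0"
        using st tu tendsto_add_zero unfolding null_rel_iff by blast
    qed (use st tu in \<open>auto simp: null_rel_iff CS_closed p_ge_0 intro!: p_triangle\<close>)
    then show "(s, u) \<in> null_rel A p" using st tu by (simp add: null_rel_iff)
  qed
qed

lemma cls_eq_iff: "s \<in> CS \<Longrightarrow> t \<in> CS \<Longrightarrow> cls s = cls t \<longleftrightarrow> (\<lambda>k. p (s k \<ominus> t k)) \<longlonglongrightarrow> 0"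
  using eq_equiv_class_iff[OF equiv_null] by (simp add: null_rel_iff)

lemma in_cls: "s \<in> CS \<Longrightarrow> s \<in> cls s"
  using equiv_null by (rule equiv_class_self)

lemma in_cls_D: "s' \<in> cls s \<Longrightarrow> s' \<in> CS \<and> (\<lambda>k. p (s k \<ominus> s' k)) \<longlonglongrightarrow> 0"
  by (simp add: null_rel_iff)

lemma carrier_C: "carrier C = CS // null_rel A p"
  by (simp add: completion_def)

lemma cls_closed [simp]: "s \<in> CS \<Longrightarrow> cls s \<in> carrier C"
  by (simp add: carrier_C quotientI)

lemma carrier_C_E: assumes "X \<in> carrier C" obtains s where "s \<in> CS" "X = cls s"
  using assms unfolding carrier_C by (rule quotientE)

text \<open>The operations of the completion are unions over representatives; such a union collapses once the
members are known not to depend on the representatives.\<close>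

lemma UN2_eq:
  assumes "s \<in> X" "t \<in> Y" "\<And>s' t'. s' \<in> X \<Longrightarrow> t' \<in> Y \<Longrightarrow> f s' t' = c"
  shows "(\<Union>s'\<in>X. \<Union>t'\<in>Y. f s' t') = c"
  using assms by blast

lemma C_ops:
  assumes s: "s \<in> CS" and t: "t \<in> CS"
  shows "cls s \<otimes>\<^bsub>C\<^esub> cls t = cls (\<lambda>k. s k \<otimes> t k)"
    "cls s \<oplus>\<^bsub>C\<^esub> cls t = cls (\<lambda>k. s k \<oplus> t k)"
    "c \<odot>\<^bsub>C\<^esub> cls s = cls (\<lambda>k. c \<odot> s k)"
    "adj\<^bsub>C\<^esub> cls s = cls (\<lambda>k. adj (s k))"
proof -
  note cl = CS_closed[OF s] CS_closed[OF t]
  have 1: "(\<Union>s'\<in>cls s. \<Union>t'\<in>cls t. cls (\<lambda>k. s' k \<otimes> t' k)) = cls (\<lambda>k. s k \<otimes> t k)"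
  proof (rule UN2_eq[OF in_cls[OF s] in_cls[OF t]])
    fix s' t' assume "s' \<in> cls s" "t' \<in> cls t"
    then have s': "s' \<in> CS" "(\<lambda>k. p (s k \<ominus> s' k)) \<longlonglongrightarrow> 0" and t': "t' \<in> CS" "(\<lambda>k. p (t k \<ominus> t' k)) \<longlonglongrightarrow> 0"
      using in_cls_D by blast+
    note cl' = CS_closed[OF s'(1)] CS_closed[OF t'(1)]
    obtain K L where K: "K > 0" "\<And>k. p (s' k) \<le> K" and L: "L > 0" "\<And>k. p (t k) \<le> L"
      using CS_bounded[OF s'(1)] CS_bounded[OF t] by blast
    show "cls (\<lambda>k. s' k \<otimes> t' k) = cls (\<lambda>k. s k \<otimes> t k)"
    proof (subst cls_eq_iff)
      show "(\<lambda>k. p (s' k \<otimes> t' k \<ominus> s k \<otimes> t k)) \<longlonglongrightarrow> 0"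
      proof (rule null_seq_le)
        show "(\<lambda>k. K * p (t k \<ominus> t' k) + p (s k \<ominus> s' k) * L) \<longlonglongrightarrow> 0"
          using tendsto_add[OF tendsto_mult_left[OF t'(2), of K] tendsto_mult_right[OF s'(2), of L]] by simp
        show "p (s' k \<otimes> t' k \<ominus> s k \<otimes> t k) \<le> K * p (t k \<ominus> t' k) + p (s k \<ominus> s' k) * L" for k
          using cl cl' p_diff_commute[of "s k" "s' k"] p_diff_commute[of "t k" "t' k"]
          by (intro order_trans[OF p_diff_mult] add_mono mult_mono K L less_imp_le[OF K(1)]) (auto simp: p_ge_0)
      qed (use cl cl' in \<open>auto simp: p_ge_0\<close>)
    qed (simp_all add: CS_ops(1,2) s' t' s t)
  qed
  then show "cls s \<otimes>\<^bsub>C\<^esub> cls t = cls (\<lambda>k. s k \<otimes> t k)" by (simp add: completion_def)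
  have 2: "(\<Union>s'\<in>cls s. \<Union>t'\<in>cls t. cls (\<lambda>k. s' k \<oplus> t' k)) = cls (\<lambda>k. s k \<oplus> t k)"
  proof (rule UN2_eq[OF in_cls[OF s] in_cls[OF t]])
    fix s' t' assume "s' \<in> cls s" "t' \<in> cls t"
    then have s': "s' \<in> CS" "(\<lambda>k. p (s k \<ominus> s' k)) \<longlonglongrightarrow> 0" and t': "t' \<in> CS" "(\<lambda>k. p (t k \<ominus> t' k)) \<longlonglongrightarrow> 0"
      using in_cls_D by blast+
    note cl' = CS_closed[OF s'(1)] CS_closed[OF t'(1)]
    show "cls (\<lambda>k. s' k \<oplus> t' k) = cls (\<lambda>k. s k \<oplus> t k)"
    proof (rule sym, subst cls_eq_iff)
      show "(\<lambda>k. p (s k \<oplus> t k \<ominus> (s' k \<oplus> t' k))) \<longlonglongrightarrow> 0"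
      proof (rule null_seq_le)
        show "(\<lambda>k. p (s k \<ominus> s' k) + p (t k \<ominus> t' k)) \<longlonglongrightarrow> 0"
          using tendsto_add[OF s'(2) t'(2)] by simp
        show "p (s k \<oplus> t k \<ominus> (s' k \<oplus> t' k)) \<le> p (s k \<ominus> s' k) + p (t k \<ominus> t' k)" for k
          unfolding diff_add[OF cl cl'] by (rule p_add) (simp_all add: cl cl')
      qed (simp add: p_ge_0 cl cl')
    qed (simp_all add: CS_ops(1,2) s' t' s t)
  qed
  then show "cls s \<oplus>\<^bsub>C\<^esub> cls t = cls (\<lambda>k. s k \<oplus> t k)" by (simp add: completion_def)
  have 3: "(\<Union>s'\<in>cls s. cls (\<lambda>k. c \<odot> s' k)) = cls (\<lambda>k. c \<odot> s k)"
  proof (rule UN_constant_eq[OF in_cls[OF s]], rule ballI)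
    fix s' assume "s' \<in> cls s"
    then have s': "s' \<in> CS" "(\<lambda>k. p (s k \<ominus> s' k)) \<longlonglongrightarrow> 0" using in_cls_D by blast+
    show "cls (\<lambda>k. c \<odot> s' k) = cls (\<lambda>k. c \<odot> s k)"
    proof (rule sym, rule cls_eq_iff[THEN iffD2])
      show "(\<lambda>k. c \<odot> s k) \<in> CS" "(\<lambda>k. c \<odot> s' k) \<in> CS" by (rule CS_ops1, rule s s'(1))+
      show "(\<lambda>k. p (c \<odot> s k \<ominus> c \<odot> s' k)) \<longlonglongrightarrow> 0"
        using tendsto_mult_left[OF s'(2), of "cmod c"] by (simp add: diff_smult p_smult cl CS_closed[OF s'(1)])
    qed
  qed
  then show "c \<odot>\<^bsub>C\<^esub> cls s = cls (\<lambda>k. c \<odot> s k)" by (simp add: completion_def)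
  have 4: "(\<Union>s'\<in>cls s. cls (\<lambda>k. adj (s' k))) = cls (\<lambda>k. adj (s k))"
  proof (rule UN_constant_eq[OF in_cls[OF s]], rule ballI)
    fix s' assume "s' \<in> cls s"
    then have s': "s' \<in> CS" "(\<lambda>k. p (s k \<ominus> s' k)) \<longlonglongrightarrow> 0" using in_cls_D by blast+
    show "cls (\<lambda>k. adj (s' k)) = cls (\<lambda>k. adj (s k))"
    proof (rule sym, rule cls_eq_iff[THEN iffD2])
      show "(\<lambda>k. adj (s k)) \<in> CS" "(\<lambda>k. adj (s' k)) \<in> CS" by (rule CS_ops1, rule s s'(1))+
      show "(\<lambda>k. p (adj (s k) \<ominus> adj (s' k))) \<longlonglongrightarrow> 0"
        using s' by (simp add: diff_adj p_adj cl CS_closed[OF s'(1)])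
    qed
  qed
  then show "adj\<^bsub>C\<^esub> cls s = cls (\<lambda>k. adj (s k))" by (simp add: completion_def)
qed

lemma C_ops1:
  "s \<in> CS \<Longrightarrow> c \<odot>\<^bsub>C\<^esub> cls s = cls (\<lambda>k. c \<odot> s k)" "s \<in> CS \<Longrightarrow> adj\<^bsub>C\<^esub> cls s = cls (\<lambda>k. adj (s k))"
  using C_ops(3,4)[of s s] by simp_all

lemma C_consts: "\<one>\<^bsub>C\<^esub> = cls (\<lambda>k. \<one>)" "\<zero>\<^bsub>C\<^esub> = cls (\<lambda>k. \<zero>)"
  by (simp_all add: completion_def)

lemma C_norm: assumes s: "s \<in> CS" and r: "(\<lambda>k. p (s k)) \<longlonglongrightarrow> r" shows "\<parallel>cls s\<parallel>\<^bsub>C\<^esub> = r"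
proof -
  have "(\<lambda>k. p (s' k)) \<longlonglongrightarrow> r" if "s' \<in> cls s" for s'
  proof -
    have s': "s' \<in> CS" "(\<lambda>k. p (s k \<ominus> s' k)) \<longlonglongrightarrow> 0" using in_cls_D[OF that] by auto
    have "(\<lambda>k. \<bar>p (s k) - p (s' k)\<bar>) \<longlonglongrightarrow> 0"
      by (rule null_seq_le[OF _ _ s'(2)]) (auto intro!: p_abs_diff CS_closed s s')
    then have "(\<lambda>k. p (s k) - p (s' k)) \<longlonglongrightarrow> 0" by (rule tendsto_rabs_zero_cancel)
    from tendsto_diff[OF r this] show ?thesis by simp
  qed
  then have "(THE r. \<forall>s'\<in>cls s. (\<lambda>k. p (s' k)) \<longlonglongrightarrow> r) = r"
    by (intro the_equality) (use in_cls[OF s] LIMSEQ_unique r in blast)+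
  then show ?thesis by (simp add: completion_def)
qed

lemma C_norm_lim: "s \<in> CS \<Longrightarrow> (\<lambda>k. p (s k)) \<longlonglongrightarrow> \<parallel>cls s\<parallel>\<^bsub>C\<^esub>"
  using CS_p_convergent C_norm by (fastforce simp: convergent_def)

lemma CS_neg: "s \<in> CS \<Longrightarrow> (\<lambda>k. \<ominus> s k) \<in> CS"
  using CS_ops(3)[of s s "- 1"] by (simp add: cs_minus_one CS_closed)

lemma ring_C: "ring C"
proof -
  note o = C_ops(1,2) C_ops1 C_consts CS_ops(1,2) CS_ops1 CS_closed
  have "abelian_group C"
  proof (rule abelian_groupI)
    show "\<zero>\<^bsub>C\<^esub> \<in> carrier C" by (simp add: C_consts)
    fix X Y assume X: "X \<in> carrier C" and Y: "Y \<in> carrier C"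
    obtain s where s: "s \<in> CS" "X = cls s" using X by (rule carrier_C_E)
    obtain t where t: "t \<in> CS" "Y = cls t" using Y by (rule carrier_C_E)
    show "X \<oplus>\<^bsub>C\<^esub> Y \<in> carrier C" by (simp add: s t o)
    show "X \<oplus>\<^bsub>C\<^esub> Y = Y \<oplus>\<^bsub>C\<^esub> X" by (simp add: s t o rs)
    show "\<zero>\<^bsub>C\<^esub> \<oplus>\<^bsub>C\<^esub> X = X" by (simp add: s o rs)
    show "\<exists>Y\<in>carrier C. Y \<oplus>\<^bsub>C\<^esub> X = \<zero>\<^bsub>C\<^esub>"
      by (rule bexI[of _ "cls (\<lambda>k. \<ominus> s k)"]) (simp_all add: s o CS_neg rs)
    fix Z assume "Z \<in> carrier C"
    then obtain u where u: "u \<in> CS" "Z = cls u" by (rule carrier_C_E)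
    show "X \<oplus>\<^bsub>C\<^esub> Y \<oplus>\<^bsub>C\<^esub> Z = X \<oplus>\<^bsub>C\<^esub> (Y \<oplus>\<^bsub>C\<^esub> Z)" by (simp add: s t u o rs)
  qed
  moreover have "monoid C"
  proof (rule monoidI)
    show "\<one>\<^bsub>C\<^esub> \<in> carrier C" by (simp add: C_consts)
    fix X Y assume X: "X \<in> carrier C" and Y: "Y \<in> carrier C"
    obtain s where s: "s \<in> CS" "X = cls s" using X by (rule carrier_C_E)
    obtain t where t: "t \<in> CS" "Y = cls t" using Y by (rule carrier_C_E)
    show "X \<otimes>\<^bsub>C\<^esub> Y \<in> carrier C" by (simp add: s t o)
    show "\<one>\<^bsub>C\<^esub> \<otimes>\<^bsub>C\<^esub> X = X" "X \<otimes>\<^bsub>C\<^esub> \<one>\<^bsub>C\<^esub> = X" by (simp_all add: s o)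
    fix Z assume "Z \<in> carrier C"
    then obtain u where u: "u \<in> CS" "Z = cls u" by (rule carrier_C_E)
    show "X \<otimes>\<^bsub>C\<^esub> Y \<otimes>\<^bsub>C\<^esub> Z = X \<otimes>\<^bsub>C\<^esub> (Y \<otimes>\<^bsub>C\<^esub> Z)" by (simp add: s t u o rs)
  qed
  ultimately show ?thesis
  proof (rule ringI)
    fix X Y Z assume X: "X \<in> carrier C" and Y: "Y \<in> carrier C" and Z: "Z \<in> carrier C"
    obtain s where s: "s \<in> CS" "X = cls s" using X by (rule carrier_C_E)
    obtain t where t: "t \<in> CS" "Y = cls t" using Y by (rule carrier_C_E)
    obtain u where u: "u \<in> CS" "Z = cls u" using Z by (rule carrier_C_E)
    show "(X \<oplus>\<^bsub>C\<^esub> Y) \<otimes>\<^bsub>C\<^esub> Z = X \<otimes>\<^bsub>C\<^esub> Z \<oplus>\<^bsub>C\<^esub> Y \<otimes>\<^bsub>C\<^esub> Z"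
      "Z \<otimes>\<^bsub>C\<^esub> (X \<oplus>\<^bsub>C\<^esub> Y) = Z \<otimes>\<^bsub>C\<^esub> X \<oplus>\<^bsub>C\<^esub> Z \<otimes>\<^bsub>C\<^esub> Y" by (simp_all add: s t u o rs)
  qed
qed

end

lemma cring_complex_ring: "cring complex_ring"
  by (rule cringI, rule abelian_groupI)
     (auto simp: algebra_simps intro!: comm_monoidI exI[of _ "- x" for x])

lemma star_algebraI:
  fixes A :: "('a, 'm) star_algebra_scheme" (structure)
  assumes "ring A"
    and "\<And>c a. a \<in> carrier A \<Longrightarrow> c \<odot> a \<in> carrier A"
    and "\<And>c d a. a \<in> carrier A \<Longrightarrow> (c + d) \<odot> a = c \<odot> a \<oplus> d \<odot> a"
    and "\<And>c a b. a \<in> carrier A \<Longrightarrow> b \<in> carrier A \<Longrightarrow> c \<odot> (a \<oplus> b) = c \<odot> a \<oplus> c \<odot> b"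
    and "\<And>c d a. a \<in> carrier A \<Longrightarrow> (c * d) \<odot> a = c \<odot> (d \<odot> a)"
    and "\<And>a. a \<in> carrier A \<Longrightarrow> 1 \<odot> a = a"
    and "\<And>c a b. a \<in> carrier A \<Longrightarrow> b \<in> carrier A \<Longrightarrow> (c \<odot> a) \<otimes> b = c \<odot> (a \<otimes> b)"
    and "\<And>c a b. a \<in> carrier A \<Longrightarrow> b \<in> carrier A \<Longrightarrow> a \<otimes> (c \<odot> b) = c \<odot> (a \<otimes> b)"
    and "\<And>a. a \<in> carrier A \<Longrightarrow> adj a \<in> carrier A"
    and "\<And>a. a \<in> carrier A \<Longrightarrow> adj (adj a) = a"
    and "\<And>a b. a \<in> carrier A \<Longrightarrow> b \<in> carrier A \<Longrightarrow> adj (a \<oplus> b) = adj a \<oplus> adj b"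
    and "\<And>c a. a \<in> carrier A \<Longrightarrow> adj (c \<odot> a) = cnj c \<odot> adj a"
    and "\<And>a b. a \<in> carrier A \<Longrightarrow> b \<in> carrier A \<Longrightarrow> adj (a \<otimes> b) = adj b \<otimes> adj a"
  shows "star_algebra A"
proof (rule star_algebra.intro)
  show "module complex_ring A"
    by (rule moduleI[OF cring_complex_ring ring.is_abelian_group[OF assms(1)]]) (use assms in simp_all)
  show "star_algebra_axioms A" by standard (use assms in simp_all)
qed (rule assms)

lemma completingI: "star_algebra A \<Longrightarrow> cstar_seminorm A p \<Longrightarrow> completing A p"
  by (simp add: completing_def completing_axioms_def)

context completing
begin

lemma star_algebra_C: "star_algebra C"
proof (rule star_algebraI[OF ring_C])
  note o = C_ops(1,2) C_ops1 C_consts CS_ops(1,2) CS_ops1 CS_closed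
  fix X Y c d assume X: "X \<in> carrier C" and Y: "Y \<in> carrier C"
  obtain s where s: "s \<in> CS" "X = cls s" using X by (rule carrier_C_E)
  obtain t where t: "t \<in> CS" "Y = cls t" using Y by (rule carrier_C_E)
  show "c \<odot>\<^bsub>C\<^esub> (X \<oplus>\<^bsub>C\<^esub> Y) = c \<odot>\<^bsub>C\<^esub> X \<oplus>\<^bsub>C\<^esub> c \<odot>\<^bsub>C\<^esub> Y" by (simp add: s t o cs_add_right)
  show "(c \<odot>\<^bsub>C\<^esub> X) \<otimes>\<^bsub>C\<^esub> Y = c \<odot>\<^bsub>C\<^esub> (X \<otimes>\<^bsub>C\<^esub> Y)" by (simp add: s t o smult_mult_left)
  show "X \<otimes>\<^bsub>C\<^esub> (c \<odot>\<^bsub>C\<^esub> Y) = c \<odot>\<^bsub>C\<^esub> (X \<otimes>\<^bsub>C\<^esub> Y)" by (simp add: s t o smult_mult_right)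
  show "adj\<^bsub>C\<^esub> (X \<oplus>\<^bsub>C\<^esub> Y) = adj\<^bsub>C\<^esub> X \<oplus>\<^bsub>C\<^esub> adj\<^bsub>C\<^esub> Y" by (simp add: s t o adj_add)
  show "adj\<^bsub>C\<^esub> (X \<otimes>\<^bsub>C\<^esub> Y) = adj\<^bsub>C\<^esub> Y \<otimes>\<^bsub>C\<^esub> adj\<^bsub>C\<^esub> X" by (simp add: s t o adj_mult)
next
  note o = C_ops(1,2) C_ops1 C_consts CS_ops(1,2) CS_ops1 CS_closed
  fix X c d assume X: "X \<in> carrier C"
  obtain s where s: "s \<in> CS" "X = cls s" using X by (rule carrier_C_E)
  show "c \<odot>\<^bsub>C\<^esub> X \<in> carrier C" "adj\<^bsub>C\<^esub> X \<in> carrier C" by (simp_all add: s o)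
  show "(c + d) \<odot>\<^bsub>C\<^esub> X = c \<odot>\<^bsub>C\<^esub> X \<oplus>\<^bsub>C\<^esub> d \<odot>\<^bsub>C\<^esub> X" by (simp add: s o cs_add_left)
  show "(c * d) \<odot>\<^bsub>C\<^esub> X = c \<odot>\<^bsub>C\<^esub> (d \<odot>\<^bsub>C\<^esub> X)" by (simp add: s o cs_assoc)
  show "1 \<odot>\<^bsub>C\<^esub> X = X" by (simp add: s o)
  show "adj\<^bsub>C\<^esub> (adj\<^bsub>C\<^esub> X) = X" by (simp add: s o adj_adj)
  show "adj\<^bsub>C\<^esub> (c \<odot>\<^bsub>C\<^esub> X) = cnj c \<odot>\<^bsub>C\<^esub> adj\<^bsub>C\<^esub> X" by (simp add: s o adj_smult)
qed

lemma cstar_seminorm_C: "cstar_seminorm C (cnorm C)"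
  unfolding cstar_seminorm_def
proof (intro conjI ballI allI)
  note o = C_ops(1,2) C_ops1 C_consts CS_ops(1,2) CS_ops1 CS_closed
  fix X assume X: "X \<in> carrier C"
  obtain s where s: "s \<in> CS" "X = cls s" using X by (rule carrier_C_E)
  note ls = C_norm_lim[OF s(1)] and cl = CS_closed[OF s(1)]
  show "0 \<le> \<parallel>X\<parallel>\<^bsub>C\<^esub>" unfolding s by (rule LIMSEQ_le_const[OF ls]) (auto simp: p_ge_0 cl)
  show "\<parallel>c \<odot>\<^bsub>C\<^esub> X\<parallel>\<^bsub>C\<^esub> = cmod c * \<parallel>X\<parallel>\<^bsub>C\<^esub>" for c unfolding s C_ops(3)[OF s(1) s(1)]
    by (rule C_norm) (use s tendsto_mult_left[OF ls] in \<open>auto simp: CS_ops(3)[OF s(1) s(1)] p_smult cl\<close>)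
  show "\<parallel>adj\<^bsub>C\<^esub> X \<otimes>\<^bsub>C\<^esub> X\<parallel>\<^bsub>C\<^esub> = (\<parallel>X\<parallel>\<^bsub>C\<^esub>)\<^sup>2"
    unfolding s C_ops(4)[OF s(1) s(1)] C_ops(1)[OF CS_ops(4)[OF s(1) s(1)] s(1)]
    by (rule C_norm) (use s tendsto_power[OF ls, of 2] in \<open>auto simp: CS_ops(2)[OF CS_ops(4)[OF s(1) s(1)] s(1)] p_adj_mult cl\<close>)
  fix Y assume Y: "Y \<in> carrier C"
  obtain t where t: "t \<in> CS" "Y = cls t" using Y by (rule carrier_C_E)
  note lt = C_norm_lim[OF t(1)] and cl' = CS_closed[OF t(1)]
  show "\<parallel>X \<oplus>\<^bsub>C\<^esub> Y\<parallel>\<^bsub>C\<^esub> \<le> \<parallel>X\<parallel>\<^bsub>C\<^esub> + \<parallel>Y\<parallel>\<^bsub>C\<^esub>" unfolding s t C_ops(2)[OF s(1) t(1)]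
    by (rule LIMSEQ_le[OF C_norm_lim[OF CS_ops(1)[OF s(1) t(1)]] tendsto_add[OF ls lt]])
       (auto intro!: p_add cl cl')
  show "\<parallel>X \<otimes>\<^bsub>C\<^esub> Y\<parallel>\<^bsub>C\<^esub> \<le> \<parallel>X\<parallel>\<^bsub>C\<^esub> * \<parallel>Y\<parallel>\<^bsub>C\<^esub>" unfolding s t C_ops(1)[OF s(1) t(1)]
    by (rule LIMSEQ_le[OF C_norm_lim[OF CS_ops(2)[OF s(1) t(1)]] tendsto_mult[OF ls lt]])
       (auto intro!: p_mult cl cl')
qed

abbreviation "emb \<equiv> completion_embed A p"

lemma emb_star_hom: "emb \<in> star_hom A C"
proof -
  note o = C_ops[OF CS_const CS_const] C_consts completion_embed_def
  show ?thesis unfolding star_hom_def ring_hom_def by (auto simp: o adj_closed C_ops(3,4)[OF CS_const CS_const])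
qed

lemma emb_closed: "a \<in> carrier A \<Longrightarrow> emb a \<in> carrier C"
  by (simp add: completion_embed_def)

lemma norm_emb: "a \<in> carrier A \<Longrightarrow> \<parallel>emb a\<parallel>\<^bsub>C\<^esub> = p a"
  unfolding completion_embed_def by (rule C_norm) auto

lemma emb_eq_iff: "a \<in> carrier A \<Longrightarrow> b \<in> carrier A \<Longrightarrow> emb a = emb b \<longleftrightarrow> p (a \<ominus> b) = 0"
  unfolding completion_embed_def by (subst cls_eq_iff) (auto simp: LIMSEQ_const_iff)

lemma cls_minus: "s \<in> CS \<Longrightarrow> t \<in> CS \<Longrightarrow> cls s \<ominus>\<^bsub>C\<^esub> cls t = cls (\<lambda>k. s k \<ominus> t k)"
  using C_ops[of s "\<lambda>k. \<ominus> t k"] C_ops(3)[of t t "- 1"] CS_neg[of t]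
  by (simp add: star_algebra.cs_minus_one[OF star_algebra_C] star_algebra.rs(14)[OF star_algebra_C] rs(14) cs_minus_one CS_closed)

lemma CS_minus: "s \<in> CS \<Longrightarrow> t \<in> CS \<Longrightarrow> (\<lambda>k. s k \<ominus> t k) \<in> CS"
  using CS_ops(1)[of s "\<lambda>k. \<ominus> t k"] CS_neg[of t] by (simp add: rs(14) CS_closed)

lemma cls_emb_dist:
  assumes s: "s \<in> CS" and N: "\<And>k. k \<ge> N \<Longrightarrow> p (s k \<ominus> s m) \<le> e"
  shows "\<parallel>cls s \<ominus>\<^bsub>C\<^esub> emb (s m)\<parallel>\<^bsub>C\<^esub> \<le> e"
proof -
  have c: "(\<lambda>k. s m) \<in> CS" by (simp add: CS_closed[OF s])
  show ?thesis unfolding completion_embed_def cls_minus[OF s c]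
    by (rule LIMSEQ_le_const2[OF C_norm_lim[OF CS_minus[OF s c]]]) (use N in blast)
qed

lemma emb_dense:
  assumes "X \<in> carrier C" "e > 0" shows "\<exists>a\<in>carrier A. \<parallel>X \<ominus>\<^bsub>C\<^esub> emb a\<parallel>\<^bsub>C\<^esub> \<le> e"
proof -
  obtain s where s: "s \<in> CS" "X = cls s" using assms(1) by (rule carrier_C_E)
  obtain N where "\<forall>k\<ge>N. \<forall>l\<ge>N. p (s k \<ominus> s l) < e" using CS_D[OF s(1) assms(2)] by blast
  then have "\<parallel>X \<ominus>\<^bsub>C\<^esub> emb (s N)\<parallel>\<^bsub>C\<^esub> \<le> e" unfolding s
    by (intro cls_emb_dist[OF s(1), of N]) (auto intro: less_imp_le)
  then show ?thesis using CS_closed[OF s(1)] by blast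
qed

lemma emb_minus: "a \<in> carrier A \<Longrightarrow> b \<in> carrier A \<Longrightarrow> emb (a \<ominus> b) = emb a \<ominus>\<^bsub>C\<^esub> emb b"
  by (rule star_hom_minus(1)[OF star_alg star_algebra_C emb_star_hom])

lemma cls_limit:
  assumes s: "s \<in> CS" shows "(\<lambda>k. \<parallel>emb (s k) \<ominus>\<^bsub>C\<^esub> cls s\<parallel>\<^bsub>C\<^esub>) \<longlonglongrightarrow> 0"
proof (rule LIMSEQ_I)
  fix e :: real assume e: "e > 0"
  then obtain N where N: "\<forall>k\<ge>N. \<forall>l\<ge>N. p (s k \<ominus> s l) < e/2" using CS_D[OF s, of "e/2"] by auto
  have "norm (\<parallel>emb (s k) \<ominus>\<^bsub>C\<^esub> cls s\<parallel>\<^bsub>C\<^esub> - 0) < e" if k: "k \<ge> N" for k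
  proof -
    have "\<parallel>cls s \<ominus>\<^bsub>C\<^esub> emb (s k)\<parallel>\<^bsub>C\<^esub> \<le> e/2"
      by (rule cls_emb_dist[OF s, of N]) (use N k in \<open>auto intro: less_imp_le\<close>)
    moreover have "\<parallel>cls s \<ominus>\<^bsub>C\<^esub> emb (s k)\<parallel>\<^bsub>C\<^esub> = \<parallel>emb (s k) \<ominus>\<^bsub>C\<^esub> cls s\<parallel>\<^bsub>C\<^esub>"
      by (rule seminorm_diff_commute[OF star_algebra_C cstar_seminorm_C]) (use s in \<open>auto simp: emb_closed CS_closed\<close>)
    moreover have "0 \<le> \<parallel>emb (s k) \<ominus>\<^bsub>C\<^esub> cls s\<parallel>\<^bsub>C\<^esub>"
      by (rule seminorm_ge_0[OF cstar_seminorm_C])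
         (use s in \<open>auto simp: emb_closed CS_closed star_algebra.rs(4)[OF star_algebra_C]\<close>)
    ultimately show ?thesis using e by simp
  qed
  then show "\<exists>no. \<forall>n\<ge>no. norm (\<parallel>emb (s n) \<ominus>\<^bsub>C\<^esub> cls s\<parallel>\<^bsub>C\<^esub> - 0) < e" by blast
qed

theorem cstar_algebra_C: "cstar_algebra C"
proof (rule cstar_algebra.intro[OF star_algebra_C], standard)
  show "cstar_seminorm C (cnorm C)" by (rule cstar_seminorm_C)
  fix X assume X: "X \<in> carrier C" "\<parallel>X\<parallel>\<^bsub>C\<^esub> = 0"
  obtain s where s: "s \<in> CS" "X = cls s" using X(1) by (rule carrier_C_E)
  have "(\<lambda>k. p (s k)) \<longlonglongrightarrow> 0" using C_norm_lim[OF s(1)] X(2) s(2) by simp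
  then have "cls s = cls (\<lambda>k. \<zero>)"
    by (subst cls_eq_iff) (auto simp: s CS_closed[OF s(1)] rs(14) rs(15) cs_minus_one)
  then show "X = \<zero>\<^bsub>C\<^esub>" by (simp add: s C_consts)
next
  interpret CC: star_algebra C by (rule star_algebra_C)
  fix S assume S: "S \<in> cauchy_seqs C (cnorm C)"
  then have SC: "\<And>k. S k \<in> carrier C" by (simp add: cauchy_seqs_def)
  have "\<exists>a\<in>carrier A. \<parallel>S n \<ominus>\<^bsub>C\<^esub> emb a\<parallel>\<^bsub>C\<^esub> \<le> inverse (real (Suc n))" for n
    by (rule emb_dense[OF SC]) simp
  then obtain d where d: "\<And>n. d n \<in> carrier A" "\<And>n. \<parallel>S n \<ominus>\<^bsub>C\<^esub> emb (d n)\<parallel>\<^bsub>C\<^esub> \<le> inverse (real (Suc n))"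
    by metis
  note tri = seminorm_diff_triangle[OF star_algebra_C cstar_seminorm_C]
    and com = seminorm_diff_commute[OF star_algebra_C cstar_seminorm_C]
  have "d \<in> CS" unfolding cauchy_seqs_def
  proof (intro CollectI conjI allI impI d)
    fix e :: real assume e: "e > 0"
    obtain N where N: "\<And>k l. k \<ge> N \<Longrightarrow> l \<ge> N \<Longrightarrow> \<parallel>S k \<ominus>\<^bsub>C\<^esub> S l\<parallel>\<^bsub>C\<^esub> < e/3"
    proof -
      have "\<exists>N. \<forall>k\<ge>N. \<forall>l\<ge>N. \<parallel>S k \<ominus>\<^bsub>C\<^esub> S l\<parallel>\<^bsub>C\<^esub> < e/3" using S divide_pos_pos[OF e zero_less_numeral[of "num.Bit1 num.One"]]
        unfolding cauchy_seqs_def mem_Collect_eq by blast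
      then show ?thesis using that by blast
    qed
    obtain M where M: "inverse (real (Suc M)) < e/3" using reals_Archimedean[of "e/3"] e by auto
    have small: "\<parallel>S n \<ominus>\<^bsub>C\<^esub> emb (d n)\<parallel>\<^bsub>C\<^esub> < e/3" if "n \<ge> M" for n
    proof -
      have "inverse (real (Suc n)) \<le> inverse (real (Suc M))" using that by (intro le_imp_inverse_le) auto
      then show ?thesis using d(2)[of n] M by linarith
    qed
    show "\<exists>N. \<forall>k\<ge>N. \<forall>l\<ge>N. p (d k \<ominus> d l) < e"
    proof (intro exI[of _ "max M N"] allI impI)
      fix k l assume kl: "max M N \<le> k" "max M N \<le> l"
      note ec = emb_closed[OF d(1)]
      have "p (d k \<ominus> d l) = \<parallel>emb (d k) \<ominus>\<^bsub>C\<^esub> emb (d l)\<parallel>\<^bsub>C\<^esub>"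
        using norm_emb[OF rs(4)[OF d(1) d(1)]] emb_minus[OF d(1) d(1)] by simp
      also have "\<dots> \<le> \<parallel>emb (d k) \<ominus>\<^bsub>C\<^esub> S k\<parallel>\<^bsub>C\<^esub> + (\<parallel>S k \<ominus>\<^bsub>C\<^esub> S l\<parallel>\<^bsub>C\<^esub> + \<parallel>S l \<ominus>\<^bsub>C\<^esub> emb (d l)\<parallel>\<^bsub>C\<^esub>)"
        by (rule order_trans[OF tri[OF ec SC ec] add_left_mono[OF tri[OF SC SC ec]]])
      also have "\<dots> < e" using small[of k] small[of l] N[of k l] com[OF ec SC, of k k] kl by simp
      finally show "p (d k \<ominus> d l) < e" .
    qed
  qed
  show "\<exists>a\<in>carrier C. (\<lambda>k. \<parallel>S k \<ominus>\<^bsub>C\<^esub> a\<parallel>\<^bsub>C\<^esub>) \<longlonglongrightarrow> 0"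
  proof (rule bexI[of _ "cls d"])
    show "(\<lambda>k. \<parallel>S k \<ominus>\<^bsub>C\<^esub> cls d\<parallel>\<^bsub>C\<^esub>) \<longlonglongrightarrow> 0"
    proof (rule null_seq_le)
      show "(\<lambda>k. inverse (real (Suc k)) + \<parallel>emb (d k) \<ominus>\<^bsub>C\<^esub> cls d\<parallel>\<^bsub>C\<^esub>) \<longlonglongrightarrow> 0"
        by (rule tendsto_add_zero[OF LIMSEQ_inverse_real_of_nat cls_limit[OF \<open>d \<in> CS\<close>]])
      fix k
      have cd: "cls d \<in> carrier C" using \<open>d \<in> CS\<close> by simp
      show "0 \<le> \<parallel>S k \<ominus>\<^bsub>C\<^esub> cls d\<parallel>\<^bsub>C\<^esub>" by (rule seminorm_ge_0[OF cstar_seminorm_C]) (simp add: SC cd)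
      show "\<parallel>S k \<ominus>\<^bsub>C\<^esub> cls d\<parallel>\<^bsub>C\<^esub> \<le> inverse (real (Suc k)) + \<parallel>emb (d k) \<ominus>\<^bsub>C\<^esub> cls d\<parallel>\<^bsub>C\<^esub>"
        by (rule order_trans[OF tri[OF SC emb_closed[OF d(1)] cd] add_right_mono[OF d(2)]])
    qed
  qed (use \<open>d \<in> CS\<close> in simp)
qed

end

lemma sec_minus:
  fixes B :: "'b cstar_algebra"
  assumes B: "cstar_algebra B" and "a \<in> carrier B" "b \<in> carrier B"
  shows "sec B (a \<ominus>\<^bsub>B\<^esub> b) = sec B a - sec B b"
  by (rule cfam_eqI) (simp add: ev_sec assms ring.ring_simprules[OF cstar_ring])

lemma sec_tendsto_iff:
  fixes B :: "'b cstar_algebra"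
  assumes B: "cstar_algebra B" and x: "\<And>k. x k \<in> carrier B" and b: "b \<in> carrier B"
  shows "(\<lambda>k. sec B (x k)) \<longlonglongrightarrow> sec B b \<longleftrightarrow> (\<lambda>k. \<parallel>x k \<ominus>\<^bsub>B\<^esub> b\<parallel>\<^bsub>B\<^esub>) \<longlonglongrightarrow> 0"
proof -
  have "norm (sec B (x k) - sec B b) = \<parallel>x k \<ominus>\<^bsub>B\<^esub> b\<parallel>\<^bsub>B\<^esub>" for k
    using x b norm_sec[OF B ring.ring_simprules(4)[OF cstar_ring[OF B]]] by (simp flip: sec_minus[OF B])
  then show ?thesis using tendsto_norm_zero_iff[of "\<lambda>k. sec B (x k) - sec B b"] LIM_zero_iff[of "\<lambda>k. sec B (x k)"]
    by simp
qed

lemma tendsto_cscale: "(f \<longlongrightarrow> (l::'a::cstar)) F \<Longrightarrow> ((\<lambda>x. c *\<^sub>C f x) \<longlongrightarrow> c *\<^sub>C l) F"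
  by (rule bounded_linear.tendsto[of "\<lambda>x. c *\<^sub>C x"])
     (auto intro!: bounded_linear_intro[where K="cmod c"]
       simp: cscale_add_right cscale_scaleR scaleR_cscale mult.commute)

text \<open>An element of the completion is sent to the limit of the images of any Cauchy sequence
representing it.\<close>

theorem (in completing) extend_star_hom:
  fixes B :: "'b cstar_algebra"
  assumes B: "cstar_algebra B" and h: "h \<in> star_hom A B"
    and le: "\<And>a. a \<in> carrier A \<Longrightarrow> \<parallel>h a\<parallel>\<^bsub>B\<^esub> \<le> p a"
  shows "\<exists>H\<in>star_hom C B. \<forall>a\<in>carrier A. H (emb a) = h a"
proof -
  note sB = cstar_star[OF B] and hD = star_homD[OF h]
  define lim where "lim s b \<longleftrightarrow> s \<in> CS \<and> b \<in> carrier B \<and> (\<lambda>k. sec B (h (s k))) \<longlonglongrightarrow> sec B b" for s b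
  have hm: "h (a \<ominus> b) = h a \<ominus>\<^bsub>B\<^esub> h b" if "a \<in> carrier A" "b \<in> carrier A" for a b
    by (rule star_hom_minus(1)[OF star_alg sB h that])
  have ex: "\<exists>b. lim s b" if s: "s \<in> CS" for s
  proof -
    note c = CS_closed[OF s]
    have "(\<lambda>k. h (s k)) \<in> cauchy_seqs B (cnorm B)" unfolding cauchy_seqs_def
    proof (intro CollectI conjI allI impI)
      fix e :: real assume "e > 0"
      then obtain N where "\<forall>k\<ge>N. \<forall>l\<ge>N. p (s k \<ominus> s l) < e" using CS_D[OF s] by blast
      moreover have "\<parallel>h (s k) \<ominus>\<^bsub>B\<^esub> h (s l)\<parallel>\<^bsub>B\<^esub> \<le> p (s k \<ominus> s l)" for k l
        using le[of "s k \<ominus> s l"] c by (simp add: hm)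
      ultimately show "\<exists>N. \<forall>k\<ge>N. \<forall>l\<ge>N. \<parallel>h (s k) \<ominus>\<^bsub>B\<^esub> h (s l)\<parallel>\<^bsub>B\<^esub> < e"
        using order_le_less_trans by blast
    qed (rule hD(1)[OF c])
    then obtain b where b: "b \<in> carrier B" "(\<lambda>k. \<parallel>h (s k) \<ominus>\<^bsub>B\<^esub> b\<parallel>\<^bsub>B\<^esub>) \<longlonglongrightarrow> 0"
      using cstar_algebra.complete[OF B] by blast
    then have "lim s b" unfolding lim_def using s sec_tendsto_iff[OF B hD(1)[OF c] b(1)] by simp
    then show ?thesis by blast
  qed
  have unique: "b = b'" if "lim s b" "lim s' b'" "cls s = cls s'" for s s' b b'
  proof -
    have s: "s \<in> CS" "s' \<in> CS" and b: "b \<in> carrier B" "b' \<in> carrier B" using that by (auto simp: lim_def)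
    note c = CS_closed[OF s(1)] CS_closed[OF s(2)]
    have "(\<lambda>k. p (s k \<ominus> s' k)) \<longlonglongrightarrow> 0" using that(3) cls_eq_iff s by blast
    then have "(\<lambda>k. norm (sec B (h (s k)) - sec B (h (s' k)))) \<longlonglongrightarrow> 0"
    proof (rule null_seq_le[rotated 2])
      fix k
      have "sec B (h (s k)) - sec B (h (s' k)) = sec B (h (s k \<ominus> s' k))"
        using c by (simp add: hm sec_minus[OF B] hD(1))
      then show "norm (sec B (h (s k)) - sec B (h (s' k))) \<le> p (s k \<ominus> s' k)"
        using c le[of "s k \<ominus> s' k"] by (simp add: norm_sec[OF B] hD(1))
    qed simp
    then have "(\<lambda>k. sec B (h (s k)) - sec B (h (s' k))) \<longlonglongrightarrow> 0" by (rule tendsto_norm_zero_cancel)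
    moreover have "(\<lambda>k. sec B (h (s k)) - sec B (h (s' k))) \<longlonglongrightarrow> sec B b - sec B b'"
      using that by (intro tendsto_diff) (auto simp: lim_def)
    ultimately have "sec B b - sec B b' = 0" using LIMSEQ_unique by blast
    then show ?thesis using sec_inj[OF B b] by simp
  qed
  define H where "H X = (SOME b. \<exists>s. X = cls s \<and> lim s b)" for X
  have H: "H (cls s) = b" if "lim s b" for s b
  proof -
    have "\<exists>b s'. cls s = cls s' \<and> lim s' b" using that by blast
    then have "\<exists>s'. cls s = cls s' \<and> lim s' (H (cls s))" unfolding H_def by (rule someI_ex)
    then show ?thesis using unique that by blast
  qed
  have L: "lim (\<lambda>k. s k \<oplus> t k) (a \<oplus>\<^bsub>B\<^esub> b)" "lim (\<lambda>k. s k \<otimes> t k) (a \<otimes>\<^bsub>B\<^esub> b)"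
    "lim (\<lambda>k. c \<odot> s k) (c \<odot>\<^bsub>B\<^esub> a)" "lim (\<lambda>k. adj (s k)) (adj\<^bsub>B\<^esub> a)"
    if st: "lim s a" "lim t b" for s t a b c
  proof -
    have s: "s \<in> CS" "t \<in> CS" and ab: "a \<in> carrier B" "b \<in> carrier B"
      and l: "(\<lambda>k. sec B (h (s k))) \<longlonglongrightarrow> sec B a" "(\<lambda>k. sec B (h (t k))) \<longlonglongrightarrow> sec B b"
      using st by (auto simp: lim_def)
    note cl = CS_closed[OF s(1)] CS_closed[OF s(2)]
    note S = sec_simps[OF B hD(1)[OF cl(1)]] sec_simps[OF B ab(1)]
    show "lim (\<lambda>k. s k \<oplus> t k) (a \<oplus>\<^bsub>B\<^esub> b)" "lim (\<lambda>k. s k \<otimes> t k) (a \<otimes>\<^bsub>B\<^esub> b)"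
      using CS_ops[OF s] ab cl ring.ring_simprules(1-6)[OF cstar_ring[OF B]]
      by (simp_all add: lim_def hD S tendsto_add[OF l] tendsto_mult[OF l])
    show "lim (\<lambda>k. c \<odot> s k) (c \<odot>\<^bsub>B\<^esub> a)" "lim (\<lambda>k. adj (s k)) (adj\<^bsub>B\<^esub> a)"
      using CS_ops(3,4)[OF s] ab cl star_algebra.cs_closed[OF sB] star_algebra.adj_closed[OF sB]
      by (simp_all add: lim_def hD S tendsto_cscale[OF l(1)] tendsto_star[OF l(1)])
  qed
  have const: "lim (\<lambda>k. a) (h a)" if "a \<in> carrier A" for a
    using that by (simp add: lim_def hD(1))
  have emb: "H (emb a) = h a" if "a \<in> carrier A" for a
    using H[OF const[OF that]] by (simp add: completion_embed_def)
  have E: "\<exists>s b. X = cls s \<and> lim s b" if "X \<in> carrier C" for X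
    using that ex by (metis carrier_C_E)
  have Hom: "H X \<in> carrier B \<and> H (X \<oplus>\<^bsub>C\<^esub> Y) = H X \<oplus>\<^bsub>B\<^esub> H Y \<and> H (X \<otimes>\<^bsub>C\<^esub> Y) = H X \<otimes>\<^bsub>B\<^esub> H Y \<and>
      H (c \<odot>\<^bsub>C\<^esub> X) = c \<odot>\<^bsub>B\<^esub> H X \<and> H (adj\<^bsub>C\<^esub> X) = adj\<^bsub>B\<^esub> H X"
    if X: "X \<in> carrier C" and Y: "Y \<in> carrier C" for X Y c
  proof -
    obtain s a where s: "X = cls s" "lim s a" using E[OF X] by blast
    obtain t b where t: "Y = cls t" "lim t b" using E[OF Y] by blast
    have c: "s \<in> CS" "t \<in> CS" using s t by (auto simp: lim_def)
    show ?thesis using H[OF s(2)] H[OF t(2)] H[OF L(1)[OF s(2) t(2)]] H[OF L(2)[OF s(2) t(2)]]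
        H[OF L(3)[OF s(2) t(2)]] H[OF L(4)[OF s(2) t(2)]] s(2)
      by (simp add: s(1) t(1) C_ops(1,2)[OF c] C_ops1 c) (simp add: lim_def)
  qed
  have "H \<one>\<^bsub>C\<^esub> = \<one>\<^bsub>B\<^esub>" using emb[of \<one>] star_homD(4)[OF emb_star_hom, of \<one>] hD(4)[of \<one>] by simp
  then have "H \<in> star_hom C B" unfolding star_hom_def ring_hom_def using Hom by auto
  then show ?thesis using emb by blast
qed

section \<open>Monoid *-algebras and universal C*-algebras\<close>

text \<open>Products and involutions of finitely supported functions are sums over supports.  They are handled
as additive extensions of functions on the basis, so that identities need only be checked on the
single-point functions.\<close>

abbreviation "sg \<equiv> Poly_Mapping.single"
abbreviation "lk \<equiv> Poly_Mapping.lookup"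
abbreviation "ks \<equiv> Poly_Mapping.keys"

lemma lookup_scale [simp]: "lk (Poly_Mapping.map ((*) c) p) k = c * (lk p k :: complex)"
  by transfer (auto simp: when_def)

lemma sum_singles: "(\<Sum>x\<in>ks p. sg x (lk p x)) = (p :: 'w \<Rightarrow>\<^sub>0 complex)"
proof (rule poly_mapping_eqI)
  fix k show "lk (\<Sum>x\<in>ks p. sg x (lk p x)) k = lk p k"
    by (simp add: lookup_sum lookup_single when_def sum.delta in_keys_iff)
qed

lemma poly_induct [consumes 1, case_names zero single add]:
  fixes p :: "'w \<Rightarrow>\<^sub>0 complex"
  assumes "ks p \<subseteq> S" and "P 0" and "\<And>x c. x \<in> S \<Longrightarrow> P (sg x c)"
    and "\<And>p q. ks p \<subseteq> S \<Longrightarrow> ks q \<subseteq> S \<Longrightarrow> P p \<Longrightarrow> P q \<Longrightarrow> P (p + q)"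
  shows "P p"
proof -
  have "F \<subseteq> S \<Longrightarrow> ks (\<Sum>x\<in>F. sg x (lk p x)) \<subseteq> S \<and> P (\<Sum>x\<in>F. sg x (lk p x))" if "finite F" for F
    using that
  proof (induction F rule: finite_induct)
    case (insert x F)
    have "ks (sg x (lk p x)) \<subseteq> S" using insert by simp
    then show ?case using insert assms(3)[of x] assms(4)
      by (simp add: subset_trans[OF keys_add])
  qed (simp add: assms)
  from this[of "ks p"] assms(1) show ?thesis by (simp add: sum_singles)
qed

lemma poly_induct_UNIV [case_names zero single add]:
  fixes p :: "'w \<Rightarrow>\<^sub>0 complex"
  assumes "P 0" "\<And>x c. P (sg x c)" "\<And>p q. P p \<Longrightarrow> P q \<Longrightarrow> P (p + q)"
  shows "P p"
  by (rule poly_induct[of p UNIV]) (use assms in auto)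

definition lin_ext :: "('w \<Rightarrow> complex \<Rightarrow> 'v::ab_group_add) \<Rightarrow> ('w \<Rightarrow>\<^sub>0 complex) \<Rightarrow> 'v" where
  "lin_ext G p = (\<Sum>x\<in>ks p. G x (lk p x))"

lemma lin_ext_add:
  assumes "\<And>x. G x 0 = 0" "\<And>x c d. G x (c + d) = G x c + G x d"
  shows "lin_ext G (p + q) = lin_ext G p + lin_ext G q"
  unfolding lin_ext_def by (rule setsum_keys_plus_distrib) (rule assms)+

lemma lin_ext_single: "G x 0 = 0 \<Longrightarrow> lin_ext G (sg x c) = G x c"
  by (cases "c = 0") (simp_all add: lin_ext_def)

lemma lin_ext_zero [simp]: "lin_ext G 0 = 0"
  by (simp add: lin_ext_def)

definition mono_mult :: "('w, 'm) monoid_scheme \<Rightarrow> ('w \<Rightarrow>\<^sub>0 complex) \<Rightarrow> ('w \<Rightarrow>\<^sub>0 complex) \<Rightarrow> ('w \<Rightarrow>\<^sub>0 complex)" where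
  "mono_mult M p q = lin_ext (\<lambda>x c. lin_ext (\<lambda>y d. sg (x \<otimes>\<^bsub>M\<^esub> y) (c * d)) q) p"

lemma lin_ext_plus: "lin_ext (\<lambda>x c. G x c + G' x c) p = lin_ext G p + lin_ext G' p"
  by (simp add: lin_ext_def sum.distrib)

text \<open>Additivity in the coefficient of the inner extension, as needed to evaluate the outer one.\<close>

lemma inner_ext:
  "lin_ext (\<lambda>y d. sg (x \<otimes>\<^bsub>M\<^esub> y) (0 * d)) q = 0"
  "lin_ext (\<lambda>y d. sg (x \<otimes>\<^bsub>M\<^esub> y) ((c + c') * d)) q =
    lin_ext (\<lambda>y d. sg (x \<otimes>\<^bsub>M\<^esub> y) (c * d)) q + lin_ext (\<lambda>y d. sg (x \<otimes>\<^bsub>M\<^esub> y) (c' * d)) q"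
  by (simp_all add: lin_ext_def single_add distrib_right sum.distrib)

lemma mono_mult_simps:
  "mono_mult M (p + p') q = mono_mult M p q + mono_mult M p' q"
  "mono_mult M p (q + q') = mono_mult M p q + mono_mult M p q'"
  "mono_mult M (sg x c) (sg y d) = sg (x \<otimes>\<^bsub>M\<^esub> y) (c * d)"
  "mono_mult M 0 q = 0" "mono_mult M p 0 = 0"
proof -
  show "mono_mult M (p + p') q = mono_mult M p q + mono_mult M p' q"
    unfolding mono_mult_def by (rule lin_ext_add) (rule inner_ext)+
  have "lin_ext (\<lambda>y d. sg (x \<otimes>\<^bsub>M\<^esub> y) (c * d)) (q + q') =
     lin_ext (\<lambda>y d. sg (x \<otimes>\<^bsub>M\<^esub> y) (c * d)) q + lin_ext (\<lambda>y d. sg (x \<otimes>\<^bsub>M\<^esub> y) (c * d)) q'" for x c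
    by (rule lin_ext_add) (simp_all add: distrib_left single_add)
  then show "mono_mult M p (q + q') = mono_mult M p q + mono_mult M p q'"
    unfolding mono_mult_def by (simp add: lin_ext_plus)
  show "mono_mult M (sg x c) (sg y d) = sg (x \<otimes>\<^bsub>M\<^esub> y) (c * d)"
    unfolding mono_mult_def by (simp add: lin_ext_single inner_ext)
  show "mono_mult M 0 q = 0" "mono_mult M p 0 = 0"
    by (simp_all add: mono_mult_def) (simp add: lin_ext_def)
qed

definition mono_star :: "('w \<Rightarrow> 'w) \<Rightarrow> ('w \<Rightarrow>\<^sub>0 complex) \<Rightarrow> ('w \<Rightarrow>\<^sub>0 complex)" where
  "mono_star st p = lin_ext (\<lambda>x c. sg (st x) (cnj c)) p"

lemma mono_star_simps:
  "mono_star st (p + q) = mono_star st p + mono_star st q"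
  "mono_star st (sg x c) = sg (st x) (cnj c)" "mono_star st 0 = 0"
  unfolding mono_star_def by (rule lin_ext_add) (simp_all add: single_add lin_ext_single)

abbreviation "pscale c \<equiv> Poly_Mapping.map ((*) (c::complex))"

lemma scale_simps:
  "pscale c (p + q) = pscale c p + pscale c q" "pscale c (sg x d) = sg x (c * d)" "pscale c 0 = 0"
  "pscale (c + d) p = pscale c p + pscale d p" "pscale (c * d) p = pscale c (pscale d p)" "pscale 1 p = p"
  by (rule poly_mapping_eqI; simp add: lookup_add lookup_single when_def distrib_left distrib_right mult.assoc)+

lemma keys_scale: "ks (pscale c p) \<subseteq> ks p"
  by (auto simp: in_keys_iff)

lemma monoid_star_algebra_simps:
  "carrier (monoid_star_algebra M st) = {p. ks p \<subseteq> carrier M}"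
  "p \<otimes>\<^bsub>monoid_star_algebra M st\<^esub> q = mono_mult M p q"
  "\<one>\<^bsub>monoid_star_algebra M st\<^esub> = sg \<one>\<^bsub>M\<^esub> 1"
  "\<zero>\<^bsub>monoid_star_algebra M st\<^esub> = 0"
  "p \<oplus>\<^bsub>monoid_star_algebra M st\<^esub> q = p + q"
  "c \<odot>\<^bsub>monoid_star_algebra M st\<^esub> p = pscale c p"
  "adj\<^bsub>monoid_star_algebra M st\<^esub> p = mono_star st p"
  by (simp_all add: monoid_star_algebra_def mono_mult_def mono_star_def lin_ext_def)

theorem star_algebra_monoid_star_algebra:
  assumes M: "monoid M" and st: "\<And>x. x \<in> carrier M \<Longrightarrow> st x \<in> carrier M"
    "\<And>x. x \<in> carrier M \<Longrightarrow> st (st x) = x"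
    "\<And>x y. x \<in> carrier M \<Longrightarrow> y \<in> carrier M \<Longrightarrow> st (x \<otimes>\<^bsub>M\<^esub> y) = st y \<otimes>\<^bsub>M\<^esub> st x"
  shows "star_algebra (monoid_star_algebra M st)"
proof -
  interpret monoid M by (rule M)
  let ?K = "carrier M"
  let ?S = "monoid_star_algebra M st"
  have add_closed: "ks (p + q) \<subseteq> ?K" if "ks p \<subseteq> ?K" "ks q \<subseteq> ?K" for p q :: "'a \<Rightarrow>\<^sub>0 complex"
    using keys_add[of p q] that by blast
  have mult_closed: "ks (mono_mult M p q) \<subseteq> ?K" if "ks p \<subseteq> ?K" "ks q \<subseteq> ?K" for p q
    using that(1)
  proof (induction p rule: poly_induct)
    case (single x c)
    show ?case using that(2)
      by (induction q rule: poly_induct) (use single in \<open>simp_all add: mono_mult_simps add_closed\<close>)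
  qed (simp_all add: mono_mult_simps add_closed)
  have star_closed: "ks (mono_star st p) \<subseteq> ?K" if "ks p \<subseteq> ?K" for p
    using that by (induction p rule: poly_induct) (simp_all add: mono_star_simps add_closed st)
  have assoc: "mono_mult M (mono_mult M p q) r = mono_mult M p (mono_mult M q r)"
    if "ks p \<subseteq> ?K" "ks q \<subseteq> ?K" "ks r \<subseteq> ?K" for p q r
    using that(1)
  proof (induction p rule: poly_induct)
    case (single x c)
    note x = single
    show ?case using that(2)
    proof (induction q rule: poly_induct)
      case (single y d)
      note y = single
      show ?case using that(3)
        by (induction r rule: poly_induct) (simp_all add: mono_mult_simps x y m_assoc mult.assoc)
    qed (simp_all add: mono_mult_simps)
  qed (simp_all add: mono_mult_simps)
  have one: "mono_mult M (sg \<one>\<^bsub>M\<^esub> 1) p = p" "mono_mult M p (sg \<one>\<^bsub>M\<^esub> 1) = p" if "ks p \<subseteq> ?K" for p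
    using that by (induction p rule: poly_induct) (simp_all add: mono_mult_simps)
  have scl: "mono_mult M (pscale c p) q = pscale c (mono_mult M p q)"
     and scr: "mono_mult M p (pscale c q) = pscale c (mono_mult M p q)"
    if "ks p \<subseteq> ?K" "ks q \<subseteq> ?K" for p q c
  proof -
    have "mono_mult M (pscale c p) q = pscale c (mono_mult M p q) \<and> mono_mult M p (pscale c q) = pscale c (mono_mult M p q)"
      using that(1)
    proof (induction p rule: poly_induct)
      case (single x d)
      show ?case using that(2)
        by (induction q rule: poly_induct) (simp_all add: mono_mult_simps scale_simps mult.left_commute mult.assoc)
    qed (simp_all add: mono_mult_simps scale_simps)
    then show "mono_mult M (pscale c p) q = pscale c (mono_mult M p q)"
      "mono_mult M p (pscale c q) = pscale c (mono_mult M p q)" by auto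
  qed
  have star_star: "mono_star st (mono_star st p) = p" if "ks p \<subseteq> ?K" for p
    using that by (induction p rule: poly_induct) (simp_all add: mono_star_simps st)
  have star_scale: "mono_star st (pscale c p) = pscale (cnj c) (mono_star st p)" if "ks p \<subseteq> ?K" for p c
    using that by (induction p rule: poly_induct) (simp_all add: mono_star_simps scale_simps)
  have star_mult: "mono_star st (mono_mult M p q) = mono_mult M (mono_star st q) (mono_star st p)"
    if "ks p \<subseteq> ?K" "ks q \<subseteq> ?K" for p q
    using that(1)
  proof (induction p rule: poly_induct)
    case (single x d)
    note x = single
    show ?case using that(2)
      by (induction q rule: poly_induct) (simp_all add: mono_mult_simps mono_star_simps st x mult.commute)
  qed (simp_all add: mono_mult_simps mono_star_simps)
  have "ring ?S"
  proof (rule ringI)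
    show "abelian_group ?S"
      by (rule abelian_groupI)
        (auto simp: monoid_star_algebra_simps add_closed add_ac intro!: exI[of _ "- x" for x])
    show "monoid ?S"
      by (rule monoidI) (simp_all add: monoid_star_algebra_simps mult_closed assoc one)
  qed (simp_all add: monoid_star_algebra_simps mono_mult_simps)
  then show ?thesis
  proof (rule star_algebraI)
    show "c \<odot>\<^bsub>?S\<^esub> a \<in> carrier ?S" if "a \<in> carrier ?S" for c a
      using that keys_scale[of c a] by (auto simp: monoid_star_algebra_simps)
  qed (simp_all add: monoid_star_algebra_simps scale_simps scl scr star_closed star_star star_scale star_mult mono_star_simps)
qed

lemma star_algebra_minus_eq:
  assumes "star_algebra (monoid_star_algebra M st)" "ks p \<subseteq> carrier M" "ks q \<subseteq> carrier M"
  shows "p \<ominus>\<^bsub>monoid_star_algebra M st\<^esub> q = p - q"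
proof -
  interpret star_algebra "monoid_star_algebra M st" by (rule assms)
  have "\<ominus>\<^bsub>monoid_star_algebra M st\<^esub> q = pscale (- 1) q"
    using cs_minus_one[of q] assms by (simp add: monoid_star_algebra_simps)
  also have "\<dots> = - q" by (rule poly_mapping_eqI) simp
  finally show ?thesis by (simp add: rs(14) monoid_star_algebra_simps)
qed

lemma star_algebra_pre_tensor:
  assumes A: "star_algebra A" and B: "star_algebra B" shows "star_algebra (pre_tensor A B)"
proof -
  interpret A: star_algebra A by (rule A)
  interpret B: star_algebra B by (rule B)
  show ?thesis unfolding pre_tensor_def
    by (rule star_algebra_monoid_star_algebra)
       (auto simp: DirProd_monoid ring.is_monoid[OF A.is_ring] ring.is_monoid[OF B.is_ring]
         A.adj_closed B.adj_closed A.adj_adj B.adj_adj A.adj_mult B.adj_mult)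
qed

abbreviation free_monoid :: "'e letter list monoid" where
  "free_monoid \<equiv> \<lparr>carrier = UNIV, mult = (@), one = []\<rparr>"

lemma letter_adj_adj [simp]: "letter_adj (letter_adj l) = l"
  by (cases l) auto

lemma monoid_free: "monoid (free_monoid :: 'e letter list monoid)"
  by (rule monoidI) auto

lemma star_algebra_free: "star_algebra (free_star_algebra :: 'e star_poly star_algebra)"
  unfolding free_star_algebra_def
  by (rule star_algebra_monoid_star_algebra[OF monoid_free]) (auto simp: rev_map o_def)

lemma
  fixes p q :: "'e star_poly"
  shows free_simps: "p \<in> carrier free_star_algebra" "p \<oplus>\<^bsub>free_star_algebra\<^esub> q = p + q" "\<zero>\<^bsub>free_star_algebra\<^esub> = (0 :: 'e star_poly)"
    "\<one>\<^bsub>free_star_algebra\<^esub> = (monomial [] :: 'e star_poly)" "c \<odot>\<^bsub>free_star_algebra\<^esub> p = pscale c p"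
    "p \<ominus>\<^bsub>free_star_algebra\<^esub> q = p - q"
    "monomial v \<otimes>\<^bsub>free_star_algebra\<^esub> monomial w = (monomial (v @ w) :: 'e star_poly)"
    "adj\<^bsub>free_star_algebra\<^esub> (monomial w) = (monomial (rev (map letter_adj w)) :: 'e star_poly)"
    and free_ops: "p \<otimes>\<^bsub>free_star_algebra\<^esub> q = mono_mult free_monoid p q"
    "adj\<^bsub>free_star_algebra\<^esub> p = mono_star (\<lambda>w. rev (map letter_adj w)) p"
  using star_algebra_minus_eq[OF star_algebra_free[unfolded free_star_algebra_def], of p q]
  by (simp_all add: free_star_algebra_def monoid_star_algebra_simps monomial_def mono_mult_simps mono_star_simps)

text \<open>Evaluation of noncommutative polynomials in a C*-algebra.\<close>

primrec letter_val :: "('e \<Rightarrow> 'a::cstar) \<Rightarrow> 'e letter \<Rightarrow> 'a" where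
  "letter_val b (Gen e) = b e"
| "letter_val b (GenAdj e) = star (b e)"

primrec word_val :: "('e \<Rightarrow> 'a::cstar) \<Rightarrow> 'e letter list \<Rightarrow> 'a" where
  "word_val b [] = 1"
| "word_val b (l # w) = letter_val b l * word_val b w"

definition poly_val :: "('e \<Rightarrow> 'a::cstar) \<Rightarrow> 'e star_poly \<Rightarrow> 'a" where
  "poly_val b = lin_ext (\<lambda>w c. c *\<^sub>C word_val b w)"

lemma word_val_append: "word_val b (v @ w) = word_val b v * word_val b w"
  by (induction v) (auto simp: mult.assoc)

lemma letter_val_adj: "letter_val b (letter_adj l) = star (letter_val b l)"
  by (cases l) auto

lemma word_val_adj: "word_val b (rev (map letter_adj w)) = star (word_val b w)"
  by (induction w) (auto simp: word_val_append star_mult letter_val_adj)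

lemma poly_val_simps:
  "poly_val b (p + q) = poly_val b p + poly_val b q" "poly_val b (sg w c) = c *\<^sub>C word_val b w"
  "poly_val b 0 = 0" "poly_val b (monomial w) = word_val b w"
  unfolding poly_val_def monomial_def by (rule lin_ext_add) (simp_all add: cscale_add_left lin_ext_single)

lemma poly_val_minus: "poly_val b (p - q) = poly_val b p - poly_val b q"
  using poly_val_simps(1)[of b "p - q" q] by simp

lemma poly_val_sum: "poly_val b (sum f S) = (\<Sum>i\<in>S. poly_val b (f i))"
  by (induction S rule: infinite_finite_induct) (simp_all add: poly_val_simps)

lemma poly_val_mult: "poly_val b (mono_mult free_monoid p q) = poly_val b p * poly_val b q"
proof (induction p rule: poly_induct_UNIV)
  case (single v c)
  show ?case
    by (induction q rule: poly_induct_UNIV)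
       (simp_all add: mono_mult_simps poly_val_simps word_val_append distrib_left mult.commute)
qed (simp_all add: mono_mult_simps poly_val_simps distrib_right)

lemma poly_val_star: "poly_val b (mono_star (\<lambda>w. rev (map letter_adj w)) p) = star (poly_val b p)"
  by (induction p rule: poly_induct_UNIV)
     (simp_all add: mono_star_simps poly_val_simps word_val_adj star_add star_cscale)

lemma poly_val_scale: "poly_val b (pscale c p) = c *\<^sub>C poly_val b p"
  by (induction p rule: poly_induct_UNIV) (simp_all add: scale_simps poly_val_simps cscale_add_right)

definition free_eval :: "'a cstar_algebra \<Rightarrow> ('e \<Rightarrow> 'a) \<Rightarrow> 'e star_poly \<Rightarrow> 'a" where
  "free_eval B b p = ev B (poly_val (\<lambda>e. sec B (b e)) p)"

lemma free_eval_star_hom: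
  assumes B: "cstar_algebra B" shows "free_eval B b \<in> star_hom free_star_algebra B"
  unfolding star_hom_def ring_hom_def free_eval_def using B
  by (simp add: free_simps(1-6) free_ops poly_val_simps poly_val_mult poly_val_star poly_val_scale)

lemma star_hom_pullback_seminorm:
  fixes B :: "'b cstar_algebra"
  assumes A: "star_algebra A" and B: "cstar_algebra B" and h: "h \<in> star_hom A B"
  shows "cstar_seminorm A (\<lambda>a. \<parallel>h a\<parallel>\<^bsub>B\<^esub>)"
  unfolding cstar_seminorm_def
  using star_homD[OF h] seminorm_ge_0[OF cstar_sn[OF B]] seminorm_add[OF cstar_sn[OF B]]
    seminorm_mult[OF cstar_sn[OF B]] seminorm_smult[OF cstar_sn[OF B]] seminorm_adj_mult[OF cstar_sn[OF B]]
    star_algebra.adj_closed[OF A]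
  by simp

subsection \<open>The universal property\<close>

definition vanishing_seminorms :: "'e star_poly set \<Rightarrow> ('e star_poly \<Rightarrow> real) set" where
  "vanishing_seminorms R = {p. cstar_seminorm free_star_algebra p \<and> (\<forall>r\<in>R. p r = 0)}"

text \<open>Any bound would do for the universal C*-algebra to exist; relations which make the generators
contractions suffice here.\<close>

definition bounded_relations :: "'e star_poly set \<Rightarrow> bool" where
  "bounded_relations R \<longleftrightarrow> (\<forall>p\<in>vanishing_seminorms R. \<forall>e. p (monomial [Gen e]) \<le> 1)"

lemma universal_seminorm_SUP: "universal_seminorm R a = (SUP p\<in>vanishing_seminorms R. p a)"
  unfolding universal_seminorm_def vanishing_seminorms_def by (rule arg_cong[where f=Sup]) auto

lemma bounded_relations_word:
  assumes "bounded_relations R" "p \<in> vanishing_seminorms R"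
  shows "p (monomial w) \<le> 1"
proof (induction w)
  have p: "cstar_seminorm free_star_algebra p" using assms(2) by (simp add: vanishing_seminorms_def)
  {
    case Nil
    show ?case using seminorm_one[OF star_algebra_free p] by (simp add: free_simps)
  next
    case (Cons l w)
    have "p (monomial [l]) \<le> 1"
    proof (cases l)
      case (GenAdj e)
      then show ?thesis using seminorm_adj[OF star_algebra_free p free_simps(1), of "monomial [Gen e]"] assms
        by (simp add: free_simps bounded_relations_def)
    qed (use assms in \<open>simp add: bounded_relations_def\<close>)
    moreover have "p (monomial (l # w)) \<le> p (monomial [l]) * p (monomial w)"
      using seminorm_mult[OF p free_simps(1) free_simps(1), of "monomial [l]" "monomial w"]
      by (simp add: free_simps)
    moreover have "p (monomial [l]) * p (monomial w) \<le> 1 * 1"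
      using Cons calculation(1) by (intro mult_mono seminorm_ge_0[OF p free_simps(1)]) auto
    ultimately show ?case by simp
  }
qed

lemma bounded_relations_bound:
  assumes "bounded_relations R" "p \<in> vanishing_seminorms R"
  shows "p a \<le> (\<Sum>w\<in>ks a. cmod (lk a w))"
proof -
  have p: "cstar_seminorm free_star_algebra p" using assms(2) by (simp add: vanishing_seminorms_def)
  have "p (\<Sum>w\<in>F. sg w (lk a w)) \<le> (\<Sum>w\<in>F. cmod (lk a w))" if "finite F" for F
    using that
  proof (induction F rule: finite_induct)
    case empty
    show ?case using seminorm_zero[OF star_algebra_free p] by (simp add: free_simps)
  next
    case (insert w F)
    have "sg w (lk a w) = lk a w \<odot>\<^bsub>free_star_algebra\<^esub> monomial w" by (simp add: free_simps monomial_def scale_simps)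
    then have "p (sg w (lk a w)) = cmod (lk a w) * p (monomial w)"
      by (simp add: seminorm_smult[OF p free_simps(1)])
    also have "\<dots> \<le> cmod (lk a w)" using bounded_relations_word[OF assms, of w] by (simp add: mult_left_le)
    finally show ?case
      using insert seminorm_add[OF p free_simps(1) free_simps(1), of "sg w (lk a w)" "\<Sum>w\<in>F. sg w (lk a w)"]
      by (simp add: free_simps)
  qed
  from this[of "ks a"] show ?thesis by (simp add: sum_singles)
qed

context
  fixes R :: "'e star_poly set"
  assumes R: "bounded_relations R"
begin

lemma zero_vanishing: "(\<lambda>_. 0) \<in> vanishing_seminorms R"
  by (simp add: vanishing_seminorms_def cstar_seminorm_def)

lemma bdd_vanishing: "bdd_above ((\<lambda>p. p a) ` vanishing_seminorms R)"
  by (rule bdd_aboveI2[where M="\<Sum>w\<in>ks a. cmod (lk a w)"]) (rule bounded_relations_bound[OF R])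

lemma cstar_seminorm_universal: "cstar_seminorm free_star_algebra (universal_seminorm R)"
  unfolding universal_seminorm_SUP[abs_def]
  by (rule cstar_seminorm_SUP[OF star_algebra_free])
     (use zero_vanishing bdd_vanishing in \<open>auto simp: vanishing_seminorms_def\<close>)

lemma completing_universal: "completing free_star_algebra (universal_seminorm R)"
  by (rule completingI[OF star_algebra_free cstar_seminorm_universal])

lemma cstar_algebra_universal: "cstar_algebra (universal_cstar R)"
  unfolding universal_cstar_def by (rule completing.cstar_algebra_C[OF completing_universal])

definition uemb :: "'e star_poly \<Rightarrow> 'e universal_elem" where
  "uemb = completion_embed free_star_algebra (universal_seminorm R)"

lemma uemb_star_hom: "uemb \<in> star_hom free_star_algebra (universal_cstar R)"
  unfolding universal_cstar_def uemb_def by (rule completing.emb_star_hom[OF completing_universal])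

lemma uemb_relation: assumes r: "p - q \<in> R" shows "uemb p = uemb q"
proof -
  have "universal_seminorm R (p - q) = 0"
  proof -
    have "(\<lambda>p'. p' (p - q)) ` vanishing_seminorms R = {0}"
      using r zero_vanishing by (auto simp: vanishing_seminorms_def)
    then show ?thesis by (simp add: universal_seminorm_SUP)
  qed
  then show ?thesis unfolding uemb_def
    by (subst completing.emb_eq_iff[OF completing_universal]) (simp_all add: free_simps)
qed

lemma uemb_gen: "uemb (monomial [Gen e]) = universal_gen R e"
  by (simp add: uemb_def universal_gen_def)

text \<open>The pull-back of the norm of \<open>B\<close> is one of the seminorms of which the universal seminorm is the
supremum.\<close>

theorem universal_property:
  fixes B :: "'b cstar_algebra"
  assumes B: "cstar_algebra B" and b: "\<And>e. b e \<in> carrier B" and rel: "\<And>r. r \<in> R \<Longrightarrow> free_eval B b r = \<zero>\<^bsub>B\<^esub>"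
  shows "\<exists>H\<in>star_hom (universal_cstar R) B. (\<forall>e. H (universal_gen R e) = b e) \<and> (\<forall>p. H (uemb p) = free_eval B b p)"
proof -
  have "(\<lambda>a. \<parallel>free_eval B b a\<parallel>\<^bsub>B\<^esub>) \<in> vanishing_seminorms R"
    using star_hom_pullback_seminorm[OF star_algebra_free B free_eval_star_hom[OF B]] rel
    by (simp add: vanishing_seminorms_def B)
  then have le: "\<parallel>free_eval B b a\<parallel>\<^bsub>B\<^esub> \<le> universal_seminorm R a" for a
    unfolding universal_seminorm_SUP using cSUP_upper[OF _ bdd_vanishing] by fastforce
  obtain H where H: "H \<in> star_hom (universal_cstar R) B" "\<And>p. H (uemb p) = free_eval B b p"
    using completing.extend_star_hom[OF completing_universal B free_eval_star_hom[OF B], of b] le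
    unfolding universal_cstar_def uemb_def by (auto simp: free_simps)
  moreover have "H (universal_gen R e) = b e" for e
    unfolding uemb_gen[symmetric] H(2) by (simp add: free_eval_def poly_val_simps B b)
  ultimately show ?thesis by blast
qed

end

text \<open>In a C*-algebra each summand of a sum of squares equal to one is a contraction.\<close>

lemma generator_bound:
  fixes e :: "'k::finite \<Rightarrow> 'e"
  assumes p: "p \<in> vanishing_seminorms R"
    and sa: "\<And>k. monomial [Gen (e k)] - monomial [GenAdj (e k)] \<in> R"
    and sq: "(\<Sum>k\<in>UNIV. monomial [Gen (e k), Gen (e k)]) - monomial [] \<in> R"
  shows "p (monomial [Gen (e k)]) \<le> 1"
proof -
  have sn: "cstar_seminorm free_star_algebra p" and van: "\<And>r. r \<in> R \<Longrightarrow> p r = 0"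
    using p by (auto simp: vanishing_seminorms_def)
  interpret completing free_star_algebra p by (rule completingI[OF star_algebra_free sn])
  note CA = cstar_algebra_C and eh = star_homD[OF emb_star_hom free_simps(1)]
  have rel: "emb a = emb b" if "a - b \<in> R" for a b
    using van[OF that] by (subst emb_eq_iff) (simp_all add: free_simps)
  let ?x = "\<lambda>k. emb (monomial [Gen (e k)])"
  have xc: "?x k \<in> carrier C" for k by (rule emb_closed) (simp add: free_simps)
  have sq': "star (sec C (?x k)) * sec C (?x k) = sec C (emb (monomial [Gen (e k), Gen (e k)]))" for k
  proof -
    have "adj\<^bsub>C\<^esub> (?x k) = ?x k"
      using eh(6)[of "monomial [Gen (e k)]"] rel[OF sa, of k] by (simp add: free_simps)
    then have "star (sec C (?x k)) * sec C (?x k) = sec C (?x k \<otimes>\<^bsub>C\<^esub> ?x k)"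
      by (simp add: sec_simps[OF CA xc] xc flip: sec_simps(4)[OF CA xc])
    also have "?x k \<otimes>\<^bsub>C\<^esub> ?x k = emb (monomial [Gen (e k), Gen (e k)])"
      using eh(2)[of "monomial [Gen (e k)]" "monomial [Gen (e k)]"] by (simp add: free_simps)
    finally show ?thesis .
  qed
  have sum': "sec C (emb (sum f S)) = (\<Sum>k\<in>S. sec C (emb (f k)))" if "finite S" for S and f :: "'k \<Rightarrow> 'e star_poly"
    using that
  proof (induction S rule: finite_induct)
    case empty
    then show ?case
      using star_hom_minus(2)[OF star_alg star_algebra_C emb_star_hom free_simps(1) free_simps(1)] sec_simps(5)[OF CA xc]
      by (simp add: free_simps)
  next
    case (insert k S)
    then show ?case using eh(3)[of "sum f S" "f k"] eh(1)
      by (simp add: free_simps) (metis add.commute eh(3) free_simps(1,2) sec_simps(1)[OF CA])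
  qed
  have "(\<Sum>k\<in>UNIV. star (sec C (?x k)) * sec C (?x k)) = sec C (emb (\<Sum>k\<in>UNIV. monomial [Gen (e k), Gen (e k)]))"
    by (simp only: sq' sum'[OF finite])
  also have "\<dots> = sec C \<one>\<^bsub>C\<^esub>" unfolding rel[OF sq] using eh(4) by (simp add: free_simps)
  finally have "(\<Sum>k\<in>UNIV. star (sec C (?x k)) * sec C (?x k)) = sec C \<one>\<^bsub>C\<^esub>" .
  then have "\<parallel>?x k\<parallel>\<^bsub>C\<^esub> \<le> 1"
    using norm_le_one_of_sum_squares[OF CA finite[of UNIV] xc, of "\<lambda>k. k" k] by simp
  then show ?thesis using norm_emb[OF free_simps(1)] by simp
qed

section \<open>Operators on square-summable functions\<close>

abbreviation l2 :: "('i \<Rightarrow> complex) \<Rightarrow> 'i set \<Rightarrow> real" where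
  "l2 f F \<equiv> L2_set (\<lambda>i. cmod (f i)) F"

lemma ell2_iff_bounded: "f \<in> ell2 \<longleftrightarrow> (\<exists>C. \<forall>F. finite F \<longrightarrow> l2 f F \<le> C)"
proof
  assume f: "f \<in> ell2"
  have "l2 f F \<le> ell2_norm f" if "finite F" for F
    unfolding L2_set_def ell2_norm_def
    by (intro real_sqrt_le_mono finite_sum_le_infsum) (use f that in \<open>auto simp: ell2_def\<close>)
  then show "\<exists>C. \<forall>F. finite F \<longrightarrow> l2 f F \<le> C" by blast
next
  assume "\<exists>C. \<forall>F. finite F \<longrightarrow> l2 f F \<le> C"
  then obtain C where C: "\<And>F. finite F \<Longrightarrow> l2 f F \<le> C" by blast
  have "(\<Sum>i\<in>F. (cmod (f i))\<^sup>2) \<le> C\<^sup>2" if "finite F" for F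
    using power_mono[OF C[OF that], of 2] by (simp add: L2_set_def sum_nonneg)
  then show "f \<in> ell2" unfolding ell2_def
    by (intro CollectI nonneg_bdd_above_summable_on bdd_aboveI[where M="C\<^sup>2"]) auto
qed

lemma l2_le_norm: "f \<in> ell2 \<Longrightarrow> finite F \<Longrightarrow> l2 f F \<le> ell2_norm f"
  unfolding L2_set_def ell2_norm_def
  by (intro real_sqrt_le_mono finite_sum_le_infsum) (auto simp: ell2_def)

lemma ell2_norm_ge_0 [simp]: "0 \<le> ell2_norm f"
  unfolding ell2_norm_def by (intro real_sqrt_ge_zero infsum_nonneg) auto

lemma ell2_norm_squared: "(ell2_norm f)\<^sup>2 = (\<Sum>\<^sub>\<infinity>i. (cmod (f i))\<^sup>2)"
  unfolding ell2_norm_def by (intro real_sqrt_pow2 infsum_nonneg) auto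

lemma ell2_normI:
  assumes "\<And>F. finite F \<Longrightarrow> l2 f F \<le> C" shows "f \<in> ell2" "ell2_norm f \<le> C"
proof -
  show f: "f \<in> ell2" using assms ell2_iff_bounded by blast
  have C: "C \<ge> 0" using assms[of "{}"] by simp
  have "(\<Sum>i\<in>F. (cmod (f i))\<^sup>2) \<le> C\<^sup>2" if "finite F" for F
    using power_mono[OF assms[OF that], of 2] by (simp add: L2_set_def sum_nonneg)
  then have "(\<Sum>\<^sub>\<infinity>i. (cmod (f i))\<^sup>2) \<le> C\<^sup>2"
    using f by (intro infsum_le_finite_sums) (auto simp: ell2_def)
  then show "ell2_norm f \<le> C" unfolding ell2_norm_def using C real_sqrt_le_mono by fastforce
qed

lemma ell2_zero [simp]: "(\<lambda>i. 0) \<in> ell2"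
  by (rule ell2_normI[where C=0]) (simp add: L2_set_def)

lemma ell2_add:
  assumes "f \<in> ell2" "g \<in> ell2"
  shows "(\<lambda>i. f i + g i) \<in> ell2" "ell2_norm (\<lambda>i. f i + g i) \<le> ell2_norm f + ell2_norm g"
proof -
  have *: "l2 (\<lambda>i. f i + g i) F \<le> ell2_norm f + ell2_norm g" if "finite F" for F
  proof -
    have "l2 (\<lambda>i. f i + g i) F \<le> L2_set (\<lambda>i. cmod (f i) + cmod (g i)) F"
      by (intro L2_set_mono) (auto simp: norm_triangle_ineq)
    also have "\<dots> \<le> l2 f F + l2 g F" by (rule L2_set_triangle_ineq)
    also have "\<dots> \<le> ell2_norm f + ell2_norm g" using assms that by (intro add_mono l2_le_norm)
    finally show ?thesis .
  qed
  show "(\<lambda>i. f i + g i) \<in> ell2" "ell2_norm (\<lambda>i. f i + g i) \<le> ell2_norm f + ell2_norm g"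
    using ell2_normI[OF *] by auto
qed

lemma ell2_scale:
  assumes f: "f \<in> ell2"
  shows "(\<lambda>i. c * f i) \<in> ell2" "ell2_norm (\<lambda>i. c * f i) = cmod c * ell2_norm f"
proof -
  show "(\<lambda>i. c * f i) \<in> ell2"
    using summable_on_cmult_right[of "\<lambda>i. (cmod (f i))\<^sup>2" UNIV "(cmod c)\<^sup>2"] f
    by (simp add: ell2_def norm_mult power_mult_distrib)
  have "(ell2_norm (\<lambda>i. c * f i))\<^sup>2 = (cmod c * ell2_norm f)\<^sup>2"
    unfolding power_mult_distrib ell2_norm_squared by (simp add: norm_mult power_mult_distrib infsum_cmult_right')
  then show "ell2_norm (\<lambda>i. c * f i) = cmod c * ell2_norm f" by (simp add: power2_eq_iff_nonneg)
qed

lemma ell2_inner_summable: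
  assumes "f \<in> ell2" "g \<in> ell2"
  shows "(\<lambda>i. cnj (f i) * g i) abs_summable_on UNIV"
    and "cmod (ell2_inner f g) \<le> ell2_norm f * ell2_norm g"
proof -
  have *: "(\<Sum>i\<in>F. norm (cnj (f i) * g i)) \<le> ell2_norm f * ell2_norm g" if "finite F" for F
  proof -
    have "(\<Sum>i\<in>F. norm (cnj (f i) * g i)) \<le> l2 f F * l2 g F"
      using L2_set_mult_ineq[of "\<lambda>i. cmod (f i)" "\<lambda>i. cmod (g i)" F] by (simp add: norm_mult)
    also have "\<dots> \<le> ell2_norm f * ell2_norm g" using assms that by (intro mult_mono l2_le_norm) auto
    finally show ?thesis .
  qed
  show s: "(\<lambda>i. cnj (f i) * g i) abs_summable_on UNIV"
    by (intro nonneg_bdd_above_summable_on bdd_aboveI[where M="ell2_norm f * ell2_norm g"]) (use * in auto)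
  have "cmod (ell2_inner f g) \<le> (\<Sum>\<^sub>\<infinity>i. norm (cnj (f i) * g i))"
    unfolding ell2_inner_def by (rule norm_infsum_bound[OF s])
  also have "\<dots> \<le> ell2_norm f * ell2_norm g" by (rule infsum_le_finite_sums[OF s]) (use * in auto)
  finally show "cmod (ell2_inner f g) \<le> ell2_norm f * ell2_norm g" .
qed

lemmas ell2_inner_summable' = abs_summable_summable[OF ell2_inner_summable(1)]

lemma ell2_inner_simps:
  assumes "f \<in> ell2" "g \<in> ell2"
  shows "h \<in> ell2 \<Longrightarrow> ell2_inner (\<lambda>i. f i + h i) g = ell2_inner f g + ell2_inner h g"
    "h \<in> ell2 \<Longrightarrow> ell2_inner f (\<lambda>i. g i + h i) = ell2_inner f g + ell2_inner f h"
    "ell2_inner (\<lambda>i. c * f i) g = cnj c * ell2_inner f g"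
    "ell2_inner f (\<lambda>i. c * g i) = c * ell2_inner f g"
proof -
  show "h \<in> ell2 \<Longrightarrow> ell2_inner (\<lambda>i. f i + h i) g = ell2_inner f g + ell2_inner h g"
    unfolding ell2_inner_def using assms
    by (simp add: distrib_right infsum_add ell2_inner_summable')
  show "h \<in> ell2 \<Longrightarrow> ell2_inner f (\<lambda>i. g i + h i) = ell2_inner f g + ell2_inner f h"
    unfolding ell2_inner_def using assms
    by (simp add: distrib_left infsum_add ell2_inner_summable')
  show "ell2_inner (\<lambda>i. c * f i) g = cnj c * ell2_inner f g"
    unfolding ell2_inner_def by (simp add: mult.assoc infsum_cmult_right')
  show "ell2_inner f (\<lambda>i. c * g i) = c * ell2_inner f g"
    unfolding ell2_inner_def by (simp add: mult.left_commute infsum_cmult_right')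
qed

lemma ell2_inner_zero [simp]: "ell2_inner (\<lambda>i. 0) g = 0" "ell2_inner f (\<lambda>i. 0) = 0"
  by (simp_all add: ell2_inner_def)

lemma ell2_inner_cnj: "cnj (ell2_inner f g) = ell2_inner g f"
  unfolding ell2_inner_def by (simp flip: infsum_cnj add: mult.commute)

lemma ell2_inner_self: assumes "f \<in> ell2" shows "ell2_inner f f = complex_of_real ((ell2_norm f)\<^sup>2)"
proof -
  have "cnj (f i) * f i = complex_of_real ((cmod (f i))\<^sup>2)" for i
    using complex_norm_square[of "f i"] by (simp add: mult.commute)
  moreover have "(\<Sum>\<^sub>\<infinity>i. complex_of_real ((cmod (f i))\<^sup>2)) = complex_of_real (\<Sum>\<^sub>\<infinity>i. (cmod (f i))\<^sup>2)"
    using infsum_comm_additive[of complex_of_real "\<lambda>i. (cmod (f i))\<^sup>2" UNIV] assms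
      bounded_linear.isCont[OF bounded_linear_of_real continuous_ident]
    by (simp add: ell2_def o_def additive_def)
  ultimately show ?thesis unfolding ell2_inner_def ell2_norm_squared by simp
qed

definition delta :: "'i \<Rightarrow> 'i \<Rightarrow> complex" where
  "delta i j = (if j = i then 1 else 0)"

lemma delta_ell2 [simp]: "delta i \<in> ell2"
proof (rule ell2_normI[where C=1])
  fix F :: "'a set" assume "finite F"
  then have "(\<Sum>j\<in>F. (cmod (delta i j))\<^sup>2) = (\<Sum>j\<in>F. if j = i then 1 else 0)"
    by (intro sum.cong) (auto simp: delta_def)
  also have "\<dots> \<le> 1" using \<open>finite F\<close> by simp
  finally show "l2 (delta i) F \<le> 1" by (simp add: L2_set_def)
qed

lemma ell2_inner_delta: "ell2_inner (delta i) g = g i"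
proof -
  have "ell2_inner (delta i) g = (\<Sum>\<^sub>\<infinity>j\<in>{i}. g j)"
    unfolding ell2_inner_def by (rule infsum_cong_neutral) (auto simp: delta_def)
  then show ?thesis by simp
qed

subsection \<open>Bounded operators\<close>

lemma bounded_operatorD:
  assumes "bounded_operator T"
  shows "f \<in> ell2 \<Longrightarrow> T f \<in> ell2" "f \<in> ell2 \<Longrightarrow> g \<in> ell2 \<Longrightarrow> T (\<lambda>i. f i + g i) = (\<lambda>i. T f i + T g i)"
    "f \<in> ell2 \<Longrightarrow> T (\<lambda>i. c * f i) = (\<lambda>i. c * T f i)"
  using assms by (auto simp: bounded_operator_def)

lemma bounded_operatorI:
  assumes "\<And>f. f \<in> ell2 \<Longrightarrow> T f \<in> ell2" "\<And>f g. f \<in> ell2 \<Longrightarrow> g \<in> ell2 \<Longrightarrow> T (\<lambda>i. f i + g i) = (\<lambda>i. T f i + T g i)"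
    "\<And>c f. f \<in> ell2 \<Longrightarrow> T (\<lambda>i. c * f i) = (\<lambda>i. c * T f i)" "\<And>f. f \<in> ell2 \<Longrightarrow> ell2_norm (T f) \<le> C * ell2_norm f"
  shows "bounded_operator T"
  using assms unfolding bounded_operator_def by blast

lemma operator_norm:
  assumes T: "bounded_operator T"
  shows "f \<in> ell2 \<Longrightarrow> ell2_norm (T f) \<le> operator_norm T * ell2_norm f" "0 \<le> operator_norm T"
proof -
  let ?S = "{ell2_norm (T f) | f. f \<in> ell2 \<and> ell2_norm f \<le> 1}"
  obtain C where C: "\<And>f. f \<in> ell2 \<Longrightarrow> ell2_norm (T f) \<le> C * ell2_norm f"
    using T unfolding bounded_operator_def by blast
  have "ell2_norm (T f) \<le> \<bar>C\<bar>" if "f \<in> ell2" "ell2_norm f \<le> 1" for f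
  proof -
    have "C * ell2_norm f \<le> \<bar>C\<bar> * 1" using that by (intro mult_mono) auto
    then show ?thesis using C[OF that(1)] by simp
  qed
  then have bdd: "bdd_above ?S" by (auto intro!: bdd_aboveI[where M="\<bar>C\<bar>"])
  have up: "ell2_norm (T f) \<le> operator_norm T" if "f \<in> ell2" "ell2_norm f \<le> 1" for f
    unfolding operator_norm_def by (rule cSup_upper[OF _ bdd]) (use that in auto)
  have nz: "ell2_norm (\<lambda>i. 0) = 0" by (simp add: ell2_norm_def)
  show ge: "0 \<le> operator_norm T" 
    by (rule order_trans[OF ell2_norm_ge_0 up[OF ell2_zero]]) (simp add: nz)
  show "ell2_norm (T f) \<le> operator_norm T * ell2_norm f" if f: "f \<in> ell2"
  proof (cases "ell2_norm f = 0")
    case True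
    then show ?thesis using C[OF f] by simp
  next
    case False
    define c where "c = complex_of_real (1 / ell2_norm f)"
    have c: "cmod c * ell2_norm f = 1" using False by (simp add: c_def norm_divide)
    have "ell2_norm (T (\<lambda>i. c * f i)) \<le> operator_norm T"
      by (rule up) (use ell2_scale[OF f] c in auto)
    then have "cmod c * ell2_norm (T f) \<le> operator_norm T"
      using bounded_operatorD[OF T] f ell2_scale by metis
    then have "cmod c * ell2_norm (T f) * ell2_norm f \<le> operator_norm T * ell2_norm f"
      by (rule mult_right_mono) simp
    moreover have "cmod c * ell2_norm (T f) * ell2_norm f = (cmod c * ell2_norm f) * ell2_norm (T f)" by simp
    ultimately show ?thesis unfolding c by simp
  qed
qed

lemma operator_norm_least:
  assumes "C \<ge> 0" "\<And>f. f \<in> ell2 \<Longrightarrow> ell2_norm (T f) \<le> C * ell2_norm f"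
  shows "operator_norm T \<le> C"
  unfolding operator_norm_def
proof (rule cSup_least)
  have nz: "ell2_norm (\<lambda>i. 0) = 0" by (simp add: ell2_norm_def)
  show "{ell2_norm (T f) |f. f \<in> ell2 \<and> ell2_norm f \<le> 1} \<noteq> {}" using nz ell2_zero by (metis (mono_tags, lifting) empty_Collect_eq zero_le_one)
  fix x assume "x \<in> {ell2_norm (T f) |f. f \<in> ell2 \<and> ell2_norm f \<le> 1}"
  then obtain f where f: "x = ell2_norm (T f)" "f \<in> ell2" "ell2_norm f \<le> 1" by blast
  have "C * ell2_norm f \<le> C * 1" using f assms(1) by (intro mult_left_mono)
  then show "x \<le> C" using f assms(2)[OF f(2)] by simp
qed

lemma bounded_operator_zero: "bounded_operator (\<lambda>f i. 0)"
  by (rule bounded_operatorI[where C=0]) (auto simp: ell2_norm_def)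

lemma bounded_operator_add:
  assumes T: "bounded_operator T" and S: "bounded_operator S"
  shows "bounded_operator (\<lambda>f i. T f i + S f i)"
proof (rule bounded_operatorI[where C="operator_norm T + operator_norm S"])
  note D = bounded_operatorD[OF T] bounded_operatorD[OF S]
  show "(\<lambda>i. T f i + S f i) \<in> ell2" if "f \<in> ell2" for f using that by (intro ell2_add D)
  show "ell2_norm (\<lambda>i. T f i + S f i) \<le> (operator_norm T + operator_norm S) * ell2_norm f" if "f \<in> ell2" for f
    using ell2_add(2)[OF D(1)[OF that] D(4)[OF that]] operator_norm(1)[OF T that] operator_norm(1)[OF S that]
    by (simp add: distrib_right)
qed (use bounded_operatorD[OF T] bounded_operatorD[OF S] in \<open>auto simp: algebra_simps\<close>)

lemma bounded_operator_scale:
  assumes T: "bounded_operator T" shows "bounded_operator (\<lambda>f i. c * T f i)"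
proof (rule bounded_operatorI[where C="cmod c * operator_norm T"])
  note D = bounded_operatorD[OF T]
  show "(\<lambda>i. c * T f i) \<in> ell2" if "f \<in> ell2" for f using that by (intro ell2_scale D)
  show "ell2_norm (\<lambda>i. c * T f i) \<le> (cmod c * operator_norm T) * ell2_norm f" if "f \<in> ell2" for f
    using operator_norm(1)[OF T that] by (simp add: ell2_scale[OF D(1)[OF that]] mult.assoc mult_left_mono)
qed (use bounded_operatorD[OF T] in \<open>auto simp: algebra_simps\<close>)

lemma bounded_operator_comp:
  assumes T: "bounded_operator T" and S: "bounded_operator S"
  shows "bounded_operator (\<lambda>f. T (S f))" "f \<in> ell2 \<Longrightarrow> ell2_norm (T (S f)) \<le> operator_norm T * operator_norm S * ell2_norm f"
proof -
  note D = bounded_operatorD[OF T] bounded_operatorD[OF S]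
  show n: "ell2_norm (T (S f)) \<le> operator_norm T * operator_norm S * ell2_norm f" if f: "f \<in> ell2" for f
  proof -
    have "ell2_norm (T (S f)) \<le> operator_norm T * ell2_norm (S f)" using f by (intro operator_norm(1)[OF T] D)
    also have "\<dots> \<le> operator_norm T * (operator_norm S * ell2_norm f)"
      by (intro mult_left_mono operator_norm S f T)
    finally show ?thesis by (simp add: mult.assoc)
  qed
  show "bounded_operator (\<lambda>f. T (S f))"
    by (rule bounded_operatorI[where C="operator_norm T * operator_norm S"]) (use n D in simp_all)
qed

definition adjoint_pair :: "'i operator \<Rightarrow> 'i operator \<Rightarrow> bool" where
  "adjoint_pair T S \<longleftrightarrow> bounded_operator T \<and> bounded_operator S \<and>
     (\<forall>f\<in>ell2. \<forall>g\<in>ell2. ell2_inner (S f) g = ell2_inner f (T g))"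

lemma adjoint_pair_sym: assumes "adjoint_pair T S" shows "adjoint_pair S T"
proof -
  have "ell2_inner (T f) g = ell2_inner f (S g)" if "f \<in> ell2" "g \<in> ell2" for f g
    using assms that unfolding adjoint_pair_def by (metis ell2_inner_cnj)
  then show ?thesis using assms by (simp add: adjoint_pair_def)
qed

lemma adjoint_pair_comp:
  "adjoint_pair T T' \<Longrightarrow> adjoint_pair S S' \<Longrightarrow> adjoint_pair (\<lambda>f. T (S f)) (\<lambda>f. S' (T' f))"
  by (simp add: adjoint_pair_def bounded_operator_comp bounded_operatorD)

subsection \<open>Amplification and tensor products of operators\<close>

text \<open>The operators \<open>1 \<otimes> S\<close> and \<open>T \<otimes> 1\<close>; the second one is \<open>1 \<otimes> T\<close> conjugated by the interchange of the
variables, so that all estimates need only be made once.\<close>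

definition ampl :: "'j operator \<Rightarrow> ('i \<times> 'j) operator" where
  "ampl S h = (\<lambda>(i, j). S (\<lambda>j'. h (i, j')) j)"

definition flip :: "('i \<times> 'j \<Rightarrow> complex) \<Rightarrow> ('j \<times> 'i \<Rightarrow> complex)" where
  "flip h = (\<lambda>(j, i). h (i, j))"

lemma row_ell2: assumes h: "h \<in> ell2" shows "(\<lambda>j. h (i, j)) \<in> ell2"
proof (rule ell2_normI)
  fix F :: "'b set" assume F: "finite F"
  have "l2 (\<lambda>j. h (i, j)) F = l2 h (Pair i ` F)"
    unfolding L2_set_def by (simp add: sum.reindex inj_on_def)
  also have "\<dots> \<le> ell2_norm h" using F h by (intro l2_le_norm) auto
  finally show "l2 (\<lambda>j. h (i, j)) F \<le> ell2_norm h" .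
qed

lemma row_norms: assumes h: "h \<in> ell2" and F: "finite F"
  shows "(\<Sum>i\<in>F. (ell2_norm (\<lambda>j. h (i, j)))\<^sup>2) \<le> (ell2_norm h)\<^sup>2"
proof -
  have s: "(\<lambda>x. (cmod (h x))\<^sup>2) summable_on UNIV" using h by (simp add: ell2_def)
  have sF: "(\<lambda>x. (cmod (h x))\<^sup>2) summable_on (F \<times> UNIV)" by (rule summable_on_subset_banach[OF s]) simp
  have "(\<Sum>i\<in>F. (ell2_norm (\<lambda>j. h (i, j)))\<^sup>2) = (\<Sum>\<^sub>\<infinity>i\<in>F. \<Sum>\<^sub>\<infinity>j. (cmod (h (i, j)))\<^sup>2)"
    using F by (simp add: ell2_norm_squared)
  also have "\<dots> = (\<Sum>\<^sub>\<infinity>x\<in>F \<times> UNIV. (cmod (h x))\<^sup>2)" using infsum_Sigma_banach[OF sF] by simp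
  also have "\<dots> \<le> (\<Sum>\<^sub>\<infinity>x. (cmod (h x))\<^sup>2)" by (rule infsum_mono2[OF sF s]) auto
  finally show ?thesis by (simp add: ell2_norm_squared)
qed

text \<open>Fubini for the square-summable functions of two variables.\<close>

lemma ell2_inner_rows:
  assumes "f \<in> ell2" "g \<in> ell2"
  shows "ell2_inner f g = (\<Sum>\<^sub>\<infinity>i. ell2_inner (\<lambda>j. f (i, j)) (\<lambda>j. g (i, j)))"
proof -
  have "(\<lambda>x. cnj (f x) * g x) summable_on (Sigma UNIV (\<lambda>_. UNIV))"
    using ell2_inner_summable'[OF assms] by simp
  from infsum_Sigma_banach[OF this] show ?thesis by (simp add: ell2_inner_def)
qed

lemma ampl_bounded:
  assumes S: "bounded_operator S"
  shows "bounded_operator (ampl S :: ('i \<times> 'j) operator)" "operator_norm (ampl S :: ('i \<times> 'j) operator) \<le> operator_norm S"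
proof -
  note D = bounded_operatorD[OF S]
  have *: "ampl S h \<in> ell2 \<and> ell2_norm (ampl S h) \<le> operator_norm S * ell2_norm h"
    if h: "h \<in> ell2" for h :: "'i \<times> 'j \<Rightarrow> complex"
  proof -
    have "l2 (ampl S h) F \<le> operator_norm S * ell2_norm h" if F: "finite F" for F
    proof -
      let ?A = "fst ` F" and ?B = "snd ` F"
      have "(\<Sum>x\<in>F. (cmod (ampl S h x))\<^sup>2) \<le> (\<Sum>x\<in>?A \<times> ?B. (cmod (ampl S h x))\<^sup>2)"
        using F by (intro sum_mono2 subset_fst_snd) auto
      also have "\<dots> = (\<Sum>i\<in>?A. (l2 (S (\<lambda>j. h (i, j))) ?B)\<^sup>2)"
        by (simp add: sum.cartesian_product' ampl_def L2_set_def sum_nonneg)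
      also have "\<dots> \<le> (\<Sum>i\<in>?A. (operator_norm S * ell2_norm (\<lambda>j. h (i, j)))\<^sup>2)"
        using F by (intro sum_mono power_mono order_trans[OF l2_le_norm operator_norm(1)[OF S]] D row_ell2 h) auto
      also have "\<dots> = (operator_norm S)\<^sup>2 * (\<Sum>i\<in>?A. (ell2_norm (\<lambda>j. h (i, j)))\<^sup>2)"
        by (simp add: power_mult_distrib sum_distrib_left)
      also have "\<dots> \<le> (operator_norm S)\<^sup>2 * (ell2_norm h)\<^sup>2"
        using F by (intro mult_left_mono row_norms h) auto
      finally have "l2 (ampl S h) F \<le> sqrt ((operator_norm S * ell2_norm h)\<^sup>2)"
        unfolding L2_set_def by (simp add: power_mult_distrib)
      then show ?thesis using operator_norm(2)[OF S] by simp
    qed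
    then show ?thesis using ell2_normI by blast
  qed
  show "bounded_operator (ampl S :: ('i \<times> 'j) operator)"
  proof (rule bounded_operatorI[where C="operator_norm S"])
    fix f g :: "'i \<times> 'j \<Rightarrow> complex" and c assume f: "f \<in> ell2"
    show "ampl S f \<in> ell2" "ell2_norm (ampl S f) \<le> operator_norm S * ell2_norm f" using *[OF f] by auto
    show "ampl S (\<lambda>x. c * f x) = (\<lambda>x. c * ampl S f x)"
      using D(3)[OF row_ell2[OF f]] by (auto simp: ampl_def)
    assume g: "g \<in> ell2"
    show "ampl S (\<lambda>x. f x + g x) = (\<lambda>x. ampl S f x + ampl S g x)"
      using D(2)[OF row_ell2[OF f] row_ell2[OF g]] by (auto simp: ampl_def)
  qed
  show "operator_norm (ampl S :: ('i \<times> 'j) operator) \<le> operator_norm S"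
    by (rule operator_norm_least) (use * operator_norm(2)[OF S] in auto)
qed

lemma ampl_adjoint: assumes "adjoint_pair S S'" shows "adjoint_pair (ampl S) (ampl S')"
proof -
  have S: "bounded_operator S" "bounded_operator S'"
    and e: "\<And>f g. f \<in> ell2 \<Longrightarrow> g \<in> ell2 \<Longrightarrow> ell2_inner (S' f) g = ell2_inner f (S g)"
    using assms by (auto simp: adjoint_pair_def)
  note b = ampl_bounded(1)[OF S(1)] ampl_bounded(1)[OF S(2)]
  have "ell2_inner (ampl S' f) g = ell2_inner f (ampl S g)" if fg: "f \<in> ell2" "g \<in> ell2" for f g :: "'b \<times> 'a \<Rightarrow> complex"
    unfolding ell2_inner_rows[OF bounded_operatorD(1)[OF b(2) fg(1)] fg(2)]
      ell2_inner_rows[OF fg(1) bounded_operatorD(1)[OF b(1) fg(2)]]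
    by (simp add: ampl_def e row_ell2 fg)
  then show ?thesis using b by (simp add: adjoint_pair_def)
qed

lemma flip_ell2:
  shows "flip h \<in> ell2 \<longleftrightarrow> h \<in> ell2" "ell2_norm (flip h) = ell2_norm h" "flip (flip h) = h"
    "ell2_inner (flip f) g = ell2_inner f (flip g)"
proof -
  have b: "bij_betw prod.swap (UNIV :: ('x \<times> 'y) set) UNIV" by (rule bij_swap)
  have f: "flip h x = h (prod.swap x)" for h :: "'y \<times> 'x \<Rightarrow> complex" and x by (cases x) (simp add: flip_def)
  show "flip h \<in> ell2 \<longleftrightarrow> h \<in> ell2" for h :: "'y \<times> 'x \<Rightarrow> complex"
    unfolding ell2_def mem_Collect_eq f by (rule summable_on_reindex_bij_betw[OF b])
  show "ell2_norm (flip h) = ell2_norm h" for h :: "'y \<times> 'x \<Rightarrow> complex"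
    unfolding ell2_norm_def f by (subst infsum_reindex_bij_betw[OF b]) simp
  show "flip (flip h) = h" for h :: "'y \<times> 'x \<Rightarrow> complex" by (auto simp: flip_def)
  show "ell2_inner (flip f) g = ell2_inner f (flip g)" for f :: "'y \<times> 'x \<Rightarrow> complex" and g
  proof -
    have "ell2_inner (flip f) g = (\<Sum>\<^sub>\<infinity>x. cnj (f (prod.swap x)) * flip g (prod.swap x))"
      unfolding ell2_inner_def f by (simp add: flip_def case_prod_beta)
    also have "\<dots> = ell2_inner f (flip g)"
      unfolding ell2_inner_def by (rule infsum_reindex_bij_betw[OF b])
    finally show ?thesis .
  qed
qed

definition lampl :: "'i operator \<Rightarrow> ('i \<times> 'j) operator" where
  "lampl T h = flip (ampl T (flip h))"

lemma lampl_bounded: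
  assumes T: "bounded_operator T"
  shows "bounded_operator (lampl T :: ('i \<times> 'j) operator)" "operator_norm (lampl T :: ('i \<times> 'j) operator) \<le> operator_norm T"
proof -
  note b = ampl_bounded[OF T, where 'i='j]
  note D = bounded_operatorD[OF b(1)]
  have n: "ell2_norm (lampl T h) \<le> operator_norm T * ell2_norm h" if "h \<in> ell2" for h :: "'i \<times> 'j \<Rightarrow> complex"
  proof -
    have "ell2_norm (ampl T (flip h)) \<le> operator_norm (ampl T :: ('j \<times> 'i) operator) * ell2_norm (flip h)"
      by (rule operator_norm(1)[OF b(1)]) (simp add: flip_ell2 that)
    also have "\<dots> \<le> operator_norm T * ell2_norm (flip h)" using b(2) by (intro mult_right_mono) auto
    finally show ?thesis by (simp add: lampl_def flip_ell2)
  qed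
  have e: "flip (\<lambda>x. f x + g x) = (\<lambda>x. flip f x + flip g x)" "flip (\<lambda>x. c * f x) = (\<lambda>x. c * flip f x)"
    for f g :: "'x \<times> 'y \<Rightarrow> complex" and c by (auto simp: flip_def)
  show "bounded_operator (lampl T :: ('i \<times> 'j) operator)"
    by (rule bounded_operatorI[where C="operator_norm T"]) (use n in \<open>simp_all add: lampl_def flip_ell2 e D\<close>)
  show "operator_norm (lampl T :: ('i \<times> 'j) operator) \<le> operator_norm T"
    by (rule operator_norm_least) (use n operator_norm(2)[OF T] in auto)
qed

lemma lampl_adjoint: assumes "adjoint_pair T T'" shows "adjoint_pair (lampl T :: ('i \<times> 'j) operator) (lampl T')"
proof -
  have T: "bounded_operator T" "bounded_operator T'" using assms by (auto simp: adjoint_pair_def)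
  have "ell2_inner (ampl T' f) g = ell2_inner f (ampl T g)" if "f \<in> ell2" "g \<in> ell2" for f g :: "'j \<times> 'i \<Rightarrow> complex"
    using ampl_adjoint[OF assms, where 'b='j] that by (simp add: adjoint_pair_def)
  then show ?thesis using lampl_bounded(1)[OF T(1)] lampl_bounded(1)[OF T(2)]
    by (simp add: adjoint_pair_def) (simp add: lampl_def flip_ell2)
qed

lemma tensor_operator_eq: "tensor_operator T S h = lampl T (ampl S h)"
  by (auto simp: tensor_operator_def lampl_def ampl_def flip_def)

definition etens :: "('i \<Rightarrow> complex) \<Rightarrow> ('j \<Rightarrow> complex) \<Rightarrow> 'i \<times> 'j \<Rightarrow> complex" where
  "etens u w = (\<lambda>(i, j). u i * w j)"

lemma ampl_etens: "bounded_operator S \<Longrightarrow> w \<in> ell2 \<Longrightarrow> ampl S (etens u w) = etens u (S w)"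
  by (auto simp: ampl_def etens_def bounded_operatorD(3))

lemma flip_etens: "flip (etens u w) = etens w u"
  by (auto simp: flip_def etens_def)

lemma lampl_etens: "bounded_operator T \<Longrightarrow> u \<in> ell2 \<Longrightarrow> lampl T (etens u w) = etens (T u) w"
  by (simp add: lampl_def flip_etens ampl_etens)

lemma etens_delta: "etens (delta i) (delta j) = delta (i, j)"
  by (auto simp: etens_def delta_def)

text \<open>By means of the adjoints the claim is moved to the basis vectors, which are elementary tensors.\<close>

lemma ampl_lampl_commute:
  assumes T: "adjoint_pair T T'" and S: "adjoint_pair S S'" and h: "h \<in> ell2"
  shows "lampl T (ampl S h) = ampl S (lampl T h)"
proof
  fix x :: "'a \<times> 'b"
  obtain i j where x: "x = (i, j)" by (cases x)
  note lT = lampl_adjoint[OF T, where 'j='b] and aS = ampl_adjoint[OF S, where 'b='a]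
  have b: "bounded_operator T'" "bounded_operator S'" using T S by (auto simp: adjoint_pair_def)
  have d: "delta x \<in> ell2" by simp
  have "lampl T (ampl S h) x = ell2_inner (ampl S' (lampl T' (delta x))) h"
    using adjoint_pair_comp[OF lT aS] h d by (simp add: adjoint_pair_def flip: ell2_inner_delta[of x])
  also have "ampl S' (lampl T' (delta x)) = lampl T' (ampl S' (delta x))"
    by (simp add: x etens_delta[symmetric] ampl_etens lampl_etens b)
  also have "ell2_inner (lampl T' (ampl S' (delta x))) h = ampl S (lampl T h) x"
    using adjoint_pair_comp[OF aS lT] h d by (simp add: adjoint_pair_def flip: ell2_inner_delta[of x])
  finally show "lampl T (ampl S h) x = ampl S (lampl T h) x" .
qed

lemma tensor_operator_facts:
  assumes T: "adjoint_pair T T'" and S: "adjoint_pair S S'"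
  shows "bounded_operator (tensor_operator T S)" "operator_norm (tensor_operator T S) \<le> operator_norm T * operator_norm S"
    "adjoint_pair (tensor_operator T S) (tensor_operator T' S')"
proof -
  have b: "bounded_operator T" "bounded_operator S" using T S by (auto simp: adjoint_pair_def)
  note lT = lampl_bounded[OF b(1), where 'j='b] and aS = ampl_bounded[OF b(2), where 'i='a]
  have e: "tensor_operator T S = (\<lambda>h. lampl T (ampl S h))" for T :: "'a operator" and S :: "'b operator"
    by (rule ext) (rule tensor_operator_eq)
  show "bounded_operator (tensor_operator T S)" unfolding e by (rule bounded_operator_comp[OF lT(1) aS(1)])
  show "operator_norm (tensor_operator T S) \<le> operator_norm T * operator_norm S" unfolding e
  proof (rule operator_norm_least)
    show "0 \<le> operator_norm T * operator_norm S" by (intro mult_nonneg_nonneg operator_norm(2) b)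
    fix h :: "'a \<times> 'b \<Rightarrow> complex" assume h: "h \<in> ell2"
    have "ell2_norm (lampl T (ampl S h)) \<le> operator_norm (lampl T :: ('a \<times> 'b) operator) * operator_norm (ampl S :: ('a \<times> 'b) operator) * ell2_norm h"
      by (rule bounded_operator_comp(2)[OF lT(1) aS(1) h])
    also have "\<dots> \<le> operator_norm T * operator_norm S * ell2_norm h"
      by (intro mult_right_mono mult_mono lT aS operator_norm b) auto
    finally show "ell2_norm (lampl T (ampl S h)) \<le> operator_norm T * operator_norm S * ell2_norm h" .
  qed
  have "adjoint_pair (\<lambda>h. lampl T (ampl S h)) (\<lambda>h. ampl S' (lampl T' h))"
    by (rule adjoint_pair_comp[OF lampl_adjoint[OF T] ampl_adjoint[OF S]])
  moreover have "ampl S' (lampl T' h) = lampl T' (ampl S' h)" if "h \<in> ell2" for h :: "'a \<times> 'b \<Rightarrow> complex"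
    using ampl_lampl_commute[OF adjoint_pair_sym[OF T] adjoint_pair_sym[OF S] that] by simp
  moreover have "bounded_operator (\<lambda>h. lampl T' (ampl S' h) :: 'a \<times> 'b \<Rightarrow> complex)"
    by (rule bounded_operator_comp[OF lampl_bounded(1) ampl_bounded(1)]) (use T S in \<open>auto simp: adjoint_pair_def\<close>)
  ultimately show "adjoint_pair (tensor_operator T S) (tensor_operator T' S')"
    by (simp add: adjoint_pair_def e)
qed

lemma tensor_operator_mult:
  assumes T: "adjoint_pair T T'" and S: "adjoint_pair S S'" and V: "adjoint_pair V V'" and W: "adjoint_pair W W'"
    and h: "h \<in> ell2"
  shows "tensor_operator T S (tensor_operator V W h) = tensor_operator (\<lambda>f. T (V f)) (\<lambda>f. S (W f)) h"
proof -
  have aW: "ampl W h \<in> ell2" using W h ampl_bounded(1) bounded_operatorD(1) by (auto simp: adjoint_pair_def)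
  have "tensor_operator T S (tensor_operator V W h) = lampl T (lampl V (ampl S (ampl W h)))"
    by (simp add: tensor_operator_eq ampl_lampl_commute[OF V S aW])
  also have "\<dots> = tensor_operator (\<lambda>f. T (V f)) (\<lambda>f. S (W f)) h"
    by (simp add: tensor_operator_eq lampl_def ampl_def flip_ell2 case_prod_beta)
  finally show ?thesis .
qed

section \<open>Representations and the minimal tensor product\<close>

lemma representationD:
  assumes "representation A \<pi>" "a \<in> carrier A"
  shows "bounded_operator (\<pi> a)"
    "b \<in> carrier A \<Longrightarrow> f \<in> ell2 \<Longrightarrow> \<pi> (a \<oplus>\<^bsub>A\<^esub> b) f = (\<lambda>i. \<pi> a f i + \<pi> b f i)"
    "f \<in> ell2 \<Longrightarrow> \<pi> (c \<odot>\<^bsub>A\<^esub> a) f = (\<lambda>i. c * \<pi> a f i)"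
    "b \<in> carrier A \<Longrightarrow> f \<in> ell2 \<Longrightarrow> \<pi> (a \<otimes>\<^bsub>A\<^esub> b) f = \<pi> a (\<pi> b f)"
    "f \<in> ell2 \<Longrightarrow> g \<in> ell2 \<Longrightarrow> ell2_inner (\<pi> (adj\<^bsub>A\<^esub> a) f) g = ell2_inner f (\<pi> a g)"
  using assms unfolding representation_def by blast+

context
  fixes A :: "('a, 'm) star_algebra_scheme" and \<pi> :: "'a \<Rightarrow> 'i operator"
  assumes A: "star_algebra A" and \<pi>: "representation A \<pi>"
begin

interpretation star_algebra A by (rule A)

lemmas rep = representationD[OF \<pi>]

lemma rep_adjoint_pair: "a \<in> carrier A \<Longrightarrow> adjoint_pair (\<pi> a) (\<pi> (adj\<^bsub>A\<^esub> a))"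
  by (simp add: adjoint_pair_def rep(1,5) adj_closed)

lemma rep_norm_squared:
  assumes a: "a \<in> carrier A" and f: "f \<in> ell2"
  shows "complex_of_real ((ell2_norm (\<pi> a f))\<^sup>2) = ell2_inner (\<pi> (adj\<^bsub>A\<^esub> a \<otimes>\<^bsub>A\<^esub> a) f) f"
proof -
  have c: "\<pi> a f \<in> ell2" by (rule bounded_operatorD(1)[OF rep(1)[OF a] f])
  show ?thesis using rep(4)[OF adj_closed[OF a] a f] rep(5)[OF a c f] ell2_inner_self[OF c] by simp
qed

lemma rep_adj_norm_le: assumes a: "a \<in> carrier A" shows "operator_norm (\<pi> (adj\<^bsub>A\<^esub> a)) \<le> operator_norm (\<pi> a)"
proof (rule operator_norm_least[OF operator_norm(2)[OF rep(1)[OF a]]])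
  fix f :: "'i \<Rightarrow> complex" assume f: "f \<in> ell2"
  let ?g = "\<pi> (adj\<^bsub>A\<^esub> a) f"
  have g: "?g \<in> ell2" by (rule bounded_operatorD(1)[OF rep(1)[OF adj_closed[OF a]] f])
  have ag: "\<pi> a ?g \<in> ell2" by (rule bounded_operatorD(1)[OF rep(1)[OF a] g])
  have "ell2_inner f (\<pi> a ?g) = complex_of_real ((ell2_norm ?g)\<^sup>2)"
    unfolding rep(5)[OF a f g, symmetric] by (rule ell2_inner_self[OF g])
  then have "(ell2_norm ?g)\<^sup>2 = cmod (ell2_inner f (\<pi> a ?g))" by (simp only: norm_of_real) simp
  also have "\<dots> \<le> ell2_norm f * ell2_norm (\<pi> a ?g)" by (rule ell2_inner_summable(2)[OF f ag])
  also have "\<dots> \<le> ell2_norm f * (operator_norm (\<pi> a) * ell2_norm ?g)"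
    by (intro mult_left_mono operator_norm(1)[OF rep(1)[OF a] g]) simp
  finally have "ell2_norm ?g * ell2_norm ?g \<le> (operator_norm (\<pi> a) * ell2_norm f) * ell2_norm ?g"
    by (simp add: power2_eq_square mult_ac)
  then show "ell2_norm ?g \<le> operator_norm (\<pi> a) * ell2_norm f"
    using operator_norm(2)[OF rep(1)[OF a]] ell2_norm_ge_0[of ?g]
    by (cases "ell2_norm ?g = 0") (auto simp: mult_le_cancel_right)
qed

lemma cstar_seminorm_rep: "cstar_seminorm A (\<lambda>a. operator_norm (\<pi> a))"
  unfolding cstar_seminorm_def
proof (intro conjI ballI allI)
  fix a assume a: "a \<in> carrier A"
  note ba = rep(1)[OF a]
  show "0 \<le> operator_norm (\<pi> a)" by (rule operator_norm(2)[OF ba])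
  have le: "operator_norm (\<pi> (c \<odot>\<^bsub>A\<^esub> a)) \<le> cmod c * operator_norm (\<pi> a)" if a: "a \<in> carrier A" for a c
  proof (rule operator_norm_least)
    show "0 \<le> cmod c * operator_norm (\<pi> a)" using operator_norm(2)[OF rep(1)[OF a]] by simp
    fix f :: "'i \<Rightarrow> complex" assume f: "f \<in> ell2"
    show "ell2_norm (\<pi> (c \<odot>\<^bsub>A\<^esub> a) f) \<le> cmod c * operator_norm (\<pi> a) * ell2_norm f"
      using operator_norm(1)[OF rep(1)[OF a] f] ell2_scale(2)[OF bounded_operatorD(1)[OF rep(1)[OF a] f], of c]
      by (simp add: rep(3)[OF a f] mult.assoc mult_left_mono)
  qed
  show "operator_norm (\<pi> (c \<odot>\<^bsub>A\<^esub> a)) = cmod c * operator_norm (\<pi> a)" for c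
  proof (rule antisym[OF le[OF a]])
    show "cmod c * operator_norm (\<pi> a) \<le> operator_norm (\<pi> (c \<odot>\<^bsub>A\<^esub> a))"
    proof (cases "c = 0")
      case True
      then show ?thesis using operator_norm(2)[OF rep(1), of "c \<odot>\<^bsub>A\<^esub> a"] a by simp
    next
      case False
      have "operator_norm (\<pi> (inverse c \<odot>\<^bsub>A\<^esub> (c \<odot>\<^bsub>A\<^esub> a))) \<le> cmod (inverse c) * operator_norm (\<pi> (c \<odot>\<^bsub>A\<^esub> a))"
        using a by (intro le) simp
      then show ?thesis using False a by (simp add: cs_assoc norm_inverse norm_divide field_simps)
    qed
  qed
  have mult: "operator_norm (\<pi> (a \<otimes>\<^bsub>A\<^esub> b)) \<le> operator_norm (\<pi> a) * operator_norm (\<pi> b)"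
    if a: "a \<in> carrier A" and b: "b \<in> carrier A" for a b
    using bounded_operator_comp(2)[OF rep(1)[OF a] rep(1)[OF b]]
    by (intro operator_norm_least) (auto simp: rep(4)[OF a b] operator_norm(2)[OF rep(1)] a b)
  show "operator_norm (\<pi> (adj\<^bsub>A\<^esub> a \<otimes>\<^bsub>A\<^esub> a)) = (operator_norm (\<pi> a))\<^sup>2"
  proof (rule antisym)
    have "operator_norm (\<pi> (adj\<^bsub>A\<^esub> a \<otimes>\<^bsub>A\<^esub> a)) \<le> operator_norm (\<pi> (adj\<^bsub>A\<^esub> a)) * operator_norm (\<pi> a)"
      by (rule mult[OF adj_closed[OF a] a])
    also have "\<dots> \<le> operator_norm (\<pi> a) * operator_norm (\<pi> a)"
      by (rule mult_right_mono[OF rep_adj_norm_le[OF a] operator_norm(2)[OF ba]])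
    finally show "operator_norm (\<pi> (adj\<^bsub>A\<^esub> a \<otimes>\<^bsub>A\<^esub> a)) \<le> (operator_norm (\<pi> a))\<^sup>2" by (simp add: power2_eq_square)
    let ?N = "operator_norm (\<pi> (adj\<^bsub>A\<^esub> a \<otimes>\<^bsub>A\<^esub> a))"
    have aa: "adj\<^bsub>A\<^esub> a \<otimes>\<^bsub>A\<^esub> a \<in> carrier A" using a by (simp add: adj_closed)
    note baa = rep(1)[OF aa]
    have "operator_norm (\<pi> a) \<le> sqrt ?N"
    proof (rule operator_norm_least)
      show "0 \<le> sqrt ?N" using operator_norm(2)[OF baa] by simp
      fix f :: "'i \<Rightarrow> complex" assume f: "f \<in> ell2"
      have "(ell2_norm (\<pi> a f))\<^sup>2 = cmod (ell2_inner (\<pi> (adj\<^bsub>A\<^esub> a \<otimes>\<^bsub>A\<^esub> a) f) f)"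
        unfolding rep_norm_squared[OF a f, symmetric] norm_of_real by simp
      also have "\<dots> \<le> ell2_norm (\<pi> (adj\<^bsub>A\<^esub> a \<otimes>\<^bsub>A\<^esub> a) f) * ell2_norm f"
        by (rule ell2_inner_summable(2)[OF bounded_operatorD(1)[OF baa f] f])
      also have "\<dots> \<le> (?N * ell2_norm f) * ell2_norm f"
        by (intro mult_right_mono operator_norm(1)[OF baa f]) simp
      finally have "ell2_norm (\<pi> a f) \<le> sqrt (?N * (ell2_norm f)\<^sup>2)"
        by (intro real_le_rsqrt) (simp add: power2_eq_square mult.assoc)
      then show "ell2_norm (\<pi> a f) \<le> sqrt ?N * ell2_norm f" by (simp add: real_sqrt_mult)
    qed
    then have "(operator_norm (\<pi> a))\<^sup>2 \<le> (sqrt ?N)\<^sup>2" by (rule power_mono) (rule operator_norm(2)[OF ba])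
    then show "(operator_norm (\<pi> a))\<^sup>2 \<le> ?N" using operator_norm(2)[OF baa] by simp
  qed
  fix b assume b: "b \<in> carrier A"
  show "operator_norm (\<pi> (a \<otimes>\<^bsub>A\<^esub> b)) \<le> operator_norm (\<pi> a) * operator_norm (\<pi> b)" by (rule mult[OF a b])
  show "operator_norm (\<pi> (a \<oplus>\<^bsub>A\<^esub> b)) \<le> operator_norm (\<pi> a) + operator_norm (\<pi> b)"
  proof (rule operator_norm_least)
    show "0 \<le> operator_norm (\<pi> a) + operator_norm (\<pi> b)"
      using operator_norm(2)[OF ba] operator_norm(2)[OF rep(1)[OF b]] by simp
    fix f :: "'i \<Rightarrow> complex" assume f: "f \<in> ell2"
    show "ell2_norm (\<pi> (a \<oplus>\<^bsub>A\<^esub> b) f) \<le> (operator_norm (\<pi> a) + operator_norm (\<pi> b)) * ell2_norm f"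
      unfolding rep(2)[OF a b f]
      using ell2_add(2)[OF bounded_operatorD(1)[OF ba f] bounded_operatorD(1)[OF rep(1)[OF b] f]]
        operator_norm(1)[OF ba f] operator_norm(1)[OF rep(1)[OF b] f] by (simp add: distrib_right)
  qed
qed

end

text \<open>If \<open>a* a + s\<^sup>2 = 1\<close> with selfadjoint \<open>s\<close>, then the squared norms of \<open>\<pi>(a) f\<close> and \<open>\<pi>(s) f\<close> add up to
\<open>\<langle>\<pi>(1) f, f\<rangle>\<close>, and \<open>\<pi>(1)\<close> is a contraction.\<close>

lemma rep_contractive:
  fixes A :: "'a cstar_algebra" and \<pi> :: "'a \<Rightarrow> 'i operator"
  assumes A: "cstar_algebra A" and \<pi>: "representation A \<pi>" and a: "a \<in> carrier A"
  shows "operator_norm (\<pi> a) \<le> \<parallel>a\<parallel>\<^bsub>A\<^esub>"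
proof -
  interpret star_algebra A by (rule cstar_star[OF A])
  note rep = representationD[OF \<pi>] and sa = cstar_star[OF A]
  note sn = cstar_seminorm_rep[OF sa \<pi>]
  have *: "operator_norm (\<pi> a) \<le> 1" if a: "a \<in> carrier A" and n: "\<parallel>a\<parallel>\<^bsub>A\<^esub> \<le> 1" for a
  proof (rule operator_norm_least)
    fix f :: "'i \<Rightarrow> complex" assume f: "f \<in> ell2"
    obtain s where s: "s \<in> carrier A" "adj\<^bsub>A\<^esub> s = s" "adj\<^bsub>A\<^esub> a \<otimes>\<^bsub>A\<^esub> a \<oplus>\<^bsub>A\<^esub> s \<otimes>\<^bsub>A\<^esub> s = \<one>\<^bsub>A\<^esub>"
      using defect_exists[OF A a n] by blast
    have aa: "adj\<^bsub>A\<^esub> a \<otimes>\<^bsub>A\<^esub> a \<in> carrier A" "s \<otimes>\<^bsub>A\<^esub> s \<in> carrier A" using a s by (auto simp: adj_closed)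
    note e = bounded_operatorD(1)[OF rep(1)[OF aa(1)] f] bounded_operatorD(1)[OF rep(1)[OF aa(2)] f]
    have "ell2_inner (\<pi> \<one>\<^bsub>A\<^esub> f) f = ell2_inner (\<pi> (adj\<^bsub>A\<^esub> a \<otimes>\<^bsub>A\<^esub> a) f) f + ell2_inner (\<pi> (s \<otimes>\<^bsub>A\<^esub> s) f) f"
      unfolding s(3)[symmetric] rep(2)[OF aa f] by (rule ell2_inner_simps(1)[OF e(1) f e(2)])
    also have "\<dots> = complex_of_real ((ell2_norm (\<pi> a f))\<^sup>2 + (ell2_norm (\<pi> s f))\<^sup>2)"
      using rep_norm_squared[OF sa \<pi> a f] rep_norm_squared[OF sa \<pi> s(1) f] by (simp add: s)
    finally have 1: "ell2_inner (\<pi> \<one>\<^bsub>A\<^esub> f) f = complex_of_real ((ell2_norm (\<pi> a f))\<^sup>2 + (ell2_norm (\<pi> s f))\<^sup>2)" .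
    have "operator_norm (\<pi> \<one>\<^bsub>A\<^esub>) \<le> 1" using seminorm_one[OF sa sn] .
    have pf: "\<pi> \<one>\<^bsub>A\<^esub> f \<in> ell2" by (rule bounded_operatorD(1)[OF rep(1)[OF rs(6)] f])
    have "(ell2_norm (\<pi> a f))\<^sup>2 \<le> cmod (ell2_inner (\<pi> \<one>\<^bsub>A\<^esub> f) f)"
      unfolding 1 norm_of_real by simp
    also have "\<dots> \<le> ell2_norm (\<pi> \<one>\<^bsub>A\<^esub> f) * ell2_norm f" by (rule ell2_inner_summable(2)[OF pf f])
    also have "\<dots> \<le> (operator_norm (\<pi> \<one>\<^bsub>A\<^esub>) * ell2_norm f) * ell2_norm f"
      by (intro mult_right_mono operator_norm(1)[OF rep(1)[OF rs(6)] f]) simp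
    also have "\<dots> \<le> (1 * ell2_norm f) * ell2_norm f"
      by (intro mult_right_mono) (use \<open>operator_norm (\<pi> \<one>\<^bsub>A\<^esub>) \<le> 1\<close> in auto)
    finally have "(ell2_norm (\<pi> a f))\<^sup>2 \<le> (ell2_norm f)\<^sup>2" by (simp add: power2_eq_square)
    from power2_le_imp_le[OF this ell2_norm_ge_0]
    show "ell2_norm (\<pi> a f) \<le> 1 * ell2_norm f" by simp
  qed simp
  show ?thesis
  proof (cases "\<parallel>a\<parallel>\<^bsub>A\<^esub> = 0")
    case True
    then have "a = \<zero>\<^bsub>A\<^esub>" using cstar_algebra.norm_definite[OF A a] by simp
    then show ?thesis using seminorm_zero[OF sa sn] True by simp
  next
    case False
    then have pos: "\<parallel>a\<parallel>\<^bsub>A\<^esub> > 0" using cnorm_ge_0[OF A a] by simp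
    define c where "c = complex_of_real (1 / \<parallel>a\<parallel>\<^bsub>A\<^esub>)"
    have cm: "cmod c = 1 / \<parallel>a\<parallel>\<^bsub>A\<^esub>" using pos by (simp add: c_def norm_divide)
    have "operator_norm (\<pi> (c \<odot>\<^bsub>A\<^esub> a)) \<le> 1"
      by (rule *) (use a pos in \<open>simp_all add: seminorm_smult[OF cstar_sn[OF A] a] cm\<close>)
    then show ?thesis using pos by (simp add: seminorm_smult[OF sn a] cm field_simps)
  qed
qed

definition tensor_rep :: "('a \<Rightarrow> 'i operator) \<Rightarrow> ('b \<Rightarrow> 'j operator) \<Rightarrow> ('a \<times> 'b \<Rightarrow>\<^sub>0 complex) \<Rightarrow> ('i \<times> 'j) operator" where
  "tensor_rep \<pi> \<rho> z h x = (\<Sum>(a, b)\<in>ks z. lk z (a, b) * tensor_operator (\<pi> a) (\<rho> b) h x)"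

lemma tensor_rep_ext:
  "tensor_rep \<pi> \<rho> z h x = lin_ext (\<lambda>ab c. c * tensor_operator (\<pi> (fst ab)) (\<rho> (snd ab)) h x) z"
  by (simp add: tensor_rep_def lin_ext_def case_prod_beta)

lemma tensor_rep_simps:
  "tensor_rep \<pi> \<rho> (z + z') h = (\<lambda>x. tensor_rep \<pi> \<rho> z h x + tensor_rep \<pi> \<rho> z' h x)"
  "tensor_rep \<pi> \<rho> (sg (a, b) c) h = (\<lambda>x. c * tensor_operator (\<pi> a) (\<rho> b) h x)"
  "tensor_rep \<pi> \<rho> 0 h = (\<lambda>x. 0)"
  by (rule ext; simp add: tensor_rep_ext lin_ext_add distrib_right lin_ext_single)+

context
  fixes A :: "('a, 'm) star_algebra_scheme" and B :: "('b, 'k) star_algebra_scheme"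
    and \<pi> :: "'a \<Rightarrow> 'i operator" and \<rho> :: "'b \<Rightarrow> 'j operator"
  assumes A: "star_algebra A" and B: "star_algebra B" and \<pi>: "representation A \<pi>" and \<rho>: "representation B \<rho>"
begin

interpretation A: star_algebra A by (rule A)
interpretation B: star_algebra B by (rule B)

lemmas rA = representationD[OF \<pi>] and rB = representationD[OF \<rho>]
  and adjA = rep_adjoint_pair[OF A \<pi>] and adjB = rep_adjoint_pair[OF B \<rho>]

lemma pre_carrier: "z \<in> carrier (pre_tensor A B) \<longleftrightarrow> ks z \<subseteq> carrier A \<times> carrier B"
  by (simp add: pre_tensor_def monoid_star_algebra_simps DirProd_def)

lemma tensor_rep_bounded: "ks z \<subseteq> carrier A \<times> carrier B \<Longrightarrow> bounded_operator (tensor_rep \<pi> \<rho> z)"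
proof (induction z rule: poly_induct)
  case zero
  have "tensor_rep \<pi> \<rho> 0 = (\<lambda>h x. 0)" by (rule ext) (simp add: tensor_rep_simps)
  then show ?case by (simp add: bounded_operator_zero)
next
  case (single x c)
  obtain a b where x: "x = (a, b)" "a \<in> carrier A" "b \<in> carrier B" using single by blast
  have "tensor_rep \<pi> \<rho> (sg x c) = (\<lambda>h i. c * tensor_operator (\<pi> a) (\<rho> b) h i)"
    by (rule ext) (simp add: x tensor_rep_simps)
  then show ?case using bounded_operator_scale[OF tensor_operator_facts(1)[OF adjA[OF x(2)] adjB[OF x(3)]]] by simp
next
  case (add p q)
  have "tensor_rep \<pi> \<rho> (p + q) = (\<lambda>h i. tensor_rep \<pi> \<rho> p h i + tensor_rep \<pi> \<rho> q h i)"
    by (rule ext) (simp add: tensor_rep_simps)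
  then show ?case using bounded_operator_add add.IH by simp
qed

lemma tensor_rep_representation: "representation (pre_tensor A B) (tensor_rep \<pi> \<rho>)"
  unfolding representation_def
proof (intro conjI ballI allI)
  note pc = pre_carrier
  have st: "z \<otimes>\<^bsub>pre_tensor A B\<^esub> z' = mono_mult (A \<times>\<times> B) z z'" "z \<oplus>\<^bsub>pre_tensor A B\<^esub> z' = z + z'"
    "c \<odot>\<^bsub>pre_tensor A B\<^esub> z = pscale c z" "adj\<^bsub>pre_tensor A B\<^esub> z = mono_star (\<lambda>(a, b). (adj\<^bsub>A\<^esub> a, adj\<^bsub>B\<^esub> b)) z" for z z' c
    by (simp_all add: pre_tensor_def monoid_star_algebra_simps)
  fix z assume z: "z \<in> carrier (pre_tensor A B)"
  note kz = z[unfolded pc]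
  show "bounded_operator (tensor_rep \<pi> \<rho> z)" by (rule tensor_rep_bounded[OF kz])
  fix f :: "'i \<times> 'j \<Rightarrow> complex" assume f: "f \<in> ell2"
  show "tensor_rep \<pi> \<rho> (c \<odot>\<^bsub>pre_tensor A B\<^esub> z) f = (\<lambda>i. c * tensor_rep \<pi> \<rho> z f i)" for c
    unfolding st by (induction z rule: poly_induct_UNIV) (auto simp: scale_simps tensor_rep_simps distrib_left)
  show "ell2_inner (tensor_rep \<pi> \<rho> (adj\<^bsub>pre_tensor A B\<^esub> z) f) g = ell2_inner f (tensor_rep \<pi> \<rho> z g)"
    if g: "g \<in> ell2" for g
    unfolding st using kz
  proof (induction z rule: poly_induct)
    case (single x c)
    obtain a b where x: "x = (a, b)" "a \<in> carrier A" "b \<in> carrier B" using single by blast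
    have "adjoint_pair (tensor_operator (\<pi> a) (\<rho> b)) (tensor_operator (\<pi> (adj\<^bsub>A\<^esub> a)) (\<rho> (adj\<^bsub>B\<^esub> b)))"
      by (rule tensor_operator_facts(3)[OF adjA[OF x(2)] adjB[OF x(3)]])
    then show ?case using f g
      by (simp add: x mono_star_simps tensor_rep_simps adjoint_pair_def ell2_inner_simps bounded_operatorD(1))
  next
    case (add p q)
    have cl: "ks (mono_star (\<lambda>(a, b). (adj\<^bsub>A\<^esub> a, adj\<^bsub>B\<^esub> b)) p) \<subseteq> carrier A \<times> carrier B"
      if "ks p \<subseteq> carrier A \<times> carrier B" for p
      using star_algebra.adj_closed[OF star_algebra_pre_tensor[OF A B], of p] that by (simp add: st pc)
    note D = bounded_operatorD(1)[OF tensor_rep_bounded]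
    show ?case using add f g D[OF cl[OF add(1)] f] D[OF cl[OF add(2)] f] D[OF add(1) g] D[OF add(2) g]
      by (simp add: mono_star_simps tensor_rep_simps ell2_inner_simps)
  qed (simp add: mono_star_simps tensor_rep_simps)
  fix z' assume z': "z' \<in> carrier (pre_tensor A B)"
  note kz' = z'[unfolded pc]
  show "tensor_rep \<pi> \<rho> (z \<oplus>\<^bsub>pre_tensor A B\<^esub> z') f = (\<lambda>i. tensor_rep \<pi> \<rho> z f i + tensor_rep \<pi> \<rho> z' f i)"
    by (simp add: st tensor_rep_simps)
  have f': "tensor_rep \<pi> \<rho> z' f \<in> ell2" if "ks z' \<subseteq> carrier A \<times> carrier B" for z'
    by (rule bounded_operatorD(1)[OF tensor_rep_bounded[OF that] f])
  show "tensor_rep \<pi> \<rho> (z \<otimes>\<^bsub>pre_tensor A B\<^esub> z') f = tensor_rep \<pi> \<rho> z (tensor_rep \<pi> \<rho> z' f)"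
    unfolding st using kz
  proof (induction z rule: poly_induct)
    case (single x c)
    note X = single
    obtain a b where x: "x = (a, b)" "a \<in> carrier A" "b \<in> carrier B" using single by blast
    have b0: "bounded_operator (tensor_rep \<pi> \<rho> (sg x c))" using single by (intro tensor_rep_bounded) simp
    show ?case using kz'
    proof (induction z' rule: poly_induct)
      case (single y d)
      obtain a' b' where y: "y = (a', b')" "a' \<in> carrier A" "b' \<in> carrier B" using single by blast
      have t1: "tensor_operator (\<pi> a) (\<rho> b) (tensor_operator (\<pi> a') (\<rho> b') f) =
          tensor_operator (\<lambda>f. \<pi> a (\<pi> a' f)) (\<lambda>f. \<rho> b (\<rho> b' f)) f"
        by (rule tensor_operator_mult[OF adjA[OF x(2)] adjB[OF x(3)] adjA[OF y(2)] adjB[OF y(3)] f])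
      note tb = tensor_operator_facts(1)[OF adjA[OF x(2)] adjB[OF x(3)]] tensor_operator_facts(1)[OF adjA[OF y(2)] adjB[OF y(3)]]
      have t2: "tensor_operator (\<pi> (a \<otimes>\<^bsub>A\<^esub> a')) (\<rho> (b \<otimes>\<^bsub>B\<^esub> b')) f = tensor_operator (\<lambda>f. \<pi> a (\<pi> a' f)) (\<lambda>f. \<rho> b (\<rho> b' f)) f"
      proof -
        have "\<rho> (b \<otimes>\<^bsub>B\<^esub> b') (\<lambda>j'. f (i', j')) = \<rho> b (\<rho> b' (\<lambda>j'. f (i', j')))" for i'
          by (rule rB(4)[OF x(3) y(3) row_ell2[OF f]])
        then have 1: "ampl (\<rho> (b \<otimes>\<^bsub>B\<^esub> b')) f = ampl (\<lambda>f. \<rho> b (\<rho> b' f)) f" by (simp add: ampl_def)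
        have "ampl (\<lambda>f. \<rho> b (\<rho> b' f)) f \<in> ell2"
          by (rule bounded_operatorD(1)[OF ampl_bounded(1) f], rule bounded_operator_comp(1)) (rule rB x y)+
        then have "(\<lambda>i'. ampl (\<lambda>f. \<rho> b (\<rho> b' f)) f (i', j)) \<in> ell2" for j
          using row_ell2[of "flip (ampl (\<lambda>f. \<rho> b (\<rho> b' f)) f)" j] by (simp add: flip_ell2) (simp add: flip_def)
        then have "\<pi> (a \<otimes>\<^bsub>A\<^esub> a') (\<lambda>i'. ampl (\<lambda>f. \<rho> b (\<rho> b' f)) f (i', j)) = \<pi> a (\<pi> a' (\<lambda>i'. ampl (\<lambda>f. \<rho> b (\<rho> b' f)) f (i', j)))" for j
          by (rule rA(4)[OF x(2) y(2)])
        then show ?thesis unfolding tensor_operator_eq 1 by (simp add: lampl_def ampl_def flip_def)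
      qed
      show ?case using x y
        by (simp add: mono_mult_simps tensor_rep_simps t2 t1 bounded_operatorD[OF tb(1)] bounded_operatorD(1)[OF tb(2)] f mult.assoc)
    next
      case (add p q)
      then show ?case by (simp add: mono_mult_simps tensor_rep_simps bounded_operatorD(2)[OF b0 f' f'])
    next
      case zero
      show ?case using bounded_operatorD(3)[OF b0 ell2_zero, of 0] by (simp add: mono_mult_simps tensor_rep_simps)
    qed
  qed (simp_all add: mono_mult_simps tensor_rep_simps)
qed

end

text \<open>The seminorms in the definition of the spatial norm.\<close>

definition min_reps :: "('a, 'm) star_algebra_scheme \<Rightarrow> ('b, 'k) star_algebra_scheme \<Rightarrow>
    (('a \<times> 'b \<Rightarrow>\<^sub>0 complex) \<Rightarrow> real) set" where
  "min_reps A B = (\<lambda>(\<pi>, \<rho>) z. operator_norm (tensor_rep \<pi> \<rho> z)) ` {(\<pi>, \<rho>).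
     representation A (\<pi> :: 'a \<Rightarrow> 'a operator) \<and> representation B (\<rho> :: 'b \<Rightarrow> 'b operator)}"

lemma min_repsI:
  fixes \<pi> :: "'a \<Rightarrow> 'a operator" and \<rho> :: "'b \<Rightarrow> 'b operator"
  shows "representation A \<pi> \<Longrightarrow> representation B \<rho> \<Longrightarrow> (\<lambda>z. operator_norm (tensor_rep \<pi> \<rho> z)) \<in> min_reps A B"
  unfolding min_reps_def by (rule image_eqI[of _ _ "(\<pi>, \<rho>)"]) auto

lemma min_seminorm_SUP:
  fixes A :: "('a, 'm) star_algebra_scheme" and B :: "('b, 'k) star_algebra_scheme"
  shows "min_seminorm A B z = (SUP p\<in>min_reps A B. p z)"
proof -
  have e: "(\<lambda>h ij. \<Sum>(a :: 'a, b :: 'b)\<in>ks z. lk z (a, b) * tensor_operator (\<pi> a) (\<rho> b) h ij) = tensor_rep \<pi> \<rho> z" for \<pi> :: "'a \<Rightarrow> 'a operator" and \<rho> :: "'b \<Rightarrow> 'b operator"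
    by (intro ext) (simp add: tensor_rep_def)
  show ?thesis unfolding min_seminorm_def e
  proof (rule arg_cong[where f=Sup], rule subset_antisym; rule subsetI)
    fix x assume "x \<in> {operator_norm (tensor_rep \<pi> \<rho> z) | (\<pi> :: 'a \<Rightarrow> 'a operator) (\<rho> :: 'b \<Rightarrow> 'b operator).
      representation A \<pi> \<and> representation B \<rho>}"
    then obtain \<pi> :: "'a \<Rightarrow> 'a operator" and \<rho> :: "'b \<Rightarrow> 'b operator"
      where x: "x = operator_norm (tensor_rep \<pi> \<rho> z)" "representation A \<pi>" "representation B \<rho>" by blast
    show "x \<in> (\<lambda>p. p z) ` min_reps A B" unfolding x(1)
      by (rule image_eqI[OF _ min_repsI[OF x(2,3)]]) simp
  qed (auto simp: min_reps_def)
qed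

lemma zero_representation: "representation A (\<lambda>a f i. 0)"
  by (simp add: representation_def bounded_operator_zero)

context
  fixes A :: "'a cstar_algebra" and B :: "'b cstar_algebra"
  assumes A: "cstar_algebra A" and B: "cstar_algebra B"
begin

lemmas sA = cstar_star[OF A] and sB = cstar_star[OF B]

lemma min_reps_bound:
  assumes p: "p \<in> min_reps A B" and z: "ks z \<subseteq> carrier A \<times> carrier B"
  shows "p z \<le> (\<Sum>x\<in>ks z. cmod (lk z x) * (\<parallel>fst x\<parallel>\<^bsub>A\<^esub> * \<parallel>snd x\<parallel>\<^bsub>B\<^esub>))"
proof -
  obtain \<pi> :: "'a \<Rightarrow> 'a operator" and \<rho> :: "'b \<Rightarrow> 'b operator"
    where p: "p = (\<lambda>z. operator_norm (tensor_rep \<pi> \<rho> z))" and r: "representation A \<pi>" "representation B \<rho>"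
    using p by (auto simp: min_reps_def)
  let ?T = "pre_tensor A B"
  have sn: "cstar_seminorm ?T p" unfolding p
    by (rule cstar_seminorm_rep[OF star_algebra_pre_tensor[OF sA sB] tensor_rep_representation[OF sA sB r]])
  have pc: "\<And>z. z \<in> carrier ?T \<longleftrightarrow> ks z \<subseteq> carrier A \<times> carrier B" by (rule pre_carrier[OF sA sB r])
  have add: "z \<oplus>\<^bsub>?T\<^esub> z' = z + z'" "\<zero>\<^bsub>?T\<^esub> = 0" "c \<odot>\<^bsub>?T\<^esub> z = pscale c z" for z z' c by (simp_all add: pre_tensor_def monoid_star_algebra_simps)
  have "ks (\<Sum>x\<in>F. sg x (lk z x)) \<subseteq> carrier A \<times> carrier B \<and>
      p (\<Sum>x\<in>F. sg x (lk z x)) \<le> (\<Sum>x\<in>F. cmod (lk z x) * (\<parallel>fst x\<parallel>\<^bsub>A\<^esub> * \<parallel>snd x\<parallel>\<^bsub>B\<^esub>))"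
    if "finite F" "F \<subseteq> carrier A \<times> carrier B" for F using that
  proof (induction F rule: finite_induct)
    case empty
    then show ?case using seminorm_zero[OF star_algebra_pre_tensor[OF sA sB] sn] by (simp add: add)
  next
    case (insert x F)
    obtain a b where x: "x = (a, b)" "a \<in> carrier A" "b \<in> carrier B" using insert.prems by blast
    have cl: "sg x (lk z x) \<in> carrier ?T" "sg x 1 \<in> carrier ?T" "(\<Sum>x\<in>F. sg x (lk z x)) \<in> carrier ?T"
      using insert x by (auto simp: pc)
    have "sg x (lk z x) = (lk z x) \<odot>\<^bsub>?T\<^esub> sg x 1" by (simp add: add scale_simps)
    then have "p (sg x (lk z x)) = cmod (lk z x) * p (sg x 1)" by (simp add: seminorm_smult[OF sn cl(2)])
    also have "tensor_rep \<pi> \<rho> (sg x 1) = tensor_operator (\<pi> a) (\<rho> b)" by (intro ext) (simp add: tensor_rep_simps x)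
    then have "p (sg x 1) \<le> operator_norm (\<pi> a) * operator_norm (\<rho> b)" unfolding p
      using tensor_operator_facts(2)[OF rep_adjoint_pair[OF sA r(1) x(2)] rep_adjoint_pair[OF sB r(2) x(3)]] by simp
    then have "p (sg x 1) \<le> \<parallel>a\<parallel>\<^bsub>A\<^esub> * \<parallel>b\<parallel>\<^bsub>B\<^esub>"
      using mult_mono[OF rep_contractive[OF A r(1) x(2)] rep_contractive[OF B r(2) x(3)]
          cnorm_ge_0[OF A x(2)] operator_norm(2)[OF representationD(1)[OF r(2) x(3)]]] by linarith
    then have "cmod (lk z x) * p (sg x 1) \<le> cmod (lk z x) * (\<parallel>a\<parallel>\<^bsub>A\<^esub> * \<parallel>b\<parallel>\<^bsub>B\<^esub>)"
      by (rule mult_left_mono) simp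
    finally have "p (sg x (lk z x)) \<le> cmod (lk z x) * (\<parallel>a\<parallel>\<^bsub>A\<^esub> * \<parallel>b\<parallel>\<^bsub>B\<^esub>)" .
    moreover have "p (sg x (lk z x) + (\<Sum>x\<in>F. sg x (lk z x))) \<le> p (sg x (lk z x)) + p (\<Sum>x\<in>F. sg x (lk z x))"
      using seminorm_add[OF sn cl(1,3)] by (simp only: add)
    moreover have "ks (sg x (lk z x) + (\<Sum>x\<in>F. sg x (lk z x))) \<subseteq> carrier A \<times> carrier B"
      using keys_add[of "sg x (lk z x)" "\<Sum>x\<in>F. sg x (lk z x)"] cl(1,3) unfolding pc by blast
    ultimately show ?case using insert x(1) by simp
  qed
  from this[of "ks z"] z show ?thesis by (simp add: sum_singles)
qed

lemma star_algebra_pt: "star_algebra (pre_tensor A B)"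
  by (rule star_algebra_pre_tensor[OF sA sB])

lemma pt_carrier: "z \<in> carrier (pre_tensor A B) \<longleftrightarrow> ks z \<subseteq> carrier A \<times> carrier B"
  by (rule pre_carrier[OF sA sB zero_representation zero_representation])

lemma bdd_min_reps: "z \<in> carrier (pre_tensor A B) \<Longrightarrow> bdd_above ((\<lambda>p. p z) ` min_reps A B)"
  by (rule bdd_aboveI2) (rule min_reps_bound, simp_all add: pt_carrier)

lemma cstar_seminorm_min: "cstar_seminorm (pre_tensor A B) (min_seminorm A B)"
  unfolding min_seminorm_SUP[abs_def]
proof (rule cstar_seminorm_SUP[OF star_algebra_pt])
  show "min_reps A B \<noteq> {}" using min_repsI[OF zero_representation zero_representation, of A B] by blast
  show "cstar_seminorm (pre_tensor A B) p" if "p \<in> min_reps A B" for p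
    using that cstar_seminorm_rep[OF star_algebra_pt tensor_rep_representation[OF sA sB]]
    by (auto simp: min_reps_def)
qed (rule bdd_min_reps)

lemma completing_min: "completing (pre_tensor A B) (min_seminorm A B)"
  by (rule completingI[OF star_algebra_pt cstar_seminorm_min])

lemma cstar_algebra_min_tensor: "cstar_algebra (min_tensor A B)"
  unfolding min_tensor_def by (rule completing.cstar_algebra_C[OF completing_min])

text \<open>Elements of spatial norm zero vanish in all representations, not only those attaining the
supremum; this is how equations in the tensor product are evaluated.\<close>

lemma min_seminorm_zeroD:
  assumes z: "z \<in> carrier (pre_tensor A B)" and 0: "min_seminorm A B z = 0"
    and r: "representation A (\<pi> :: 'a \<Rightarrow> 'a operator)" "representation B (\<rho> :: 'b \<Rightarrow> 'b operator)"
    and h: "h \<in> ell2"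
  shows "tensor_rep \<pi> \<rho> z h = (\<lambda>x. 0)"
proof -
  have "operator_norm (tensor_rep \<pi> \<rho> z) \<le> 0"
    using cSUP_upper[OF min_repsI[OF r] bdd_min_reps[OF z]] 0 by (simp add: min_seminorm_SUP)
  note b = tensor_rep_bounded[OF sA sB r z[unfolded pt_carrier]]
  have "ell2_norm (tensor_rep \<pi> \<rho> z h) = 0"
    using operator_norm(1)[OF b h] \<open>operator_norm (tensor_rep \<pi> \<rho> z) \<le> 0\<close> operator_norm(2)[OF b] ell2_norm_ge_0[of "tensor_rep \<pi> \<rho> z h"]
    by (intro antisym) simp_all
  then have n: "l2 (tensor_rep \<pi> \<rho> z h) {x} \<le> 0" for x
    using l2_le_norm[OF bounded_operatorD(1)[OF b h], of "{x}"] by simp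
  show ?thesis
  proof
    fix x show "tensor_rep \<pi> \<rho> z h x = 0" using n[of x] by (simp add: L2_set_def)
  qed
qed

end

section \<open>The Gelfand-Naimark-Segal construction\<close>

lemma ell2_tail:
  assumes h: "h \<in> ell2" and e: "e > 0"
  shows "\<exists>F. finite F \<and> (\<lambda>i. if i \<in> F then 0 else h i) \<in> ell2 \<and> ell2_norm (\<lambda>i. if i \<in> F then 0 else h i) \<le> e"
proof -
  let ?S = "\<lambda>F. \<Sum>i\<in>F. (cmod (h i))\<^sup>2" and ?T = "\<Sum>\<^sub>\<infinity>i. (cmod (h i))\<^sup>2"
  have s: "(\<lambda>i. (cmod (h i))\<^sup>2) summable_on UNIV" using h by (simp add: ell2_def)
  have "\<exists>F. finite F \<and> ?T - e\<^sup>2 < ?S F"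
  proof (rule ccontr)
    assume "\<not> ?thesis"
    then have "?T \<le> ?T - e\<^sup>2" by (intro infsum_le_finite_sums[OF s]) (auto simp: not_less)
    then show False using e by simp
  qed
  then obtain F where F: "finite F" "?T - e\<^sup>2 < ?S F" by blast
  have "l2 (\<lambda>i. if i \<in> F then 0 else h i) K \<le> e" if K: "finite K" for K
  proof -
    have "(\<Sum>i\<in>K. (cmod (if i \<in> F then 0 else h i))\<^sup>2) = ?S (K - F)"
      using K by (intro sum.mono_neutral_cong_right) auto
    also have "?S (K - F) + ?S F = ?S ((K - F) \<union> F)" using K F by (intro sum.union_disjoint[symmetric]) auto
    then have "?S (K - F) = ?S ((K - F) \<union> F) - ?S F" by simp
    also have "\<dots> \<le> ?T - ?S F" using K F by (intro diff_right_mono finite_sum_le_infsum[OF s]) auto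
    also have "\<dots> \<le> e\<^sup>2" using F by simp
    finally show ?thesis using e by (simp add: L2_set_def real_le_lsqrt)
  qed
  then show ?thesis using ell2_normI[of "\<lambda>i. if i \<in> F then 0 else h i" e] F(1) by blast
qed

locale positive_form =
  fixes f :: "'c::cstar \<Rightarrow> complex"
  assumes f: "positive_functional f"
begin

definition ip :: "'c \<Rightarrow> 'c \<Rightarrow> complex" where "ip a b = f (star a * b)"

lemma f_simps: "f (x + y) = f x + f y" "f (c *\<^sub>C x) = c * f x" "f 0 = 0" "f (- x) = - f x" "f (x - y) = f x - f y"
proof -
  show 1: "f (x + y) = f x + f y" "f (c *\<^sub>C x) = c * f x" for x y c using f by (auto simp: positive_functional_def)
  show "f 0 = 0" using 1(2)[of 0 0] by simp
  show 2: "f (- x) = - f x" for x using 1(2)[of "- 1" x] by (simp add: cscale_minus_left)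
  show "f (x - y) = f x - f y" using 1(1)[of x "- y"] by (simp add: 2)
qed

lemma f_sum: "f (sum g S) = (\<Sum>i\<in>S. f (g i))"
  by (induction S rule: infinite_finite_induct) (simp_all add: f_simps)

lemma ip_simps: "ip (a + b) d = ip a d + ip b d" "ip a (b + d) = ip a b + ip a d" "ip (c *\<^sub>C a) b = cnj c * ip a b"
  "ip a (c *\<^sub>C b) = c * ip a b" "ip (a - b) d = ip a d - ip b d" "ip a (b - d) = ip a b - ip a d"
  "ip 0 a = 0" "ip a 0 = 0"
  by (simp_all add: ip_def star_add star_diff star_cscale distrib_left distrib_right left_diff_distrib
      right_diff_distrib f_simps)

lemma ip_sum: "ip a (sum g S) = (\<Sum>i\<in>S. ip a (g i))" "ip (sum g S) a = (\<Sum>i\<in>S. ip (g i) a)"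
  by (simp_all add: ip_def star_sum sum_distrib_left sum_distrib_right f_sum)

lemma ip_pos: "Im (ip a a) = 0" "0 \<le> Re (ip a a)"
  using f by (auto simp: positive_functional_def ip_def)

lemma ip_cnj: "cnj (ip a b) = ip b a"
proof -
  have 1: "Im (ip a b) + Im (ip b a) = 0"
    using ip_pos(1)[of "a + b"] ip_pos(1)[of a] ip_pos(1)[of b] by (simp add: ip_simps)
  have 2: "Re (ip a b) - Re (ip b a) = 0"
    using ip_pos(1)[of "a + \<i> *\<^sub>C b"] ip_pos(1)[of a] ip_pos(1)[of b] by (simp add: ip_simps)
  show ?thesis using 1 2 by (auto simp: complex_eq_iff)
qed

lemma ip_mult_left: "ip (a * b) d = ip b (star a * d)"
  by (simp add: ip_def star_mult mult.assoc)

text \<open>The difference of the two sides is \<open>\<langle>s b, s b\<rangle>\<close> for a square root \<open>s\<close> of \<open>\<parallel>a\<parallel>\<^sup>2 - a* a\<close>.\<close>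

lemma ip_mult_le: "Re (ip (a * b) (a * b)) \<le> (norm a)\<^sup>2 * Re (ip b b)"
proof -
  have "cpos ((norm a)\<^sup>2 *\<^sub>R 1 - star a * a)"
    by (rule cpos_norm_diff) (simp_all add: star_mult norm_star_mult)
  then obtain s where s: "cpos s" "s * s = (norm a)\<^sup>2 *\<^sub>R 1 - star a * a" using cpos_sqrt by blast
  have "ip (s * b) (s * b) = f (star b * (s * s) * b)"
    by (simp add: ip_def star_mult cpos_selfadj[OF s(1)] mult.assoc)
  also have "\<dots> = complex_of_real ((norm a)\<^sup>2) * ip b b - ip (a * b) (a * b)"
    unfolding s(2)
    by (simp add: ip_def star_mult left_diff_distrib right_diff_distrib f_simps mult.assoc flip: cscale_of_real)
  finally have "Re (ip (s * b) (s * b)) = (norm a)\<^sup>2 * Re (ip b b) - Re (ip (a * b) (a * b))" by simp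
  then show ?thesis using ip_pos(2)[of "s * b"] by simp
qed

end

text \<open>Instead of completing a quotient by null vectors, the Hilbert space of the positive form is
realized on square-summable functions by means of an orthonormal family with total span, given by
the index set \<open>I\<close>.  The representation is zero on the coordinates outside \<open>I\<close>.\<close>

locale gns = positive_form f for f :: "'c::cstar \<Rightarrow> complex" +
  fixes e :: "'i \<Rightarrow> 'c" and I :: "'i set"
  assumes ortho: "\<And>i j. i \<in> I \<Longrightarrow> j \<in> I \<Longrightarrow> f (star (e i) * e j) = (if i = j then 1 else 0)"
    and off: "\<And>i. i \<notin> I \<Longrightarrow> e i = 0"
    and total: "\<And>a \<epsilon>. \<epsilon> > 0 \<Longrightarrow> \<exists>F c. finite F \<and> F \<subseteq> I \<and>
      Re (f (star (a - (\<Sum>i\<in>F. c i *\<^sub>C e i)) * (a - (\<Sum>i\<in>F. c i *\<^sub>C e i)))) \<le> \<epsilon>"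
begin

lemma ip_e: "ip (e i) (e j) = (if i = j \<and> i \<in> I then 1 else 0)"
  using ortho[of i j] off[of i] off[of j] by (cases "i \<in> I"; cases "j \<in> I") (auto simp: ip_def f_simps)

text \<open>The Fourier coefficients, i.e. the canonical map of the algebra to its Hilbert space.\<close>

definition V :: "'c \<Rightarrow> 'i \<Rightarrow> complex" where "V a = (\<lambda>i. ip (e i) a)"

lemma V_simps: "V (a + b) = (\<lambda>i. V a i + V b i)" "V (c *\<^sub>C a) = (\<lambda>i. c * V a i)"
  by (simp_all add: V_def ip_simps)

lemma V_off: "i \<notin> I \<Longrightarrow> V a i = 0"
  by (simp add: V_def off ip_simps)

text \<open>The squared distance to a linear combination, split by Pythagoras into the distance to the span and
the deviation of the coefficients from the Fourier coefficients.\<close>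

lemma ip_residual:
  assumes F: "finite F" "F \<subseteq> I"
  shows "Re (ip (a - (\<Sum>i\<in>F. c i *\<^sub>C e i)) (a - (\<Sum>i\<in>F. c i *\<^sub>C e i))) =
    Re (ip a a) - (\<Sum>i\<in>F. (cmod (V a i))\<^sup>2) + (\<Sum>i\<in>F. (cmod (c i - V a i))\<^sup>2)"
proof -
  let ?s = "\<Sum>i\<in>F. c i *\<^sub>C e i"
  have as: "ip a ?s = (\<Sum>i\<in>F. c i * cnj (V a i))"
    by (simp add: ip_sum ip_simps V_def ip_cnj)
  have sa: "ip ?s a = (\<Sum>i\<in>F. cnj (c i) * V a i)"
    by (simp add: ip_sum ip_simps V_def)
  have ss: "ip ?s ?s = (\<Sum>i\<in>F. c i * cnj (c i))"
  proof -
    have "(\<Sum>j\<in>F. c j * ip (e i) (e j)) = c i" if "i \<in> F" for i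
    proof -
      have "(\<Sum>j\<in>F. c j * ip (e i) (e j)) = (\<Sum>j\<in>F. if i = j then c j else 0)"
        using that F by (intro sum.cong) (auto simp: ip_e)
      then show ?thesis using F that by simp
    qed
    then have "(\<Sum>i\<in>F. cnj (c i) * (\<Sum>j\<in>F. c j * ip (e i) (e j))) = (\<Sum>i\<in>F. c i * cnj (c i))"
      by (intro sum.cong) (simp_all add: mult.commute)
    moreover have "ip ?s ?s = (\<Sum>i\<in>F. cnj (c i) * (\<Sum>j\<in>F. c j * ip (e i) (e j)))"
      unfolding ip_sum(2)[of "\<lambda>i. c i *\<^sub>C e i" F] by (simp add: ip_simps ip_sum(1) sum_distrib_left mult.left_commute)
    ultimately show ?thesis by simp
  qed
  have "ip (a - ?s) (a - ?s) = ip a a + (ip ?s ?s - ip a ?s - ip ?s a)" by (simp add: ip_simps)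
  also have "ip ?s ?s - ip a ?s - ip ?s a = (\<Sum>i\<in>F. (c i - V a i) * cnj (c i - V a i) - V a i * cnj (V a i))"
    unfolding as sa ss by (simp add: sum_subtractf[symmetric] algebra_simps)
  finally have "ip (a - ?s) (a - ?s) = ip a a + complex_of_real (\<Sum>i\<in>F. (cmod (c i - V a i))\<^sup>2 - (cmod (V a i))\<^sup>2)"
    by (simp add: complex_norm_square[symmetric] del: complex_cnj_diff)
  then show ?thesis by (simp add: sum_subtractf)
qed

text \<open>Bessel's inequality, and Parseval's equation because the family is total.\<close>

lemma V_ell2: "V a \<in> ell2" and V_norm: "(ell2_norm (V a))\<^sup>2 = Re (ip a a)"
proof -
  have bessel: "l2 (V a) F \<le> sqrt (Re (ip a a))" if F: "finite F" for F
  proof -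
    have "(\<Sum>i\<in>F. (cmod (V a i))\<^sup>2) = (\<Sum>i\<in>F \<inter> I. (cmod (V a i))\<^sup>2)"
      using F by (intro sum.mono_neutral_right) (auto simp: V_off)
    also have "\<dots> \<le> Re (ip a a)"
      using ip_residual[of "F \<inter> I" a "V a"] ip_pos(2)[of "a - (\<Sum>i\<in>F \<inter> I. V a i *\<^sub>C e i)"] F by simp
    finally show ?thesis by (simp add: L2_set_def)
  qed
  show E: "V a \<in> ell2" by (rule ell2_normI(1)[OF bessel])
  have s: "(\<lambda>i. (cmod (V a i))\<^sup>2) summable_on UNIV" using E by (simp add: ell2_def)
  show "(ell2_norm (V a))\<^sup>2 = Re (ip a a)"
  proof (rule antisym)
    have "(ell2_norm (V a))\<^sup>2 \<le> (sqrt (Re (ip a a)))\<^sup>2" by (rule power_mono[OF ell2_normI(2)[OF bessel] ell2_norm_ge_0])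
    then show "(ell2_norm (V a))\<^sup>2 \<le> Re (ip a a)" by (simp add: ip_pos)
    show "Re (ip a a) \<le> (ell2_norm (V a))\<^sup>2"
    proof (rule field_le_epsilon)
      fix \<epsilon> :: real assume "\<epsilon> > 0"
      then obtain F c where F: "finite F" "F \<subseteq> I" and le: "Re (ip (a - (\<Sum>i\<in>F. c i *\<^sub>C e i)) (a - (\<Sum>i\<in>F. c i *\<^sub>C e i))) \<le> \<epsilon>"
        using total[of \<epsilon> a] by (auto simp: ip_def)
      have "Re (ip a a) - (\<Sum>i\<in>F. (cmod (V a i))\<^sup>2) \<le> \<epsilon>"
        using ip_residual[OF F, of a c] le sum_nonneg[of F "\<lambda>i. (cmod (c i - V a i))\<^sup>2"] by simp
      moreover have "(\<Sum>i\<in>F. (cmod (V a i))\<^sup>2) \<le> (ell2_norm (V a))\<^sup>2"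
        unfolding ell2_norm_squared by (rule finite_sum_le_infsum[OF s F(1)]) auto
      ultimately show "Re (ip a a) \<le> (ell2_norm (V a))\<^sup>2 + \<epsilon>" by simp
    qed
  qed
qed

lemma V_inner: "ell2_inner (V a) (V b) = ip a b"
proof -
  define D where "D a b = ell2_inner (V a) (V b) - ip a b" for a b
  have D_simps: "D (a + b) d = D a d + D b d" "D a (b + d) = D a b + D a d" "D (c *\<^sub>C a) b = cnj c * D a b"
    "D a (c *\<^sub>C b) = c * D a b" for a b c d
    by (simp_all add: D_def V_simps ell2_inner_simps V_ell2 ip_simps algebra_simps)
  have D0: "D a a = 0" for a
  proof -
    have "ip a a = complex_of_real (Re (ip a a))" using ip_pos(1)[of a] by (simp add: complex_eq_iff)
    then show ?thesis by (simp add: D_def ell2_inner_self V_ell2 V_norm)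
  qed
  have "D a b + D b a = 0" using D0[of "a + b"] D0[of a] D0[of b] by (simp add: D_simps add.commute)
  moreover have "D a b - D b a = 0"
  proof -
    have "\<i> * (D a b - D b a) = 0"
      using D0[of "a + \<i> *\<^sub>C b"] D0[of a] D0[of b] by (simp add: D_simps algebra_simps)
    then show ?thesis by simp
  qed
  ultimately have "2 * D a b = 0" by (simp add: algebra_simps)
  then show ?thesis by (simp add: D_def)
qed

text \<open>The values are prescribed by \<open>\<langle>e\<^sub>i, \<pi>(a) h\<rangle> = \<langle>a* e\<^sub>i, h\<rangle>\<close>, which makes sense for all \<open>h\<close>
without extending by continuity.\<close>

definition \<pi> :: "'c \<Rightarrow> 'i operator" where
  "\<pi> a h = (\<lambda>i. ell2_inner (V (star a * e i)) h)"

lemma pi_V: "\<pi> a (V b) = V (a * b)"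
  by (simp add: \<pi>_def V_inner ip_mult_left) (simp add: V_def)

definition supp_part :: "('i \<Rightarrow> complex) \<Rightarrow> 'i \<Rightarrow> complex" where
  "supp_part h = (\<lambda>i. if i \<in> I then h i else 0)"

lemma supp_part_ell2: "h \<in> ell2 \<Longrightarrow> supp_part h \<in> ell2" and supp_part_norm: "h \<in> ell2 \<Longrightarrow> ell2_norm (supp_part h) \<le> ell2_norm h"
proof -
  assume h: "h \<in> ell2"
  have "l2 (supp_part h) F \<le> ell2_norm h" if "finite F" for F
    by (rule order_trans[OF L2_set_mono l2_le_norm[OF h that]]) (auto simp: supp_part_def)
  then show "supp_part h \<in> ell2" "ell2_norm (supp_part h) \<le> ell2_norm h" using ell2_normI by blast+
qed

lemma inner_supp_part: assumes "\<And>i. i \<notin> I \<Longrightarrow> u i = 0"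
  shows "ell2_inner u (supp_part h) = ell2_inner u h" "ell2_inner (supp_part h) u = ell2_inner h u"
  unfolding ell2_inner_def supp_part_def using assms by (auto intro!: infsum_cong)

lemma pi_supp_part: "\<pi> a (supp_part h) = \<pi> a h"
  by (simp add: \<pi>_def inner_supp_part V_off)

lemma pi_off: "i \<notin> I \<Longrightarrow> \<pi> a h i = 0"
proof -
  assume "i \<notin> I"
  then have "V (star a * e i) = (\<lambda>_. 0)" by (simp add: off V_def ip_simps)
  then show ?thesis by (simp add: \<pi>_def)
qed

text \<open>The canonical map has dense range in the functions supported on \<open>I\<close>; finite Fourier sums realize it.\<close>

lemma V_dense:
  assumes h: "h \<in> ell2" and \<epsilon>: "\<epsilon> > 0"
  shows "\<exists>b. ell2_norm (\<lambda>i. supp_part h i + (- 1) * V b i) \<le> \<epsilon> \<and> ell2_norm (V b) \<le> ell2_norm h"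
proof -
  obtain F where F: "finite F" "ell2_norm (\<lambda>i. if i \<in> F then 0 else supp_part h i) \<le> \<epsilon>"
    using ell2_tail[OF supp_part_ell2[OF h] \<epsilon>] by blast
  define b where "b = (\<Sum>i\<in>F. h i *\<^sub>C e i)"
  have Vb: "V b i = (if i \<in> F then supp_part h i else 0)" for i
  proof -
    have "V b i = (\<Sum>j\<in>F. h j * ip (e i) (e j))" by (simp add: V_def b_def ip_sum ip_simps)
    also have "\<dots> = (\<Sum>j\<in>F. if i = j then supp_part h j else 0)"
      by (intro sum.cong) (auto simp: ip_e supp_part_def)
    finally show ?thesis using F(1) by simp
  qed
  have "(\<lambda>i. supp_part h i + (- 1) * V b i) = (\<lambda>i. if i \<in> F then 0 else supp_part h i)"
    by (rule ext) (simp add: Vb)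
  moreover have "ell2_norm (V b) \<le> ell2_norm h"
  proof (rule ell2_normI(2))
    fix K :: "'i set" assume "finite K"
    then show "l2 (V b) K \<le> ell2_norm h"
      by (intro order_trans[OF L2_set_mono l2_le_norm[OF h]]) (auto simp: Vb supp_part_def)
  qed
  ultimately show ?thesis using F(2) by (intro exI[of _ b] conjI) (simp_all only:)
qed

lemma pi_linear:
  assumes "h \<in> ell2" "k \<in> ell2"
  shows "\<pi> a (\<lambda>i. h i + k i) = (\<lambda>i. \<pi> a h i + \<pi> a k i)" "\<pi> a (\<lambda>i. c * h i) = (\<lambda>i. c * \<pi> a h i)"
  by (simp_all add: \<pi>_def ell2_inner_simps V_ell2 assms)

lemma V_norm_mult: "ell2_norm (V (a * b)) \<le> norm a * ell2_norm (V b)"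
proof (rule power2_le_imp_le)
  show "(ell2_norm (V (a * b)))\<^sup>2 \<le> (norm a * ell2_norm (V b))\<^sup>2"
    by (simp add: V_norm power_mult_distrib ip_mult_le)
qed simp

text \<open>On the range of \<open>V\<close> this is \<open>V_norm_mult\<close>.  For general \<open>h\<close>, finitely many coordinates at a time are
approximated: each coordinate of \<open>\<pi> a h\<close> is a continuous function of \<open>h\<close>.\<close>

lemma pi_bounded: "bounded_operator (\<pi> a)" and pi_norm: "h \<in> ell2 \<Longrightarrow> ell2_norm (\<pi> a h) \<le> norm a * ell2_norm h"
proof -
  have *: "l2 (\<pi> a h) K \<le> norm a * ell2_norm h" if h: "h \<in> ell2" and K: "finite K" for h K
  proof (rule field_le_epsilon)
    fix \<epsilon> :: real assume \<epsilon>: "\<epsilon> > 0"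
    define C where "C = (\<Sum>i\<in>K. ell2_norm (V (star a * e i))) + 1"
    have C: "C > 0" unfolding C_def by (intro add_nonneg_pos sum_nonneg) auto
    obtain b where b: "ell2_norm (\<lambda>i. supp_part h i + (- 1) * V b i) \<le> \<epsilon> / C" "ell2_norm (V b) \<le> ell2_norm h"
      using V_dense[OF h, of "\<epsilon> / C"] \<epsilon> C by auto
    let ?r = "\<lambda>i. supp_part h i + (- 1) * V b i"
    have re: "?r \<in> ell2" by (intro ell2_add ell2_scale supp_part_ell2 h V_ell2)
    have "supp_part h = (\<lambda>i. V b i + ?r i)" by auto
    then have "\<pi> a h = (\<lambda>i. \<pi> a (V b) i + \<pi> a ?r i)" using pi_linear(1)[OF V_ell2 re, of a b] pi_supp_part[of a h] by simp
    then have "l2 (\<pi> a h) K \<le> L2_set (\<lambda>i. cmod (\<pi> a (V b) i) + cmod (\<pi> a ?r i)) K"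
      by (simp only:) (intro L2_set_mono norm_triangle_ineq norm_ge_zero)
    also have "\<dots> \<le> l2 (\<pi> a (V b)) K + l2 (\<pi> a ?r) K" by (rule L2_set_triangle_ineq)
    also have "l2 (\<pi> a (V b)) K \<le> norm a * ell2_norm h" unfolding pi_V
      by (rule order_trans[OF l2_le_norm[OF V_ell2 K] order_trans[OF V_norm_mult mult_left_mono[OF b(2)]]]) simp
    also have "l2 (\<pi> a ?r) K \<le> (\<Sum>i\<in>K. cmod (\<pi> a ?r i))" by (rule L2_set_le_sum) simp
    also have "\<dots> \<le> (\<Sum>i\<in>K. ell2_norm (V (star a * e i)) * (\<epsilon> / C))" unfolding \<pi>_def
      by (intro sum_mono order_trans[OF ell2_inner_summable(2)[OF V_ell2 re] mult_left_mono[OF b(1)]]) simp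
    also have "\<dots> \<le> C * (\<epsilon> / C)" unfolding sum_distrib_right[symmetric]
      using \<epsilon> C by (intro mult_right_mono) (auto simp: C_def)
    also have "\<dots> = \<epsilon>" using C by simp
    finally show "l2 (\<pi> a h) K \<le> norm a * ell2_norm h + \<epsilon>" by simp
  qed
  show "ell2_norm (\<pi> a h) \<le> norm a * ell2_norm h" if "h \<in> ell2" by (rule ell2_normI(2)[OF *[OF that]])
  then show "bounded_operator (\<pi> a)"
    using ell2_normI(2)[OF *] by (intro bounded_operatorI[where C="norm a"] pi_linear) (use ell2_normI(1)[OF *] in auto)
qed

lemmas pi_ell2 = bounded_operatorD(1)[OF pi_bounded]

text \<open>Both sides are continuous in \<open>h\<close> and depend only on its part supported on \<open>I\<close>, where the range of
\<open>V\<close> is dense.\<close>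

lemma eq_by_density:
  assumes h: "h \<in> ell2"
    and u: "u \<in> ell2" "\<And>i. i \<notin> I \<Longrightarrow> u i = 0"
    and w: "w \<in> ell2"
    and eq: "\<And>b. ell2_inner u (V b) = ell2_inner w (\<pi> a (V b))"
  shows "ell2_inner u h = ell2_inner w (\<pi> a h)"
proof -
  have "cmod (ell2_inner u h - ell2_inner w (\<pi> a h)) \<le> 0"
  proof (rule field_le_epsilon)
    fix \<epsilon> :: real assume \<epsilon>: "\<epsilon> > 0"
    define C where "C = ell2_norm u + ell2_norm w * norm a + 1"
    have C: "C > 0" unfolding C_def by (intro add_nonneg_pos add_nonneg_nonneg mult_nonneg_nonneg) auto
    obtain b where b: "ell2_norm (\<lambda>i. supp_part h i + (- 1) * V b i) \<le> \<epsilon> / C"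
      using V_dense[OF h, of "\<epsilon> / C"] \<epsilon> C by auto
    let ?r = "\<lambda>i. supp_part h i + (- 1) * V b i"
    have re: "?r \<in> ell2" by (intro ell2_add ell2_scale supp_part_ell2 h V_ell2)
    have h': "supp_part h = (\<lambda>i. V b i + ?r i)" by auto
    have "ell2_inner u h = ell2_inner u (V b) + ell2_inner u ?r"
      using inner_supp_part(1)[where u=u and h=h, OF u(2)] ell2_inner_simps(2)[OF u(1) V_ell2 re, of b] by (simp flip: h')
    moreover have "\<pi> a h = (\<lambda>i. \<pi> a (V b) i + \<pi> a ?r i)"
      using pi_linear(1)[OF V_ell2 re, of a b] pi_supp_part[of a h] by (simp flip: h')
    then have "ell2_inner w (\<pi> a h) = ell2_inner w (\<pi> a (V b)) + ell2_inner w (\<pi> a ?r)"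
      using ell2_inner_simps(2)[OF w pi_ell2[OF V_ell2] pi_ell2[OF re]] by simp
    ultimately have "ell2_inner u h - ell2_inner w (\<pi> a h) = ell2_inner u ?r - ell2_inner w (\<pi> a ?r)"
      using eq[of b] by simp
    then have "cmod (ell2_inner u h - ell2_inner w (\<pi> a h)) \<le> cmod (ell2_inner u ?r) + cmod (ell2_inner w (\<pi> a ?r))"
      by (simp add: norm_triangle_ineq4)
    also have "\<dots> \<le> ell2_norm u * ell2_norm ?r + ell2_norm w * (norm a * ell2_norm ?r)"
      by (intro add_mono ell2_inner_summable(2)[OF u(1) re]
          order_trans[OF ell2_inner_summable(2)[OF w pi_ell2[OF re]] mult_left_mono[OF pi_norm[OF re]]]) simp
    also have "\<dots> = (ell2_norm u + ell2_norm w * norm a) * ell2_norm ?r" by (simp add: distrib_right)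
    also have "\<dots> \<le> C * (\<epsilon> / C)" using b C by (intro mult_mono) (auto simp: C_def)
    also have "\<dots> = \<epsilon>" using C by simp
    finally show "cmod (ell2_inner u h - ell2_inner w (\<pi> a h)) \<le> 0 + \<epsilon>" by simp
  qed
  then show ?thesis by simp
qed

lemma inner_V_pi: "h \<in> ell2 \<Longrightarrow> ell2_inner (V c) (\<pi> a h) = ell2_inner (V (star a * c)) h"
  by (rule eq_by_density[symmetric]) (simp_all add: V_ell2 V_off pi_V V_inner ip_mult_left)

lemma pi_mult: "h \<in> ell2 \<Longrightarrow> \<pi> (a * b) h = \<pi> a (\<pi> b h)"
  using inner_V_pi[of h _ b] by (simp add: \<pi>_def[of "a * b"] \<pi>_def[of a] star_mult mult.assoc)

lemma pi_add: "h \<in> ell2 \<Longrightarrow> \<pi> (a + b) h = (\<lambda>i. \<pi> a h i + \<pi> b h i)"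
  by (simp add: \<pi>_def star_add distrib_right V_simps ell2_inner_simps V_ell2)

lemma pi_scale: "h \<in> ell2 \<Longrightarrow> \<pi> (c *\<^sub>C a) h = (\<lambda>i. c * \<pi> a h i)"
  by (simp add: \<pi>_def star_cscale V_simps ell2_inner_simps V_ell2)

lemma pi_star: assumes h: "h \<in> ell2" and g: "g \<in> ell2"
  shows "ell2_inner (\<pi> (star a) h) g = ell2_inner h (\<pi> a g)"
proof -
  have "ell2_inner (\<pi> a g) h = ell2_inner g (\<pi> (star a) h)"
  proof (rule eq_by_density[OF h pi_ell2[OF g] pi_off g])
    fix b
    show "ell2_inner (\<pi> a g) (V b) = ell2_inner g (\<pi> (star a) (V b))"
      using arg_cong[OF inner_V_pi[OF g, of b a], of cnj] by (simp add: ell2_inner_cnj pi_V)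
  qed
  from arg_cong[OF this, of cnj] show ?thesis by (simp add: ell2_inner_cnj)
qed

lemma pi_nonzero: assumes "f (star a * a) \<noteq> 0" shows "V 1 \<in> ell2" "\<pi> a (V 1) \<noteq> (\<lambda>i. 0)"
proof -
  show "V 1 \<in> ell2" by (rule V_ell2)
  show "\<pi> a (V 1) \<noteq> (\<lambda>i. 0)"
  proof
    assume "\<pi> a (V 1) = (\<lambda>i. 0)"
    then have "V a = (\<lambda>i. 0)" by (simp add: pi_V)
    then have "ip a a = 0" using V_inner[of a a] by simp
    then show False using assms by (simp add: ip_def)
  qed
qed

end

subsection \<open>Gram-Schmidt orthonormalization\<close>

context positive_form
begin

text \<open>The squared seminorm of the form.\<close>

definition q :: "'c \<Rightarrow> real" where "q z = Re (ip z z)"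

lemma q_nonneg: "0 \<le> q z" by (simp add: q_def ip_pos)

lemma q_0: "q 0 = 0" by (simp add: q_def ip_simps)

lemma q_add: "q (x + y) \<le> 2 * q x + 2 * q y"
  using q_nonneg[of "x - y"] by (simp add: q_def ip_simps)

lemma q_scale: "q (c *\<^sub>C x) = (cmod c)\<^sup>2 * q x"
proof -
  have "ip (c *\<^sub>C x) (c *\<^sub>C x) = (c * cnj c) * ip x x" by (simp add: ip_simps)
  also have "c * cnj c = complex_of_real ((cmod c)\<^sup>2)" using complex_norm_square[of c] by simp
  finally show ?thesis by (simp add: q_def)
qed

lemma q_le_norm: "q z \<le> (norm z)\<^sup>2 * q 1"
  using ip_mult_le[of z 1] by (simp add: q_def)

text \<open>The orthonormal vectors obtained from the first terms of a sequence.  Residues of seminorm zero are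
skipped: they contribute nothing to the Hilbert space.\<close>

primrec gs :: "(nat \<Rightarrow> 'c) \<Rightarrow> nat \<Rightarrow> 'c set" where
  "gs d 0 = {}"
| "gs d (Suc n) = (let r = d n - (\<Sum>x\<in>gs d n. ip x (d n) *\<^sub>C x) in
     if q r = 0 then gs d n else insert (complex_of_real (1 / sqrt (q r)) *\<^sub>C r) (gs d n))"

definition orthonormal :: "'c set \<Rightarrow> bool" where
  "orthonormal E \<longleftrightarrow> (\<forall>x\<in>E. \<forall>y\<in>E. ip x y = (if x = y then 1 else 0))"

lemma gs_step:
  assumes E: "finite E" "orthonormal E" and r: "r = d - (\<Sum>x\<in>E. ip x d *\<^sub>C x)"
    and qr: "q r \<noteq> 0" and u: "u = complex_of_real (1 / sqrt (q r)) *\<^sub>C r"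
  shows "orthonormal (insert u E)" "u \<notin> E" "d = (\<Sum>x\<in>insert u E. (if x = u then complex_of_real (sqrt (q r)) else ip x d) *\<^sub>C x)"
proof -
  have qp: "q r > 0" using qr q_nonneg[of r] by simp
  have xr: "ip x r = 0" if x: "x \<in> E" for x
  proof -
    have "(\<Sum>y\<in>E. ip y d * ip x y) = (\<Sum>y\<in>E. if x = y then ip y d else 0)"
      using E(2) x by (intro sum.cong) (auto simp: orthonormal_def)
    then show ?thesis using E(1) x by (simp add: r ip_simps ip_sum)
  qed
  then have xu: "ip x u = 0" "ip u x = 0" if "x \<in> E" for x
    using that ip_cnj[of x u] by (auto simp: u ip_simps)
  have rr: "ip r r = complex_of_real (q r)" using ip_pos(1)[of r] by (simp add: q_def complex_eq_iff)
  have "ip u u = complex_of_real ((1 / sqrt (q r)) * (1 / sqrt (q r)) * q r)"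
    unfolding u ip_simps(3,4) rr complex_cnj_complex_of_real by (simp only: of_real_mult mult.assoc)
  also have "(1 / sqrt (q r)) * (1 / sqrt (q r)) * q r = 1"
    using qp by (simp add: field_simps)
  finally have uu: "ip u u = 1" by simp
  show "u \<notin> E" using xu uu by force
  then show "orthonormal (insert u E)" using E(2) uu xu by (auto simp: orthonormal_def)
  have "complex_of_real (sqrt (q r)) *\<^sub>C u = r"
    unfolding u cscale_cscale of_real_mult[symmetric] using qp by simp
  moreover have "(\<Sum>x\<in>E. (if x = u then complex_of_real (sqrt (q r)) else ip x d) *\<^sub>C x) = (\<Sum>x\<in>E. ip x d *\<^sub>C x)"
    using \<open>u \<notin> E\<close> by (intro sum.cong) auto
  ultimately have "(\<Sum>x\<in>insert u E. (if x = u then complex_of_real (sqrt (q r)) else ip x d) *\<^sub>C x) = r + (\<Sum>x\<in>E. ip x d *\<^sub>C x)"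
    using E(1) \<open>u \<notin> E\<close> by simp
  moreover have "d = r + (\<Sum>x\<in>E. ip x d *\<^sub>C x)" by (simp add: r)
  ultimately show "d = (\<Sum>x\<in>insert u E. (if x = u then complex_of_real (sqrt (q r)) else ip x d) *\<^sub>C x)"
    by simp
qed

lemma gs_orthonormal: "finite (gs d n) \<and> orthonormal (gs d n)"
proof (induction n)
  case (Suc n)
  then show ?case using gs_step(1)[OF _ _ refl _ refl, of "gs d n" "d n"] by (simp add: Let_def)
qed (simp add: orthonormal_def)

lemma gs_mono: "m \<le> n \<Longrightarrow> gs d m \<subseteq> gs d n"
  by (induction n rule: dec_induct) (auto simp: Let_def)

text \<open>The vectors stay inside any subspace that contains the sequence; this keeps them inside the direct
summand under consideration.\<close>

lemma gs_closed:
  assumes "\<And>n. d n \<in> S" "0 \<in> S" "\<And>x y. x \<in> S \<Longrightarrow> y \<in> S \<Longrightarrow> x + y \<in> S" "\<And>c x. x \<in> S \<Longrightarrow> c *\<^sub>C x \<in> S"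
  shows "gs d n \<subseteq> S"
proof (induction n)
  case (Suc n)
  have sum: "(\<Sum>x\<in>F. c x *\<^sub>C x) \<in> S" if "finite F" "F \<subseteq> S" for F and c :: "'c \<Rightarrow> complex"
    using that by (induction F rule: finite_induct) (use assms in auto)
  have "(\<Sum>x\<in>gs d n. ip x (d n) *\<^sub>C x) \<in> S" using gs_orthonormal Suc by (intro sum) auto
  then have "(- 1) *\<^sub>C (\<Sum>x\<in>gs d n. ip x (d n) *\<^sub>C x) \<in> S" by (rule assms)
  then have "d n + (- 1) *\<^sub>C (\<Sum>x\<in>gs d n. ip x (d n) *\<^sub>C x) \<in> S" by (rule assms(3)[OF assms(1)])
  then have "d n - (\<Sum>x\<in>gs d n. ip x (d n) *\<^sub>C x) \<in> S" by (simp add: cscale_minus_left)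
  then show ?case using Suc assms(4) by (auto simp: Let_def)
qed simp

definition combos :: "'c set \<Rightarrow> 'c set" where
  "combos E = {w. \<exists>F c. finite F \<and> F \<subseteq> E \<and> w = (\<Sum>x\<in>F. c x *\<^sub>C x)}"

lemma combosI: "finite F \<Longrightarrow> F \<subseteq> E \<Longrightarrow> (\<Sum>x\<in>F. c x *\<^sub>C x) \<in> combos E"
  by (auto simp: combos_def)

lemma combos_add: assumes "v \<in> combos E" "w \<in> combos E" shows "v + w \<in> combos E"
proof -
  obtain F c where F: "finite F" "F \<subseteq> E" "v = (\<Sum>x\<in>F. c x *\<^sub>C x)" using assms by (auto simp: combos_def)
  obtain G d where G: "finite G" "G \<subseteq> E" "w = (\<Sum>x\<in>G. d x *\<^sub>C x)" using assms by (auto simp: combos_def)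
  have "v = (\<Sum>x\<in>F \<union> G. (if x \<in> F then c x else 0) *\<^sub>C x)" "w = (\<Sum>x\<in>F \<union> G. (if x \<in> G then d x else 0) *\<^sub>C x)"
    unfolding F(3) G(3) using F(1) G(1) by (intro sum.mono_neutral_cong_left; auto)+
  then have "v + w = (\<Sum>x\<in>F \<union> G. ((if x \<in> F then c x else 0) + (if x \<in> G then d x else 0)) *\<^sub>C x)"
    by (simp only: sum.distrib cscale_add_left)
  then show ?thesis using combosI[of "F \<union> G" E] F G by simp
qed

lemma combos_scale: assumes "v \<in> combos E" shows "c *\<^sub>C v \<in> combos E"
proof -
  obtain F d where F: "finite F" "F \<subseteq> E" "v = (\<Sum>x\<in>F. d x *\<^sub>C x)" using assms by (auto simp: combos_def)
  have "c *\<^sub>C v = (\<Sum>x\<in>F. (c * d x) *\<^sub>C x)" by (simp add: F cscale_sum_right)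
  then show ?thesis using combosI[OF F(1,2)] by simp
qed

definition approximable :: "'c set \<Rightarrow> 'c set" where
  "approximable E = {z. \<forall>\<epsilon>>0. \<exists>w\<in>combos E. q (z - w) \<le> \<epsilon>}"

lemma approximable_near:
  assumes "\<And>\<epsilon>. \<epsilon> > 0 \<Longrightarrow> \<exists>y\<in>approximable E. q (z - y) \<le> \<epsilon>" shows "z \<in> approximable E"
  unfolding approximable_def
proof (intro CollectI allI impI)
  fix \<epsilon> :: real assume e: "\<epsilon> > 0"
  obtain y where y: "y \<in> approximable E" "q (z - y) \<le> \<epsilon> / 4" using assms[of "\<epsilon> / 4"] e by auto
  obtain w where w: "w \<in> combos E" "q (y - w) \<le> \<epsilon> / 4"
    using y(1) e unfolding approximable_def by (auto dest!: spec[of _ "\<epsilon> / 4"])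
  have "q (z - w) \<le> \<epsilon>" using q_add[of "z - y" "y - w"] y w by simp
  then show "\<exists>w\<in>combos E. q (z - w) \<le> \<epsilon>" using w by blast
qed

lemma approximable_add: assumes "y \<in> approximable E" "z \<in> approximable E" shows "y + z \<in> approximable E"
  unfolding approximable_def
proof (intro CollectI allI impI)
  fix \<epsilon> :: real assume e: "\<epsilon> > 0"
  obtain v where v: "v \<in> combos E" "q (y - v) \<le> \<epsilon> / 4"
    using assms(1) e unfolding approximable_def by (auto dest!: spec[of _ "\<epsilon> / 4"])
  obtain w where w: "w \<in> combos E" "q (z - w) \<le> \<epsilon> / 4"
    using assms(2) e unfolding approximable_def by (auto dest!: spec[of _ "\<epsilon> / 4"])
  have eq: "(y + z) - (v + w) = (y - v) + (z - w)" by simp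
  have "q ((y + z) - (v + w)) \<le> \<epsilon>" unfolding eq using q_add[of "y - v" "z - w"] v w by linarith
  then show "\<exists>w\<in>combos E. q (y + z - w) \<le> \<epsilon>" using combos_add[OF v(1) w(1)] by blast
qed

lemma approximable_scale: assumes "z \<in> approximable E" shows "c *\<^sub>C z \<in> approximable E"
  unfolding approximable_def
proof (intro CollectI allI impI)
  fix \<epsilon> :: real assume e: "\<epsilon> > 0"
  define \<delta> where "\<delta> = \<epsilon> / ((cmod c)\<^sup>2 + 1)"
  have p: "(cmod c)\<^sup>2 + 1 > 0" by (simp add: add_nonneg_pos)
  then have d: "\<delta> > 0" using e by (simp add: \<delta>_def)
  obtain w where w: "w \<in> combos E" "q (z - w) \<le> \<delta>"
    using assms d unfolding approximable_def by blast
  have "q (c *\<^sub>C z - c *\<^sub>C w) = (cmod c)\<^sup>2 * q (z - w)" by (simp flip: cscale_diff_right add: q_scale)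
  also have "\<dots> \<le> ((cmod c)\<^sup>2 + 1) * \<delta>" using w(2) d by (intro mult_mono q_nonneg) auto
  also have "\<dots> = \<epsilon>" using p unfolding \<delta>_def by (intro nonzero_mult_div_cancel_left[of _ \<epsilon>, unfolded times_divide_eq_right[symmetric]]) simp
  finally show "\<exists>w\<in>combos E. q (c *\<^sub>C z - w) \<le> \<epsilon>" using combos_scale[OF w(1)] by blast
qed

lemma approximable_sum:
  assumes "finite F" "\<And>i. i \<in> F \<Longrightarrow> g i \<in> approximable E" shows "(\<Sum>i\<in>F. c i *\<^sub>C g i) \<in> approximable E"
  using assms
proof (induction F rule: finite_induct)
  case empty
  have "0 \<in> combos E" using combosI[of "{}" E] by simp
  then show ?case unfolding approximable_def by (auto intro!: bexI[of _ 0] simp: q_0)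
qed (simp add: approximable_add approximable_scale)

lemma gs_approximable: "d n \<in> approximable (\<Union>n. gs d n)"
proof -
  let ?r = "d n - (\<Sum>x\<in>gs d n. ip x (d n) *\<^sub>C x)"
  note gsn = gs_orthonormal[of d n, THEN conjunct1] gs_orthonormal[of d n, THEN conjunct2]
  have "\<exists>w\<in>combos (\<Union>n. gs d n). q (d n - w) = 0"
  proof (cases "q ?r = 0")
    case True
    moreover have "(\<Sum>x\<in>gs d n. ip x (d n) *\<^sub>C x) \<in> combos (\<Union>n. gs d n)" by (rule combosI[OF gsn(1)]) blast
    ultimately show ?thesis by (rule bexI)
  next
    case False
    let ?u = "complex_of_real (1 / sqrt (q ?r)) *\<^sub>C ?r"
    have "insert ?u (gs d n) = gs d (Suc n)" using False by (simp add: Let_def)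
    then have sub: "insert ?u (gs d n) \<subseteq> (\<Union>n. gs d n)" by blast
    have "d n \<in> combos (\<Union>n. gs d n)"
      by (subst gs_step(3)[OF gsn refl False refl]) (rule combosI[OF _ sub], simp add: gsn)
    then show ?thesis by (intro bexI[of _ "d n"]) (simp_all add: q_0)
  qed
  then show ?thesis unfolding approximable_def by force
qed

lemma gs_union_orthonormal: "orthonormal (\<Union>n. gs d n)"
  unfolding orthonormal_def
proof (intro ballI)
  fix x y assume "x \<in> (\<Union>n. gs d n)" "y \<in> (\<Union>n. gs d n)"
  then obtain m n where "x \<in> gs d m" "y \<in> gs d n" by blast
  then have "x \<in> gs d (max m n)" "y \<in> gs d (max m n)" using gs_mono[of m "max m n" d] gs_mono[of n "max m n" d] by auto
  then show "ip x y = (if x = y then 1 else 0)"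
    using gs_orthonormal[of d "max m n"] by (auto simp: orthonormal_def)
qed

end

text \<open>The carrier type of \<open>A\<close> itself indexes the basis: the orthonormal vectors are elements of \<open>A\<close>, and
an element is its own index.  Density of the sequence in norm implies density for the form.\<close>

theorem separating_representation:
  fixes A :: "'a cstar_algebra" and d :: "nat \<Rightarrow> 'a"
  assumes A: "cstar_algebra A" and d: "\<And>n. d n \<in> carrier A"
    and dense: "\<And>x \<delta>. x \<in> carrier A \<Longrightarrow> \<delta> > 0 \<Longrightarrow>
      \<exists>F c. finite F \<and> norm (sec A x - (\<Sum>n\<in>F. c n *\<^sub>C sec A (d n))) < \<delta>"
    and a: "a \<in> carrier A" "a \<noteq> \<zero>\<^bsub>A\<^esub>"
  shows "\<exists>(\<pi> :: 'a \<Rightarrow> 'a operator) h. representation A \<pi> \<and> h \<in> ell2 \<and> \<pi> a h \<noteq> (\<lambda>i. 0)"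
proof -
  note st = cstar_star[OF A]
  interpret A: star_algebra A by (rule st)
  have z: "sec A \<zero>\<^bsub>A\<^esub> = 0" by (rule sec_simps(5)[OF A a(1)])
  have "sec A a \<noteq> 0" using sec_inj[OF A a(1) A.rs(2)] a(2) z by simp
  then obtain f0 where f0: "positive_functional f0" "f0 (star (sec A a) * sec A a) \<noteq> 0"
    using exists_positive_functional by blast
  let ?m = "\<lambda>F. sec A (ev A F)"
  have m: "star_morphism ?m"
    unfolding star_morphism_def using A by (simp add: sec_simps[OF A])
  note ms = morphism_simps[OF m]
  \<comment> \<open>Composition with the projection to the summand \<open>A\<close>, so that the elements of \<open>A\<close> suffice for a total family.\<close>
  define f where "f F = f0 (?m F)" for F
  have pf: "positive_functional f"
    using f0(1) by (simp add: positive_functional_def f_def ms)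
  interpret positive_form f by standard (rule pf)
  let ?D = "\<lambda>n. sec A (d n)"
  define E where "E = (\<Union>n. gs ?D n)"
  have S: "range ?m = sec A ` carrier A"
  proof
    show "range ?m \<subseteq> sec A ` carrier A" using A by auto
    show "sec A ` carrier A \<subseteq> range ?m"
    proof
      fix y assume "y \<in> sec A ` carrier A"
      then obtain x where "x \<in> carrier A" "y = sec A x" by blast
      then have "y = ?m (sec A x)" by (simp add: A)
      then show "y \<in> range ?m" by blast
    qed
  qed
  have ES: "E \<subseteq> sec A ` carrier A"
  proof -
    have "gs ?D n \<subseteq> range ?m" for n
    proof (rule gs_closed)
      show "?D n \<in> range ?m" for n unfolding S using d by blast
      show "0 \<in> range ?m" by (rule range_eqI[of _ _ 0]) (simp add: ms)
      show "x + y \<in> range ?m" if "x \<in> range ?m" "y \<in> range ?m" for x y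
        using that by (auto simp flip: ms(1))
      show "c *\<^sub>C x \<in> range ?m" if "x \<in> range ?m" for c x
        using that by (auto simp flip: ms(2))
    qed
    then show ?thesis unfolding E_def S[symmetric] by blast
  qed
  have W: "x \<in> approximable E" for x
  proof (rule approximable_near)
    fix \<epsilon> :: real assume e: "\<epsilon> > 0"
    define k where "k = q 1 + 1"
    \<comment> \<open>Chosen such that \<open>q (x - y) \<le> 2 q (x - ?m x) + 2 \<delta>\<^sup>2 q 1\<close> stays below the given bound.\<close>
    define \<delta> where "\<delta> = sqrt (\<epsilon> / 2 / k)"
    have q1: "k > 0" using q_nonneg[of 1] by (simp add: k_def)
    have dl: "\<delta> > 0" "\<delta>\<^sup>2 * k = \<epsilon> / 2" using e q1 by (simp_all add: \<delta>_def)
    obtain F c where F: "finite F" "norm (?m x - (\<Sum>n\<in>F. c n *\<^sub>C ?D n)) < \<delta>"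
      using dense[of "ev A x" \<delta>] A dl by auto
    let ?y = "\<Sum>n\<in>F. c n *\<^sub>C ?D n"
    have yW: "?y \<in> approximable E"
      by (rule approximable_sum[OF F(1)]) (use gs_approximable[of ?D] in \<open>simp add: E_def\<close>)
    \<comment> \<open>The component outside the summand \<open>A\<close> is null for the form.\<close>
    have "ip (x - ?m x) (x - ?m x) = 0"
    proof -
      have "?m (?m x) = ?m x" using A by simp
      then have "?m (x - ?m x) = 0" unfolding ms(7)[of x "?m x"] by simp
      then show ?thesis using f0(1) positive_form.f_simps(3)[of f0] by (simp add: ip_def f_def ms positive_form_def)
    qed
    then have "q (x - ?m x) = 0" by (simp add: q_def)
    moreover have "q (?m x - ?y) \<le> \<delta>\<^sup>2 * k"
      by (rule order_trans[OF q_le_norm]) (use F(2) q_nonneg[of 1] in \<open>intro mult_mono power_mono; simp add: k_def\<close>)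
    ultimately have "q (x - ?y) \<le> \<epsilon>" using q_add[of "x - ?m x" "?m x - ?y"] dl by simp
    then show "\<exists>y\<in>approximable E. q (x - y) \<le> \<epsilon>" using yW by blast
  qed
  define I where "I = {x \<in> carrier A. sec A x \<in> E}"
  define e where "e x = (if x \<in> I then sec A x else 0)" for x
  interpret G: gns f e I
  proof
    show "f (star (e i) * e j) = (if i = j then 1 else 0)" if "i \<in> I" "j \<in> I" for i j
    proof -
      have "ip (sec A i) (sec A j) = (if sec A i = sec A j then 1 else 0)"
        using gs_union_orthonormal[of ?D] that by (auto simp: orthonormal_def I_def E_def)
      moreover have "sec A i = sec A j \<longleftrightarrow> i = j" using sec_inj[OF A] that by (auto simp: I_def)
      ultimately show ?thesis using that by (simp add: e_def ip_def)
    qed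
    show "e i = 0" if "i \<notin> I" for i using that by (simp add: e_def)
    fix x and \<epsilon> :: real assume "\<epsilon> > 0"
    then obtain w where w: "w \<in> combos E" "q (x - w) \<le> \<epsilon>" using W[of x] by (auto simp: approximable_def)
    then obtain F c where F: "finite F" "F \<subseteq> E" "w = (\<Sum>x\<in>F. c x *\<^sub>C x)" by (auto simp: combos_def)
    define K where "K = {x \<in> carrier A. sec A x \<in> F}"
    have bij: "bij_betw (sec A) K F"
      unfolding bij_betw_def
    proof
      show "inj_on (sec A) K" using sec_inj[OF A] by (auto simp: inj_on_def K_def)
      show "sec A ` K = F" using F(2) ES by (auto simp: K_def)
    qed
    have "w = (\<Sum>i\<in>K. c (sec A i) *\<^sub>C sec A i)"
      unfolding F(3) by (rule sum.reindex_bij_betw[OF bij, symmetric])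
    also have "\<dots> = (\<Sum>i\<in>K. c (sec A i) *\<^sub>C e i)"
      using F(2) by (intro sum.cong) (auto simp: e_def I_def K_def)
    finally have "w = (\<Sum>i\<in>K. c (sec A i) *\<^sub>C e i)" .
    moreover have "finite K" using bij F(1) bij_betw_finite by blast
    moreover have "K \<subseteq> I" using F(2) by (auto simp: K_def I_def)
    ultimately show "\<exists>F c. finite F \<and> F \<subseteq> I \<and> Re (f (star (x - (\<Sum>i\<in>F. c i *\<^sub>C e i)) * (x - (\<Sum>i\<in>F. c i *\<^sub>C e i)))) \<le> \<epsilon>"
      using w(2) by (intro exI[of _ K] exI[of _ "\<lambda>i. c (sec A i)"]) (simp add: q_def ip_def)
  qed
  have "representation A (\<lambda>x. G.\<pi> (sec A x))"
    unfolding representation_def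
    by (simp add: G.pi_bounded sec_simps[OF A] G.pi_add G.pi_scale G.pi_mult G.pi_star)
  moreover have "?m (sec A a) = sec A a" using a(1) A by simp
  then have "f (star (sec A a) * sec A a) \<noteq> 0" unfolding f_def ms(3) ms(4) using f0(2) by simp
  then have "G.V 1 \<in> ell2" "G.\<pi> (sec A a) (G.V 1) \<noteq> (\<lambda>i. 0)" by (rule G.pi_nonzero)+
  ultimately show ?thesis by blast
qed

section \<open>Two-by-two matrices\<close>

text \<open>Only the two-by-two matrices occur as a concrete target.  The indices \<open>False\<close> and \<open>True\<close> are the first
and the second one.\<close>

type_synonym mat2 = "bool \<Rightarrow> bool \<Rightarrow> complex"

text \<open>The matrices act on the span of two basis vectors.  The general index type allows these
representations to enter spatial tensor products, whose Hilbert spaces are prescribed.\<close>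

definition mat_rep :: "(bool \<Rightarrow> 'u) \<Rightarrow> mat2 \<Rightarrow> 'u operator" where
  "mat_rep \<iota> m h u = (if u = \<iota> False then m False False * h (\<iota> False) + m False True * h (\<iota> True)
     else if u = \<iota> True then m True False * h (\<iota> False) + m True True * h (\<iota> True) else 0)"

lemma two_point_norm:
  assumes "\<And>u. u \<noteq> a \<Longrightarrow> u \<noteq> b \<Longrightarrow> f u = 0"
  shows "f \<in> ell2" "ell2_norm f \<le> cmod (f a) + cmod (f b)"
proof -
  have "l2 f F \<le> cmod (f a) + cmod (f b)" if F: "finite F" for F
  proof -
    have "l2 f F \<le> (\<Sum>u\<in>F. cmod (f u))" by (rule L2_set_le_sum) simp
    also have "\<dots> \<le> (\<Sum>u\<in>{a, b}. cmod (f u))"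
    proof -
      have "(\<Sum>u\<in>F. cmod (f u)) = (\<Sum>u\<in>F \<inter> {a, b}. cmod (f u))"
        using F assms by (intro sum.mono_neutral_right) auto
      also have "\<dots> \<le> (\<Sum>u\<in>{a, b}. cmod (f u))" by (intro sum_mono2) auto
      finally show ?thesis .
    qed
    also have "\<dots> \<le> cmod (f a) + cmod (f b)" by (cases "a = b") auto
    finally show ?thesis .
  qed
  then show "f \<in> ell2" "ell2_norm f \<le> cmod (f a) + cmod (f b)" using ell2_normI by blast+
qed

lemma entry_le_norm: assumes "h \<in> ell2" shows "cmod (h u) \<le> ell2_norm h"
  using l2_le_norm[OF assms, of "{u}"] by simp

text \<open>A crude norm, equivalent to the operator norm and convenient for completeness.\<close>

definition msum :: "mat2 \<Rightarrow> real" where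
  "msum m = cmod (m False False) + cmod (m False True) + cmod (m True False) + cmod (m True True)"

context
  fixes \<iota> :: "bool \<Rightarrow> 'u"
  assumes \<iota>: "inj \<iota>"
begin

lemma iota: "\<iota> True \<noteq> \<iota> False" "\<iota> False \<noteq> \<iota> True"
  using \<iota> by (auto simp: inj_def)

lemma mat_rep_norm: assumes h: "h \<in> ell2"
  shows "mat_rep \<iota> m h \<in> ell2" "ell2_norm (mat_rep \<iota> m h) \<le> msum m * ell2_norm h"
proof -
  have z: "mat_rep \<iota> m h u = 0" if "u \<noteq> \<iota> False" "u \<noteq> \<iota> True" for u using that by (simp add: mat_rep_def)
  show "mat_rep \<iota> m h \<in> ell2" by (rule two_point_norm(1)[OF z])
  have e: "cmod (x * h u) \<le> cmod x * ell2_norm h" for x u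
    by (simp add: norm_mult mult_left_mono entry_le_norm[OF h])
  have "ell2_norm (mat_rep \<iota> m h) \<le> cmod (mat_rep \<iota> m h (\<iota> False)) + cmod (mat_rep \<iota> m h (\<iota> True))"
    by (rule two_point_norm(2)[OF z])
  also have "\<dots> \<le> (cmod (m False False) * ell2_norm h + cmod (m False True) * ell2_norm h)
      + (cmod (m True False) * ell2_norm h + cmod (m True True) * ell2_norm h)"
    by (simp add: mat_rep_def iota) (intro add_mono norm_triangle_le e)
  also have "\<dots> = msum m * ell2_norm h" by (simp add: msum_def algebra_simps)
  finally show "ell2_norm (mat_rep \<iota> m h) \<le> msum m * ell2_norm h" .
qed

lemma mat_rep_inner:
  "ell2_inner (mat_rep \<iota> m f) g = cnj (mat_rep \<iota> m f (\<iota> False)) * g (\<iota> False) + cnj (mat_rep \<iota> m f (\<iota> True)) * g (\<iota> True)"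
proof -
  have "ell2_inner (mat_rep \<iota> m f) g = (\<Sum>\<^sub>\<infinity>u\<in>{\<iota> False, \<iota> True}. cnj (mat_rep \<iota> m f u) * g u)"
    unfolding ell2_inner_def by (rule infsum_cong_neutral) (auto simp: mat_rep_def)
  then show ?thesis by (simp add: iota)
qed

end

definition M2 :: "mat2 cstar_algebra" where
  "M2 = \<lparr>carrier = UNIV, mult = (\<lambda>m n i j. m i False * n False j + m i True * n True j),
     one = (\<lambda>i j. if i = j then 1 else 0), zero = (\<lambda>i j. 0), add = (\<lambda>m n i j. m i j + n i j),
     smult = (\<lambda>c m i j. c * m i j), involution = (\<lambda>m i j. cnj (m j i)),
     cnorm = (\<lambda>m. operator_norm (mat_rep id m))\<rparr>"

lemma M2_simps:
  "carrier M2 = UNIV" "m \<otimes>\<^bsub>M2\<^esub> n = (\<lambda>i j. m i False * n False j + m i True * n True j)"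
  "\<one>\<^bsub>M2\<^esub> = (\<lambda>i j. if i = j then 1 else 0)" "\<zero>\<^bsub>M2\<^esub> = (\<lambda>i j. 0)" "m \<oplus>\<^bsub>M2\<^esub> n = (\<lambda>i j. m i j + n i j)"
  "c \<odot>\<^bsub>M2\<^esub> m = (\<lambda>i j. c * m i j)" "adj\<^bsub>M2\<^esub> m = (\<lambda>i j. cnj (m j i))"
  "\<parallel>m\<parallel>\<^bsub>M2\<^esub> = operator_norm (mat_rep id m)"
  by (simp_all add: M2_def)

lemma star_algebra_M2: "star_algebra M2"
proof (rule star_algebraI, rule ringI, rule abelian_groupI)
  show "monoid M2" by (rule monoidI) (auto simp: M2_simps fun_eq_iff algebra_simps)
  fix x :: mat2
  show "\<exists>y\<in>carrier M2. y \<oplus>\<^bsub>M2\<^esub> x = \<zero>\<^bsub>M2\<^esub>"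
    by (rule bexI[of _ "\<lambda>i j. - x i j"]) (auto simp: M2_simps)
qed (auto simp: M2_simps fun_eq_iff algebra_simps)

lemma M2_minus: "m \<ominus>\<^bsub>M2\<^esub> n = (\<lambda>i j. m i j - n i j)"
  using star_algebra.cs_minus_one[OF star_algebra_M2, of n] star_algebra.rs(14)[OF star_algebra_M2, of m n]
  by (simp add: M2_simps)

lemma mat_rep_M2:
  fixes \<iota> :: "bool \<Rightarrow> 'u"
  assumes i: "inj \<iota>" shows "representation M2 (mat_rep \<iota>)"
  unfolding representation_def
proof (intro conjI ballI allI)
  fix m n :: mat2 and f g :: "'u \<Rightarrow> complex" and c
  note io = iota[OF i]
  show "bounded_operator (mat_rep \<iota> m)"
  proof (rule bounded_operatorI)
    fix f g :: "'u \<Rightarrow> complex" and c assume f: "f \<in> ell2"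
    show "mat_rep \<iota> m f \<in> ell2" "ell2_norm (mat_rep \<iota> m f) \<le> msum m * ell2_norm f"
      by (rule mat_rep_norm[OF i f])+
    show "mat_rep \<iota> m (\<lambda>i. f i + g i) = (\<lambda>i. mat_rep \<iota> m f i + mat_rep \<iota> m g i)"
      "mat_rep \<iota> m (\<lambda>i. c * f i) = (\<lambda>i. c * mat_rep \<iota> m f i)"
      by (auto simp: mat_rep_def fun_eq_iff algebra_simps)
  qed
  show "mat_rep \<iota> (m \<oplus>\<^bsub>M2\<^esub> n) f = (\<lambda>i. mat_rep \<iota> m f i + mat_rep \<iota> n f i)"
    unfolding M2_simps(5) by (auto simp: mat_rep_def fun_eq_iff algebra_simps)
  show "mat_rep \<iota> (c \<odot>\<^bsub>M2\<^esub> m) f = (\<lambda>i. c * mat_rep \<iota> m f i)"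
    unfolding M2_simps(6) by (auto simp: mat_rep_def fun_eq_iff algebra_simps)
  show "mat_rep \<iota> (m \<otimes>\<^bsub>M2\<^esub> n) f = mat_rep \<iota> m (mat_rep \<iota> n f)"
    unfolding M2_simps(2) by (auto simp: mat_rep_def fun_eq_iff algebra_simps io)
  have "ell2_inner f (mat_rep \<iota> m g) = cnj (ell2_inner (mat_rep \<iota> m g) f)" by (simp add: ell2_inner_cnj)
  then show "ell2_inner (mat_rep \<iota> (adj\<^bsub>M2\<^esub> m) f) g = ell2_inner f (mat_rep \<iota> m g)"
    unfolding M2_simps(7) mat_rep_inner[OF i] by (simp add: mat_rep_def io algebra_simps)
qed

theorem cstar_algebra_M2: "cstar_algebra M2"
proof (rule cstar_algebra.intro[OF star_algebra_M2], standard)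
  have i: "inj (id :: bool \<Rightarrow> bool)" by simp
  show sn: "cstar_seminorm M2 (cnorm M2)"
  proof -
    have "cnorm M2 = (\<lambda>m. operator_norm (mat_rep id m))" by (simp add: M2_def)
    then show ?thesis using cstar_seminorm_rep[OF star_algebra_M2 mat_rep_M2[OF i]] by simp
  qed
  have up: "\<parallel>m\<parallel>\<^bsub>M2\<^esub> \<le> msum m" for m
    unfolding M2_simps(8) by (rule operator_norm_least[OF _ mat_rep_norm(2)[OF i]]) (simp add: msum_def)
  have low: "cmod (m p r) \<le> \<parallel>m\<parallel>\<^bsub>M2\<^esub>" for m p r
  proof -
    have n: "ell2_norm (delta r) \<le> 1"
    proof -
      have "(ell2_norm (delta r))\<^sup>2 = 1"
        using ell2_inner_self[OF delta_ell2, of r] ell2_inner_delta[of r "delta r"]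
        by (metis delta_def of_real_eq_1_iff)
      then show ?thesis using ell2_norm_ge_0[of "delta r"] by (simp add: power2_eq_1_iff)
    qed
    have b: "bounded_operator (mat_rep id m)" by (rule representationD(1)[OF mat_rep_M2[OF i]]) (simp add: M2_simps)
    have "m p r = mat_rep id m (delta r) p" by (cases p; cases r) (simp_all add: mat_rep_def delta_def)
    also have "cmod \<dots> \<le> ell2_norm (mat_rep id m (delta r))" by (rule entry_le_norm[OF bounded_operatorD(1)[OF b delta_ell2]])
    also have "\<dots> \<le> operator_norm (mat_rep id m) * ell2_norm (delta r)" by (rule operator_norm(1)[OF b delta_ell2])
    also have "\<dots> \<le> operator_norm (mat_rep id m) * 1" by (rule mult_left_mono[OF n operator_norm(2)[OF b]])
    finally show ?thesis by (simp add: M2_simps)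
  qed
  show "m = \<zero>\<^bsub>M2\<^esub>" if "\<parallel>m\<parallel>\<^bsub>M2\<^esub> = 0" for m
  proof (intro ext)
    fix p r show "m p r = \<zero>\<^bsub>M2\<^esub> p r" using low[of m p r] that by (simp add: M2_simps)
  qed
  fix s assume s: "s \<in> cauchy_seqs M2 (cnorm M2)"
  have "Cauchy (\<lambda>k. s k p r)" for p r
  proof (rule CauchyI)
    fix e :: real assume "e > 0"
    then obtain N where N: "\<forall>k\<ge>N. \<forall>l\<ge>N. \<parallel>s k \<ominus>\<^bsub>M2\<^esub> s l\<parallel>\<^bsub>M2\<^esub> < e" using s by (auto simp: cauchy_seqs_def)
    show "\<exists>M. \<forall>m\<ge>M. \<forall>n\<ge>M. norm (s m p r - s n p r) < e"
      using N order_le_less_trans[OF low[of _ p r]] by (metis M2_minus)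
  qed
  then have "\<exists>a. (\<lambda>k. s k p r) \<longlonglongrightarrow> a" for p r by (simp add: Cauchy_convergent_iff convergent_def)
  then obtain a where a: "\<And>p r. (\<lambda>k. s k p r) \<longlonglongrightarrow> a p r" by metis
  have c: "(\<lambda>k. cmod (s k p r - a p r)) \<longlonglongrightarrow> 0" for p r
    using a[of p r] by (intro tendsto_norm_zero LIM_zero)
  have t: "(\<lambda>k. msum (s k \<ominus>\<^bsub>M2\<^esub> a)) \<longlonglongrightarrow> 0"
    unfolding msum_def M2_minus by (intro tendsto_add_zero c)
  have "(\<lambda>k. \<parallel>s k \<ominus>\<^bsub>M2\<^esub> a\<parallel>\<^bsub>M2\<^esub>) \<longlonglongrightarrow> 0"
    by (rule tendsto_sandwich[of "\<lambda>_. 0" _ _ "\<lambda>k. msum (s k \<ominus>\<^bsub>M2\<^esub> a)"])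
       (use up t seminorm_ge_0[OF sn] in \<open>auto simp: M2_simps(1)\<close>)
  then show "\<exists>a\<in>carrier M2. (\<lambda>k. \<parallel>s k \<ominus>\<^bsub>M2\<^esub> a\<parallel>\<^bsub>M2\<^esub>) \<longlonglongrightarrow> 0" by (auto simp: M2_simps(1))
qed

text \<open>The selfadjoint matrix \<open>s \<sigma>\<^sub>x + t \<sigma>\<^sub>z\<close> in terms of Pauli matrices.\<close>

definition pauli :: "real \<Rightarrow> real \<Rightarrow> mat2" where
  "pauli s t i j = (if i = j then (if i then - complex_of_real t else complex_of_real t) else complex_of_real s)"

section \<open>Solutions of the relations\<close>

lemma sec_hom_sum:
  fixes B :: "'b cstar_algebra"
  assumes B: "cstar_algebra B" and h: "h \<in> star_hom free_star_algebra B"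
  shows "sec B (h (sum f S)) = (\<Sum>i\<in>S. sec B (h (f i)))"
proof (induction S rule: infinite_finite_induct)
  case (insert i S)
  then show ?case using star_homD(3)[OF h free_simps(1) free_simps(1), of "f i" "sum f S"] star_homD(1)[OF h free_simps(1)]
    by (simp add: free_simps sec_simps[OF B])
qed (use star_hom_minus(2)[OF star_algebra_free cstar_star[OF B] h free_simps(1) free_simps(1)]
      sec_simps(5)[OF B star_homD(1)[OF h free_simps(1)]] in \<open>auto simp: free_simps\<close>)

context
  fixes B :: "'b cstar_algebra" and b :: "'e \<Rightarrow> 'b"
  assumes B: "cstar_algebra B" and b: "\<And>e. b e \<in> carrier B"
begin

interpretation BB: star_algebra B by (rule cstar_star[OF B])

lemma free_eval_gen_adj: "adj\<^bsub>B\<^esub> (b i) = b i \<Longrightarrow> free_eval B b (monomial [Gen i] - monomial [GenAdj i]) = \<zero>\<^bsub>B\<^esub>"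
  by (simp add: free_eval_def poly_val_minus poly_val_simps B b BB.rs)

lemma free_eval_quadratic:
  "b i \<otimes>\<^bsub>B\<^esub> b j = b k \<otimes>\<^bsub>B\<^esub> b l \<Longrightarrow> free_eval B b (monomial [Gen i, Gen j] - monomial [Gen k, Gen l]) = \<zero>\<^bsub>B\<^esub>"
  by (simp add: free_eval_def poly_val_minus poly_val_simps B b BB.rs)

lemma free_eval_sum_one:
  assumes "(\<Sum>k\<in>K. sec B (b (g k)) * sec B (b (h k))) = sec B \<one>\<^bsub>B\<^esub>"
  shows "free_eval B b ((\<Sum>k\<in>K. monomial [Gen (g k), Gen (h k)]) - monomial []) = \<zero>\<^bsub>B\<^esub>"
  using assms by (simp add: free_eval_def poly_val_minus poly_val_simps poly_val_sum B b BB.rs)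

lemma free_eval_sum_zero:
  assumes "(\<Sum>k\<in>K. sec B (b (g k)) * sec B (b (h k))) = 0"
  shows "free_eval B b (\<Sum>k\<in>K. monomial [Gen (g k), Gen (h k)]) = \<zero>\<^bsub>B\<^esub>"
  using assms by (simp add: free_eval_def poly_val_minus poly_val_simps poly_val_sum B b)

end

text \<open>Solutions of the defining relations, in the form in which they are produced and consumed below; sums
are formed in the type of families.\<close>

definition sphere_tuple :: "'b cstar_algebra \<Rightarrow> nat ^ 'n ^ 'n \<Rightarrow> ('n::finite \<Rightarrow> 'b) \<Rightarrow> bool" where
  "sphere_tuple B \<epsilon> x \<longleftrightarrow> (\<forall>i. x i \<in> carrier B) \<and> (\<forall>i. adj\<^bsub>B\<^esub> (x i) = x i) \<and>
     (\<Sum>i\<in>UNIV. sec B (x i) * sec B (x i)) = sec B \<one>\<^bsub>B\<^esub> \<and>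
     (\<forall>i j. \<epsilon> $ i $ j = 1 \<longrightarrow> x i \<otimes>\<^bsub>B\<^esub> x j = x j \<otimes>\<^bsub>B\<^esub> x i)"

definition O_tuple :: "'b cstar_algebra \<Rightarrow> nat ^ 'n ^ 'n \<Rightarrow> ('n::finite \<Rightarrow> 'n \<Rightarrow> 'b) \<Rightarrow> bool" where
  "O_tuple B \<epsilon> u \<longleftrightarrow> (\<forall>i j. u i j \<in> carrier B) \<and> (\<forall>i j. adj\<^bsub>B\<^esub> (u i j) = u i j) \<and>
     (\<forall>i j. (\<Sum>k\<in>UNIV. sec B (u i k) * sec B (u j k)) = (if i = j then sec B \<one>\<^bsub>B\<^esub> else 0)) \<and>
     (\<forall>i j. (\<Sum>k\<in>UNIV. sec B (u k i) * sec B (u k j)) = (if i = j then sec B \<one>\<^bsub>B\<^esub> else 0)) \<and>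
     (\<forall>i j k l. \<epsilon> $ i $ j = 1 \<longrightarrow> \<epsilon> $ k $ l = 1 \<longrightarrow> u i k \<otimes>\<^bsub>B\<^esub> u j l = u j l \<otimes>\<^bsub>B\<^esub> u i k) \<and>
     (\<forall>i j k l. \<epsilon> $ i $ j = 1 \<longrightarrow> \<epsilon> $ k $ l = 0 \<longrightarrow> u i k \<otimes>\<^bsub>B\<^esub> u j l = u j k \<otimes>\<^bsub>B\<^esub> u i l) \<and>
     (\<forall>i j k l. \<epsilon> $ i $ j = 0 \<longrightarrow> \<epsilon> $ k $ l = 1 \<longrightarrow> u i k \<otimes>\<^bsub>B\<^esub> u j l = u i l \<otimes>\<^bsub>B\<^esub> u j k)"

lemma sphere_tupleD:
  assumes "sphere_tuple B \<epsilon> x"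
  shows "x i \<in> carrier B" "adj\<^bsub>B\<^esub> (x i) = x i" "(\<Sum>i\<in>UNIV. sec B (x i) * sec B (x i)) = sec B \<one>\<^bsub>B\<^esub>"
    "\<epsilon> $ i $ j = 1 \<Longrightarrow> x i \<otimes>\<^bsub>B\<^esub> x j = x j \<otimes>\<^bsub>B\<^esub> x i"
  using assms unfolding sphere_tuple_def by blast+

lemma O_tupleD:
  assumes "O_tuple B \<epsilon> u"
  shows "u i j \<in> carrier B" "adj\<^bsub>B\<^esub> (u i j) = u i j"
    "(\<Sum>k\<in>UNIV. sec B (u i k) * sec B (u j k)) = (if i = j then sec B \<one>\<^bsub>B\<^esub> else 0)"
    "(\<Sum>k\<in>UNIV. sec B (u k i) * sec B (u k j)) = (if i = j then sec B \<one>\<^bsub>B\<^esub> else 0)"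
    "\<epsilon> $ i $ j = 1 \<Longrightarrow> \<epsilon> $ k $ l = 1 \<Longrightarrow> u i k \<otimes>\<^bsub>B\<^esub> u j l = u j l \<otimes>\<^bsub>B\<^esub> u i k"
    "\<epsilon> $ i $ j = 1 \<Longrightarrow> \<epsilon> $ k $ l = 0 \<Longrightarrow> u i k \<otimes>\<^bsub>B\<^esub> u j l = u j k \<otimes>\<^bsub>B\<^esub> u i l"
    "\<epsilon> $ i $ j = 0 \<Longrightarrow> \<epsilon> $ k $ l = 1 \<Longrightarrow> u i k \<otimes>\<^bsub>B\<^esub> u j l = u i l \<otimes>\<^bsub>B\<^esub> u j k"
  using assms unfolding O_tuple_def by blast+

lemma sphere_bounded: "bounded_relations (sphere_relations \<epsilon>)"
  unfolding bounded_relations_def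
proof (intro ballI allI)
  fix p and i :: 'a assume "p \<in> vanishing_seminorms (sphere_relations \<epsilon>)"
  then show "p (monomial [Gen i]) \<le> 1"
    using generator_bound[of p "sphere_relations \<epsilon>" "\<lambda>i. i" i] by (auto simp: sphere_relations_def)
qed

lemma O_bounded: "bounded_relations (orthogonality_relations \<union> R_eps \<epsilon>)"
  unfolding bounded_relations_def
proof (intro ballI allI)
  fix p and e :: "'a \<times> 'a" assume p: "p \<in> vanishing_seminorms (orthogonality_relations \<union> R_eps \<epsilon>)"
  obtain i k where e: "e = (i, k)" by (cases e)
  have "p (monomial [Gen (i, k)]) \<le> 1"
  proof (rule generator_bound[OF p, of "\<lambda>k. (i, k)" k])
    show "(\<Sum>k\<in>UNIV. monomial [Gen (i, k), Gen (i, k)]) - monomial [] \<in> orthogonality_relations \<union> R_eps \<epsilon>"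
      unfolding orthogonality_relations_def by (rule UnI1, rule UnI1, rule UnI2) (auto intro!: exI[of _ i])
  qed (auto simp: orthogonality_relations_def)
  then show "p (monomial [Gen e]) \<le> 1" by (simp add: e)
qed

lemma cstar_C_sphere: "cstar_algebra (C_sphere \<epsilon>)"
  unfolding C_sphere_def by (rule cstar_algebra_universal[OF sphere_bounded])

lemma cstar_C_O: "cstar_algebra (C_O \<epsilon>)"
  unfolding C_O_def by (rule cstar_algebra_universal[OF O_bounded])

lemma sphere_universal:
  fixes B :: "'b cstar_algebra"
  assumes B: "cstar_algebra B" and x: "sphere_tuple B \<epsilon> x"
  shows "\<exists>h\<in>star_hom (C_sphere \<epsilon>) B. \<forall>i. h (sphere_coord \<epsilon> i) = x i"
proof -
  have xc: "\<And>i. x i \<in> carrier B" using x by (simp add: sphere_tuple_def)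
  have "free_eval B x r = \<zero>\<^bsub>B\<^esub>" if "r \<in> sphere_relations \<epsilon>" for r
    using that x unfolding sphere_relations_def sphere_tuple_def
    by (auto intro!: free_eval_gen_adj[OF B xc] free_eval_quadratic[OF B xc] free_eval_sum_one[OF B xc])
  from universal_property[OF sphere_bounded B xc this] show ?thesis
    unfolding C_sphere_def sphere_coord_def by blast
qed

lemma O_universal:
  fixes B :: "'b cstar_algebra"
  assumes B: "cstar_algebra B" and u: "O_tuple B \<epsilon> u"
  shows "\<exists>h\<in>star_hom (C_O \<epsilon>) B. \<forall>i j. h (O_gen \<epsilon> i j) = u i j"
proof -
  let ?b = "\<lambda>(i, j). u i j"
  have uc: "\<And>e. ?b e \<in> carrier B" using u by (auto simp: O_tuple_def)
  note q = free_eval_quadratic[OF B uc]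
  have 1: "free_eval B ?b r = \<zero>\<^bsub>B\<^esub>" if "r \<in> orthogonality_relations" for r
    using that unfolding orthogonality_relations_def
  proof (elim UnE)
    assume "r \<in> {monomial [Gen (i, j)] - monomial [GenAdj (i, j)] |i j. True}"
    then show ?thesis using u by (auto intro!: free_eval_gen_adj[OF B uc] simp: O_tuple_def)
  next
    assume "r \<in> {(\<Sum>k\<in>UNIV. monomial [Gen (i, k), Gen (j, k)]) - (if i = j then monomial [] else 0) |i j. True}"
    then obtain i j where r: "r = (\<Sum>k\<in>UNIV. monomial [Gen (i, k), Gen (j, k)]) - (if i = j then monomial [] else 0)" by blast
    have "(\<Sum>k\<in>UNIV. sec B (u i k) * sec B (u j k)) = (if i = j then sec B \<one>\<^bsub>B\<^esub> else 0)" using u by (simp add: O_tuple_def)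
    then show ?thesis using free_eval_sum_one[where b="?b" and K=UNIV and g="\<lambda>k. (i, k)" and h="\<lambda>k. (j, k)", OF B uc] free_eval_sum_zero[where b="?b" and K=UNIV and g="\<lambda>k. (i, k)" and h="\<lambda>k. (j, k)", OF B uc]
      by (auto simp: r split: if_splits)
  next
    assume "r \<in> {(\<Sum>k\<in>UNIV. monomial [Gen (k, i), Gen (k, j)]) - (if i = j then monomial [] else 0) |i j. True}"
    then obtain i j where r: "r = (\<Sum>k\<in>UNIV. monomial [Gen (k, i), Gen (k, j)]) - (if i = j then monomial [] else 0)" by blast
    have "(\<Sum>k\<in>UNIV. sec B (u k i) * sec B (u k j)) = (if i = j then sec B \<one>\<^bsub>B\<^esub> else 0)" using u by (simp add: O_tuple_def)
    then show ?thesis using free_eval_sum_one[where b="?b" and K=UNIV and g="\<lambda>k. (k, i)" and h="\<lambda>k. (k, j)", OF B uc] free_eval_sum_zero[where b="?b" and K=UNIV and g="\<lambda>k. (k, i)" and h="\<lambda>k. (k, j)", OF B uc]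
      by (auto simp: r split: if_splits)
  qed
  have 2: "free_eval B ?b r = \<zero>\<^bsub>B\<^esub>" if "r \<in> R_eps \<epsilon>" for r
    using that unfolding R_eps_def
  proof (elim UnE)
    assume "r \<in> {monomial [Gen (i, k), Gen (j, l)] - monomial [Gen (j, l), Gen (i, k)] |i j k l. \<epsilon> $ i $ j = 1 \<and> \<epsilon> $ k $ l = 1}"
    then obtain i j k l where r: "r = monomial [Gen (i, k), Gen (j, l)] - monomial [Gen (j, l), Gen (i, k)]" and e: "\<epsilon> $ i $ j = 1" "\<epsilon> $ k $ l = 1" by blast
    show ?thesis unfolding r by (rule q) (simp, rule O_tupleD(5)[OF u e])
  next
    assume "r \<in> {monomial [Gen (i, k), Gen (j, l)] - monomial [Gen (j, k), Gen (i, l)] |i j k l. \<epsilon> $ i $ j = 1 \<and> \<epsilon> $ k $ l = 0}"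
    then obtain i j k l where r: "r = monomial [Gen (i, k), Gen (j, l)] - monomial [Gen (j, k), Gen (i, l)]" and e: "\<epsilon> $ i $ j = 1" "\<epsilon> $ k $ l = 0" by blast
    show ?thesis unfolding r by (rule q) (simp, rule O_tupleD(6)[OF u e])
  next
    assume "r \<in> {monomial [Gen (i, k), Gen (j, l)] - monomial [Gen (i, l), Gen (j, k)] |i j k l. \<epsilon> $ i $ j = 0 \<and> \<epsilon> $ k $ l = 1}"
    then obtain i j k l where r: "r = monomial [Gen (i, k), Gen (j, l)] - monomial [Gen (i, l), Gen (j, k)]" and e: "\<epsilon> $ i $ j = 0" "\<epsilon> $ k $ l = 1" by blast
    show ?thesis unfolding r by (rule q) (simp, rule O_tupleD(7)[OF u e])
  qed
  have "free_eval B ?b r = \<zero>\<^bsub>B\<^esub>" if "r \<in> orthogonality_relations \<union> R_eps \<epsilon>" for r using that 1 2 by blast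
  from universal_property[OF O_bounded B uc this] obtain H
    where H: "H \<in> star_hom (universal_cstar (orthogonality_relations \<union> R_eps \<epsilon>)) B"
      "\<And>e. H (universal_gen (orthogonality_relations \<union> R_eps \<epsilon>) e) = ?b e" by blast
  then show ?thesis unfolding C_O_def O_gen_def by (intro bexI[of _ H] allI) (simp_all only: H(2) prod.case)
qed

context
  fixes R :: "'e star_poly set"
  assumes R: "bounded_relations R"
begin

abbreviation "UC \<equiv> universal_cstar R"
abbreviation "ug \<equiv> universal_gen R"

lemmas UC = cstar_algebra_universal[OF R] and uh = uemb_star_hom[OF R] and ur = uemb_relation[OF R]

lemma ug_closed: "ug e \<in> carrier UC"
  using star_homD(1)[OF uh free_simps(1)] by (simp flip: uemb_gen[OF R])

lemma ug_adj: "monomial [Gen e] - monomial [GenAdj e] \<in> R \<Longrightarrow> adj\<^bsub>UC\<^esub> (ug e) = ug e"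
  using star_homD(6)[OF uh free_simps(1), of "monomial [Gen e]"] ur[of "monomial [Gen e]" "monomial [GenAdj e]"]
  by (simp add: free_simps uemb_gen[OF R])

lemma ug_mult: "ug e \<otimes>\<^bsub>UC\<^esub> ug e' = uemb R (monomial [Gen e, Gen e'])"
  using star_homD(2)[OF uh free_simps(1) free_simps(1), of "monomial [Gen e]" "monomial [Gen e']"]
  by (simp add: free_simps uemb_gen[OF R])

lemma ug_quadratic: "monomial [Gen i, Gen j] - monomial [Gen k, Gen l] \<in> R \<Longrightarrow> ug i \<otimes>\<^bsub>UC\<^esub> ug j = ug k \<otimes>\<^bsub>UC\<^esub> ug l"
  unfolding ug_mult by (rule ur)

lemma ug_sum:
  assumes "(\<Sum>k\<in>K. monomial [Gen (g k), Gen (h k)]) - q \<in> R"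
  shows "(\<Sum>k\<in>K. sec UC (ug (g k)) * sec UC (ug (h k))) = sec UC (uemb R q)"
proof -
  have "(\<Sum>k\<in>K. sec UC (ug (g k)) * sec UC (ug (h k))) = (\<Sum>k\<in>K. sec UC (uemb R (monomial [Gen (g k), Gen (h k)])))"
    by (simp add: sec_simps(2)[OF UC ug_closed ug_closed, symmetric] ug_mult)
  also have "\<dots> = sec UC (uemb R (\<Sum>k\<in>K. monomial [Gen (g k), Gen (h k)]))" by (rule sec_hom_sum[OF UC uh, symmetric])
  finally show ?thesis using ur[OF assms] by simp
qed

lemma uemb_consts: "uemb R (monomial []) = \<one>\<^bsub>UC\<^esub>" "sec UC (uemb R 0) = 0"
proof -
  show "uemb R (monomial []) = \<one>\<^bsub>UC\<^esub>" using star_homD(4)[OF uh free_simps(1)] by (simp add: free_simps)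
  show "sec UC (uemb R 0) = 0" using sec_hom_sum[OF UC uh, of "\<lambda>_. 0" "{}"] by simp
qed

end

lemma sphere_tuple_coord: "sphere_tuple (C_sphere \<epsilon>) \<epsilon> (sphere_coord \<epsilon>)"
proof -
  note b = sphere_bounded[of \<epsilon>]
  let ?R = "sphere_relations \<epsilon>"
  have 1: "(\<Sum>i\<in>UNIV. monomial [Gen i, Gen i]) - monomial [] \<in> ?R" by (simp add: sphere_relations_def)
  have 2: "monomial [Gen i] - monomial [GenAdj i] \<in> ?R" for i unfolding sphere_relations_def by blast
  have 3: "monomial [Gen i, Gen j] - monomial [Gen j, Gen i] \<in> ?R" if "\<epsilon> $ i $ j = 1" for i j
    using that unfolding sphere_relations_def by blast
  have s: "(\<Sum>i\<in>UNIV. sec (universal_cstar ?R) (universal_gen ?R i) * sec (universal_cstar ?R) (universal_gen ?R i)) = sec (universal_cstar ?R) \<one>\<^bsub>universal_cstar ?R\<^esub>"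
    using ug_sum[OF b 1] by (simp only: uemb_consts(1)[OF b])
  show ?thesis
    unfolding sphere_tuple_def C_sphere_def sphere_coord_def
    by (intro conjI allI impI ug_closed[OF b] s ug_adj[OF b 2] ug_quadratic[OF b 3])
qed

lemma O_tuple_gen: "O_tuple (C_O \<epsilon>) \<epsilon> (O_gen \<epsilon>)"
proof -
  note b = O_bounded[of \<epsilon>]
  let ?R = "orthogonality_relations \<union> R_eps \<epsilon>"
  have 1: "(\<Sum>k\<in>UNIV. monomial [Gen (i, k), Gen (j, k)]) - (if i = j then monomial [] else 0) \<in> ?R" for i j
    unfolding orthogonality_relations_def by (rule UnI1, rule UnI1, rule UnI2) blast
  have 2: "(\<Sum>k\<in>UNIV. monomial [Gen (k, i), Gen (k, j)]) - (if i = j then monomial [] else 0) \<in> ?R" for i j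
    unfolding orthogonality_relations_def by (rule UnI1, rule UnI2) blast
  have 0: "monomial [Gen (i, j)] - monomial [GenAdj (i, j)] \<in> ?R" for i j
    unfolding orthogonality_relations_def by blast
  have s: "sec (universal_cstar ?R) (uemb ?R (if i = j then monomial [] else 0)) = (if i = j then sec (universal_cstar ?R) \<one>\<^bsub>universal_cstar ?R\<^esub> else 0)" for i j :: 'a
    by (simp only: if_distrib[of "uemb ?R"] if_distrib[of "sec (universal_cstar ?R)"] uemb_consts[OF b])
  have R: "monomial [Gen (i, k), Gen (j, l)] - monomial [Gen (j, l), Gen (i, k)] \<in> ?R" if "\<epsilon> $ i $ j = 1" "\<epsilon> $ k $ l = 1" for i j k l
    using that unfolding R_eps_def by blast
  have R2: "monomial [Gen (i, k), Gen (j, l)] - monomial [Gen (j, k), Gen (i, l)] \<in> ?R" if "\<epsilon> $ i $ j = 1" "\<epsilon> $ k $ l = 0" for i j k l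
    using that unfolding R_eps_def by blast
  have R3: "monomial [Gen (i, k), Gen (j, l)] - monomial [Gen (i, l), Gen (j, k)] \<in> ?R" if "\<epsilon> $ i $ j = 0" "\<epsilon> $ k $ l = 1" for i j k l
    using that unfolding R_eps_def by blast
  note S1 = ug_sum[OF b, of "\<lambda>k. (i, k)" "\<lambda>k. (j, k)" UNIV "if i = j then monomial [] else 0" for i j, OF 1, unfolded s]
    and S2 = ug_sum[OF b, of "\<lambda>k. (k, i)" "\<lambda>k. (k, j)" UNIV "if i = j then monomial [] else 0" for i j, OF 2, unfolded s]
  show ?thesis
    unfolding O_tuple_def C_O_def O_gen_def
    by (intro conjI allI impI ug_closed[OF b] S1 S2 ug_adj[OF b 0] ug_quadratic[OF b R] ug_quadratic[OF b R2] ug_quadratic[OF b R3])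
qed

section \<open>Noncommutativity\<close>

lemma pauli_facts:
  "adj\<^bsub>M2\<^esub> (pauli s t) = pauli s t"
  "pauli s t \<otimes>\<^bsub>M2\<^esub> pauli s' t' = (\<lambda>i j. if i = j then complex_of_real (s * s' + t * t')
     else if i then complex_of_real (s * t' - t * s') else complex_of_real (t * s' - s * t'))"
  by (auto simp: M2_simps pauli_def fun_eq_iff)

text \<open>A product \<open>u\<^sub>i\<^sub>k u\<^sub>j\<^sub>l\<close> of entries is nonzero only for \<open>k = i\<close> and \<open>l = j\<close>, so only the relations \<open>a\<^sub>i a\<^sub>j = a\<^sub>j a\<^sub>i\<close> for
\<open>\<epsilon>\<^sub>i\<^sub>j = 1\<close> are not automatic.\<close>

lemma diagonal_O_tuple:
  fixes a :: "'n::finite \<Rightarrow> 'b" and B :: "'b cstar_algebra"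
  assumes B: "cstar_algebra B" and a: "\<And>i. a i \<in> carrier B" "\<And>i. adj\<^bsub>B\<^esub> (a i) = a i" "\<And>i. a i \<otimes>\<^bsub>B\<^esub> a i = \<one>\<^bsub>B\<^esub>"
    and \<epsilon>: "commutation_matrix \<epsilon>" and comm: "\<And>i j. \<epsilon> $ i $ j = 1 \<Longrightarrow> a i \<otimes>\<^bsub>B\<^esub> a j = a j \<otimes>\<^bsub>B\<^esub> a i"
  shows "O_tuple B \<epsilon> (\<lambda>i j. if i = j then a i else \<zero>\<^bsub>B\<^esub>)"
proof -
  interpret star_algebra B by (rule cstar_star[OF B])
  have sym: "\<epsilon> $ i $ j = \<epsilon> $ j $ i" for i j
    using \<epsilon> unfolding commutation_matrix_def by (metis transpose_def vec_lambda_beta)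
  have z: "sec B \<zero>\<^bsub>B\<^esub> = 0" by (rule sec_simps(5)[OF B a(1)])
  have s: "sec B (a i) * sec B (a i) = sec B \<one>\<^bsub>B\<^esub>" for i
    by (simp add: sec_simps(2)[OF B a(1) a(1), symmetric] a(3))
  have 1: "(\<Sum>k\<in>UNIV. sec B (if i = k then a i else \<zero>\<^bsub>B\<^esub>) * sec B (if j = k then a j else \<zero>\<^bsub>B\<^esub>)) = (if i = j then sec B \<one>\<^bsub>B\<^esub> else 0)" for i j
  proof -
    have "(\<Sum>k\<in>UNIV. sec B (if i = k then a i else \<zero>\<^bsub>B\<^esub>) * sec B (if j = k then a j else \<zero>\<^bsub>B\<^esub>)) =
        (\<Sum>k\<in>UNIV. if k = i then (if i = j then sec B \<one>\<^bsub>B\<^esub> else 0) else 0)"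
      by (intro sum.cong) (auto simp: z s)
    then show ?thesis by simp
  qed
  have 2: "(\<Sum>k\<in>UNIV. sec B (if k = i then a k else \<zero>\<^bsub>B\<^esub>) * sec B (if k = j then a k else \<zero>\<^bsub>B\<^esub>)) = (if i = j then sec B \<one>\<^bsub>B\<^esub> else 0)" for i j
  proof -
    have "(\<Sum>k\<in>UNIV. sec B (if k = i then a k else \<zero>\<^bsub>B\<^esub>) * sec B (if k = j then a k else \<zero>\<^bsub>B\<^esub>)) =
        (\<Sum>k\<in>UNIV. if k = i then (if i = j then sec B \<one>\<^bsub>B\<^esub> else 0) else 0)"
      by (intro sum.cong) (auto simp: z s)
    then show ?thesis by simp
  qed
  show ?thesis unfolding O_tuple_def using 1 2 a sym comm by (auto simp: rs)
qed

text \<open>The diagonal with \<open>\<sigma>\<^sub>x\<close> at \<open>i\<close>, \<open>\<sigma>\<^sub>z\<close> at \<open>j\<close> and the identity elsewhere solves the relations, and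
\<open>\<sigma>\<^sub>x\<close> does not commute with \<open>\<sigma>\<^sub>z\<close>.\<close>

lemma O_gen_not_commuting:
  fixes \<epsilon> :: "nat ^ 'n::finite ^ 'n"
  assumes \<epsilon>: "commutation_matrix \<epsilon>" and ij: "i \<noteq> j" "\<epsilon> $ i $ j \<noteq> 1"
  shows "O_gen \<epsilon> i i \<otimes>\<^bsub>C_O \<epsilon>\<^esub> O_gen \<epsilon> j j \<noteq> O_gen \<epsilon> j j \<otimes>\<^bsub>C_O \<epsilon>\<^esub> O_gen \<epsilon> i i"
proof
  assume eq: "O_gen \<epsilon> i i \<otimes>\<^bsub>C_O \<epsilon>\<^esub> O_gen \<epsilon> j j = O_gen \<epsilon> j j \<otimes>\<^bsub>C_O \<epsilon>\<^esub> O_gen \<epsilon> i i"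
  have sym: "\<epsilon> $ i $ j = \<epsilon> $ j $ i" for i j
    using \<epsilon> unfolding commutation_matrix_def by (metis transpose_def vec_lambda_beta)
  define a where "a k = (if k = i then pauli 1 0 else if k = j then pauli 0 1 else \<one>\<^bsub>M2\<^esub>)" for k
  have p1: "pauli s t \<otimes>\<^bsub>M2\<^esub> pauli s t = \<one>\<^bsub>M2\<^esub>" if "s * s + t * t = 1" for s t
    unfolding pauli_facts using that by (auto simp: M2_simps fun_eq_iff)
  have "O_tuple M2 \<epsilon> (\<lambda>i j. if i = j then a i else \<zero>\<^bsub>M2\<^esub>)"
  proof (rule diagonal_O_tuple[OF cstar_algebra_M2 _ _ _ \<epsilon>])
    show "a k \<in> carrier M2" for k by (simp add: M2_simps)
    show "adj\<^bsub>M2\<^esub> (a k) = a k" for k by (auto simp: a_def pauli_facts) (auto simp: M2_simps fun_eq_iff)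
    show "a k \<otimes>\<^bsub>M2\<^esub> a k = \<one>\<^bsub>M2\<^esub>" for k by (auto simp: a_def p1) (auto simp: M2_simps fun_eq_iff)
    show "a k \<otimes>\<^bsub>M2\<^esub> a l = a l \<otimes>\<^bsub>M2\<^esub> a k" if "\<epsilon> $ k $ l = 1" for k l
      using that ij sym[of i j] by (auto simp: a_def) (auto simp: M2_simps fun_eq_iff)
  qed
  then obtain h where h: "h \<in> star_hom (C_O \<epsilon>) M2" "\<And>i j. h (O_gen \<epsilon> i j) = (if i = j then a i else \<zero>\<^bsub>M2\<^esub>)"
    using O_universal[OF cstar_algebra_M2] by blast
  have c: "\<And>i j. O_gen \<epsilon> i j \<in> carrier (C_O \<epsilon>)" using O_tuple_gen[of \<epsilon>] by (simp add: O_tuple_def)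
  have "a i \<otimes>\<^bsub>M2\<^esub> a j = a j \<otimes>\<^bsub>M2\<^esub> a i"
    using arg_cong[OF eq, of h] star_homD(2)[OF h(1) c c] h(2) by simp
  then have "(a i \<otimes>\<^bsub>M2\<^esub> a j) True False = (a j \<otimes>\<^bsub>M2\<^esub> a i) True False" by simp
  then show False using ij(1) by (simp add: a_def pauli_facts)
qed

lemma O_gen_commuting:
  "\<epsilon> $ i $ j = 1 \<Longrightarrow> O_gen \<epsilon> i i \<otimes>\<^bsub>C_O \<epsilon>\<^esub> O_gen \<epsilon> j j = O_gen \<epsilon> j j \<otimes>\<^bsub>C_O \<epsilon>\<^esub> O_gen \<epsilon> i i"
  by (rule O_tupleD(5)[OF O_tuple_gen])

section \<open>Elementary tensors\<close>

lemma commutation_matrixD: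
  assumes "commutation_matrix \<epsilon>"
  shows "\<epsilon> $ i $ j = \<epsilon> $ j $ i" "\<epsilon> $ i $ j \<noteq> 1 \<Longrightarrow> \<epsilon> $ i $ j = 0" "\<epsilon> $ i $ i = 0"
proof -
  show "\<epsilon> $ i $ j = \<epsilon> $ j $ i" using assms unfolding commutation_matrix_def by (metis transpose_def vec_lambda_beta)
  show "\<epsilon> $ i $ j \<noteq> 1 \<Longrightarrow> \<epsilon> $ i $ j = 0" "\<epsilon> $ i $ i = 0" using assms unfolding commutation_matrix_def by auto
qed

context
  fixes A :: "'a cstar_algebra" and B :: "'b cstar_algebra"
  assumes A: "cstar_algebra A" and B: "cstar_algebra B"
begin

lemmas cT = cstar_algebra_min_tensor[OF A B] and st_A = cstar_star[OF A] and st_B = cstar_star[OF B]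

lemma pre_ops:
  "z \<otimes>\<^bsub>pre_tensor A B\<^esub> z' = mono_mult (A \<times>\<times> B) z z'" "z \<oplus>\<^bsub>pre_tensor A B\<^esub> z' = z + z'"
  "adj\<^bsub>pre_tensor A B\<^esub> z = mono_star (\<lambda>(a, b). (adj\<^bsub>A\<^esub> a, adj\<^bsub>B\<^esub> b)) z" "\<one>\<^bsub>pre_tensor A B\<^esub> = sg (\<one>\<^bsub>A\<^esub>, \<one>\<^bsub>B\<^esub>) 1"
  "\<zero>\<^bsub>pre_tensor A B\<^esub> = 0"
  by (simp_all add: pre_tensor_def monoid_star_algebra_simps)

lemma pre_minus: "z \<in> carrier (pre_tensor A B) \<Longrightarrow> z' \<in> carrier (pre_tensor A B) \<Longrightarrow> z \<ominus>\<^bsub>pre_tensor A B\<^esub> z' = z - z'"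
  using star_algebra_pt[OF A B] unfolding pt_carrier[OF A B] unfolding pre_tensor_def
  by (rule star_algebra_minus_eq) auto

lemma sg_carrier: "a \<in> carrier A \<Longrightarrow> b \<in> carrier B \<Longrightarrow> sg (a, b) c \<in> carrier (pre_tensor A B)"
  by (auto simp: pt_carrier[OF A B])

abbreviation "temb \<equiv> completion_embed (pre_tensor A B) (min_seminorm A B)"

lemma temb_hom: "temb \<in> star_hom (pre_tensor A B) (min_tensor A B)"
  unfolding min_tensor_def by (rule completing.emb_star_hom[OF completing_min[OF A B]])

text \<open>An equation in the spatial tensor product may be checked in the representations \<open>\<pi> \<otimes> \<rho>\<close>.\<close>

lemma temb_eqI:
  assumes z: "z \<in> carrier (pre_tensor A B)" "z' \<in> carrier (pre_tensor A B)"
    and e: "\<And>(\<pi> :: 'a \<Rightarrow> 'a operator) (\<rho> :: 'b \<Rightarrow> 'b operator) h. representation A \<pi> \<Longrightarrow> representation B \<rho> \<Longrightarrow> h \<in> ell2 \<Longrightarrow>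
      tensor_rep \<pi> \<rho> z h = tensor_rep \<pi> \<rho> z' h"
  shows "temb z = temb z'"
proof -
  have c: "z - z' \<in> carrier (pre_tensor A B)" using z keys_diff[of z z'] by (auto simp: pt_carrier[OF A B])
  have "p (z - z') = 0" if p: "p \<in> min_reps A B" for p
  proof -
    obtain \<pi> :: "'a \<Rightarrow> 'a operator" and \<rho> :: "'b \<Rightarrow> 'b operator"
      where p: "p = (\<lambda>z. operator_norm (tensor_rep \<pi> \<rho> z))" and r: "representation A \<pi>" "representation B \<rho>"
      using p by (auto simp: min_reps_def)
    note b = tensor_rep_bounded[OF st_A st_B r c[unfolded pt_carrier[OF A B]]]
    have "tensor_rep \<pi> \<rho> (z - z') h = (\<lambda>x. 0)" if h: "h \<in> ell2" for h
    proof
      fix x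
      have "tensor_rep \<pi> \<rho> (z - z' + z') h x = tensor_rep \<pi> \<rho> (z - z') h x + tensor_rep \<pi> \<rho> z' h x"
        by (simp only: tensor_rep_simps)
      then show "tensor_rep \<pi> \<rho> (z - z') h x = 0" using e[OF r h] by simp
    qed
    then have "operator_norm (tensor_rep \<pi> \<rho> (z - z')) \<le> 0"
      by (intro operator_norm_least) (simp_all add: ell2_norm_def)
    then show ?thesis using operator_norm(2)[OF b] by (simp add: p)
  qed
  moreover have "min_reps A B \<noteq> {}" using min_repsI[OF zero_representation zero_representation, of A B] by blast
  ultimately have "(\<lambda>p. p (z - z')) ` min_reps A B = {0}" by (auto simp: image_iff)
  then have "min_seminorm A B (z - z') = 0" by (simp add: min_seminorm_SUP)
  then show ?thesis by (simp add: completing.emb_eq_iff[OF completing_min[OF A B]] z pre_minus)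
qed

lemma tensor_closed: "a \<in> carrier A \<Longrightarrow> b \<in> carrier B \<Longrightarrow> tensor A B a b \<in> carrier (min_tensor A B)"
  unfolding tensor_def by (rule star_homD(1)[OF temb_hom sg_carrier])

lemma tensor_mult:
  assumes "a \<in> carrier A" "b \<in> carrier B" "a' \<in> carrier A" "b' \<in> carrier B"
  shows "tensor A B a b \<otimes>\<^bsub>min_tensor A B\<^esub> tensor A B a' b' = tensor A B (a \<otimes>\<^bsub>A\<^esub> a') (b \<otimes>\<^bsub>B\<^esub> b')"
  using star_homD(2)[OF temb_hom sg_carrier[OF assms(1,2), of 1] sg_carrier[OF assms(3,4), of 1]]
  by (simp add: tensor_def pre_ops mono_mult_simps)

lemma tensor_adj:
  assumes "a \<in> carrier A" "b \<in> carrier B"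
  shows "adj\<^bsub>min_tensor A B\<^esub> (tensor A B a b) = tensor A B (adj\<^bsub>A\<^esub> a) (adj\<^bsub>B\<^esub> b)"
  using star_homD(6)[OF temb_hom sg_carrier[OF assms, of 1]] by (simp add: tensor_def pre_ops mono_star_simps)

lemma tensor_one: "tensor A B \<one>\<^bsub>A\<^esub> \<one>\<^bsub>B\<^esub> = \<one>\<^bsub>min_tensor A B\<^esub>"
proof -
  have "\<one>\<^bsub>A\<^esub> \<in> carrier A" "\<one>\<^bsub>B\<^esub> \<in> carrier B" using star_algebra.rs(6)[OF st_A] star_algebra.rs(6)[OF st_B] by auto
  from star_homD(4)[OF temb_hom sg_carrier[OF this]] show ?thesis by (simp add: tensor_def pre_ops)
qed

lemma tensor_add:
  assumes a: "a \<in> carrier A" "a' \<in> carrier A" and b: "b \<in> carrier B" "b' \<in> carrier B"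
  shows "tensor A B (a \<oplus>\<^bsub>A\<^esub> a') b = tensor A B a b \<oplus>\<^bsub>min_tensor A B\<^esub> tensor A B a' b"
    "tensor A B a (b \<oplus>\<^bsub>B\<^esub> b') = tensor A B a b \<oplus>\<^bsub>min_tensor A B\<^esub> tensor A B a b'"
proof -
  have s: "sg (x, y) 1 + sg (x', y') 1 \<in> carrier (pre_tensor A B)" if "x \<in> carrier A" "y \<in> carrier B" "x' \<in> carrier A" "y' \<in> carrier B" for x y x' y'
    using star_algebra.rs(1)[OF star_algebra_pt[OF A B] sg_carrier[OF that(1,2)] sg_carrier[OF that(3,4)]] by (simp add: pre_ops)
  have t: "temb (sg (x, y) 1 + sg (x', y') 1) = tensor A B x y \<oplus>\<^bsub>min_tensor A B\<^esub> tensor A B x' y'" if "x \<in> carrier A" "y \<in> carrier B" "x' \<in> carrier A" "y' \<in> carrier B" for x y x' y'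
    using star_homD(3)[OF temb_hom sg_carrier[OF that(1,2), of 1] sg_carrier[OF that(3,4), of 1]] by (simp add: pre_ops tensor_def)
  have aa: "a \<oplus>\<^bsub>A\<^esub> a' \<in> carrier A" by (rule star_algebra.rs(1)[OF st_A a])
  have bb: "b \<oplus>\<^bsub>B\<^esub> b' \<in> carrier B" by (rule star_algebra.rs(1)[OF st_B b])
  show "tensor A B (a \<oplus>\<^bsub>A\<^esub> a') b = tensor A B a b \<oplus>\<^bsub>min_tensor A B\<^esub> tensor A B a' b"
    unfolding t[OF a(1) b(1) a(2) b(1), symmetric]
    unfolding tensor_def
  proof (rule temb_eqI[OF sg_carrier[OF aa b(1)] s[OF a(1) b(1) a(2) b(1)]])
    fix \<pi> :: "'a \<Rightarrow> 'a operator" and \<rho> :: "'b \<Rightarrow> 'b operator" and h :: "'a \<times> 'b \<Rightarrow> complex"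
    assume r: "representation A \<pi>" "representation B \<rho>" and h: "h \<in> ell2"
    have "ampl (\<rho> b) h \<in> ell2" by (rule bounded_operatorD(1)[OF ampl_bounded(1)[OF representationD(1)[OF r(2) b(1)]] h])
    then have "flip (ampl (\<rho> b) h) \<in> ell2" by (simp add: flip_ell2)
    from row_ell2[OF this] have c: "(\<lambda>i. \<rho> b (\<lambda>j'. h (i, j')) j) \<in> ell2" for j by (simp add: flip_def ampl_def)
    show "tensor_rep \<pi> \<rho> (sg (a \<oplus>\<^bsub>A\<^esub> a', b) 1) h = tensor_rep \<pi> \<rho> (sg (a, b) 1 + sg (a', b) 1) h"
      by (auto simp: tensor_rep_simps tensor_operator_def representationD(2)[OF r(1) a c])
  qed
  show "tensor A B a (b \<oplus>\<^bsub>B\<^esub> b') = tensor A B a b \<oplus>\<^bsub>min_tensor A B\<^esub> tensor A B a b'"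
    unfolding t[OF a(1) b(1) a(1) b(2), symmetric]
    unfolding tensor_def
  proof (rule temb_eqI[OF sg_carrier[OF a(1) bb] s[OF a(1) b(1) a(1) b(2)]])
    fix \<pi> :: "'a \<Rightarrow> 'a operator" and \<rho> :: "'b \<Rightarrow> 'b operator" and h :: "'a \<times> 'b \<Rightarrow> complex"
    assume r: "representation A \<pi>" "representation B \<rho>" and h: "h \<in> ell2"
    have c: "(\<lambda>i. \<rho> b (\<lambda>j'. h (i, j')) j) \<in> ell2" if "b \<in> carrier B" for j b
    proof -
      have "ampl (\<rho> b) h \<in> ell2" by (rule bounded_operatorD(1)[OF ampl_bounded(1)[OF representationD(1)[OF r(2) that]] h])
      then have "flip (ampl (\<rho> b) h) \<in> ell2" by (simp add: flip_ell2)
      from row_ell2[OF this] show ?thesis by (simp add: flip_def ampl_def)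
    qed
    show "tensor_rep \<pi> \<rho> (sg (a, b \<oplus>\<^bsub>B\<^esub> b') 1) h = tensor_rep \<pi> \<rho> (sg (a, b) 1 + sg (a, b') 1) h"
      by (auto simp: tensor_rep_simps tensor_operator_def representationD(2)[OF r(2) b row_ell2[OF h]]
          bounded_operatorD(2)[OF representationD(1)[OF r(1) a(1)] c[OF b(1)] c[OF b(2)]])
  qed
qed

text \<open>The map \<open>(a, b) \<mapsto> a \<otimes> b\<close> on families, where finite sums and signs are at hand.\<close>

definition tens :: "'a cfam \<Rightarrow> 'b cfam \<Rightarrow> ('a, 'b) tensor_elem cfam" where
  "tens F G = sec (min_tensor A B) (tensor A B (ev A F) (ev B G))"

lemma tens_sec: "a \<in> carrier A \<Longrightarrow> b \<in> carrier B \<Longrightarrow> tens (sec A a) (sec B b) = sec (min_tensor A B) (tensor A B a b)"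
  by (simp add: tens_def A B)

lemma tens_simps:
  "tens (F + F') G = tens F G + tens F' G" "tens F (G + G') = tens F G + tens F G'"
  "tens F G * tens F' G' = tens (F * F') (G * G')" "star (tens F G) = tens (star F) (star G)"
proof -
  note e = ev_closed[OF A] ev_closed[OF B]
  note s = sec_simps[OF cT tensor_closed]
  show "tens (F + F') G = tens F G + tens F' G" "tens F (G + G') = tens F G + tens F G'"
    "tens F G * tens F' G' = tens (F * F') (G * G')" "star (tens F G) = tens (star F) (star G)"
    using A B
    by (simp_all add: tens_def s(1)[OF e tensor_closed[OF e], symmetric] s(2)[OF e tensor_closed[OF e], symmetric] s(4)[OF e, symmetric]
      tensor_add[OF e(1) e(1) e(2) e(2)] e tensor_mult tensor_adj)
qed

lemma tens_zero: "tens 0 G = 0" "tens F 0 = 0"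
  using tens_simps(1)[of 0 0 G] tens_simps(2)[of F 0 0] by simp_all

lemma tens_sum: "tens (sum f K) G = (\<Sum>k\<in>K. tens (f k) G)" "tens F (sum g K) = (\<Sum>k\<in>K. tens F (g k))"
  by (induction K rule: infinite_finite_induct) (simp_all add: tens_simps tens_zero)

lemma tens_one: "tens (sec A \<one>\<^bsub>A\<^esub>) (sec B \<one>\<^bsub>B\<^esub>) = sec (min_tensor A B) \<one>\<^bsub>min_tensor A B\<^esub>"
  using star_algebra.rs(6)[OF st_A] star_algebra.rs(6)[OF st_B] by (simp add: tens_sec tensor_one)

end

section \<open>The action on the sphere\<close>

text \<open>Let \<open>X\<^sub>i = \<Sum>\<^sub>k u\<^sub>i\<^sub>k \<otimes> x\<^sub>k\<close>.  Orthogonality of the columns turns \<open>\<Sum>\<^sub>i X\<^sub>i\<^sup>2\<close> into \<open>1 \<otimes> \<Sum>\<^sub>k x\<^sub>k\<^sup>2\<close>.  For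
\<open>\<epsilon>\<^sub>i\<^sub>j = 1\<close> the expansions of \<open>X\<^sub>i X\<^sub>j\<close> and \<open>X\<^sub>j X\<^sub>i\<close> match term by term after interchanging the two
summation indices in those terms where the corresponding coordinates commute.\<close>

lemma action_sphere_tuple:
  fixes A :: "'a cstar_algebra" and B :: "'b cstar_algebra" and u :: "'n::finite \<Rightarrow> 'n \<Rightarrow> 'a"
  assumes A: "cstar_algebra A" and B: "cstar_algebra B" and \<epsilon>: "commutation_matrix \<epsilon>"
    and x: "sphere_tuple B \<epsilon> x"
    and u: "\<And>i j. u i j \<in> carrier A" "\<And>i j. adj\<^bsub>A\<^esub> (u i j) = u i j"
    and orth: "\<And>k l. (\<Sum>i\<in>UNIV. sec A (u i k) * sec A (u i l)) = (if k = l then sec A \<one>\<^bsub>A\<^esub> else 0)"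
    and r1: "\<And>i j k l. \<epsilon> $ i $ j = 1 \<Longrightarrow> \<epsilon> $ k $ l = 1 \<Longrightarrow> u i k \<otimes>\<^bsub>A\<^esub> u j l = u j l \<otimes>\<^bsub>A\<^esub> u i k"
    and r2: "\<And>i j k l. \<epsilon> $ i $ j = 1 \<Longrightarrow> \<epsilon> $ k $ l = 0 \<Longrightarrow> u i k \<otimes>\<^bsub>A\<^esub> u j l = u j k \<otimes>\<^bsub>A\<^esub> u i l"
  shows "sphere_tuple (min_tensor A B) \<epsilon> (\<lambda>i. \<Oplus>\<^bsub>min_tensor A B\<^esub>k\<in>UNIV. tensor A B (u i k) (x k))"
proof -
  let ?T = "min_tensor A B" and ?t = "tens A B" and ?U = "\<lambda>i k. sec A (u i k)" and ?x = "\<lambda>k. sec B (x k)"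
  note T = cstar_algebra_min_tensor[OF A B] and xD = sphere_tupleD[OF x] and \<epsilon>D = commutation_matrixD[OF \<epsilon>]
  interpret T: star_algebra ?T by (rule cstar_star[OF T])
  note ts = tens_simps[OF A B] and tz = tens_zero[OF A B] and tsum = tens_sum[OF A B]
  have tc: "tensor A B (u i k) (x k) \<in> carrier ?T" for i k by (rule tensor_closed[OF A B u(1) xD(1)])
  define X where "X i = (\<Oplus>\<^bsub>?T\<^esub>k\<in>UNIV. tensor A B (u i k) (x k))" for i
  have Xc: "X i \<in> carrier ?T" for i unfolding X_def
    by (rule abelian_monoid.finsum_closed[OF ring_abelian_monoid[OF cstar_ring[OF T]]]) (simp add: tc)
  have Xs: "sec ?T (X i) = (\<Sum>k\<in>UNIV. ?t (?U i k) (?x k))" for i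
    unfolding X_def by (subst sec_finsum[OF T finite tc]) (simp add: tens_sec[OF A B u(1) xD(1)])
  have adj: "adj\<^bsub>?T\<^esub> (X i) = X i" for i
  proof -
    have U: "star (?U i k) = ?U i k" "star (?x k) = ?x k" for k
      using sec_simps(4)[OF A u(1), of i k] sec_simps(4)[OF B xD(1), of k] by (simp_all add: u(2) xD(2))
    have s: "star (sum f K) = (\<Sum>k\<in>K. star (f k))" for f :: "'n \<Rightarrow> ('a, 'b) tensor_elem cfam" and K
      by (induction K rule: infinite_finite_induct) (simp_all add: star_add)
    have "sec ?T (adj\<^bsub>?T\<^esub> (X i)) = sec ?T (X i)"
      by (subst sec_simps(4)[OF T Xc]) (simp add: Xs s ts(4) U)
    then show ?thesis by (simp add: sec_inj[OF T T.adj_closed[OF Xc] Xc])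
  qed
  have prod: "sec ?T (X i) * sec ?T (X j) = (\<Sum>k\<in>UNIV. \<Sum>l\<in>UNIV. ?t (?U i k * ?U j l) (?x k * ?x l))" for i j
    by (simp add: Xs sum_product ts(3))
  have "(\<Sum>i\<in>UNIV. sec ?T (X i) * sec ?T (X i)) = (\<Sum>k\<in>UNIV. \<Sum>l\<in>UNIV. ?t (\<Sum>i\<in>UNIV. ?U i k * ?U i l) (?x k * ?x l))"
  proof -
    have "(\<Sum>i\<in>UNIV. \<Sum>k\<in>UNIV. \<Sum>l\<in>UNIV. f i k l) = (\<Sum>k\<in>UNIV. \<Sum>l\<in>UNIV. \<Sum>i\<in>UNIV. f i k l)" for f :: "'n \<Rightarrow> 'n \<Rightarrow> 'n \<Rightarrow> ('a, 'b) tensor_elem cfam"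
      by (rule trans[OF sum.swap], rule sum.cong[OF refl], rule sum.swap)
    then show ?thesis unfolding prod tsum(1) .
  qed
  also have "\<dots> = (\<Sum>k\<in>UNIV. \<Sum>l\<in>UNIV. if k = l then ?t (sec A \<one>\<^bsub>A\<^esub>) (?x k * ?x k) else 0)"
    unfolding orth by (intro sum.cong) (auto simp: tz)
  also have "\<dots> = ?t (sec A \<one>\<^bsub>A\<^esub>) (\<Sum>k\<in>UNIV. ?x k * ?x k)" by (simp add: tsum(2))
  also have "\<dots> = sec ?T \<one>\<^bsub>?T\<^esub>" unfolding xD(3) by (rule tens_one[OF A B])
  finally have sq: "(\<Sum>i\<in>UNIV. sec ?T (X i) * sec ?T (X i)) = sec ?T \<one>\<^bsub>?T\<^esub>" .
  have comm: "X i \<otimes>\<^bsub>?T\<^esub> X j = X j \<otimes>\<^bsub>?T\<^esub> X i" if ij: "\<epsilon> $ i $ j = 1" for i j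
  proof -
    define \<sigma> where "\<sigma> p = (if \<epsilon> $ fst p $ snd p = 1 then prod.swap p else p)" for p :: "'n \<times> 'n"
    have \<sigma>\<sigma>: "\<sigma> (\<sigma> p) = p" for p using \<epsilon>D(1)[of "fst p" "snd p"] by (auto simp: \<sigma>_def)
    have term_eq: "?t (?U i k * ?U j l) (?x k * ?x l) = (case \<sigma> (k, l) of (k, l) \<Rightarrow> ?t (?U j k * ?U i l) (?x k * ?x l))" for k l
    proof (cases "\<epsilon> $ k $ l = 1")
      case True
      have "?U i k * ?U j l = ?U j l * ?U i k"
        using sec_simps(2)[OF A u(1) u(1), of i k j l] sec_simps(2)[OF A u(1) u(1), of j l i k] r1[OF ij True] by simp
      moreover have "?x k * ?x l = ?x l * ?x k"
        using sec_simps(2)[OF B xD(1) xD(1), of k l] sec_simps(2)[OF B xD(1) xD(1), of l k] xD(4)[OF True] by simp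
      ultimately show ?thesis using True by (simp add: \<sigma>_def)
    next
      case False
      have "?U i k * ?U j l = ?U j k * ?U i l"
        using sec_simps(2)[OF A u(1) u(1), of i k j l] sec_simps(2)[OF A u(1) u(1), of j k i l] r2[OF ij \<epsilon>D(2)[OF False]] by simp
      then show ?thesis using False by (simp add: \<sigma>_def)
    qed
    have "sec ?T (X i) * sec ?T (X j) = (\<Sum>p\<in>UNIV. case p of (k, l) \<Rightarrow> ?t (?U i k * ?U j l) (?x k * ?x l))"
      unfolding prod by (simp add: sum.cartesian_product)
    also have "\<dots> = (\<Sum>p\<in>UNIV. case \<sigma> p of (k, l) \<Rightarrow> ?t (?U j k * ?U i l) (?x k * ?x l))"
    proof (rule sum.cong[OF refl])
      fix p :: "'n \<times> 'n"
      show "(case p of (k, l) \<Rightarrow> ?t (?U i k * ?U j l) (?x k * ?x l)) = (case \<sigma> p of (k, l) \<Rightarrow> ?t (?U j k * ?U i l) (?x k * ?x l))"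
        using term_eq[of "fst p" "snd p"] by (simp add: case_prod_beta)
    qed
    also have "\<dots> = (\<Sum>p\<in>UNIV. case p of (k, l) \<Rightarrow> ?t (?U j k * ?U i l) (?x k * ?x l))"
      by (rule sum.reindex_bij_witness[of _ \<sigma> \<sigma>]) (auto simp: \<sigma>\<sigma>)
    also have "\<dots> = sec ?T (X j) * sec ?T (X i)" unfolding prod by (simp add: sum.cartesian_product)
    finally show ?thesis
      using sec_inj[OF T T.rs(5)[OF Xc Xc] T.rs(5)[OF Xc Xc], of i j j i] by (simp add: sec_simps(2)[OF T Xc Xc])
  qed
  show ?thesis unfolding X_def[symmetric] sphere_tuple_def using Xc adj sq comm by blast
qed

text \<open>The third kind of relation in \<open>R\<^sup>\<epsilon>\<close> is the second kind for the transposed matrix.\<close>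

lemma O_acts_on_sphere:
  assumes \<epsilon>: "commutation_matrix \<epsilon>" shows "acts_on_sphere (C_O \<epsilon>) (O_gen \<epsilon>) \<epsilon>"
proof -
  let ?A = "C_O \<epsilon>" and ?S = "C_sphere \<epsilon>" and ?u = "O_gen \<epsilon>"
  note u = O_tupleD[OF O_tuple_gen[of \<epsilon>]] and T = cstar_algebra_min_tensor[OF cstar_C_O cstar_C_sphere]
    and e = commutation_matrixD[OF \<epsilon>]
  have "sphere_tuple (min_tensor ?A ?S) \<epsilon> (\<lambda>i. \<Oplus>\<^bsub>min_tensor ?A ?S\<^esub>k\<in>UNIV. tensor ?A ?S (?u i k) (sphere_coord \<epsilon> k))"
    by (rule action_sphere_tuple[OF cstar_C_O cstar_C_sphere \<epsilon> sphere_tuple_coord u(1) u(2) u(4) u(5) u(6)])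
  from sphere_universal[OF T this]
  obtain \<alpha> where \<alpha>: "\<alpha> \<in> star_hom ?S (min_tensor ?A ?S)"
    "\<forall>i. \<alpha> (sphere_coord \<epsilon> i) = (\<Oplus>\<^bsub>min_tensor ?A ?S\<^esub>k\<in>UNIV. tensor ?A ?S (?u i k) (sphere_coord \<epsilon> k))" by blast
  have "sphere_tuple (min_tensor ?A ?S) \<epsilon> (\<lambda>i. \<Oplus>\<^bsub>min_tensor ?A ?S\<^esub>k\<in>UNIV. tensor ?A ?S (?u k i) (sphere_coord \<epsilon> k))"
    by (rule action_sphere_tuple[OF cstar_C_O cstar_C_sphere \<epsilon> sphere_tuple_coord, where u="\<lambda>i k. ?u k i", OF u(1) u(2) u(3) u(5) u(7)])
  from sphere_universal[OF T this]
  obtain \<beta> where \<beta>: "\<beta> \<in> star_hom ?S (min_tensor ?A ?S)"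
    "\<forall>i. \<beta> (sphere_coord \<epsilon> i) = (\<Oplus>\<^bsub>min_tensor ?A ?S\<^esub>k\<in>UNIV. tensor ?A ?S (?u k i) (sphere_coord \<epsilon> k))" by blast
  show ?thesis unfolding acts_on_sphere_def using \<alpha> \<beta> by blast
qed

section \<open>Slicing with the models\<close>

text \<open>The spatial norm refers to representations on square-summable functions on the carrier type, so
this is the form in which faithfulness is needed.\<close>

definition separated :: "'a cstar_algebra \<Rightarrow> bool" where
  "separated A \<longleftrightarrow> (\<forall>a\<in>carrier A. a \<noteq> \<zero>\<^bsub>A\<^esub> \<longrightarrow>
     (\<exists>(\<pi> :: 'a \<Rightarrow> 'a operator) h. representation A \<pi> \<and> h \<in> ell2 \<and> \<pi> a h \<noteq> (\<lambda>i. 0)))"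

lemma etens_delta_ell2: assumes h: "h \<in> ell2" shows "etens h (delta j) \<in> ell2"
proof -
  have "(\<lambda>x. (cmod (etens h (delta j) x))\<^sup>2) summable_on (\<lambda>i. (i, j)) ` UNIV"
    by (subst summable_on_reindex) (use h in \<open>auto simp: inj_on_def o_def etens_def delta_def ell2_def\<close>)
  also have "?this \<longleftrightarrow> (\<lambda>x. (cmod (etens h (delta j) x))\<^sup>2) summable_on UNIV"
    by (rule summable_on_cong_neutral) (auto simp: etens_def delta_def)
  finally show ?thesis by (simp add: ell2_def)
qed

lemma representation_comp:
  assumes h: "h \<in> star_hom A B" and \<rho>: "representation B \<rho>" shows "representation A (\<lambda>a. \<rho> (h a))"
  unfolding representation_def
  by (auto simp: star_homD[OF h] representationD[OF \<rho>])

lemma representation_sum: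
  fixes A :: "'a cstar_algebra" and \<pi> :: "'a \<Rightarrow> 'i operator"
  assumes A: "cstar_algebra A" and \<pi>: "representation A \<pi>" and h: "h \<in> ell2" and f: "\<And>k. f k \<in> carrier A"
  shows "\<pi> (ev A (\<Sum>k\<in>K. c k *\<^sub>C sec A (f k))) h i = (\<Sum>k\<in>K. c k * \<pi> (f k) h i)"
proof (induction K rule: infinite_finite_induct)
  case (insert k K)
  then show ?case using star_algebra.cs_closed[OF cstar_star[OF A] f]
    by (simp add: A f representationD(2)[OF \<pi> _ _ h] representationD(3)[OF \<pi> f h] ev_closed[OF A])
qed (use representationD(3)[OF \<pi> star_algebra.rs(2)[OF cstar_star[OF A]] h, of 0] star_algebra.cs_zero_left[OF cstar_star[OF A] star_algebra.rs(2)[OF cstar_star[OF A]]]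
     in \<open>simp_all add: A\<close>)

text \<open>The functional \<open>b \<mapsto> (\<theta> b)\<^sub>p\<^sub>q\<close> given by a matrix entry of a morphism \<open>\<theta>\<close> to the two-by-two matrices
can be applied to the second tensor factor.  Indeed, for a representation \<open>\<pi>\<close> of the first factor the
representation \<open>\<pi> \<otimes> \<theta>\<close> kills the given sum, and its entry at \<open>(p, q)\<close> is \<open>\<pi>\<close> of the element in the
conclusion, which is therefore zero.  The second factor has carrier in a type of sets only to
provide two distinct indices for the basis vectors.\<close>

lemma slice_sum:
  fixes A :: "'a cstar_algebra" and B :: "('u set) cstar_algebra"
  assumes A: "cstar_algebra A" and B: "cstar_algebra B" and sep: "separated A" and \<theta>: "\<theta> \<in> star_hom B M2"
    and f: "\<And>k. f k \<in> carrier A" and g: "\<And>k. g k \<in> carrier B" and K: "finite K"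
    and 0: "(\<Sum>k\<in>K. tens A B (sec A (f k)) (sec B (g k))) = 0"
  shows "(\<Sum>k\<in>K. \<theta> (g k) p q *\<^sub>C sec A (f k)) = 0"
proof (rule ccontr)
  let ?F = "\<Sum>k\<in>K. \<theta> (g k) p q *\<^sub>C sec A (f k)" and ?T = "min_tensor A B"
  assume ne: "?F \<noteq> 0"
  define w where "w = ev A ?F"
  have wc: "w \<in> carrier A" by (simp add: w_def ev_closed[OF A])
  have "sec A (ev A (\<Sum>k\<in>K. \<theta> (g k) p q *\<^sub>C sec A (f k))) = ?F"
    using K
  proof (induction K rule: finite_induct)
    case empty
    then show ?case using sec_simps(5)[OF A f] by (simp add: A)
  next
    case (insert k K)
    then show ?case using star_algebra.cs_closed[OF cstar_star[OF A] f]
      by (simp add: A f sec_simps[OF A ] ev_closed[OF A])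
  qed
  then have w: "sec A w = ?F" by (simp add: w_def)
  then have "w \<noteq> \<zero>\<^bsub>A\<^esub>" using ne sec_simps(5)[OF A wc] by auto
  then obtain \<pi> :: "'a \<Rightarrow> 'a operator" and h where \<pi>: "representation A \<pi>" and h: "h \<in> ell2" and nz: "\<pi> w h \<noteq> (\<lambda>i. 0)"
    using sep wc unfolding separated_def by blast
  \<comment> \<open>Any two distinct elements of the index type would do.\<close>
  define \<iota> :: "bool \<Rightarrow> 'u set" where "\<iota> b = (if b then UNIV else {})" for b
  have \<iota>: "inj \<iota>" by (auto simp: inj_def \<iota>_def)
  let ?\<rho> = "\<lambda>b. mat_rep \<iota> (\<theta> b)" and ?v = "etens h (delta (\<iota> q))"
  have \<rho>: "representation B ?\<rho>" by (rule representation_comp[OF \<theta> mat_rep_M2[OF \<iota>]])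
  define z where "z K = (\<Sum>k\<in>K. sg (f k, g k) (1 :: complex))" for K
  have zc: "z K \<in> carrier (pre_tensor A B) \<and> sec ?T (temb A B (z K)) = (\<Sum>k\<in>K. tens A B (sec A (f k)) (sec B (g k)))" if "finite K" for K
    using that
  proof (induction K rule: finite_induct)
    case empty
    have s: "sg (f undefined, g undefined) 1 \<in> carrier (pre_tensor A B)" by (rule sg_carrier[OF A B f g])
    have "temb A B 0 = \<zero>\<^bsub>?T\<^esub>"
      using star_hom_minus(2)[OF star_algebra_pt[OF A B] cstar_star[OF cT[OF A B]] temb_hom[OF A B] s s] by (simp add: pre_ops[OF A B])
    then show ?case using sec_simps(5)[OF cT[OF A B] tensor_closed[OF A B f g]] by (simp add: z_def pt_carrier[OF A B])
  next
    case (insert k K)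
    have s: "sg (f k, g k) 1 \<in> carrier (pre_tensor A B)" by (rule sg_carrier[OF A B f g])
    have e: "z (insert k K) = sg (f k, g k) 1 \<oplus>\<^bsub>pre_tensor A B\<^esub> z K" using insert by (simp add: z_def pre_ops[OF A B])
    have zK: "z K \<in> carrier (pre_tensor A B)" using insert by blast
    have "sec ?T (temb A B (z (insert k K))) = sec ?T (temb A B (sg (f k, g k) 1)) + sec ?T (temb A B (z K))"
      unfolding e star_homD(3)[OF temb_hom[OF A B] s zK]
      by (rule sec_simps(1)[OF cT[OF A B]]) (rule star_homD(1)[OF temb_hom[OF A B]], rule s zK)+
    then show ?case
      using insert star_algebra.rs(1)[OF star_algebra_pt[OF A B] s zK] by (simp add: e tens_sec[OF A B f g]) (simp add: tensor_def)
  qed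
  note zK = conjunct1[OF zc[OF K]] and tK = conjunct2[OF zc[OF K]]
  have "sec ?T (temb A B (z K)) = 0" using tK 0 by simp
  moreover have tc: "temb A B (z K) \<in> carrier ?T" by (rule star_homD(1)[OF temb_hom[OF A B] zK])
  ultimately have "\<parallel>temb A B (z K)\<parallel>\<^bsub>?T\<^esub> = 0" using norm_sec[OF cT[OF A B] tc] by simp
  then have "min_seminorm A B (z K) = 0"
    using completing.norm_emb[OF completing_min[OF A B] zK] by (simp add: min_tensor_def)
  from min_seminorm_zeroD[OF A B zK this \<pi> \<rho> etens_delta_ell2[OF h]]
  have "tensor_rep \<pi> ?\<rho> (z K) ?v = (\<lambda>x. 0)" .
  moreover have "tensor_rep \<pi> ?\<rho> (z K) ?v (i, \<iota> p) = (\<Sum>k\<in>K. \<theta> (g k) p q * \<pi> (f k) h i)" for i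
    using K
  proof (induction K rule: finite_induct)
    case (insert k K)
    have "z (insert k K) = sg (f k, g k) 1 + z K" using insert by (simp add: z_def)
    moreover have "tensor_operator (\<pi> (f k)) (?\<rho> (g k)) ?v = etens (\<pi> (f k) h) (?\<rho> (g k) (delta (\<iota> q)))"
      unfolding tensor_operator_eq
      by (subst ampl_etens[OF representationD(1)[OF \<rho> g] delta_ell2]) (rule lampl_etens[OF representationD(1)[OF \<pi> f] h])
    moreover have "?\<rho> (g k) (delta (\<iota> q)) (\<iota> p) = \<theta> (g k) p q"
      by (cases p; cases q) (simp_all add: mat_rep_def delta_def \<iota>_def)
    ultimately show ?case using insert by (simp add: tensor_rep_simps etens_def mult.commute)
  qed (simp add: z_def tensor_rep_simps)
  ultimately have "\<pi> w h i = 0" for i using representation_sum[OF A \<pi> h, of f] f by (simp add: w_def)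
  then show False using nz by auto
qed

section \<open>Quadratic relations on the sphere\<close>

text \<open>The squares are scalar, \<open>(s \<sigma>\<^sub>x + t \<sigma>\<^sub>z)\<^sup>2 = s\<^sup>2 + t\<^sup>2\<close>, and two such matrices commute precisely if the vectors
\<open>(s, t)\<close> are parallel.\<close>

lemma sphere_model:
  fixes s t :: "'n::finite \<Rightarrow> real"
  assumes 1: "(\<Sum>k\<in>UNIV. s k * s k + t k * t k) = 1" and c: "\<And>k l. \<epsilon> $ k $ l = 1 \<Longrightarrow> s k * t l = t k * s l"
  shows "\<exists>\<theta>\<in>star_hom (C_sphere \<epsilon>) M2. \<forall>k. \<theta> (sphere_coord \<epsilon> k) = pauli (s k) (t k)"
proof (rule sphere_universal[OF cstar_algebra_M2])
  note M = cstar_algebra_M2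
  have cl: "m \<in> carrier M2" for m by (simp add: M2_simps)
  have sq: "pauli x y \<otimes>\<^bsub>M2\<^esub> pauli x y = complex_of_real (x * x + y * y) \<odot>\<^bsub>M2\<^esub> \<one>\<^bsub>M2\<^esub>" for x y
    unfolding pauli_facts by (auto simp: M2_simps fun_eq_iff)
  have "(\<Sum>k\<in>UNIV. sec M2 (pauli (s k) (t k)) * sec M2 (pauli (s k) (t k))) = (\<Sum>k\<in>UNIV. (s k * s k + t k * t k) *\<^sub>R sec M2 \<one>\<^bsub>M2\<^esub>)"
    by (simp only: sec_simps(2)[OF M cl cl, symmetric] sq sec_simps(3)[OF M cl] cscale_of_real)
  also have "\<dots> = sec M2 \<one>\<^bsub>M2\<^esub>" by (simp only: scaleR_sum_left[symmetric] 1 scaleR_one)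
  finally have sum: "(\<Sum>k\<in>UNIV. sec M2 (pauli (s k) (t k)) * sec M2 (pauli (s k) (t k))) = sec M2 \<one>\<^bsub>M2\<^esub>" .
  have comm: "pauli (s k) (t k) \<otimes>\<^bsub>M2\<^esub> pauli (s l) (t l) = pauli (s l) (t l) \<otimes>\<^bsub>M2\<^esub> pauli (s k) (t k)" if "\<epsilon> $ k $ l = 1" for k l
  proof -
    have e: "s k * s l + t k * t l = s l * s k + t l * t k" "s k * t l - t k * s l = s l * t k - t l * s k" "t k * s l - s k * t l = t l * s k - s l * t k"
      using c[OF that] by (simp_all add: mult.commute)
    show ?thesis unfolding pauli_facts(2) e ..
  qed
  show "sphere_tuple M2 \<epsilon> (\<lambda>k. pauli (s k) (t k))"
    unfolding sphere_tuple_def by (intro conjI allI impI cl pauli_facts(1) sum comm)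
qed

context
  fixes A :: "'a cstar_algebra" and \<epsilon> :: "nat ^ 'n::finite ^ 'n" and C :: "'n \<Rightarrow> 'n \<Rightarrow> 'a"
  assumes A: "cstar_algebra A" and sep: "separated A" and \<epsilon>: "commutation_matrix \<epsilon>" and Cc: "\<And>k l. C k l \<in> carrier A"
    and 0: "(\<Sum>k\<in>UNIV. \<Sum>l\<in>UNIV. tens A (C_sphere \<epsilon>) (sec A (C k l)) (sec (C_sphere \<epsilon>) (sphere_coord \<epsilon> k) * sec (C_sphere \<epsilon>) (sphere_coord \<epsilon> l))) = 0"
begin

text \<open>The diagonal entry \<open>(False, False)\<close> and the off-diagonal entry \<open>(False, True)\<close> of the products of
the model matrices are the symmetric and the antisymmetric bilinear expression in \<open>(s, t)\<close>.\<close>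

lemma quadratic_slices:
  fixes s t :: "'n::finite \<Rightarrow> real"
  assumes 1: "(\<Sum>k\<in>UNIV. s k * s k + t k * t k) = 1" and c: "\<And>k l. \<epsilon> $ k $ l = 1 \<Longrightarrow> s k * t l = t k * s l"
  shows "(\<Sum>k\<in>UNIV. \<Sum>l\<in>UNIV. (s k * s l + t k * t l) *\<^sub>R sec A (C k l)) = 0"
    "(\<Sum>k\<in>UNIV. \<Sum>l\<in>UNIV. (t k * s l - s k * t l) *\<^sub>R sec A (C k l)) = 0"
proof -
  let ?S = "C_sphere \<epsilon>" and ?x = "sphere_coord \<epsilon>"
  note S = cstar_C_sphere[of \<epsilon>] and xc = sphere_tupleD(1)[OF sphere_tuple_coord[of \<epsilon>]]
  obtain \<theta> where \<theta>: "\<theta> \<in> star_hom ?S M2" "\<And>k. \<theta> (?x k) = pauli (s k) (t k)" using sphere_model[OF 1 c] by blast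
  have m: "\<theta> (?x k \<otimes>\<^bsub>?S\<^esub> ?x l) = pauli (s k) (t k) \<otimes>\<^bsub>M2\<^esub> pauli (s l) (t l)" for k l
    by (simp add: star_homD(2)[OF \<theta>(1) xc xc] \<theta>(2))
  have xx: "?x k \<otimes>\<^bsub>?S\<^esub> ?x l \<in> carrier ?S" for k l by (rule star_algebra.rs(5)[OF cstar_star[OF S] xc xc])
  have "(\<Sum>kl\<in>UNIV. tens A ?S (sec A (C (fst kl) (snd kl))) (sec ?S (?x (fst kl) \<otimes>\<^bsub>?S\<^esub> ?x (snd kl)))) = 0"
    using 0 by (simp add: sec_simps(2)[OF S xc xc] sum.cartesian_product case_prod_beta)
  from slice_sum[where f="\<lambda>kl. C (fst kl) (snd kl)" and g="\<lambda>kl. ?x (fst kl) \<otimes>\<^bsub>?S\<^esub> ?x (snd kl)", OF A S sep \<theta>(1) Cc xx finite this]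
  have z: "(\<Sum>kl\<in>UNIV. \<theta> (?x (fst kl) \<otimes>\<^bsub>?S\<^esub> ?x (snd kl)) p q *\<^sub>C sec A (C (fst kl) (snd kl))) = 0" for p q .
  show "(\<Sum>k\<in>UNIV. \<Sum>l\<in>UNIV. (s k * s l + t k * t l) *\<^sub>R sec A (C k l)) = 0"
    using z[of False False] unfolding m pauli_facts
    by (simp add: sum.cartesian_product case_prod_beta flip: of_real_mult of_real_add)
  show "(\<Sum>k\<in>UNIV. \<Sum>l\<in>UNIV. (t k * s l - s k * t l) *\<^sub>R sec A (C k l)) = 0"
    using z[of False True] unfolding m pauli_facts
    by (simp add: sum.cartesian_product case_prod_beta flip: of_real_mult of_real_diff)
qed

lemma double_sum_two:
  fixes G :: "'n \<Rightarrow> 'n \<Rightarrow> 'b::comm_monoid_add"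
  assumes "m \<noteq> n" "\<And>k l. k \<notin> {m, n} \<or> l \<notin> {m, n} \<Longrightarrow> G k l = 0"
  shows "(\<Sum>k\<in>UNIV. \<Sum>l\<in>UNIV. G k l) = G m m + G m n + (G n m + G n n)"
proof -
  have "(\<Sum>l\<in>UNIV. G k l) = G k m + G k n" for k
  proof -
    have "(\<Sum>l\<in>UNIV. G k l) = (\<Sum>l\<in>{m, n}. G k l)" by (rule sum.mono_neutral_right) (use assms in auto)
    then show ?thesis using assms(1) by simp
  qed
  moreover have "(\<Sum>k\<in>UNIV. G k m + G k n) = (\<Sum>k\<in>{m, n}. G k m + G k n)"
    by (rule sum.mono_neutral_right) (use assms in auto)
  ultimately show ?thesis using assms(1) by simp
qed

text \<open>The model with the single coordinate \<open>x\<^sub>m = \<sigma>\<^sub>x\<close>.\<close>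

lemma quadratic_relation_diagonal: "sec A (C m m) = 0"
proof -
  have "(\<Sum>k\<in>UNIV. \<Sum>l\<in>UNIV. ((if k = m then 1 else 0) * (if l = m then 1 else 0) + 0 * 0) *\<^sub>R sec A (C k l)) = 0"
  proof (rule quadratic_slices(1)[of "\<lambda>k. if k = m then 1 else 0" "\<lambda>k. 0"])
    have "(\<Sum>k\<in>UNIV. (if k = m then 1 else 0) * (if k = m then 1 else 0) + 0 * 0 :: real) = (\<Sum>k\<in>UNIV. if k = m then 1 else 0)"
      by (intro sum.cong) auto
    then show "(\<Sum>k\<in>UNIV. (if k = m then 1 else 0) * (if k = m then 1 else 0) + 0 * 0 :: real) = 1" by simp
  qed simp
  moreover have "(\<Sum>l\<in>UNIV. ((if k = m then 1 else 0) * (if l = m then 1 else 0) + 0 * 0) *\<^sub>R sec A (C k l)) = (if k = m then sec A (C m m) else 0)" for k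
  proof -
    have "(\<Sum>l\<in>UNIV. ((if k = m then 1 else 0) * (if l = m then 1 else 0) + 0 * 0) *\<^sub>R sec A (C k l)) = (\<Sum>l\<in>UNIV. if l = m then (if k = m then sec A (C m m) else 0) else 0)"
      by (intro sum.cong) auto
    then show ?thesis by simp
  qed
  ultimately show ?thesis by simp
qed

text \<open>A commutative model in the plane of two coordinates.  The Pythagorean numbers \<open>3/5\<close> and \<open>4/5\<close> make
the weights rational.\<close>

lemma quadratic_relation_antisymmetric:
  assumes mn: "m \<noteq> n" shows "sec A (C m n) + sec A (C n m) = 0"
proof -
  let ?s = "\<lambda>k. if k = m then 3/5 else if k = n then 4/5 else 0 :: real"
  have 1: "(\<Sum>k\<in>UNIV. ?s k * ?s k + 0 * 0) = 1" 
  proof -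
    have "(\<Sum>k\<in>UNIV. ?s k * ?s k + 0 * 0) = (\<Sum>k\<in>{m, n}. ?s k * ?s k + 0 * 0)"
      by (rule sum.mono_neutral_right) auto
    then show ?thesis using mn by simp
  qed
  have "(\<Sum>k\<in>UNIV. \<Sum>l\<in>UNIV. (?s k * ?s l + 0 * 0) *\<^sub>R sec A (C k l)) = 0"
    by (rule quadratic_slices(1)[where t="\<lambda>_. 0"]) (use 1 in simp_all)
  then have "(12/25::real) *\<^sub>R (sec A (C m n) + sec A (C n m)) = 0"
    by (subst (asm) double_sum_two[OF mn]) (use mn in \<open>auto simp: quadratic_relation_diagonal scaleR_add_right\<close>)
  then show ?thesis by simp
qed

text \<open>The model \<open>x\<^sub>m = 3/5 \<sigma>\<^sub>x\<close>, \<open>x\<^sub>n = 4/5 \<sigma>\<^sub>z\<close> is available since the coordinates need not commute.  It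
yields \<open>c\<^sub>m\<^sub>n = c\<^sub>n\<^sub>m\<close>, next to \<open>c\<^sub>m\<^sub>n = - c\<^sub>n\<^sub>m\<close>.\<close>

lemma quadratic_relation_free:
  assumes mn: "m \<noteq> n" and e: "\<epsilon> $ m $ n \<noteq> 1" shows "sec A (C m n) = 0"
proof -
  let ?s = "\<lambda>k. if k = m then 3/5 else 0 :: real" and ?t = "\<lambda>k. if k = n then 4/5 else 0 :: real"
  have 1: "(\<Sum>k\<in>UNIV. ?s k * ?s k + ?t k * ?t k) = 1"
  proof -
    have "(\<Sum>k\<in>UNIV. ?s k * ?s k + ?t k * ?t k) = (\<Sum>k\<in>{m, n}. ?s k * ?s k + ?t k * ?t k)"
      by (rule sum.mono_neutral_right) auto
    then show ?thesis using mn by simp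
  qed
  have "(\<Sum>k\<in>UNIV. \<Sum>l\<in>UNIV. (?t k * ?s l - ?s k * ?t l) *\<^sub>R sec A (C k l)) = 0"
    by (rule quadratic_slices(2)[OF 1]) (use e commutation_matrixD(1)[OF \<epsilon>, of m n] in auto)
  then have "(12/25::real) *\<^sub>R (sec A (C n m) - sec A (C m n)) = 0"
    by (subst (asm) double_sum_two[OF mn]) (use mn in \<open>auto simp: scaleR_diff_right\<close>)
  then have "sec A (C n m) = sec A (C m n)" by simp
  then have "2 *\<^sub>R sec A (C m n) = 0" using quadratic_relation_antisymmetric[OF mn] by (simp add: scaleR_2)
  then show ?thesis by simp
qed

end

section \<open>The relations forced by an action\<close>

lemma tens_minus:
  assumes A: "cstar_algebra (A :: 'a cstar_algebra)" and B: "cstar_algebra (B :: 'b cstar_algebra)"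
  shows "tens A B (F - F') G = tens A B F G - tens A B F' G"
  using tens_simps(1)[OF A B, of "F - F'" F' G] by (simp add: eq_diff_eq)

lemma morphism_sum: assumes f: "star_morphism f" shows "f (sum g K) = (\<Sum>i\<in>K. f (g i))"
  by (induction K rule: infinite_finite_induct) (simp_all add: morphism_simps[OF f])

text \<open>The images of the sphere relations under \<open>\<alpha>\<close> are expanded and compared.  Selfadjointness of the
coordinates gives a linear relation.  The equation \<open>\<Sum>\<^sub>i \<alpha>(x\<^sub>i)\<^sup>2 = 1\<close> becomes quadratic after writing
\<open>1 \<otimes> 1\<close> as \<open>\<Sum>\<^sub>k 1 \<otimes> x\<^sub>k\<^sup>2\<close>, with coefficients \<open>C\<^sub>k\<^sub>l = \<Sum>\<^sub>i w\<^sub>i\<^sub>k w\<^sub>i\<^sub>l - \<delta>\<^sub>k\<^sub>l\<close>, and commutation of \<open>\<alpha>(x\<^sub>i)\<close>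
with \<open>\<alpha>(x\<^sub>j)\<close> has the coefficients \<open>D\<^sub>k\<^sub>l = w\<^sub>i\<^sub>k w\<^sub>j\<^sub>l - w\<^sub>j\<^sub>k w\<^sub>i\<^sub>l\<close>.\<close>

lemma action_relations:
  fixes A :: "'a cstar_algebra" and \<epsilon> :: "nat ^ 'n::finite ^ 'n" and w :: "'n \<Rightarrow> 'n \<Rightarrow> 'a"
  defines "T \<equiv> min_tensor A (C_sphere \<epsilon>)" and "W \<equiv> \<lambda>i k. sec A (w i k)"
  assumes A: "cstar_algebra A" and sep: "separated A" and \<epsilon>: "commutation_matrix \<epsilon>" and w: "\<And>i k. w i k \<in> carrier A"
    and \<alpha>: "\<alpha> \<in> star_hom (C_sphere \<epsilon>) T"
    and \<alpha>x: "\<And>i. \<alpha> (sphere_coord \<epsilon> i) = (\<Oplus>\<^bsub>T\<^esub>k\<in>UNIV. tensor A (C_sphere \<epsilon>) (w i k) (sphere_coord \<epsilon> k))"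
  shows "adj\<^bsub>A\<^esub> (w i k) = w i k"
    "(\<Sum>i\<in>UNIV. W i k * W i k) = sec A \<one>\<^bsub>A\<^esub>"
    "k \<noteq> l \<Longrightarrow> (\<Sum>i\<in>UNIV. W i k * W i l) + (\<Sum>i\<in>UNIV. W i l * W i k) = 0"
    "k \<noteq> l \<Longrightarrow> \<epsilon> $ k $ l \<noteq> 1 \<Longrightarrow> (\<Sum>i\<in>UNIV. W i k * W i l) = 0"
    "\<epsilon> $ i $ j = 1 \<Longrightarrow> k \<noteq> l \<Longrightarrow> (W i k * W j l - W j k * W i l) + (W i l * W j k - W j l * W i k) = 0"
    "\<epsilon> $ i $ j = 1 \<Longrightarrow> \<epsilon> $ k $ l \<noteq> 1 \<Longrightarrow> W i k * W j l = W j k * W i l"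
proof -
  let ?S = "C_sphere \<epsilon>" and ?x = "sphere_coord \<epsilon>" and ?t = "tens A (C_sphere \<epsilon>)" and ?X = "\<lambda>k. sec (C_sphere \<epsilon>) (sphere_coord \<epsilon> k)"
  note S = cstar_C_sphere[of \<epsilon>] and xD = sphere_tupleD[OF sphere_tuple_coord[of \<epsilon>]]
  note ts = tens_simps[OF A S] and tz = tens_zero[OF A S] and tsum = tens_sum[OF A S] and tm = tens_minus[OF A S]
  have T: "cstar_algebra T" unfolding T_def by (rule cstar_algebra_min_tensor[OF A S])
  interpret S: star_algebra ?S by (rule cstar_star[OF S])
  interpret A: star_algebra A by (rule cstar_star[OF A])
  note \<alpha>D = star_homD[OF \<alpha>]
  have ax: "sec T (\<alpha> (?x i)) = (\<Sum>k\<in>UNIV. ?t (W i k) (?X k))" for i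
    unfolding \<alpha>x W_def tens_sec[OF A S w xD(1)]
    unfolding T_def by (rule sec_finsum[OF cstar_algebra_min_tensor[OF A S] finite tensor_closed[OF A S w xD(1)]])
  have aX: "\<alpha> (?x i) \<in> carrier T" for i by (rule \<alpha>D(1)[OF xD(1)])
  have aprod: "sec T (\<alpha> (?x i)) * sec T (\<alpha> (?x j)) = (\<Sum>k\<in>UNIV. \<Sum>l\<in>UNIV. ?t (W i k * W j l) (?X k * ?X l))" for i j
    by (simp add: ax sum_product ts(3))
  have WW: "W i k * W j l = sec A (w i k \<otimes>\<^bsub>A\<^esub> w j l)" for i j k l
    unfolding W_def by (rule sec_simps(2)[OF A w w, symmetric])
  have ww: "w i k \<otimes>\<^bsub>A\<^esub> w j l \<in> carrier A" for i j k l by (rule A.rs(5)[OF w w])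

  show "adj\<^bsub>A\<^esub> (w i k) = w i k"
  proof -
    let ?s = "\<lambda>l. if l = k then 1 else 0 :: real"
    have 1: "(\<Sum>l\<in>UNIV. ?s l * ?s l + 0 * 0) = 1"
    proof -
      have "(\<Sum>l\<in>UNIV. ?s l * ?s l + 0 * 0) = (\<Sum>l\<in>UNIV. if l = k then 1 else 0)" by (intro sum.cong) auto
      then show ?thesis by simp
    qed
    obtain \<theta> where \<theta>: "\<theta> \<in> star_hom ?S M2" "\<And>l. \<theta> (?x l) = pauli (?s l) 0"
      using sphere_model[of ?s "\<lambda>_. 0" \<epsilon>] 1 by auto
    have st: "star (sum f K) = (\<Sum>k\<in>K. star (f k))" for f :: "'n \<Rightarrow> ('a, 'n universal_elem) tensor_elem cfam" and K
      by (induction K rule: infinite_finite_induct) (simp_all add: star_add)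
    have sX: "star (?X l) = ?X l" for l using sec_simps(4)[OF S xD(1), of l] by (simp add: xD(2))
    have sW: "star (W i l) = sec A (adj\<^bsub>A\<^esub> (w i l))" for l unfolding W_def by (rule sec_simps(4)[OF A w, symmetric])
    have "star (sec T (\<alpha> (?x i))) = sec T (\<alpha> (?x i))"
      using sec_simps(4)[OF T aX, of i] \<alpha>D(6)[OF xD(1), of i] by (simp add: xD(2))
    then have "(\<Sum>l\<in>UNIV. ?t (star (W i l) - W i l) (?X l)) = 0"
      by (simp add: ax st ts(4) sX tm sum_subtractf)
    moreover have "star (W i l) - W i l = sec A (adj\<^bsub>A\<^esub> (w i l) \<ominus>\<^bsub>A\<^esub> w i l)" for l
      unfolding sW by (simp add: W_def sec_minus[OF A A.adj_closed[OF w] w])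
    ultimately have z: "(\<Sum>l\<in>UNIV. ?t (sec A (adj\<^bsub>A\<^esub> (w i l) \<ominus>\<^bsub>A\<^esub> w i l)) (?X l)) = 0" by simp
    have "(\<Sum>l\<in>UNIV. \<theta> (?x l) False True *\<^sub>C sec A (adj\<^bsub>A\<^esub> (w i l) \<ominus>\<^bsub>A\<^esub> w i l)) = 0"
      by (rule slice_sum[OF A S sep \<theta>(1) A.rs(4)[OF A.adj_closed[OF w] w] xD(1) finite z])
    moreover have "\<theta> (?x l) False True *\<^sub>C sec A (adj\<^bsub>A\<^esub> (w i l) \<ominus>\<^bsub>A\<^esub> w i l) = (if l = k then sec A (adj\<^bsub>A\<^esub> (w i k) \<ominus>\<^bsub>A\<^esub> w i k) else 0)" for l
      by (simp add: \<theta>(2) pauli_def)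
    ultimately have "sec A (adj\<^bsub>A\<^esub> (w i k)) = sec A (w i k)" by (simp add: sec_minus[OF A A.adj_closed[OF w] w])
    then show ?thesis by (simp add: sec_inj[OF A A.adj_closed[OF w] w])
  qed

  define C where "C k l = ev A ((\<Sum>i\<in>UNIV. W i k * W i l) - (if k = l then sec A \<one>\<^bsub>A\<^esub> else 0))" for k l
  have Cc: "C k l \<in> carrier A" for k l unfolding C_def by (rule ev_closed[OF A])
  have sumW: "(\<Sum>i\<in>UNIV. W i k * W i l) = sec A (\<Oplus>\<^bsub>A\<^esub>i\<in>UNIV. w i k \<otimes>\<^bsub>A\<^esub> w i l)" for k l
    unfolding WW by (rule sec_finsum[OF A finite ww, symmetric])
  have sumc: "(\<Oplus>\<^bsub>A\<^esub>i\<in>UNIV. w i k \<otimes>\<^bsub>A\<^esub> w i l) \<in> carrier A" for k l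
    by (rule abelian_monoid.finsum_closed[OF ring_abelian_monoid[OF cstar_ring[OF A]]]) (simp add: ww)
  have CC: "sec A (C k l) = (\<Sum>i\<in>UNIV. W i k * W i l) - (if k = l then sec A \<one>\<^bsub>A\<^esub> else 0)" for k l
  proof -
    have "(\<Sum>i\<in>UNIV. W i k * W i l) - (if k = l then sec A \<one>\<^bsub>A\<^esub> else 0) =
        sec A ((\<Oplus>\<^bsub>A\<^esub>i\<in>UNIV. w i k \<otimes>\<^bsub>A\<^esub> w i l) \<ominus>\<^bsub>A\<^esub> (if k = l then \<one>\<^bsub>A\<^esub> else \<zero>\<^bsub>A\<^esub>))"
      unfolding sumW using sec_simps(5)[OF A w] by (cases "k = l") (simp_all add: sec_minus[OF A sumc A.rs(6)] sec_minus[OF A sumc A.rs(2)])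
    moreover have "(\<Oplus>\<^bsub>A\<^esub>i\<in>UNIV. w i k \<otimes>\<^bsub>A\<^esub> w i l) \<ominus>\<^bsub>A\<^esub> (if k = l then \<one>\<^bsub>A\<^esub> else \<zero>\<^bsub>A\<^esub>) \<in> carrier A"
      by (rule A.rs(4)[OF sumc]) (simp add: A.rs(2,6))
    ultimately show ?thesis by (simp add: C_def A)
  qed
  have "(\<Sum>k\<in>UNIV. \<Sum>l\<in>UNIV. ?t (\<Sum>i\<in>UNIV. W i k * W i l) (?X k * ?X l)) = (\<Sum>i\<in>UNIV. sec T (\<alpha> (?x i)) * sec T (\<alpha> (?x i)))"
  proof -
    have "(\<Sum>i\<in>UNIV. \<Sum>k\<in>UNIV. \<Sum>l\<in>UNIV. f i k l) = (\<Sum>k\<in>UNIV. \<Sum>l\<in>UNIV. \<Sum>i\<in>UNIV. f i k l)" for f :: "'n \<Rightarrow> 'n \<Rightarrow> 'n \<Rightarrow> ('a, 'n universal_elem) tensor_elem cfam"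
      by (rule trans[OF sum.swap], rule sum.cong[OF refl], rule sum.swap)
    then show ?thesis unfolding aprod tsum(1) by (rule sym)
  qed
  also have "\<dots> = sec T \<one>\<^bsub>T\<^esub>"
  proof -
    have m: "star_morphism (\<lambda>F. sec T (\<alpha> (ev ?S F)))" by (rule star_morphism_of_star_hom[OF S T \<alpha>])
    have "sec T (\<alpha> (ev ?S (\<Sum>i\<in>K. ?X i * ?X i))) = (\<Sum>i\<in>K. sec T (\<alpha> (?x i)) * sec T (\<alpha> (?x i)))" for K
      by (simp only: morphism_sum[OF m] morphism_simps(3)[OF m] ev_sec_same[OF S xD(1)])
    then have "(\<Sum>i\<in>UNIV. sec T (\<alpha> (?x i)) * sec T (\<alpha> (?x i))) = sec T (\<alpha> (ev ?S (sec ?S \<one>\<^bsub>?S\<^esub>)))" unfolding xD(3)[symmetric] by simp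
    then show ?thesis by (simp add: S S.rs(6) \<alpha>D(4)[OF S.rs(6)])
  qed
  also have "\<dots> = ?t (sec A \<one>\<^bsub>A\<^esub>) (\<Sum>k\<in>UNIV. ?X k * ?X k)" unfolding xD(3) T_def by (rule tens_one[OF A S, symmetric])
  also have "\<dots> = (\<Sum>k\<in>UNIV. \<Sum>l\<in>UNIV. ?t (if k = l then sec A \<one>\<^bsub>A\<^esub> else 0) (?X k * ?X l))"
  proof -
    have "(\<Sum>l\<in>UNIV. ?t (if k = l then sec A \<one>\<^bsub>A\<^esub> else 0) (?X k * ?X l)) = (\<Sum>l\<in>UNIV. if k = l then ?t (sec A \<one>\<^bsub>A\<^esub>) (?X k * ?X k) else 0)" for k
      by (intro sum.cong) (auto simp: tz)
    then show ?thesis by (simp add: tsum(2))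
  qed
  finally have C0: "(\<Sum>k\<in>UNIV. \<Sum>l\<in>UNIV. ?t (sec A (C k l)) (?X k * ?X l)) = 0"
    unfolding CC tm by (simp add: sum_subtractf)
  note q = quadratic_relation_diagonal[OF A sep \<epsilon> Cc C0] quadratic_relation_antisymmetric[OF A sep \<epsilon> Cc C0]
    quadratic_relation_free[OF A sep \<epsilon> Cc C0]
  show "(\<Sum>i\<in>UNIV. W i k * W i k) = sec A \<one>\<^bsub>A\<^esub>" using q(1)[of k] by (simp add: CC)
  show "k \<noteq> l \<Longrightarrow> (\<Sum>i\<in>UNIV. W i k * W i l) + (\<Sum>i\<in>UNIV. W i l * W i k) = 0" using q(2)[of k l] by (simp add: CC)
  show "k \<noteq> l \<Longrightarrow> \<epsilon> $ k $ l \<noteq> 1 \<Longrightarrow> (\<Sum>i\<in>UNIV. W i k * W i l) = 0" using q(3)[of k l] by (simp add: CC)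

  assume ij: "\<epsilon> $ i $ j = 1"
  define D where "D k l = (w i k \<otimes>\<^bsub>A\<^esub> w j l) \<ominus>\<^bsub>A\<^esub> (w j k \<otimes>\<^bsub>A\<^esub> w i l)" for k l
  have Dc: "D k l \<in> carrier A" for k l unfolding D_def by (rule A.rs(4)[OF ww ww])
  have DD: "sec A (D k l) = W i k * W j l - W j k * W i l" for k l
    unfolding D_def sec_minus[OF A ww ww] WW ..
  have "sec T (\<alpha> (?x i)) * sec T (\<alpha> (?x j)) = sec T (\<alpha> (?x j)) * sec T (\<alpha> (?x i))"
    unfolding sec_simps(2)[OF T aX aX, symmetric] \<alpha>D(2)[OF xD(1) xD(1), symmetric] xD(4)[OF ij] ..
  then have D0: "(\<Sum>k\<in>UNIV. \<Sum>l\<in>UNIV. ?t (sec A (D k l)) (?X k * ?X l)) = 0"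
    unfolding DD tm aprod by (simp add: sum_subtractf)
  note q = quadratic_relation_diagonal[OF A sep \<epsilon> Dc D0] quadratic_relation_antisymmetric[OF A sep \<epsilon> Dc D0]
    quadratic_relation_free[OF A sep \<epsilon> Dc D0]
  show "k \<noteq> l \<Longrightarrow> (W i k * W j l - W j k * W i l) + (W i l * W j k - W j l * W i k) = 0"
    using q(2)[of k l] unfolding DD by blast
  show "\<epsilon> $ k $ l \<noteq> 1 \<Longrightarrow> W i k * W j l = W j k * W i l"
    using q(1)[of k] q(3)[of k l] by (cases "k = l") (simp_all add: DD)
qed

text \<open>The second and third kind of relation in \<open>R\<^sup>\<epsilon>\<close> come from the action and its transpose, respectively.
For \<open>\<epsilon>\<^sub>i\<^sub>j = \<epsilon>\<^sub>k\<^sub>l = 1\<close> the action says that the commutators \<open>[v\<^sub>i\<^sub>k, v\<^sub>j\<^sub>l]\<close> and \<open>[v\<^sub>i\<^sub>l, v\<^sub>j\<^sub>k]\<close> add up to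
zero, and the transpose that they are equal, so both vanish.  Orthogonality of the \<open>k\<close>-th and the
\<open>l\<close>-th column is immediate for \<open>\<epsilon>\<^sub>k\<^sub>l = 0\<close>; for \<open>\<epsilon>\<^sub>k\<^sub>l = 1\<close> the action only gives antisymmetry, and symmetry
is the case \<open>i = j\<close> of the third kind of relation.  Rows are dual.\<close>

lemma O_tuple_of_action:
  fixes A :: "'a cstar_algebra" and \<epsilon> :: "nat ^ 'n::finite ^ 'n" and v :: "'n \<Rightarrow> 'n \<Rightarrow> 'a"
  assumes A: "cstar_algebra A" and sep: "separated A" and \<epsilon>: "commutation_matrix \<epsilon>" and v: "\<And>i k. v i k \<in> carrier A"
    and act: "acts_on_sphere A v \<epsilon>"
  shows "O_tuple A \<epsilon> v"
proof -
  let ?V = "\<lambda>i k. sec A (v i k)"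
  interpret A: star_algebra A by (rule cstar_star[OF A])
  note e = commutation_matrixD[OF \<epsilon>]
  obtain \<alpha> \<beta> where \<alpha>: "\<alpha> \<in> star_hom (C_sphere \<epsilon>) (min_tensor A (C_sphere \<epsilon>))"
      "\<And>i. \<alpha> (sphere_coord \<epsilon> i) = (\<Oplus>\<^bsub>min_tensor A (C_sphere \<epsilon>)\<^esub>k\<in>UNIV. tensor A (C_sphere \<epsilon>) (v i k) (sphere_coord \<epsilon> k))"
    and \<beta>: "\<beta> \<in> star_hom (C_sphere \<epsilon>) (min_tensor A (C_sphere \<epsilon>))"
      "\<And>i. \<beta> (sphere_coord \<epsilon> i) = (\<Oplus>\<^bsub>min_tensor A (C_sphere \<epsilon>)\<^esub>k\<in>UNIV. tensor A (C_sphere \<epsilon>) (v k i) (sphere_coord \<epsilon> k))"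
    using act unfolding acts_on_sphere_def by blast
  note a = action_relations[OF A sep \<epsilon> v \<alpha>] and b = action_relations[where w="\<lambda>i k. v k i", OF A sep \<epsilon> v \<beta>]
  have eqI: "v i k \<otimes>\<^bsub>A\<^esub> v j l = v i' k' \<otimes>\<^bsub>A\<^esub> v j' l'" if "?V i k * ?V j l = ?V i' k' * ?V j' l'" for i j k l i' j' k' l'
    using that sec_inj[OF A A.rs(5)[OF v v] A.rs(5)[OF v v]] by (simp add: sec_simps(2)[OF A v v, symmetric])
  have r1: "?V i k * ?V j l = ?V j l * ?V i k" if ij: "\<epsilon> $ i $ j = 1" and kl: "\<epsilon> $ k $ l = 1" for i j k l
  proof -
    have ne: "i \<noteq> j" "k \<noteq> l" using ij kl e(3) by auto
    have "(?V i k * ?V j l - ?V j k * ?V i l) + (?V i l * ?V j k - ?V j l * ?V i k) = 0" by (rule a(5)[OF ij ne(2)])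
    moreover have "(?V i k * ?V j l - ?V i l * ?V j k) + (?V j k * ?V i l - ?V j l * ?V i k) = 0" by (rule b(5)[OF kl ne(1)])
    moreover have "2 *\<^sub>R (?V i k * ?V j l - ?V j l * ?V i k) =
        ((?V i k * ?V j l - ?V j k * ?V i l) + (?V i l * ?V j k - ?V j l * ?V i k)) +
        ((?V i k * ?V j l - ?V i l * ?V j k) + (?V j k * ?V i l - ?V j l * ?V i k))" by (simp add: scaleR_2)
    ultimately have "2 *\<^sub>R (?V i k * ?V j l - ?V j l * ?V i k) = 0" by (simp only: add_0)
    then show ?thesis by simp
  qed
  have r2: "?V i k * ?V j l = ?V j k * ?V i l" if "\<epsilon> $ i $ j = 1" "\<epsilon> $ k $ l \<noteq> 1" for i j k l by (rule a(6)[OF that])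
  have r3: "?V i k * ?V j l = ?V i l * ?V j k" if "\<epsilon> $ k $ l = 1" "\<epsilon> $ i $ j \<noteq> 1" for i j k l by (rule b(6)[OF that])
  have ne: "\<epsilon> $ i $ i \<noteq> 1" for i by (simp add: e(3))
  have col: "(\<Sum>i\<in>UNIV. ?V i k * ?V i l) = (if k = l then sec A \<one>\<^bsub>A\<^esub> else 0)" for k l
  proof (cases "k = l")
    case False
    have "(\<Sum>i\<in>UNIV. ?V i k * ?V i l) = 0"
    proof (cases "\<epsilon> $ k $ l = 1")
      case True
      have "(\<Sum>i\<in>UNIV. ?V i l * ?V i k) = (\<Sum>i\<in>UNIV. ?V i k * ?V i l)" by (rule sum.cong[OF refl]) (rule r3[OF True ne, symmetric])
      then have "2 *\<^sub>R (\<Sum>i\<in>UNIV. ?V i k * ?V i l) = 0" using a(3)[OF False] by (simp add: scaleR_2)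
      then show ?thesis by simp
    qed (rule a(4)[OF False])
    then show ?thesis using False by simp
  qed (simp add: a(2))
  have row: "(\<Sum>i\<in>UNIV. ?V k i * ?V l i) = (if k = l then sec A \<one>\<^bsub>A\<^esub> else 0)" for k l
  proof (cases "k = l")
    case False
    have "(\<Sum>i\<in>UNIV. ?V k i * ?V l i) = 0"
    proof (cases "\<epsilon> $ k $ l = 1")
      case True
      have "(\<Sum>i\<in>UNIV. ?V l i * ?V k i) = (\<Sum>i\<in>UNIV. ?V k i * ?V l i)" by (rule sum.cong[OF refl]) (rule r2[OF True ne, symmetric])
      then have "2 *\<^sub>R (\<Sum>i\<in>UNIV. ?V k i * ?V l i) = 0" using b(3)[OF False] by (simp add: scaleR_2)
      then show ?thesis by simp
    qed (rule b(4)[OF False])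
    then show ?thesis using False by simp
  qed (simp add: b(2))
  have ne0: "x \<noteq> 1" if "x = 0" for x :: nat using that by simp
  show ?thesis unfolding O_tuple_def
    by (intro conjI allI impI v a(1) row col eqI) (rule r1 r2 r3, assumption, (assumption | erule ne0))+
qed

section \<open>Subalgebras\<close>

lemma cstar_subalgebra_image:
  fixes A :: "'a cstar_algebra" and B :: "'b cstar_algebra"
  assumes A: "cstar_algebra A" and B: "cstar_algebra B" and h: "h \<in> star_hom A B"
  shows "cstar_subalgebra (h ` carrier A) B"
  unfolding cstar_subalgebra_def
proof (intro conjI allI ballI impI)
  interpret A: star_algebra A by (rule cstar_star[OF A])
  interpret B: star_algebra B by (rule cstar_star[OF B])
  note hD = star_homD[OF h]
  show "subring (h ` carrier A) B"
  proof (rule B.subringI)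
    show "h ` carrier A \<subseteq> carrier B" using hD(1) by blast
    show "\<one>\<^bsub>B\<^esub> \<in> h ` carrier A" using hD(4)[OF A.rs(6)] A.rs(6) by (metis imageI)
    fix x y assume "x \<in> h ` carrier A" "y \<in> h ` carrier A"
    then obtain a b where a: "a \<in> carrier A" "x = h a" and b: "b \<in> carrier A" "y = h b" by blast
    show "x \<otimes>\<^bsub>B\<^esub> y \<in> h ` carrier A" using hD(2)[OF a(1) b(1)] A.rs(5)[OF a(1) b(1)] a b by (metis imageI)
    show "x \<oplus>\<^bsub>B\<^esub> y \<in> h ` carrier A" using hD(3)[OF a(1) b(1)] A.rs(1)[OF a(1) b(1)] a b by (metis imageI)
  next
    fix x assume "x \<in> h ` carrier A"
    then obtain a where a: "a \<in> carrier A" "x = h a" by blast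
    have "\<ominus>\<^bsub>B\<^esub> x = h ((- 1) \<odot>\<^bsub>A\<^esub> a)" using hD(5)[OF a(1), of "- 1"] B.cs_minus_one[OF hD(1)[OF a(1)]] a(2) by simp
    then show "\<ominus>\<^bsub>B\<^esub> x \<in> h ` carrier A" using A.cs_closed[OF a(1), of "- 1"] by blast
  qed
  fix c x assume "x \<in> h ` carrier A"
  then obtain a where a: "a \<in> carrier A" "x = h a" by blast
  show "c \<odot>\<^bsub>B\<^esub> x \<in> h ` carrier A" using imageI[OF A.cs_closed[OF a(1)], of h c] hD(5)[OF a(1), of c] a(2) by simp
  show "adj\<^bsub>B\<^esub> x \<in> h ` carrier A" using imageI[OF A.adj_closed[OF a(1)], of h] hD(6)[OF a(1)] a(2) by simp
next
  show "a \<in> h ` carrier A" if "(\<forall>k::nat. s k \<in> h ` carrier A) \<and> a \<in> carrier B \<and> (\<lambda>k. \<parallel>s k \<ominus>\<^bsub>B\<^esub> a\<parallel>\<^bsub>B\<^esub>) \<longlonglongrightarrow> 0" for s a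
    using star_hom_closed_range[OF A B h, of s a] that by blast
qed

lemma generated_dense:
  fixes A :: "'a cstar_algebra" and b :: "'e \<Rightarrow> 'a"
  assumes A: "cstar_algebra A" and b: "\<And>e. b e \<in> carrier A" and gen: "cstar_generated A (range b) = carrier A"
    and x: "x \<in> carrier A"
  shows "sec A x \<in> closure (range (\<lambda>p. sec A (free_eval A b p)))"
proof -
  let ?R = "range (\<lambda>p. sec A (free_eval A b p))" and ?F = free_star_algebra
  define E where "E = {x \<in> carrier A. sec A x \<in> closure ?R}"
  interpret A: star_algebra A by (rule cstar_star[OF A])
  note hD = star_homD[OF free_eval_star_hom[OF A, of b] free_simps(1)]
  note sR = sec_simps[OF A hD(1)]
  have R: "X + Y \<in> ?R" "X * Y \<in> ?R" "c *\<^sub>C X \<in> ?R" "star X \<in> ?R" if "X \<in> ?R" "Y \<in> ?R" for X Y c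
  proof -
    obtain p q where p: "X = sec A (free_eval A b p)" and q: "Y = sec A (free_eval A b q)" using \<open>X \<in> ?R\<close> \<open>Y \<in> ?R\<close> by blast
    show "X + Y \<in> ?R" using sR(1)[OF hD(1), of p q] hD(3)[of q p] free_simps(1) unfolding p q by (metis rangeI)
    show "X * Y \<in> ?R" using sR(2)[OF hD(1), of p q] hD(2)[of q p] free_simps(1) unfolding p q by (metis rangeI)
    show "c *\<^sub>C X \<in> ?R" using sR(3)[of c p] hD(5)[of c p] unfolding p by (metis rangeI)
    show "star X \<in> ?R" using sR(4)[of p] hD(6)[of p] unfolding p by (metis rangeI)
  qed
  have cl: "X + Y \<in> closure ?R" "X * Y \<in> closure ?R" "c *\<^sub>C X \<in> closure ?R" "star X \<in> closure ?R"
    if "X \<in> closure ?R" "Y \<in> closure ?R" for X Y c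
  proof -
    obtain f g where f: "\<And>n. f n \<in> ?R" "f \<longlonglongrightarrow> X" and g: "\<And>n. g n \<in> ?R" "g \<longlonglongrightarrow> Y"
      using \<open>X \<in> closure ?R\<close> \<open>Y \<in> closure ?R\<close> unfolding closure_sequential by blast
    show "X + Y \<in> closure ?R" unfolding closure_sequential
      by (rule exI[of _ "\<lambda>n. f n + g n"]) (use R(1)[OF f(1) g(1)] tendsto_add[OF f(2) g(2)] in blast)
    show "X * Y \<in> closure ?R" unfolding closure_sequential
      by (rule exI[of _ "\<lambda>n. f n * g n"]) (use R(2)[OF f(1) g(1)] tendsto_mult[OF f(2) g(2)] in blast)
    show "c *\<^sub>C X \<in> closure ?R" unfolding closure_sequential
      by (rule exI[of _ "\<lambda>n. c *\<^sub>C f n"]) (use R(3)[OF f(1) f(1)] tendsto_cscale[OF f(2)] in blast)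
    show "star X \<in> closure ?R" unfolding closure_sequential
      by (rule exI[of _ "\<lambda>n. star (f n)"]) (use R(4)[OF f(1) f(1)] tendsto_star[OF f(2)] in blast)
  qed
  have "cstar_subalgebra E A"
    unfolding cstar_subalgebra_def
  proof (intro conjI allI ballI impI)
    show "subring E A"
    proof (rule ring.subringI[OF cstar_ring[OF A]])
      show "E \<subseteq> carrier A" by (auto simp: E_def)
      show "\<one>\<^bsub>A\<^esub> \<in> E" using hD(4) A.rs(6) closure_subset[of ?R] by (auto simp: E_def) (metis rangeI subsetD)
      fix x y assume "x \<in> E" "y \<in> E"
      then have x: "x \<in> carrier A" "sec A x \<in> closure ?R" and y: "y \<in> carrier A" "sec A y \<in> closure ?R" by (auto simp: E_def)
      show "x \<otimes>\<^bsub>A\<^esub> y \<in> E" using cl(2)[OF x(2) y(2)] x y by (simp add: E_def sec_simps(2)[OF A x(1) y(1)])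
      show "x \<oplus>\<^bsub>A\<^esub> y \<in> E" using cl(1)[OF x(2) y(2)] x y by (simp add: E_def sec_simps(1)[OF A x(1) y(1)])
    next
      fix x assume "x \<in> E"
      then have x: "x \<in> carrier A" "sec A x \<in> closure ?R" by (auto simp: E_def)
      have "\<ominus>\<^bsub>A\<^esub> x = (- 1) \<odot>\<^bsub>A\<^esub> x" using A.cs_minus_one[OF x(1)] by simp
      then show "\<ominus>\<^bsub>A\<^esub> x \<in> E" using cl(3)[OF x(2) x(2), of "- 1"] x A.cs_closed[OF x(1), of "- 1"]
        by (simp add: E_def sec_simps(3)[OF A x(1)])
    qed
    fix c x assume "x \<in> E"
    then have x: "x \<in> carrier A" "sec A x \<in> closure ?R" by (auto simp: E_def)
    show "c \<odot>\<^bsub>A\<^esub> x \<in> E" using cl(3)[OF x(2) x(2)] x A.cs_closed[OF x(1)] by (simp add: E_def sec_simps(3)[OF A x(1)])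
    show "adj\<^bsub>A\<^esub> x \<in> E" using cl(4)[OF x(2) x(2)] x A.adj_closed[OF x(1)] by (simp add: E_def sec_simps(4)[OF A x(1)])
  next
    fix s a assume *: "(\<forall>k::nat. s k \<in> E) \<and> a \<in> carrier A \<and> (\<lambda>k. \<parallel>s k \<ominus>\<^bsub>A\<^esub> a\<parallel>\<^bsub>A\<^esub>) \<longlonglongrightarrow> 0"
    then have s: "\<And>k. s k \<in> carrier A" "\<And>k. sec A (s k) \<in> closure ?R" and a: "a \<in> carrier A" by (auto simp: E_def)
    have "(\<lambda>k. sec A (s k)) \<longlonglongrightarrow> sec A a" using * sec_tendsto_iff[OF A s(1) a] by simp
    then have "sec A a \<in> closure ?R" by (rule closed_sequentially[OF closed_closure s(2)])
    then show "a \<in> E" using a by (simp add: E_def)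
  qed
  moreover have "range b \<subseteq> E"
  proof
    fix y assume "y \<in> range b"
    then obtain e where y: "y = b e" by blast
    have "free_eval A b (monomial [Gen e]) = b e" by (simp add: free_eval_def poly_val_simps A b)
    then have "sec A (b e) \<in> ?R" by (metis rangeI)
    then show "y \<in> E" using closure_subset[of ?R] b by (auto simp: E_def y)
  qed
  ultimately have "cstar_generated A (range b) \<subseteq> E" unfolding cstar_generated_def by blast
  then show ?thesis using gen x by (auto simp: E_def)
qed

text \<open>There are countably many words in finitely many generators, and their linear combinations are dense.\<close>

lemma separated_generated:
  fixes A :: "'a cstar_algebra" and b :: "'e::finite \<Rightarrow> 'a"
  assumes A: "cstar_algebra A" and b: "\<And>e. b e \<in> carrier A" and gen: "cstar_generated A (range b) = carrier A"
  shows "separated A"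
  unfolding separated_def
proof (intro ballI impI)
  fix a assume a: "a \<in> carrier A" "a \<noteq> \<zero>\<^bsub>A\<^esub>"
  let ?U = "UNIV :: 'e letter list set"
  have "l \<in> range Gen \<union> range GenAdj" for l :: "'e letter" by (cases l) auto
  then have "(UNIV :: 'e letter set) = range Gen \<union> range GenAdj" by blast
  moreover have "finite (range Gen \<union> range GenAdj :: 'e letter set)" by simp
  ultimately have "finite (UNIV :: 'e letter set)" by metis
  then have cU: "countable ?U" using countable_lists[OF countable_finite, of "UNIV :: 'e letter set"] by (simp add: lists_UNIV)
  let ?w = "word_val (\<lambda>e. sec A (b e))"
  define d where "d n = ev A (?w (from_nat_into ?U n))" for n
  have d: "d n \<in> carrier A" for n unfolding d_def by (rule ev_closed[OF A])
  have se: "sec A (ev A (\<Sum>w\<in>K. c w *\<^sub>C ?w w)) = (\<Sum>w\<in>K. c w *\<^sub>C sec A (ev A (?w w)))" if "finite K" for K c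
    using that
  proof (induction K rule: finite_induct)
    case empty
    then show ?case using sec_simps(5)[OF A b] by (simp add: A)
  next
    case (insert k K)
    then show ?case using star_algebra.cs_closed[OF cstar_star[OF A] ev_closed[OF A]]
      by (simp add: A sec_simps[OF A] ev_closed[OF A])
  qed
  show "\<exists>(\<pi> :: 'a \<Rightarrow> 'a operator) h. representation A \<pi> \<and> h \<in> ell2 \<and> \<pi> a h \<noteq> (\<lambda>i. 0)"
  proof (rule separating_representation[OF A d _ a])
    fix x and \<delta> :: real assume x: "x \<in> carrier A" and \<delta>: "\<delta> > 0"
    obtain f where f: "\<And>n. f n \<in> range (\<lambda>p. sec A (free_eval A b p))" "f \<longlonglongrightarrow> sec A x"
      using generated_dense[OF A b gen x] unfolding closure_sequential by blast
    obtain n where n: "norm (f n - sec A x) < \<delta>" using LIMSEQ_D[OF f(2) \<delta>] by blast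
    obtain p where p: "f n = sec A (free_eval A b p)" using f(1)[of n] by blast
    let ?j = "to_nat_on ?U"
    have inj: "inj_on ?j (ks p)" by (rule inj_on_subset[OF inj_on_to_nat_on[OF cU]]) simp
    have "f n = (\<Sum>w\<in>ks p. lk p w *\<^sub>C sec A (ev A (?w w)))"
      unfolding p free_eval_def poly_val_def lin_ext_def by (rule se) simp
    also have "\<dots> = (\<Sum>m\<in>?j ` ks p. lk p (from_nat_into ?U m) *\<^sub>C sec A (d m))"
      by (subst sum.reindex[OF inj]) (simp add: d_def cU)
    finally have "norm (sec A x - (\<Sum>m\<in>?j ` ks p. lk p (from_nat_into ?U m) *\<^sub>C sec A (d m))) < \<delta>"
      using n by (simp add: norm_minus_commute)
    then show "\<exists>F c. finite F \<and> norm (sec A x - (\<Sum>n\<in>F. c n *\<^sub>C sec A (d n))) < \<delta>"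
      by (intro exI[of _ "?j ` ks p"] exI[of _ "\<lambda>m. lk p (from_nat_into ?U m)"] conjI finite_imageI) simp_all
  qed
qed

section \<open>The quantum groups\<close>

text \<open>Surjectivity: the range is a C*-subalgebra and contains the entries of \<open>v\<close>, which generate.\<close>

lemma maximal_action:
  fixes \<epsilon> :: "nat ^ 'n::finite ^ 'n" and G :: "'g cstar_algebra" and v :: "'n \<Rightarrow> 'n \<Rightarrow> 'g"
  assumes \<epsilon>: "commutation_matrix \<epsilon>" and G: "compact_matrix_quantum_group G v" and act: "acts_on_sphere G v \<epsilon>"
  shows "quantum_subgroup G v (C_O \<epsilon>) (O_gen \<epsilon>)"
proof -
  have A: "cstar_algebra G" and v: "\<And>i j. v i j \<in> carrier G" and gen: "cstar_generated G {v i j | i j. True} = carrier G"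
    using G by (auto simp: compact_matrix_quantum_group_def)
  have r: "range (\<lambda>(i, j). v i j) = {v i j | i j. True}" by auto
  have "separated G"
    by (rule separated_generated[OF A, of "\<lambda>(i, j). v i j"]) (use v gen in \<open>auto simp: r\<close>)
  then have "O_tuple G \<epsilon> v" by (rule O_tuple_of_action[OF A _ \<epsilon> v act])
  then obtain h where h: "h \<in> star_hom (C_O \<epsilon>) G" "\<And>i j. h (O_gen \<epsilon> i j) = v i j"
    using O_universal[OF A] by blast
  have "v i j \<in> h ` carrier (C_O \<epsilon>)" for i j
    using imageI[OF O_tupleD(1)[OF O_tuple_gen[of \<epsilon>]], of h i j] by (simp add: h(2))
  then have "{v i j | i j. True} \<subseteq> h ` carrier (C_O \<epsilon>)" by blast
  then have "cstar_generated G {v i j | i j. True} \<subseteq> h ` carrier (C_O \<epsilon>)"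
    unfolding cstar_generated_def using cstar_subalgebra_image[OF cstar_C_O A h(1)] by blast
  then have "h ` carrier (C_O \<epsilon>) = carrier G" using gen star_homD(1)[OF h(1)] by blast
  then show ?thesis unfolding quantum_subgroup_def using h by blast
qed

lemma O_not_commutative:
  fixes \<epsilon> :: "nat ^ 'n::finite ^ 'n"
  assumes \<epsilon>: "commutation_matrix \<epsilon>" and ne: "\<epsilon> \<noteq> eps_comm"
  shows "\<exists>a\<in>carrier (C_O \<epsilon>). \<exists>b\<in>carrier (C_O \<epsilon>). a \<otimes>\<^bsub>C_O \<epsilon>\<^esub> b \<noteq> b \<otimes>\<^bsub>C_O \<epsilon>\<^esub> a"
proof -
  obtain i j where ij: "\<epsilon> $ i $ j \<noteq> eps_comm $ i $ j" using ne by (metis vec_eq_iff)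
  have "i \<noteq> j" using ij commutation_matrixD(3)[OF \<epsilon>] by (auto simp: eps_comm_def)
  moreover have "\<epsilon> $ i $ j \<noteq> 1" using ij \<open>i \<noteq> j\<close> by (simp add: eps_comm_def)
  ultimately show ?thesis using O_gen_not_commuting[OF \<epsilon>] O_tupleD(1)[OF O_tuple_gen[of \<epsilon>]] by metis
qed

lemma O_gen_commute_iff:
  assumes \<epsilon>: "commutation_matrix \<epsilon>" and ij: "i \<noteq> j"
  shows "O_gen \<epsilon> i i \<otimes>\<^bsub>C_O \<epsilon>\<^esub> O_gen \<epsilon> j j = O_gen \<epsilon> j j \<otimes>\<^bsub>C_O \<epsilon>\<^esub> O_gen \<epsilon> i i \<longleftrightarrow> \<epsilon> $ i $ j = 1"
  using O_gen_commuting[of \<epsilon> i j] O_gen_not_commuting[OF \<epsilon> ij] by blast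

lemma O_isomorphic_eq:
  fixes \<epsilon> \<epsilon>' :: "nat ^ 'n::finite ^ 'n"
  assumes \<epsilon>: "commutation_matrix \<epsilon>" "commutation_matrix \<epsilon>'"
    and h: "h \<in> star_iso (C_O \<epsilon>) (C_O \<epsilon>')" "\<And>i j. h (O_gen \<epsilon> i j) = O_gen \<epsilon>' i j"
  shows "\<epsilon> = \<epsilon>'"
proof -
  have hom: "h \<in> star_hom (C_O \<epsilon>) (C_O \<epsilon>')" and inj: "inj_on h (carrier (C_O \<epsilon>))"
    using h(1) by (auto simp: star_iso_def bij_betw_def)
  note c = O_tupleD(1)[OF O_tuple_gen[of \<epsilon>]]
  have "\<epsilon> $ i $ j = \<epsilon>' $ i $ j" for i j
  proof (cases "i = j")
    case False
    let ?a = "O_gen \<epsilon> i i \<otimes>\<^bsub>C_O \<epsilon>\<^esub> O_gen \<epsilon> j j" and ?b = "O_gen \<epsilon> j j \<otimes>\<^bsub>C_O \<epsilon>\<^esub> O_gen \<epsilon> i i"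
    have cl: "?a \<in> carrier (C_O \<epsilon>)" "?b \<in> carrier (C_O \<epsilon>)" by (rule star_algebra.rs(5)[OF cstar_star[OF cstar_C_O] c c])+
    have "?a = ?b \<longleftrightarrow> h ?a = h ?b" using inj_on_eq_iff[OF inj cl] by simp
    also have "\<dots> \<longleftrightarrow> O_gen \<epsilon>' i i \<otimes>\<^bsub>C_O \<epsilon>'\<^esub> O_gen \<epsilon>' j j = O_gen \<epsilon>' j j \<otimes>\<^bsub>C_O \<epsilon>'\<^esub> O_gen \<epsilon>' i i"
      by (simp add: star_homD(2)[OF hom c c] h(2))
    finally have "\<epsilon> $ i $ j = 1 \<longleftrightarrow> \<epsilon>' $ i $ j = 1" by (simp only: O_gen_commute_iff[OF \<epsilon>(1) False] O_gen_commute_iff[OF \<epsilon>(2) False])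
    then show ?thesis using commutation_matrixD(2)[OF \<epsilon>(1), of i j] commutation_matrixD(2)[OF \<epsilon>(2), of i j] by metis
  qed (simp add: commutation_matrixD(3)[OF \<epsilon>(1)] commutation_matrixD(3)[OF \<epsilon>(2)])
  then show ?thesis by (simp add: vec_eq_iff)
qed

theorem theorem2p2:
  fixes \<epsilon> \<epsilon>' :: "nat ^ 'n::finite ^ 'n"
  assumes "commutation_matrix \<epsilon>" and "commutation_matrix \<epsilon>'"
  shows
    "(\<epsilon> \<noteq> eps_comm \<longrightarrow>
        (\<exists>a\<in>carrier (C_O \<epsilon>). \<exists>b\<in>carrier (C_O \<epsilon>).
           a \<otimes>\<^bsub>C_O \<epsilon>\<^esub> b \<noteq> b \<otimes>\<^bsub>C_O \<epsilon>\<^esub> a)) \<and>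
     (\<epsilon> \<noteq> \<epsilon>' \<longrightarrow>
        \<not> (\<exists>\<phi>\<in>star_iso (C_O \<epsilon>) (C_O \<epsilon>'). \<forall>i j. \<phi> (O_gen \<epsilon> i j) = O_gen \<epsilon>' i j)) \<and>
     (acts_on_sphere (C_O \<epsilon>) (O_gen \<epsilon>) \<epsilon> \<and>
      (\<forall>(G :: 'g cstar_algebra) (v :: 'n \<Rightarrow> 'n \<Rightarrow> 'g).
         compact_matrix_quantum_group G v \<and> acts_on_sphere G v \<epsilon> \<longrightarrow>
         quantum_subgroup G v (C_O \<epsilon>) (O_gen \<epsilon>)))"
proof (intro conjI impI allI)
  show "\<exists>a\<in>carrier (C_O \<epsilon>). \<exists>b\<in>carrier (C_O \<epsilon>). a \<otimes>\<^bsub>C_O \<epsilon>\<^esub> b \<noteq> b \<otimes>\<^bsub>C_O \<epsilon>\<^esub> a" if "\<epsilon> \<noteq> eps_comm"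
    by (rule O_not_commutative[OF assms(1) that])
  show "\<not> (\<exists>\<phi>\<in>star_iso (C_O \<epsilon>) (C_O \<epsilon>'). \<forall>i j. \<phi> (O_gen \<epsilon> i j) = O_gen \<epsilon>' i j)" if "\<epsilon> \<noteq> \<epsilon>'"
    using O_isomorphic_eq[OF assms] that by blast
  show "acts_on_sphere (C_O \<epsilon>) (O_gen \<epsilon>) \<epsilon>" by (rule O_acts_on_sphere[OF assms(1)])
  fix G :: "'g cstar_algebra" and v :: "'n \<Rightarrow> 'n \<Rightarrow> 'g"
  assume "compact_matrix_quantum_group G v \<and> acts_on_sphere G v \<epsilon>"
  then show "quantum_subgroup G v (C_O \<epsilon>) (O_gen \<epsilon>)" using maximal_action[OF assms(1)] by blast
qed

end
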